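(* Let $F_\varepsilon=0$ be a generic $1$-parameter family of binary implicit differential equations, with surfaces $\mathcal{V}^{F_\varepsilon}\subset J^1(\mathbb{R},\mathbb{R})$, and write $\mathcal{V}^F=\mathcal{V}^{F_0}$. If the map $\pi^\vee|_{\mathcal{V}^F}:\mathcal{V}^F\to(\mathbb{R}^2)^\vee$ has a singularity of type $3$, $4$ or $5$, then when $\varepsilon$ passes through $0$ the curve of inflections of the solutions of the equation $F_\varepsilon=0$ undergoes, respectively, a lips-, bec-à-bec- or swallowtail-transition.
   Context: All maps are smooth; "generic" has its usual meaning in singularity theory. $J^1(\mathbb{R},\mathbb{R})$ is $\mathbb{R}^3$ with coordinates $(x,y,p)$ and contact structure $\ker(p\,dx-dy)$; $\pi(x,y,p)=(x,y)$; $\pi^\vee(x,y,p)=(p,px-y)$ with values in $(\mathbb{R}^2)^\vee$. A binary implicit differential equation is $F(x,y,p)=a(x,y)+2b(x,y)p+c(x,y)p^2=0$ with $p=dy/dx$; $\mathcal{V}^F=\{F=0\}$. Its characteristics are the integral curves of the field of lines cut on the tangent planes of $\mathcal{V}^F$ by the contact planes, and the solution curves are their images by $\pi$. The curve of inflections is the set of inflections (points of at least 3-point contact with the tangent line) of the solution curves; it is the image by $\pi$ of the critical set of $\pi^\vee|_{\mathcal{V}^F}$. A bi-inflection is a point where a solution curve has at least 4-point contact with its tangent line. Singularity types of projections of surfaces to a plane: type $3$, $4$, $5$ are those locally equivalent to the projection along the $x$-axis to the $(y,z)$-plane, at the origin, of the surface $z=x^3+xy^2$ (type 3), $z=x^3-xy^2$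 (type 4), $z=x^4+xy$ (type 5), respectively, where the allowed changes of coordinates have the form $X(x,y,z)$, $Y(y,z)$, $Z(y,z)$. Lips and bec-à-bec transitions of the curve of inflections are Morse transitions involving only the curve of inflections, of centre type and saddle type respectively, i.e. equivalent to the families $x^2+y^2-\varepsilon=0$ and $x^2-y^2-\varepsilon=0$ (up to the sign of $\varepsilon$), in which two bi-inflections are born or die. In a swallowtail transition the curve of inflections stays smooth and two bi-inflections on it collapse at $\varepsilon=0$ and are born or die. Two families of plane curves with a local transition at $q$ for parameter $0$ are equivalent if there is a local diffeomorphism (or homeomorphism) of $\mathbb{R}^2\times\mathbb{R}$ near $(q,0)$ sending isochronal sections diffeomorphically to isochronal sections. *)

theory Defs
  imports "HOL-Analysis.Analysis"
begin

section \<open>Smooth maps and local diffeomorphisms\<close>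

text \<open>\<open>iter_deriv [v\<^sub>1, \<dots>, v\<^sub>k] f\<close> is the iterated directional derivative of \<open>f\<close> along
  \<open>v\<^sub>k, \<dots>, v\<^sub>1\<close>.  At points where a derivative does not exist its value is unspecified, which is
  why \<open>smooth_on\<close> asks for differentiability at every stage.\<close>

primrec iter_deriv ::
  "'a::real_normed_vector list \<Rightarrow> ('a \<Rightarrow> 'b::real_normed_vector) \<Rightarrow> 'a \<Rightarrow> 'b" where
  "iter_deriv [] f = f"
| "iter_deriv (v # vs) f = (\<lambda>x. frechet_derivative (iter_deriv vs f) (at x) v)"

definition smooth_on ::
  "'a::real_normed_vector set \<Rightarrow> ('a \<Rightarrow> 'b::real_normed_vector) \<Rightarrow> bool" where
  "smooth_on U f \<longleftrightarrow> open U \<and> (\<forall>vs. \<forall>x\<in>U. iter_deriv vs f differentiable (at x))"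

definition diffeo_between ::
  "'a::real_normed_vector set \<Rightarrow> 'b::real_normed_vector set \<Rightarrow> ('a \<Rightarrow> 'b) \<Rightarrow> bool" where
  "diffeo_between U W f \<longleftrightarrow>
     bij_betw f U W \<and> smooth_on U f \<and> smooth_on W (inv_into U f)"


section \<open>Genericity\<close>

text \<open>The Whitney (strong) \<open>C\<^sup>\<infinity>\<close> topology: a basic neighbourhood of \<open>f\<close> controls the
  partial derivatives up to some finite order \<open>k\<close>, within a continuous positive tolerance
  \<open>\<delta>\<close>.\<close>

definition whitney_nbhd ::
  "nat \<Rightarrow> ('a::euclidean_space \<Rightarrow> real) \<Rightarrow> ('a \<Rightarrow> 'b::euclidean_space) \<Rightarrow> ('a \<Rightarrow> 'b) set" where
  "whitney_nbhd k \<delta> f =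
     {g. smooth_on UNIV g \<and>
         (\<forall>x. \<forall>vs\<in>lists Basis. length vs \<le> k \<longrightarrow>
            norm (iter_deriv vs g x - iter_deriv vs f x) < \<delta> x)}"

definition whitney_topology :: "('a::euclidean_space \<Rightarrow> 'b::euclidean_space) topology" where
  "whitney_topology = topology_generated_by
     {whitney_nbhd k \<delta> f | k \<delta> f. smooth_on UNIV f \<and> continuous_on UNIV \<delta> \<and> (\<forall>x. \<delta> x > 0)}"

lemma topspace_whitney_topology: "topspace whitney_topology = {f. smooth_on UNIV f}"
proof
  show "topspace whitney_topology \<subseteq> {f :: 'a \<Rightarrow> 'b. smooth_on UNIV f}"
    unfolding whitney_topology_def topology_generated_by_topspace
    by (auto simp only: whitney_nbhd_def mem_Collect_eq Union_iff)
  show "{f :: 'a \<Rightarrow> 'b. smooth_on UNIV f} \<subseteq> topspace whitney_topology"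
  proof
    fix f :: "'a \<Rightarrow> 'b" assume "f \<in> {f. smooth_on UNIV f}"
    then have f: "smooth_on UNIV f" by simp
    then have "f \<in> whitney_nbhd 0 (\<lambda>_. 1) f"
      by (simp add: whitney_nbhd_def)
    moreover have "openin whitney_topology (whitney_nbhd 0 (\<lambda>_. 1) f)"
      unfolding whitney_topology_def
      by (rule topology_generated_by_Basis, rule CollectI, intro exI conjI)
        (rule refl f continuous_on_const allI zero_less_one)+
    ultimately show "f \<in> topspace whitney_topology"
      using openin_subset by blast
  qed
qed

text \<open>A property is generic if it holds on a residual set of smooth maps.\<close>

definition generic_property ::
  "(('a::euclidean_space \<Rightarrow> 'b::euclidean_space) \<Rightarrow> bool) \<Rightarrow> bool" where
  "generic_property P \<longleftrightarrow>
     (\<exists>U :: nat \<Rightarrow> ('a \<Rightarrow> 'b) set.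
        (\<forall>n. openin whitney_topology (U n) \<and>
             whitney_topology closure_of U n = topspace whitney_topology) \<and>
        (\<forall>f. smooth_on UNIV f \<longrightarrow> (\<forall>n. f \<in> U n) \<longrightarrow> P f))"


section \<open>The space of 1-jets and binary differential equations\<close>

type_synonym plane = "real \<times> real"
type_synonym jet = "real \<times> real \<times> real" \<comment> \<open>coordinates \<open>(x, y, p)\<close>\<close>

text \<open>A 1-parameter family is given by its coefficients \<open>(a, b, c)\<close> as functions of
  \<open>((x, y), \<epsilon>)\<close>.  At a value of the parameter fixed in advance a generic family has no
  singularity of type 3, 4 or 5; a genericity statement about them therefore has to range over all
  values \<open>\<epsilon>\<^sub>0\<close>.  The usual normalisation \<open>\<epsilon>\<^sub>0 = 0\<close> is a translation of the parameter made after
  the family has been chosen.\<close>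

type_synonym bde_family = "plane \<times> real \<Rightarrow> real \<times> real \<times> real"

fun base_proj :: "jet \<Rightarrow> plane" where
  "base_proj (x, y, p) = (x, y)"

fun dual_proj :: "jet \<Rightarrow> plane" where
  "dual_proj (x, y, p) = (p, p * x - y)"

fun contact_plane :: "jet \<Rightarrow> jet set" where
  "contact_plane (x, y, p) = {(dx, dy, dp). p * dx - dy = 0}"

definition bde :: "bde_family \<Rightarrow> real \<Rightarrow> jet \<Rightarrow> real" where
  "bde A \<epsilon> = (\<lambda>(x, y, p). case A ((x, y), \<epsilon>) of (a, b, c) \<Rightarrow> a + 2 * b * p + c * p\<^sup>2)"

definition jet_surface :: "(jet \<Rightarrow> real) \<Rightarrow> jet set" where
  "jet_surface F = {m. F m = 0}"

text \<open>This is the tangent plane of the surface only where the differential of \<open>F\<close> does not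
  vanish.\<close>

definition surface_tangent :: "(jet \<Rightarrow> real) \<Rightarrow> jet \<Rightarrow> jet set" where
  "surface_tangent F m = {v. frechet_derivative F (at m) v = 0}"

text \<open>The field of lines is defined at the regular points of the surface where the tangent plane
  differs from the contact plane; characteristics are its (regularly parametrised) integral
  curves.\<close>

definition characteristic :: "(jet \<Rightarrow> real) \<Rightarrow> real set \<Rightarrow> (real \<Rightarrow> jet) \<Rightarrow> bool" where
  "characteristic F T \<gamma> \<longleftrightarrow>
     connected T \<and> smooth_on T \<gamma> \<and>
     (\<forall>t\<in>T. \<gamma> t \<in> jet_surface F \<and>
        frechet_derivative F (at (\<gamma> t)) \<noteq> (\<lambda>_. 0) \<and>
        surface_tangent F (\<gamma> t) \<noteq> contact_plane (\<gamma> t) \<and>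
        vector_derivative \<gamma> (at t) \<noteq> 0 \<and>
        vector_derivative \<gamma> (at t) \<in> surface_tangent F (\<gamma> t) \<inter> contact_plane (\<gamma> t))"

fun cross2 :: "plane \<Rightarrow> plane \<Rightarrow> real" where
  "cross2 (u, v) (x, y) = u * y - v * x"

text \<open>At least \<open>k\<close>-point contact of \<open>\<sigma>\<close> with its tangent line at the parameter \<open>t\<close>: the affine
  function cutting out the tangent line, restricted to \<open>\<sigma>\<close>, vanishes to order at least \<open>k\<close>
  at \<open>t\<close>.  Only immersed points count: at a cusp of a solution curve (over a fold of
  the projection to the plane) the line would always have 3-point contact, but such points are not
  inflections.\<close>

definition tangent_contact :: "(real \<Rightarrow> plane) \<Rightarrow> real \<Rightarrow> nat \<Rightarrow> bool" where
  "tangent_contact \<sigma> t k \<longleftrightarrow>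
     vector_derivative \<sigma> (at t) \<noteq> 0 \<and>
     (\<forall>j<k. (deriv ^^ j) (\<lambda>s. cross2 (vector_derivative \<sigma> (at t)) (\<sigma> s - \<sigma> t)) t = 0)"

text \<open>Points of the plane where some solution curve \<open>base_proj \<circ> \<gamma>\<close> has at least \<open>k\<close>-point contact
  with its tangent line.\<close>

definition contact_points :: "(jet \<Rightarrow> real) \<Rightarrow> nat \<Rightarrow> plane set" where
  "contact_points F k =
     {z. \<exists>T \<gamma> t. characteristic F T \<gamma> \<and> t \<in> T \<and> base_proj (\<gamma> t) = z \<and>
                tangent_contact (base_proj \<circ> \<gamma>) t k}"

definition inflection_curve :: "(jet \<Rightarrow> real) \<Rightarrow> plane set" where
  "inflection_curve F = contact_points F 3"

definition bi_inflections :: "(jet \<Rightarrow> real) \<Rightarrow> plane set" where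
  "bi_inflections F = contact_points F 4"

text \<open>The image by \<open>base_proj\<close> of the critical set of its restriction to the surface.\<close>

definition discriminant_curve :: "(jet \<Rightarrow> real) \<Rightarrow> plane set" where
  "discriminant_curve F =
     base_proj ` {m \<in> jet_surface F. (0, 0, 1) \<in> surface_tangent F m}"


section \<open>Singularities of the projection of a surface\<close>

text \<open>The projection of \<open>jet_surface F\<close> by \<open>dual_proj\<close> near \<open>m\<close> is equivalent to the projection
  \<open>(x, y, z) \<mapsto> (y, z)\<close> of the surface \<open>S\<close> at the origin.  Commutation with \<open>\<phi>\<close> says exactly that
  the change of coordinates \<open>\<Phi>\<close> sends fibres to fibres, i.e. it has the form
  \<open>X(x,y,z), Y(y,z), Z(y,z)\<close> once \<open>dual_proj\<close> is written as a coordinate projection.\<close>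

definition dual_projection_equiv :: "(jet \<Rightarrow> real) \<Rightarrow> jet \<Rightarrow> (real \<times> real \<times> real) set \<Rightarrow> bool" where
  "dual_projection_equiv F m S \<longleftrightarrow>
     (\<exists>U W \<Phi> U' W' \<phi>.
        diffeo_between U W \<Phi> \<and> m \<in> U \<and> \<Phi> m = (0, 0, 0) \<and>
        diffeo_between U' W' \<phi> \<and> dual_proj ` U \<subseteq> U' \<and>
        (\<forall>u\<in>U. snd (\<Phi> u) = \<phi> (dual_proj u)) \<and>
        \<Phi> ` (jet_surface F \<inter> U) = S \<inter> W)"

definition type3 :: "(jet \<Rightarrow> real) \<Rightarrow> jet \<Rightarrow> bool" where
  "type3 F m \<longleftrightarrow> dual_projection_equiv F m {(x, y, z). z = x^3 + x * y\<^sup>2}"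

definition type4 :: "(jet \<Rightarrow> real) \<Rightarrow> jet \<Rightarrow> bool" where
  "type4 F m \<longleftrightarrow> dual_projection_equiv F m {(x, y, z). z = x^3 - x * y\<^sup>2}"

definition type5 :: "(jet \<Rightarrow> real) \<Rightarrow> jet \<Rightarrow> bool" where
  "type5 F m \<longleftrightarrow> dual_projection_equiv F m {(x, y, z). z = x^4 + x * y}"


section \<open>Transitions\<close>

text \<open>Local equivalence of the family \<open>\<Gamma>\<close> at \<open>(q, e)\<close> with \<open>\<Delta>\<close> at \<open>(q', e')\<close>.  The
  reparametrisation \<open>\<tau>\<close> of the parameter may reverse orientation.\<close>

definition families_equiv ::
  "(real \<Rightarrow> plane set) \<Rightarrow> plane \<Rightarrow> real \<Rightarrow> (real \<Rightarrow> plane set) \<Rightarrow> plane \<Rightarrow> real \<Rightarrow> bool" where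
  "families_equiv \<Gamma> q e \<Delta> q' e' \<longleftrightarrow>
     (\<exists>U W \<Psi> \<tau>.
        diffeo_between U W \<Psi> \<and> (q, e) \<in> U \<and> \<Psi> (q, e) = (q', e') \<and>
        (\<forall>w\<in>U. snd (\<Psi> w) = \<tau> (snd w)) \<and>
        \<Psi> ` {w \<in> U. fst w \<in> \<Gamma> (snd w)} = {w \<in> W. fst w \<in> \<Delta> (snd w)})"

text \<open>In every small disc around \<open>q\<close>, two points of \<open>B \<epsilon>\<close> on one side of \<open>e\<close> collapse to \<open>q\<close> at
  \<open>\<epsilon> = e\<close> and there are none on the other side.\<close>

definition two_born_or_die :: "(real \<Rightarrow> plane set) \<Rightarrow> plane \<Rightarrow> real \<Rightarrow> bool" where
  "two_born_or_die B q e \<longleftrightarrow>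
     (\<exists>s\<in>{-1, 1}. \<exists>R>0. \<forall>r. 0 < r \<and> r < R \<longrightarrow>
        B e \<inter> ball q r = {q} \<and>
        (\<exists>\<delta>>0. \<forall>h. 0 < h \<and> h < \<delta> \<longrightarrow>
           card (B (e + s * h) \<inter> ball q r) = 2 \<and> B (e - s * h) \<inter> ball q r = {}))"

text \<open>\<open>Involving only the curve of inflections\<close>: no discriminant curve near \<open>q\<close>.\<close>

definition only_inflections :: "bde_family \<Rightarrow> plane \<Rightarrow> real \<Rightarrow> bool" where
  "only_inflections A q e \<longleftrightarrow>
     (\<forall>\<^sub>F w in nhds (q, e). fst w \<notin> discriminant_curve (bde A (snd w)))"

definition lips_transition :: "bde_family \<Rightarrow> plane \<Rightarrow> real \<Rightarrow> bool" where
  "lips_transition A q e \<longleftrightarrow>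
     families_equiv (\<lambda>\<epsilon>. inflection_curve (bde A \<epsilon>)) q e
       (\<lambda>\<epsilon>. {(x, y). x\<^sup>2 + y\<^sup>2 - \<epsilon> = 0}) (0, 0) 0 \<and>
     only_inflections A q e \<and>
     two_born_or_die (\<lambda>\<epsilon>. bi_inflections (bde A \<epsilon>)) q e"

definition bec_a_bec_transition :: "bde_family \<Rightarrow> plane \<Rightarrow> real \<Rightarrow> bool" where
  "bec_a_bec_transition A q e \<longleftrightarrow>
     families_equiv (\<lambda>\<epsilon>. inflection_curve (bde A \<epsilon>)) q e
       (\<lambda>\<epsilon>. {(x, y). x\<^sup>2 - y\<^sup>2 - \<epsilon> = 0}) (0, 0) 0 \<and>
     only_inflections A q e \<and>
     two_born_or_die (\<lambda>\<epsilon>. bi_inflections (bde A \<epsilon>)) q e"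

text \<open>That the curve of inflections stays smooth means that it is, as a family, locally
  equivalent to a straight line that does not depend on the parameter.\<close>

definition swallowtail_transition :: "bde_family \<Rightarrow> plane \<Rightarrow> real \<Rightarrow> bool" where
  "swallowtail_transition A q e \<longleftrightarrow>
     families_equiv (\<lambda>\<epsilon>. inflection_curve (bde A \<epsilon>)) q e
       (\<lambda>\<epsilon>. {(x, y). y = 0}) (0, 0) 0 \<and>
     two_born_or_die (\<lambda>\<epsilon>. bi_inflections (bde A \<epsilon>)) q e"

end

(*
  The kernel of the differential of the dual projection is spanned by xi = d/dx + p d/dy. With I
  = xi F, J = xi I, K = xi J, the inflections are the zeros of I on the surface F(x, y, p) = 0
  and the bi-inflections are those of I and J, as long as F_p does not vanish, i.e. as long as
  the surface is a graph p = P(x, y). Types 3 and 4 force I = J = 0 at a point where I,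
  restricted to the surface, is critical; type 5 forces I = J = K = 0. If no further equation
  between the jets of the family holds, I restricted to the graph has a Morse point there and is
  unfolded by the parameter (types 3 and 4), or its zero set is a smooth curve on which J has a
  fold with respect to the parameter (type 5). Each such further equation brings the number of
  equations to five on the four-dimensional space of (x, y, epsilon, p). Adding to the
  coefficients a polynomial family with sixteen parameters that moves the relevant jets freely,
  the parameters for which the five equations have a solution form the smooth image of a
  fifteen-dimensional space, hence a null set. So the families that avoid them on a compact set
  are dense, and they are open in the Whitney topology.
*)
theory Submission
  imports Defs
begin

section \<open>Directional derivatives and smooth maps\<close>

text \<open>An equation quadratic in \<open>p\<close> puts two branches of solutions over the same
  point of the plane, and inflections of the second branch could accumulate at the point of
  transition. Hence the excluded degeneracies include an inflection at the second root and a
  vanishing leading coefficient, which would send that root to infinity. Types 3 and 4 have the same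
  consequences for the jets used here. Lips and bec-a-bec are told apart only by whether the
  singular point is isolated in the critical set of the dual projection; diffeomorphisms preserve
  this, so no second-order jet of a normal form has to be transported. The five equations are
  independent only where certain functions are nonzero, and this is not a closed condition. Openness
  is therefore proved for the families that avoid the equations over a closed ball of radius n with
  these functions at least 1/(n+1) in absolute value; the countable intersection over n recovers the
  full condition. A polynomial is never small in the Whitney topology, so the perturbation is cut
  off by a bump function; all conditions are local and do not see the cut-off inside the
  ball.\<close>

definition dd :: "'a::real_normed_vector \<Rightarrow> ('a \<Rightarrow> 'b::real_normed_vector) \<Rightarrow> 'a
    \<Rightarrow> 'b" where
  "dd v f x = frechet_derivative f (at x) v"

text \<open>A finite-order form of \<open>smooth_on\<close> that allows induction on the order. The
  recursion strips the derivative taken first, whereas \<open>iter_deriv\<close> adds the one taken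
  last; so the product and chain rules can be applied to \<open>f\<close> itself in each induction
  step.\<close>

primrec ck :: "nat \<Rightarrow> 'a::real_normed_vector set \<Rightarrow> ('a \<Rightarrow> 'b::real_normed_vector)
    \<Rightarrow> bool" where
  "ck 0 U f \<longleftrightarrow> True"
| "ck (Suc n) U f \<longleftrightarrow> (\<forall>x\<in>U. f differentiable (at x)) \<and> (\<forall>v. ck n U (dd
    v f))"

lemma iter_deriv_snoc: "iter_deriv (vs @ [v]) f = iter_deriv vs (dd v f)"
  by (induction vs) (auto simp: dd_def)

lemma iter_deriv_Cons_dd: "iter_deriv (v # vs) f = dd v (iter_deriv vs f)"
  by (auto simp: dd_def)

lemma ck_iff_iter_deriv:
  "ck n U f \<longleftrightarrow> (\<forall>vs. length vs < n \<longrightarrow> (\<forall>x\<in>U. iter_deriv vs f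
      differentiable (at x)))"
proof (induction n arbitrary: f)
  case 0
  then show ?case by simp
next
  case (Suc n)
  show ?case (is "?l \<longleftrightarrow> ?r")
  proof
    assume l: ?l
    show ?r
    proof (intro allI impI)
      fix vs :: "'a list" assume len: "length vs < Suc n"
      show "\<forall>x\<in>U. iter_deriv vs f differentiable (at x)"
      proof (cases vs rule: rev_cases)
        case Nil
        then show ?thesis using l by simp
      next
        case (snoc ws v)
        then have "length ws < n" using len by simp
        then show ?thesis using l Suc.IH[of "dd v f"] snoc by (simp add: iter_deriv_snoc)
      qed
    qed
  next
    assume r: ?r
    have "\<forall>x\<in>U. f differentiable (at x)" using r[rule_format, of "[]"] by simp
    moreover have "ck n U (dd v f)" for v
      unfolding Suc.IH using r[rule_format, of "_ @ [v]"] by (simp add: iter_deriv_snoc)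
    ultimately show ?l by simp
  qed
qed

lemma smooth_on_iff_ck: "smooth_on U f \<longleftrightarrow> open U \<and> (\<forall>n. ck n U f)"
  unfolding smooth_on_def ck_iff_iter_deriv by blast

lemma smooth_on_open: "smooth_on U f \<Longrightarrow> open U"
  by (simp add: smooth_on_def)

lemma smooth_on_iff_dd:
  "smooth_on U f \<longleftrightarrow> open U \<and> (\<forall>x\<in>U. f differentiable (at x)) \<and>
      (\<forall>v. smooth_on U (dd v f))"
proof -
  have "(\<forall>n. ck n U f) \<longleftrightarrow> (\<forall>n. ck (Suc n) U f)"
    by (metis ck.simps(1) not0_implies_Suc)
  then show ?thesis unfolding smooth_on_iff_ck by auto
qed

lemma smooth_on_dd: "smooth_on U f \<Longrightarrow> smooth_on U (dd v f)"
  using smooth_on_iff_dd by blast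

lemma smooth_on_differentiable: "smooth_on U f \<Longrightarrow> x \<in> U \<Longrightarrow> f differentiable (at x)"
  using smooth_on_iff_dd by blast

lemma has_derivative_dd: "f differentiable (at x) \<Longrightarrow> (f has_derivative (\<lambda>v. dd v f x)) (at x)"
  unfolding dd_def using frechet_derivative_works by blast

lemma smooth_on_has_derivative:
  "smooth_on U f \<Longrightarrow> x \<in> U \<Longrightarrow> (f has_derivative (\<lambda>v. dd v f x)) (at x)"
  using smooth_on_differentiable has_derivative_dd by blast

lemma dd_eqI: "(f has_derivative D) (at x) \<Longrightarrow> dd v f x = D v"
  unfolding dd_def using frechet_derivative_at by metis

lemma smooth_on_continuous: "smooth_on U f \<Longrightarrow> continuous_on U f"
  by (meson continuous_at_imp_continuous_on differentiable_imp_continuous_within smooth_on_differentiable)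

lemma smooth_on_isCont: "smooth_on U f \<Longrightarrow> x \<in> U \<Longrightarrow> isCont f x"
  using differentiable_imp_continuous_within smooth_on_differentiable by blast

lemma smooth_on_differentiable_on: "smooth_on U f \<Longrightarrow> f differentiable_on U"
  by (simp add: differentiable_at_imp_differentiable_on smooth_on_differentiable)

lemma dd_cong_open:
  assumes "open U" "\<And>x. x \<in> U \<Longrightarrow> f x = g x" "x \<in> U"
  shows "dd v f x = dd v g x"
proof (cases "f differentiable (at x)")
  case True
  show ?thesis unfolding dd_def
    using frechet_derivative_transform_within_open[OF True assms(1,3)] assms(2) by metis
next
  case False
  \<comment> \<open>Without differentiability the value of \<open>dd\<close> is a mere choice; both
    functions have the same candidates for a derivative, hence the same choice is made.\<close>
  have tr: "(f has_derivative D) (at x) \<longleftrightarrow> (g has_derivative D) (at x)" for D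
    using has_derivative_transform_within_open[OF _ assms(1,3), of f D UNIV g]
      has_derivative_transform_within_open[OF _ assms(1,3), of g D UNIV f] assms(2) by auto
  show ?thesis unfolding dd_def frechet_derivative_def tr ..
qed

lemma ck_cong:
  assumes "open U" "\<And>x. x \<in> U \<Longrightarrow> f x = g x" "ck n U f"
  shows "ck n U g"
  using assms(2,3)
proof (induction n arbitrary: f g)
  case (Suc n)
  have "g differentiable (at x)" if "x \<in> U" for x
  proof -
    have "f differentiable (at x)" using Suc.prems that by simp
    then have "(g has_derivative (\<lambda>v. dd v f x)) (at x)"
      by (rule has_derivative_transform_within_open[OF has_derivative_dd assms(1) that])
        (use Suc.prems in auto)
    then show ?thesis by (rule differentiableI)
  qed
  moreover have "ck n U (dd v g)" for v
    using Suc.IH[of "dd v f" "dd v g"] dd_cong_open[OF assms(1)] Suc.prems by auto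
  ultimately show ?case by simp
qed simp

lemma ck_SucI:
  assumes "open U" "\<And>x. x \<in> U \<Longrightarrow> (f has_derivative (\<lambda>v. D v x)) (at x)" "\<And>v.
      ck n U (D v)"
  shows "ck (Suc n) U f"
proof -
  have "dd v f x = D v x" if "x \<in> U" for v x
    using dd_eqI assms(2) that by blast
  then have "ck n U (dd v f)" for v
    using ck_cong[OF assms(1) _ assms(3)] by metis
  then show ?thesis using differentiableI[OF assms(2)] by simp
qed

lemma ck_Suc_mono: "ck (Suc n) U f \<Longrightarrow> ck n U f"
proof (induction n arbitrary: f)
  case (Suc n)
  show ?case using Suc.prems Suc.IH[of "dd _ f"] by simp
qed simp

lemma ck_has_derivative: "ck (Suc n) U f \<Longrightarrow> x \<in> U \<Longrightarrow> (f has_derivative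
    (\<lambda>v. dd v f x)) (at x)"
  using has_derivative_dd by auto

lemma ck_subset: "ck n U f \<Longrightarrow> V \<subseteq> U \<Longrightarrow> ck n V f"
  by (induction n arbitrary: f) auto

lemma smooth_on_cong:
  assumes "smooth_on U f" "\<And>x. x \<in> U \<Longrightarrow> f x = g x"
  shows "smooth_on U g"
  using assms ck_cong unfolding smooth_on_iff_ck by metis

lemma smooth_on_subset: "smooth_on U f \<Longrightarrow> open V \<Longrightarrow> V \<subseteq> U \<Longrightarrow>
    smooth_on V f"
  unfolding smooth_on_iff_ck using ck_subset by blast

text \<open>Smoothness by coinduction: a class of functions closed under differentiation satisfies
  \<open>ck n\<close> for every n. It is made for integrals with a parameter, whose derivatives are
  again such integrals.\<close>

lemma smooth_on_coinduct:
  assumes "open U"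
    and "X f"
    and "\<And>f. X f \<Longrightarrow> \<exists>D. (\<forall>x\<in>U. (f has_derivative (\<lambda>v. D v x)) (at
        x)) \<and> (\<forall>v. X (D v))"
  shows "smooth_on U f"
proof -
  have "\<forall>f. X f \<longrightarrow> ck n U f" for n
  proof (induction n)
    case (Suc n)
    show ?case
    proof (intro allI impI)
      fix f assume "X f"
      with assms(3) obtain D where "\<forall>x\<in>U. (f has_derivative (\<lambda>v. D v x)) (at x)" "\<forall>v. X
          (D v)"
        by blast
      then show "ck (Suc n) U f" using ck_SucI[OF assms(1), of f D n] Suc by blast
    qed
  qed simp
  then show ?thesis using assms unfolding smooth_on_iff_ck by blast
qed

section \<open>Closure properties of smooth maps\<close>

lemma ck_const: "ck n U (\<lambda>x. c)"
proof (induction n arbitrary: c)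
  case (Suc n)
  have "dd v (\<lambda>x. c) = (\<lambda>x. 0)" for v :: 'a by (simp add: dd_def fun_eq_iff)
  then show ?case using Suc by simp
qed simp

lemma ck_bounded_linear:
  assumes "open U" "bounded_linear f" shows "ck n U f"
proof (cases n)
  case (Suc m)
  show ?thesis unfolding Suc
    by (rule ck_SucI[OF assms(1), where D="\<lambda>v x. f v"])
      (use assms bounded_linear_imp_has_derivative ck_const in auto)
qed simp

lemma ck_bounded_linear_comp:
  assumes "open U" "bounded_linear T" "ck n U f" shows "ck n U (\<lambda>x. T (f x))"
  using assms(3)
proof (induction n arbitrary: f)
  case (Suc n)
  show ?case
    by (rule ck_SucI[OF assms(1), where D="\<lambda>v x. T (dd v f x)"])
      (use Suc in \<open>simp_all add: bounded_linear.has_derivative[OF assms(2) has_derivative_dd]\<close>)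
qed simp

lemma ck_add:
  assumes "open U" "ck n U f" "ck n U g" shows "ck n U (\<lambda>x. f x + g x)"
  using assms(2,3)
proof (induction n arbitrary: f g)
  case (Suc n)
  show ?case
    by (rule ck_SucI[OF assms(1), where D="\<lambda>v x. dd v f x + dd v g x"])
      (use Suc in \<open>simp_all add: has_derivative_add[OF has_derivative_dd has_derivative_dd]\<close>)
qed simp

lemma ck_sum:
  assumes "open U" "\<And>i. i \<in> A \<Longrightarrow> ck n U (f i)" shows "ck n U (\<lambda>x. \<Sum>i\<in>A. f i x)"
  using assms(2)
  by (induction A rule: infinite_finite_induct) (auto intro: ck_add[OF assms(1)] ck_const)

lemma ck_bilinear:
  assumes B: "bounded_bilinear B" and "open U" "ck n U f" "ck n U g"
  shows "ck n U (\<lambda>x. B (f x) (g x))"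
  using assms(3,4)
proof (induction n arbitrary: f g)
  case (Suc n)
  show ?case
    by (rule ck_SucI[OF assms(2), where D="\<lambda>v x. B (f x) (dd v g x) + B (dd v f x) (g x)"])
      (use Suc.prems Suc.IH ck_Suc_mono[OF Suc.prems(1)] ck_Suc_mono[OF Suc.prems(2)] in
        \<open>simp_all add: bounded_bilinear.FDERIV[OF B has_derivative_dd has_derivative_dd] ck_add[OF
            assms(2)]\<close>)
qed simp

text \<open>In the chain rule the direction \<open>dd v g x\<close> in which \<open>f\<close> is
  differentiated moves with x, so the induction hypothesis does not apply to it. Expanding this
  direction in a basis leaves fixed directions with varying coefficients, and the bilinear rule
  finishes.\<close>

lemma ck_compose:
  fixes g :: "'a::real_normed_vector \<Rightarrow> 'b::euclidean_space" and f :: "'b \<Rightarrow>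
      'c::real_normed_vector"
  assumes "open U" "ck n V f" "ck n U g" "g ` U \<subseteq> V"
  shows "ck n U (\<lambda>x. f (g x))"
  using assms(2,3)
proof (induction n arbitrary: f)
  case (Suc n)
  define D where "D v x = (\<Sum>i\<in>Basis. (dd v g x \<bullet> i) *\<^sub>R dd i f (g x))" for v x
  show ?case
  proof (rule ck_SucI[OF assms(1), where D=D])
    fix x assume x: "x \<in> U"
    have f: "(f has_derivative (\<lambda>v. dd v f (g x))) (at (g x))"
      using ck_has_derivative[OF Suc.prems(1)] x assms(4) by blast
    then interpret f: bounded_linear "\<lambda>v. dd v f (g x)" by (rule has_derivative_bounded_linear)
    have eq: "dd (dd v g x) f (g x) = D v x" for v
    proof -
      have "dd (dd v g x) f (g x) = dd (\<Sum>i\<in>Basis. (dd v g x \<bullet> i) *\<^sub>R i) f (g x)"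
        by (simp add: euclidean_representation)
      also have "\<dots> = D v x" unfolding D_def f.sum by (simp add: f.scaleR)
      finally show ?thesis .
    qed
    have "((\<lambda>x. f (g x)) has_derivative (\<lambda>v. dd (dd v g x) f (g x))) (at x)"
      using diff_chain_at[OF ck_has_derivative[OF Suc.prems(2) x] f] by (simp add: o_def)
    then show "((\<lambda>x. f (g x)) has_derivative (\<lambda>v. D v x)) (at x)" unfolding eq .
  next
    fix v
    have g': "ck n U g" using Suc.prems ck_Suc_mono by blast
    show "ck n U (D v)" unfolding D_def
    proof (intro ck_sum[OF assms(1)] ck_bilinear[OF bounded_bilinear_scaleR assms(1)])
      fix i :: 'b
      show "ck n U (\<lambda>x. dd v g x \<bullet> i)"
        by (rule ck_bounded_linear_comp[OF assms(1) bounded_linear_inner_left]) (use Suc.prems in auto)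
      show "ck n U (\<lambda>x. dd i f (g x))"
        by (rule Suc.IH) (use Suc.prems g' in auto)
    qed
  qed
qed simp

lemma smooth_on_const: "open U \<Longrightarrow> smooth_on U (\<lambda>x. c)"
  by (simp add: smooth_on_iff_ck ck_const)

lemma smooth_on_bounded_linear: "open U \<Longrightarrow> bounded_linear f \<Longrightarrow> smooth_on U f"
  by (simp add: smooth_on_iff_ck ck_bounded_linear)

lemma smooth_on_bounded_linear_comp:
  "bounded_linear T \<Longrightarrow> smooth_on U f \<Longrightarrow> smooth_on U (\<lambda>x. T (f x))"
  by (simp add: smooth_on_iff_ck ck_bounded_linear_comp)

lemma smooth_on_id: "open U \<Longrightarrow> smooth_on U (\<lambda>x. x)"
  by (rule smooth_on_bounded_linear) auto

lemma smooth_on_add: "smooth_on U f \<Longrightarrow> smooth_on U g \<Longrightarrow> smooth_on U (\<lambda>x. f x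
    + g x)"
  by (simp add: smooth_on_iff_ck ck_add)

lemma smooth_on_sum:
  "open U \<Longrightarrow> (\<And>i. i \<in> A \<Longrightarrow> smooth_on U (f i)) \<Longrightarrow> smooth_on U
      (\<lambda>x. \<Sum>i\<in>A. f i x)"
  by (simp add: smooth_on_iff_ck ck_sum)

lemma smooth_on_bilinear:
  "bounded_bilinear B \<Longrightarrow> smooth_on U f \<Longrightarrow> smooth_on U g \<Longrightarrow> smooth_on U
      (\<lambda>x. B (f x) (g x))"
  by (simp add: smooth_on_iff_ck ck_bilinear)

lemma smooth_on_compose:
  fixes g :: "'a::real_normed_vector \<Rightarrow> 'b::euclidean_space"
  shows "smooth_on V f \<Longrightarrow> smooth_on U g \<Longrightarrow> g ` U \<subseteq> V \<Longrightarrow>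
      smooth_on U (\<lambda>x. f (g x))"
  unfolding smooth_on_iff_ck using ck_compose by metis

lemmas smooth_on_mult = smooth_on_bilinear[OF bounded_bilinear_mult]
lemmas smooth_on_scaleR = smooth_on_bilinear[OF bounded_bilinear_scaleR]
lemmas smooth_on_inner = smooth_on_bilinear[OF bounded_bilinear_inner]
lemmas smooth_on_fst = smooth_on_bounded_linear_comp[OF bounded_linear_fst]
lemmas smooth_on_snd = smooth_on_bounded_linear_comp[OF bounded_linear_snd]
lemmas smooth_on_minus = smooth_on_bounded_linear_comp[OF bounded_linear_minus[OF bounded_linear_ident]]

lemma smooth_on_diff: "smooth_on U f \<Longrightarrow> smooth_on U g \<Longrightarrow> smooth_on U (\<lambda>x. f x
    - g x)"
  using smooth_on_add[of U f "\<lambda>x. - g x"] smooth_on_minus by fastforce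

lemma smooth_on_power:
  fixes f :: "'a::real_normed_vector \<Rightarrow> real"
  shows "smooth_on U f \<Longrightarrow> smooth_on U (\<lambda>x. f x ^ n)"
  by (induction n) (auto intro: smooth_on_const smooth_on_mult dest: smooth_on_open)

lemma smooth_on_Pair:
  assumes "smooth_on U f" "smooth_on U g" shows "smooth_on U (\<lambda>x. (f x, g x))"
proof -
  have "smooth_on U (\<lambda>x. (f x, 0) + (0, g x))"
    using assms
    by (intro smooth_on_add smooth_on_bounded_linear_comp[of "\<lambda>a. (a, 0)"]
        smooth_on_bounded_linear_comp[of "\<lambda>a. (0, a)"])
      (auto intro: bounded_linear_Pair bounded_linear_zero bounded_linear_ident)
  then show ?thesis by simp
qed

text \<open>The derivative of \<open>inverse\<close> is a polynomial in \<open>inverse\<close>, so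
  the induction on the order closes.\<close>

lemma smooth_on_inverse_real: "smooth_on (- {0}) (inverse :: real \<Rightarrow> real)"
proof -
  have op: "open (- {0::real})" by auto
  have "ck n (- {0}) (inverse :: real \<Rightarrow> real)" for n
  proof (induction n)
    case (Suc n)
    show ?case
    proof (rule ck_SucI[OF op])
      fix x :: real assume "x \<in> - {0}"
      then show "(inverse has_derivative (\<lambda>v. - (inverse x * v * inverse x))) (at x)"
        using has_derivative_inverse' by blast
    next
      fix v :: real
      show "ck n (- {0}) (\<lambda>x. - (inverse x * v * inverse x))"
        by (rule ck_bounded_linear_comp[OF op bounded_linear_minus[OF bounded_linear_ident]])
          (intro ck_bilinear[OF bounded_bilinear_mult op] Suc ck_const)
    qed
  qed simp
  then show ?thesis using op smooth_on_iff_ck by blast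
qed

lemma smooth_on_inverse:
  fixes f :: "'a::real_normed_vector \<Rightarrow> real"
  shows "smooth_on U f \<Longrightarrow> (\<And>x. x \<in> U \<Longrightarrow> f x \<noteq> 0) \<Longrightarrow>
      smooth_on U (\<lambda>x. inverse (f x))"
  by (rule smooth_on_compose[OF smooth_on_inverse_real]) auto

lemma smooth_on_divide:
  fixes f g :: "'a::real_normed_vector \<Rightarrow> real"
  shows "smooth_on U f \<Longrightarrow> smooth_on U g \<Longrightarrow> (\<And>x. x \<in> U \<Longrightarrow> g x
      \<noteq> 0) \<Longrightarrow> smooth_on U (\<lambda>x. f x / g x)"
  unfolding divide_inverse by (intro smooth_on_mult smooth_on_inverse)

lemma smooth_on_sqrt_real: "smooth_on {0<..} sqrt"
proof -
  have op: "open {0::real<..}" by auto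
  have "ck n {0<..} sqrt" for n
  proof (induction n)
    case (Suc n)
    show ?case
    proof (rule ck_SucI[OF op])
      fix x :: real assume "x \<in> {0<..}"
      then have "(sqrt has_real_derivative inverse (sqrt x) / 2) (at x)"
        using DERIV_real_sqrt by auto
      then show "(sqrt has_derivative (\<lambda>v. (v / 2) * inverse (sqrt x))) (at x)"
        unfolding has_field_derivative_def
        by (rule has_derivative_eq_rhs) (auto simp: fun_eq_iff)
    next
      fix v :: real
      have "ck n {0<..} (\<lambda>x. inverse (sqrt x))"
        by (rule ck_compose[where V="- {0}", OF op _ Suc])
          (use smooth_on_inverse_real smooth_on_iff_ck in auto)
      then show "ck n {0<..} (\<lambda>x. (v / 2) * inverse (sqrt x))"
        by (intro ck_bilinear[OF bounded_bilinear_mult op] ck_const)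
    qed
  qed simp
  then show ?thesis using op smooth_on_iff_ck by blast
qed

lemma smooth_on_sqrt:
  "smooth_on U f \<Longrightarrow> (\<And>x. x \<in> U \<Longrightarrow> f x > 0) \<Longrightarrow> smooth_on U
      (\<lambda>x. sqrt (f x))"
  by (rule smooth_on_compose[OF smooth_on_sqrt_real]) auto

lemmas smooth_intros = smooth_on_const smooth_on_id smooth_on_add smooth_on_diff smooth_on_minus
  smooth_on_mult smooth_on_scaleR smooth_on_inner smooth_on_fst smooth_on_snd smooth_on_Pair
  smooth_on_power smooth_on_divide smooth_on_inverse

section \<open>Rules for directional derivatives\<close>

lemma dd_linear:
  assumes "f differentiable (at x)"
  shows "dd (a *\<^sub>R v + b *\<^sub>R w) f x = a *\<^sub>R dd v f x + b *\<^sub>R dd w f x"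
  using linear_frechet_derivative[OF assms] unfolding dd_def
  by (simp add: linear_add linear_scale)

lemma dd_chain:
  assumes "f differentiable (at (g x))" "(g has_derivative g') (at x)"
  shows "((\<lambda>x. f (g x)) has_derivative (\<lambda>v. dd (g' v) f (g x))) (at x)"
  using diff_chain_at[OF assms(2) has_derivative_dd[OF assms(1)]] by (simp add: o_def)

lemma dd_add: "f differentiable (at x) \<Longrightarrow> g differentiable (at x) \<Longrightarrow>
    dd v (\<lambda>x. f x + g x) x = dd v f x + dd v g x"
  by (rule dd_eqI, rule has_derivative_add; rule has_derivative_dd)

lemma dd_diff: "f differentiable (at x) \<Longrightarrow> g differentiable (at x) \<Longrightarrow>
    dd v (\<lambda>x. f x - g x) x = dd v f x - dd v g x"
  by (rule dd_eqI, rule has_derivative_diff; rule has_derivative_dd)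

lemma dd_mult: 
  fixes f g :: "'a::real_normed_vector \<Rightarrow> real"
  shows "f differentiable (at x) \<Longrightarrow> g differentiable (at x) \<Longrightarrow>
    dd v (\<lambda>x. f x * g x) x = f x * dd v g x + dd v f x * g x"
  by (rule dd_eqI, rule has_derivative_mult; rule has_derivative_dd)

lemma dd_const [simp]: "dd v (\<lambda>x. c) x = 0"
  by (simp add: dd_def)

section \<open>Symmetry of mixed derivatives and bump functions\<close>

lemma line_has_derivative:
  fixes f :: "'a::real_normed_vector \<Rightarrow> real"
  assumes "f differentiable (at (x + s *\<^sub>R v))"
  shows "((\<lambda>s. f (x + s *\<^sub>R v)) has_real_derivative dd v f (x + s *\<^sub>R v)) (at s)"
proof -
  have "((\<lambda>s. x + s *\<^sub>R v) has_derivative (\<lambda>h. h *\<^sub>R v)) (at s)"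
    by (auto intro!: derivative_eq_intros)
  from dd_chain[of f "\<lambda>s. x + s *\<^sub>R v", OF assms this]
  show ?thesis
    unfolding has_field_derivative_def
  proof (rule has_derivative_eq_rhs)
    show "(\<lambda>va. dd (va *\<^sub>R v) f (x + s *\<^sub>R v)) = (*) (dd v f (x + s *\<^sub>R v))"
      using dd_linear[OF assms, of _ v 0 0] by (auto simp: fun_eq_iff)
  qed
qed

text \<open>The mean value theorem is applied along \<open>v\<close> to the difference of
  \<open>f\<close> across \<open>w\<close>, then along \<open>w\<close> to \<open>dd v f\<close>.
  The left side is symmetric in \<open>v\<close> and \<open>w\<close>; exchanging them therefore
  equates the two mixed derivatives at two nearby points, and continuity gives Schwarz's
  theorem.\<close>

lemma mixed_difference:
  fixes f :: "'a::real_normed_vector \<Rightarrow> real"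
  assumes f: "smooth_on U f" and sub: "\<And>s t. 0 \<le> s \<Longrightarrow> s \<le> h \<Longrightarrow> 0 \<le> t
      \<Longrightarrow> t \<le> h \<Longrightarrow> x + s *\<^sub>R v + t *\<^sub>R w \<in> U"
    and "h > 0"
  shows "\<exists>s t. 0 < s \<and> s < h \<and> 0 < t \<and> t < h \<and>
    f (x + h *\<^sub>R v + h *\<^sub>R w) - f (x + h *\<^sub>R v) - f (x + h *\<^sub>R w) + f x
      = h * h * dd w (dd v f) (x + s *\<^sub>R v + t *\<^sub>R w)"
proof -
  define \<phi> where "\<phi> s = f (x + h *\<^sub>R w + s *\<^sub>R v) - f (x + s *\<^sub>R v)" for s
  have "\<exists>s. 0 < s \<and> s < h \<and> \<phi> h - \<phi> 0 =
      (h - 0) * (dd v f (x + h *\<^sub>R w + s *\<^sub>R v) - dd v f (x + s *\<^sub>R v))"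
  proof (rule MVT2[OF \<open>h > 0\<close>])
    fix s assume s: "0 \<le> s" "s \<le> h"
    show "(\<phi> has_real_derivative dd v f (x + h *\<^sub>R w + s *\<^sub>R v) - dd v f (x + s *\<^sub>R v)) (at s)"
      unfolding \<phi>_def
      using sub[OF s, of h] sub[OF s, of 0] \<open>h > 0\<close>
      by (intro DERIV_diff line_has_derivative smooth_on_differentiable[OF f])
        (auto simp: algebra_simps)
  qed
  then obtain s where s: "0 < s" "s < h" and 1: "\<phi> h - \<phi> 0 =
      h * (dd v f (x + h *\<^sub>R w + s *\<^sub>R v) - dd v f (x + s *\<^sub>R v))" by auto
  have "\<exists>t. 0 < t \<and> t < h \<and> dd v f (x + s *\<^sub>R v + h *\<^sub>R w) - dd v f (x + s *\<^sub>R
      v + 0 *\<^sub>R w) =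
      (h - 0) * (dd w (dd v f) (x + s *\<^sub>R v + t *\<^sub>R w))"
  proof (rule MVT2[OF \<open>h > 0\<close>])
    fix t assume t: "0 \<le> t" "t \<le> h"
    show "((\<lambda>t. dd v f (x + s *\<^sub>R v + t *\<^sub>R w)) has_real_derivative
        dd w (dd v f) (x + s *\<^sub>R v + t *\<^sub>R w)) (at t)"
      using sub[of s t] s t
      by (intro line_has_derivative smooth_on_differentiable[OF smooth_on_dd[OF f]]) auto
  qed
  then obtain t where t: "0 < t" "t < h" and 2:
    "dd v f (x + s *\<^sub>R v + h *\<^sub>R w) - dd v f (x + s *\<^sub>R v) =
      h * (dd w (dd v f) (x + s *\<^sub>R v + t *\<^sub>R w))" by auto
  have "f (x + h *\<^sub>R v + h *\<^sub>R w) - f (x + h *\<^sub>R v) - f (x + h *\<^sub>R w) + f x = \<phi> h -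
      \<phi> 0"
    by (simp add: \<phi>_def algebra_simps)
  also have "\<dots> = h * h * dd w (dd v f) (x + s *\<^sub>R v + t *\<^sub>R w)"
    using 1 2 by (simp add: algebra_simps)
  finally show ?thesis using s t by blast
qed

lemma dd_commute:
  fixes f :: "'a::real_normed_vector \<Rightarrow> real"
  assumes f: "smooth_on U f" and x: "x \<in> U"
  shows "dd v (dd w f) x = dd w (dd v f) x"
proof (rule ccontr)
  assume ne: "dd v (dd w f) x \<noteq> dd w (dd v f) x"
  define \<eta> where "\<eta> = \<bar>dd v (dd w f) x - dd w (dd v f) x\<bar> / 2"
  have \<eta>: "\<eta> > 0" using ne by (simp add: \<eta>_def)
  have c1: "isCont (dd v (dd w f)) x" and c2: "isCont (dd w (dd v f)) x"
    using f x by (auto intro!: smooth_on_isCont[of U] smooth_on_dd)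
  obtain d1 where d1: "d1 > 0" "\<And>y. dist y x < d1 \<Longrightarrow> dist (dd v (dd w f) y) (dd v (dd w f) x) <
      \<eta>"
    using c1 \<eta> unfolding continuous_at_eps_delta by metis
  obtain d2 where d2: "d2 > 0" "\<And>y. dist y x < d2 \<Longrightarrow> dist (dd w (dd v f) y) (dd w (dd v f) x) <
      \<eta>"
    using c2 \<eta> unfolding continuous_at_eps_delta by metis
  obtain d3 where d3: "d3 > 0" "ball x d3 \<subseteq> U"
    using smooth_on_open[OF f] x openE by blast
  define d where "d = min d1 (min d2 d3)"
  have d: "d > 0" using d1 d2 d3 by (simp add: d_def)
  \<comment> \<open>Small enough for the parallelogram with sides \<open>h *\<^sub>R v\<close> and
    \<open>h *\<^sub>R w\<close> to lie within distance d of x.\<close>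
  define h where "h = d / (2 * (norm v + norm w + 1))"
  have N: "norm v + norm w + 1 > 0" by (intro add_nonneg_pos add_nonneg_nonneg) auto
  have h: "h > 0" using d N unfolding h_def by simp
  have hd: "h * (norm v + norm w) < d"
  proof -
    have "h * (norm v + norm w + 1) = d / 2"
      using N by (simp add: h_def field_simps)
    then have "h * (norm v + norm w) \<le> d / 2" using h by (simp add: algebra_simps)
    then show ?thesis using d by simp
  qed
  have near: "dist (x + s *\<^sub>R v + t *\<^sub>R w) x < d" if "0 \<le> s" "s \<le> h" "0 \<le> t" "t \<le> h" for s t
  proof -
    have "dist (x + s *\<^sub>R v + t *\<^sub>R w) x \<le> norm (s *\<^sub>R v) + norm (t *\<^sub>R w)"
      using norm_triangle_ineq[of "s *\<^sub>R v" "t *\<^sub>R w"] by (simp add: dist_norm add.assoc)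
    also have "\<dots> \<le> h * norm v + h * norm w"
      using that by (intro add_mono) (auto intro: mult_right_mono)
    also have "\<dots> < d" using hd by (simp add: algebra_simps)
    finally show ?thesis .
  qed
  have inU: "x + s *\<^sub>R v + t *\<^sub>R w \<in> U" if "0 \<le> s" "s \<le> h" "0 \<le> t" "t \<le> h" for s t
    using near[OF that] d3 by (auto simp: d_def dist_commute mem_ball subset_iff)
  obtain s t where st: "0 < s" "s < h" "0 < t" "t < h" and e1:
    "f (x + h *\<^sub>R v + h *\<^sub>R w) - f (x + h *\<^sub>R v) - f (x + h *\<^sub>R w) + f x
      = h * h * dd w (dd v f) (x + s *\<^sub>R v + t *\<^sub>R w)"
    using mixed_difference[OF f inU h] by blast
  obtain s' t' where st': "0 < s'" "s' < h" "0 < t'" "t' < h" and e2: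
    "f (x + h *\<^sub>R w + h *\<^sub>R v) - f (x + h *\<^sub>R w) - f (x + h *\<^sub>R v) + f x
      = h * h * dd v (dd w f) (x + s' *\<^sub>R w + t' *\<^sub>R v)"
  proof -
    have "x + s *\<^sub>R w + t *\<^sub>R v \<in> U" if "0 \<le> s" "s \<le> h" "0 \<le> t" "t \<le> h" for s t
      using inU[OF that(3,4,1,2)] by (simp add: algebra_simps)
    from mixed_difference[OF f this h] that show thesis by blast
  qed
  have "h * h * dd w (dd v f) (x + s *\<^sub>R v + t *\<^sub>R w) = h * h * dd v (dd w f) (x + t' *\<^sub>R v + s'
      *\<^sub>R w)"
    using e1 e2 by (simp add: algebra_simps)
  then have eq: "dd w (dd v f) (x + s *\<^sub>R v + t *\<^sub>R w) = dd v (dd w f) (x + t' *\<^sub>R v + s'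
      *\<^sub>R w)"
    using h by simp
  have "dist (dd w (dd v f) (x + s *\<^sub>R v + t *\<^sub>R w)) (dd w (dd v f) x) < \<eta>"
    by (rule d2) (use near[of s t] st in \<open>auto simp: d_def\<close>)
  moreover have "dist (dd v (dd w f) (x + t' *\<^sub>R v + s' *\<^sub>R w)) (dd v (dd w f) x) < \<eta>"
    by (rule d1) (use near[of t' s'] st' in \<open>auto simp: d_def\<close>)
  moreover have "\<bar>a - b\<bar> \<le> \<bar>z - b\<bar> + \<bar>z - a\<bar>" for a b z :: real by linarith
  ultimately show False unfolding eq dist_real_def \<eta>_def
    by (metis (no_types, lifting) add_strict_mono field_sum_of_halves not_le)
qed

section \<open>Flat functions and cut-off functions\<close>

definition flat :: "nat \<Rightarrow> real \<Rightarrow> real" where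
  "flat n t = (if t > 0 then inverse t ^ n * exp (- inverse t) else 0)"

lemma flat_tendsto_0: "((\<lambda>t. flat n t) \<longlongrightarrow> 0) (at 0)"
proof -
  have "((\<lambda>u::real. u ^ n / exp u) \<longlongrightarrow> 0) at_top" by (rule tendsto_power_div_exp_0)
  then have "((\<lambda>t. inverse t ^ n / exp (inverse t)) \<longlongrightarrow> 0) (at_right (0::real))"
    using filterlim_compose filterlim_inverse_at_top_right by blast
  then have r: "(flat n \<longlongrightarrow> 0) (at_right 0)"
  proof (rule Lim_transform_eventually)
    show "\<forall>\<^sub>F x in at_right 0. inverse x ^ n / exp (inverse x) = flat n x"
      unfolding eventually_at_right_field by (auto simp: flat_def exp_minus divide_inverse intro: exI[of _ 1])
  qed
  have l: "(flat n \<longlongrightarrow> 0) (at_left 0)"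
    by (rule Lim_transform_eventually[OF tendsto_const])
      (auto simp: flat_def eventually_at_filter)
  show ?thesis using r l filterlim_split_at by blast
qed

text \<open>The powers of 1/t in front of exp(-1/t) are carried along so that the linear span of all
  \<open>flat n\<close> is closed under differentiation; smoothness of all of them then follows by
  one induction.\<close>

lemma flat_has_derivative:
  "(flat n has_real_derivative (flat (n + 2) t - real n * flat (n + 1) t)) (at t)"
proof -
  consider "t > 0" | "t < 0" | "t = 0" by linarith
  then show ?thesis
  proof cases
    case 1
    have "((\<lambda>t. inverse t ^ n * exp (- inverse t)) has_real_derivative
        (real n * inverse t ^ (n - 1) * (- (inverse t * inverse t)) * exp (- inverse t)
          + inverse t ^ n * (exp (- inverse t) * (inverse t * inverse t)))) (at t)"
      using 1 by (auto intro!: derivative_eq_intros)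
    moreover have "real n * inverse t ^ (n - 1) * (- (inverse t * inverse t)) * exp (- inverse t)
          + inverse t ^ n * (exp (- inverse t) * (inverse t * inverse t)) = flat (n + 2) t - real n * flat (n + 1) t"
      using 1 by (cases n) (simp_all add: flat_def algebra_simps)
    ultimately have "((\<lambda>t. inverse t ^ n * exp (- inverse t)) has_real_derivative
        (flat (n + 2) t - real n * flat (n + 1) t)) (at t)" by simp
    then show ?thesis
      by (rule has_field_derivative_transform_within_open[of _ _ _ "{0<..}"])
        (use 1 in \<open>auto simp: flat_def\<close>)
  next
    case 2
    have "((\<lambda>t. 0) has_real_derivative (flat (n + 2) t - real n * flat (n + 1) t)) (at t)"
      using 2 by (simp add: flat_def)
    then show ?thesis
      by (rule has_field_derivative_transform_within_open[of _ _ _ "{..<0}"])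
        (use 2 in \<open>auto simp: flat_def\<close>)
  next
    case 3
    \<comment> \<open>At 0 the difference quotient of \<open>flat n\<close> is
      \<open>flat (Suc n)\<close>, which tends to 0.\<close>
    have "((\<lambda>h. (flat n (0 + h) - flat n 0) / h) \<longlongrightarrow> 0) (at 0)"
      by (rule Lim_transform_eventually[OF flat_tendsto_0[of "Suc n"]])
        (auto simp: flat_def divide_inverse eventually_at_filter)
    then have "(flat n has_real_derivative 0) (at 0)" unfolding DERIV_def .
    then show ?thesis using 3 by (simp add: flat_def)
  qed
qed

lemma smooth_on_flat: "smooth_on UNIV (flat n)"
proof -
  have "ck k UNIV (flat n)" for k
  proof (induction k arbitrary: n)
    case (Suc k)
    show ?case
    proof (rule ck_SucI)
      fix t :: real
      show "(flat n has_derivative (\<lambda>v. v * (flat (n + 2) t + (- real n) * flat (n + 1) t))) (at t)"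
        using flat_has_derivative[of n t] unfolding has_field_derivative_def
        by (rule has_derivative_eq_rhs) (auto simp: fun_eq_iff algebra_simps)
    next
      fix v :: real
      show "ck k UNIV (\<lambda>t. v * (flat (n + 2) t + (- real n) * flat (n + 1) t))"
        by (intro ck_bilinear[OF bounded_bilinear_mult] ck_add ck_const Suc open_UNIV)
    qed auto
  qed simp
  then show ?thesis by (simp add: smooth_on_iff_ck)
qed

lemma flat_pos: "t > 0 \<Longrightarrow> flat n t > 0" and flat_nonneg: "flat n t \<ge> 0"
  and flat_eq_0: "t \<le> 0 \<Longrightarrow> flat n t = 0"
  by (auto simp: flat_def)

text \<open>A quotient a / (a + b), where a vanishes outside the ball of radius r + 1 and b inside
  the ball of radius r. As r < r + 1, they never vanish together.\<close>

lemma bump_function: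
  assumes "r > 0"
  obtains \<beta> :: "'a::euclidean_space \<Rightarrow> real"
  where "smooth_on UNIV \<beta>" "\<And>x. norm x < r \<Longrightarrow> \<beta> x = 1" "\<And>x. norm x > r + 1
      \<Longrightarrow> \<beta> x = 0"
proof -
  define a where "a x = flat 0 ((r + 1)\<^sup>2 - x \<bullet> x)" for x :: 'a
  define b where "b x = flat 0 (x \<bullet> x - r\<^sup>2)" for x :: 'a
  have lt: "r\<^sup>2 < (r + 1)\<^sup>2" using assms by (simp add: power2_eq_square algebra_simps)
  have pos: "a x + b x \<noteq> 0" for x
  proof -
    have "(r + 1)\<^sup>2 - x \<bullet> x > 0 \<or> x \<bullet> x - r\<^sup>2 > 0" using lt by linarith
    then show ?thesis
      unfolding a_def b_def using flat_nonneg flat_pos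
      by (smt (verit))
  qed
  have sa: "smooth_on UNIV a" unfolding a_def
    by (rule smooth_on_compose[OF smooth_on_flat]) (intro smooth_intros open_UNIV, auto)
  have sb: "smooth_on UNIV b" unfolding b_def
    by (rule smooth_on_compose[OF smooth_on_flat]) (intro smooth_intros open_UNIV, auto)
  show ?thesis
  proof (rule that[of "\<lambda>x. a x / (a x + b x)"])
    show "smooth_on UNIV (\<lambda>x. a x / (a x + b x))"
      using sa sb pos by (intro smooth_intros)
    show "a x / (a x + b x) = 1" if "norm x < r" for x
    proof -
      have "x \<bullet> x < r\<^sup>2" using that assms
        by (metis norm_ge_zero power2_norm_eq_inner power_strict_mono zero_less_numeral)
      then have "b x = 0" by (simp add: b_def flat_eq_0)
      then show ?thesis using pos[of x] by simp
    qed
    show "a x / (a x + b x) = 0" if "norm x > r + 1" for x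
    proof -
      have "x \<bullet> x > (r + 1)\<^sup>2" using that assms
        by (metis add_pos_pos less_eq_real_def power2_norm_eq_inner power_strict_mono zero_less_numeral zero_less_one)
      then show ?thesis by (simp add: a_def flat_eq_0)
    qed
  qed
qed

section \<open>Implicit functions and local diffeomorphisms\<close>

lemma ck_Pair:
  assumes "open U" "ck n U f" "ck n U g" shows "ck n U (\<lambda>x. (f x, g x))"
proof -
  have "ck n U (\<lambda>x. (f x, 0) + (0, g x))"
    using assms
    by (intro ck_add ck_bounded_linear_comp[of _ "\<lambda>a. (a, 0)"]
        ck_bounded_linear_comp[of _ "\<lambda>a. (0, a)"])
      (auto intro: bounded_linear_Pair bounded_linear_zero bounded_linear_ident)
  then show ?thesis by simp
qed

text \<open>The inverse function theorem for (y, t) \<mapsto> (y, G (y, t)): its inverse, evaluated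
  at (y, 0), has the implicit function as second component. The box around (y0, t0) on which this
  function describes all zeros of \<open>G\<close> is part of the conclusion, since later arguments
  need every solution near a point and not just one.\<close>

lemma implicit_function:
  fixes G :: "'b::euclidean_space \<times> real \<Rightarrow> real"
  assumes G: "smooth_on U G" and in_U: "(y0, t0) \<in> U" and G0: "G (y0, t0) = 0"
    and Gt: "dd (0, 1) G (y0, t0) \<noteq> 0"
  obtains V a \<xi> where "open V" "y0 \<in> V" "a > 0" "smooth_on V \<xi>" "\<xi> y0 = t0"
    "\<And>y t. y \<in> V \<Longrightarrow> \<bar>t - t0\<bar> < a \<Longrightarrow> (y, t) \<in> U"
    "\<And>y t. y \<in> V \<Longrightarrow> \<bar>t - t0\<bar> < a \<Longrightarrow> dd (0, 1) G (y, t) \<noteq> 0"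
    "\<And>y t. y \<in> V \<Longrightarrow> \<bar>t - t0\<bar> < a \<Longrightarrow> G (y, t) = 0
        \<longleftrightarrow> t = \<xi> y"
    "\<And>y. y \<in> V \<Longrightarrow> \<bar>\<xi> y - t0\<bar> < a"
    "\<And>y v. y \<in> V \<Longrightarrow> dd v \<xi> y = - dd (v, 0) G (y, \<xi> y) / dd (0, 1) G (y, \<xi> y)"
proof -
  define U1 where "U1 = {w \<in> U. dd (0, 1) G w \<noteq> 0}"
  have opU: "open U" using G smooth_on_open by blast
  have opU1: "open U1"
  proof -
    have "open (U \<inter> dd (0, 1) G -` (- {0}))"
      by (rule continuous_open_preimage)
        (use opU smooth_on_continuous[OF smooth_on_dd[OF G]] in auto)
    moreover have "U1 = U \<inter> dd (0, 1) G -` (- {0})" by (auto simp: U1_def)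
    ultimately show ?thesis by simp
  qed
  have G1: "smooth_on U1 G" using smooth_on_subset[OF G opU1] by (auto simp: U1_def)
  have in1: "(y0, t0) \<in> U1" using in_U Gt by (simp add: U1_def)
  have lin: "dd (v, s) G w = dd (v, 0) G w + s * dd (0, 1) G w" if "w \<in> U1" for v s w
    using dd_linear[OF smooth_on_differentiable[OF G1 that], of 1 "(v, 0)" s "(0, 1)"] by simp
  define f where "f w = (fst w, G w)" for w
  define f' where "f' w = Blinfun (\<lambda>v. (fst v, dd v G w))" for w
  have bl: "bounded_linear (\<lambda>v. (fst v, dd v G w))" if "w \<in> U1" for w
    using has_derivative_bounded_linear[OF smooth_on_has_derivative[OF G1 that]]
    by (intro bounded_linear_Pair bounded_linear_fst)
  have f'_apply: "blinfun_apply (f' w) = (\<lambda>v. (fst v, dd v G w))" if "w \<in> U1" for w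
    unfolding f'_def using bl[OF that] by (rule bounded_linear_Blinfun_apply)
  have derf: "(f has_derivative blinfun_apply (f' w)) (at w)" if "w \<in> U1" for w
    unfolding f'_apply[OF that] unfolding f_def
    by (intro has_derivative_Pair smooth_on_has_derivative[OF G1 that] has_derivative_fst has_derivative_ident)
  have contf: "continuous_on U1 f'"
  proof (rule continuous_on_blinfun_componentwise)
    fix i :: "'b \<times> real"
    have "continuous_on U1 (\<lambda>w. (fst i, dd i G w))"
      by (intro continuous_intros smooth_on_continuous smooth_on_dd G1)
    then show "continuous_on U1 (\<lambda>w. blinfun_apply (f' w) i)"
      by (rule continuous_on_eq) (simp add: f'_apply)
  qed
  \<comment> \<open>The derivative of \<open>f\<close> at the base point is triangular; this is its
    explicit inverse.\<close>
  define inw where "inw = Blinfun (\<lambda>v::'b \<times> real. (fst v, (snd v - dd (fst v, 0) G (y0, t0)) / dd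
      (0, 1) G (y0, t0)))"
  have bG: "bounded_linear (\<lambda>v. dd v G (y0, t0))"
    using has_derivative_bounded_linear[OF smooth_on_has_derivative[OF G1 in1]] .
  have bp: "bounded_linear (\<lambda>v::'b \<times> real. (fst v, 0::real))"
    by (intro bounded_linear_Pair bounded_linear_fst bounded_linear_zero)
  have "bounded_linear (\<lambda>v::'b \<times> real. (fst v, (snd v - dd (fst v, 0) G (y0, t0)) / dd (0, 1) G (y0,
      t0)))"
    using bounded_linear_compose[OF bG bp]
    by (intro bounded_linear_Pair bounded_linear_fst bounded_linear_divide[THEN bounded_linear_compose]
        bounded_linear_sub bounded_linear_snd) (simp_all add: o_def)
  then have inw_apply: "blinfun_apply inw v = (fst v, (snd v - dd (fst v, 0) G (y0, t0)) / dd (0, 1) G (y0, t0))" for v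
    unfolding inw_def by (simp add: bounded_linear_Blinfun_apply)
  have invf: "inw o\<^sub>L f' (y0, t0) = id_blinfun"
  proof (rule blinfun_eqI)
    fix v
    show "blinfun_apply (inw o\<^sub>L f' (y0, t0)) v = blinfun_apply id_blinfun v"
      using lin[OF in1, of "fst v" "snd v"] Gt
      by (simp add: inw_apply f'_apply[OF in1])
  qed
  obtain U' V g g' where U': "open U'" "U' \<subseteq> U1" "(y0, t0) \<in> U'" and V: "open V" "f (y0, t0) \<in> V"
    and hom: "homeomorphism U' V f g"
    and g': "\<And>y. y \<in> V \<Longrightarrow> (g has_derivative (g' y)) (at y)"
    using inverse_function_theorem[OF opU1 derf contf in1 invf] by metis
  obtain A B where AB: "open A" "open B" "y0 \<in> A" "t0 \<in> B" "A \<times> B \<subseteq> U'"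
    by (rule open_prod_elim[OF U'(1,3)]) (use that in blast)
  obtain a where a: "a > 0" "\<And>t. \<bar>t - t0\<bar> < a \<Longrightarrow> t \<in> B"
    using AB(2,4) by (metis dist_real_def open_dist)
  define \<xi> where "\<xi> y = snd (g (y, 0))" for y
  \<comment> \<open>The last condition confines \<open>\<xi> y\<close> to the interval on which (y,
    t) stays in the domain where \<open>f\<close> is injective, so a zero of \<open>G\<close> there
    must be the point of the graph.\<close>
  define V' where "V' = {y \<in> A. (y, 0) \<in> V \<and> \<bar>\<xi> y - t0\<bar> < a}"
  have contg: "continuous_on V g" using hom by (simp add: homeomorphism_def)
  have opV': "open V'"
  proof -
    have "open (A \<inter> (\<lambda>y. (y, 0::real)) -` V)"
      by (rule continuous_open_preimage) (use AB V in \<open>auto intro!: continuous_intros\<close>)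
    then have "open ((A \<inter> (\<lambda>y. (y, 0::real)) -` V) \<inter> \<xi> -` {t0 - a <..< t0 + a})"
    proof (rule continuous_open_preimage[rotated])
      show "continuous_on (A \<inter> (\<lambda>y. (y, 0::real)) -` V) \<xi>"
        unfolding \<xi>_def
        by (intro continuous_intros continuous_on_compose2[OF contg]) auto
    qed auto
    moreover have "V' = (A \<inter> (\<lambda>y. (y, 0::real)) -` V) \<inter> \<xi> -` {t0 - a <..< t0 + a}"
      by (auto simp: V'_def)
    ultimately show ?thesis by simp
  qed
  have fg: "f (g z) = z" "g z \<in> U'" if "z \<in> V" for z
    using hom that by (auto simp: homeomorphism_def)
  have gf: "g (f w) = w" if "w \<in> U'" for w
    using hom that by (auto simp: homeomorphism_def)
  have g0: "g (y0, 0) = (y0, t0)" using gf[OF U'(3)] G0 by (simp add: f_def)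
  have y0: "y0 \<in> V'" using AB V a G0 g0 by (simp add: V'_def \<xi>_def f_def)
  have inU': "(y, t) \<in> U'" if "y \<in> V'" "\<bar>t - t0\<bar> < a" for y t
    using that a AB by (auto simp: V'_def)
  have zero: "G (y, t) = 0 \<longleftrightarrow> t = \<xi> y" if "y \<in> V'" "\<bar>t - t0\<bar> < a" for y t
  proof
    assume "G (y, t) = 0"
    then show "t = \<xi> y" using gf[OF inU'[OF that]] by (simp add: f_def \<xi>_def)
  next
    assume t: "t = \<xi> y"
    have "(y, 0) \<in> V" using that by (simp add: V'_def)
    from fg(1)[OF this] have "fst (g (y, 0)) = y" "G (g (y, 0)) = 0" by (auto simp: f_def)
    then show "G (y, t) = 0" unfolding t \<xi>_def by (metis prod.collapse)
  qed
  have ximem: "\<bar>\<xi> y - t0\<bar> < a" if "y \<in> V'" for y using that by (simp add: V'_def)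
  have inU1: "(y, \<xi> y) \<in> U1" if "y \<in> V'" for y using inU'[OF that ximem[OF that]] U' by blast
  have der: "(\<xi> has_derivative (\<lambda>v. - dd (v, 0) G (y, \<xi> y) / dd (0, 1) G (y, \<xi> y))) (at y)" if
      y: "y \<in> V'" for y
  proof -
    have "(y, 0) \<in> V" using y by (simp add: V'_def)
    then have gd: "g differentiable (at (y, 0))" using g' by (auto intro: differentiableI)
    have "((\<lambda>y. (y, 0::real)) has_derivative (\<lambda>v. (v, 0))) (at y)"
      by (intro has_derivative_Pair has_derivative_ident has_derivative_const)
    from has_derivative_snd[OF dd_chain[OF gd this]]
    have xd: "\<xi> differentiable (at y)" unfolding \<xi>_def by (rule differentiableI)
    note hx = has_derivative_dd[OF xd]
    have "((\<lambda>y. G (y, \<xi> y)) has_derivative (\<lambda>v. dd (v, dd v \<xi> y) G (y, \<xi> y))) (at y)"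
      by (rule dd_chain[of G "\<lambda>y. (y, \<xi> y)"])
        (use smooth_on_differentiable[OF G1 inU1[OF y]] hx in \<open>auto intro!: derivative_intros\<close>)
    moreover have "((\<lambda>y. G (y, \<xi> y)) has_derivative (\<lambda>v. 0)) (at y)"
      by (rule has_derivative_transform_within_open[of "\<lambda>y. 0", OF _ opV' y])
        (use zero ximem in auto)
    ultimately have "dd (v, dd v \<xi> y) G (y, \<xi> y) = 0" for v
      using has_derivative_unique by (metis (no_types, lifting))
    then have "dd v \<xi> y = - dd (v, 0) G (y, \<xi> y) / dd (0, 1) G (y, \<xi> y)" for v
      using lin[OF inU1[OF y], of v "dd v \<xi> y"] inU1[OF y] by (simp add: U1_def field_simps)
    then show ?thesis using hx by simp
  qed
  \<comment> \<open>Bootstrapping: the derivative of \<open>\<xi>\<close> is a smooth function of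
    (y, \<xi> y), so each order of smoothness yields the next one.\<close>
  have "ck n V' \<xi>" for n
  proof (induction n)
    case (Suc n)
    define q where "q v w = - dd (v, 0) G w / dd (0, 1) G w" for v w
    have q: "smooth_on U1 (q v)" for v
      unfolding q_def by (intro smooth_intros smooth_on_dd G1) (auto simp: U1_def)
    show ?case
    proof (rule ck_SucI[OF opV'])
      show "(\<xi> has_derivative (\<lambda>v. q v (y, \<xi> y))) (at y)" if "y \<in> V'" for y
        using der[OF that] by (simp add: q_def)
      show "ck n V' (\<lambda>y. q v (y, \<xi> y))" for v
        by (rule ck_compose[where V=U1, OF opV'])
          (use q inU1 Suc in \<open>auto simp: smooth_on_iff_ck intro!: ck_Pair[OF opV' ck_bounded_linear[OF opV'
            bounded_linear_ident]]\<close>)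
    qed
  qed simp
  then have "smooth_on V' \<xi>" using opV' by (simp add: smooth_on_iff_ck)
  moreover have "\<xi> y0 = t0" by (simp add: \<xi>_def g0)
  moreover have "(y, t) \<in> U" "dd (0, 1) G (y, t) \<noteq> 0" if "y \<in> V'" "\<bar>t - t0\<bar> < a" for y t
    using inU'[OF that] U' by (auto simp: U1_def)
  moreover have "dd v \<xi> y = - dd (v, 0) G (y, \<xi> y) / dd (0, 1) G (y, \<xi> y)" if "y \<in> V'" for v y
    using dd_eqI[OF der[OF that]] .
  ultimately show ?thesis using that opV' y0 a(1) zero ximem by blast
qed

text \<open>The germ version of \<open>diffeo_between\<close>. It takes an arbitrary smooth inverse
  instead of \<open>inv_into U f\<close>, whose definition refers to the domain; thus domains can be
  shrunk and maps composed without touching the inverse.\<close>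

definition local_diffeo :: "('a::euclidean_space \<Rightarrow> 'b::euclidean_space) \<Rightarrow> 'a \<Rightarrow>
    bool" where
  "local_diffeo f a \<longleftrightarrow> (\<exists>U g. open U \<and> a \<in> U \<and> open (f ` U) \<and>
      smooth_on U f \<and> smooth_on (f ` U) g \<and>
     (\<forall>x\<in>U. g (f x) = x))"

lemma open_image_of_inverse:
  assumes "open (f ` U)" "continuous_on (f ` U) g" "\<forall>x\<in>U. g (f x) = x" "open V" "V \<subseteq> U"
  shows "open (f ` V)"
proof -
  have "open (f ` U \<inter> g -` V)" by (rule continuous_open_preimage) (use assms in auto)
  moreover have "f ` V = f ` U \<inter> g -` V" using assms by force
  ultimately show ?thesis by simp
qed

lemma local_diffeo_diffeo_between:
  assumes "local_diffeo f a" "open N" "a \<in> N"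
  obtains U where "a \<in> U" "U \<subseteq> N" "open U" "open (f ` U)" "diffeo_between U (f ` U) f"
proof -
  obtain U g where U: "open U" "a \<in> U" "open (f ` U)" "smooth_on U f" "smooth_on (f ` U) g"
    "\<forall>x\<in>U. g (f x) = x" using assms unfolding local_diffeo_def by blast
  define V where "V = U \<inter> N"
  have V: "open V" "V \<subseteq> U" "a \<in> V" using U assms by (auto simp: V_def)
  have op: "open (f ` V)"
    by (rule open_image_of_inverse[OF U(3) _ U(6) V(1,2)]) (use U smooth_on_continuous in blast)
  have inj: "inj_on f V" using U(6) V(2) by (metis inj_on_def subset_iff)
  have "inv_into V f y = g y" if "y \<in> f ` V" for y
    using that inj U(6) V(2) by (auto simp: subset_iff)
  then have "smooth_on (f ` V) (inv_into V f)"
    using smooth_on_cong[OF smooth_on_subset[OF U(5) op]] V(2) by (metis image_mono)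
  then have "diffeo_between V (f ` V) f"
    unfolding diffeo_between_def using inj smooth_on_subset[OF U(4) V(1,2)] by (simp add: bij_betw_def)
  then show ?thesis using that[of V] V op by (auto simp: V_def)
qed

lemma local_diffeo_compose:
  assumes "local_diffeo f a" "local_diffeo h (f a)"
  shows "local_diffeo (\<lambda>x. h (f x)) a"
proof -
  obtain U g where U: "open U" "a \<in> U" "open (f ` U)" "smooth_on U f" "smooth_on (f ` U) g"
    "\<forall>x\<in>U. g (f x) = x" using assms unfolding local_diffeo_def by blast
  obtain U2 g2 where U2: "open U2" "f a \<in> U2" "open (h ` U2)" "smooth_on U2 h" "smooth_on (h ` U2) g2"
    "\<forall>x\<in>U2. g2 (h x) = x" using assms unfolding local_diffeo_def by blast
  define V where "V = U \<inter> f -` U2"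
  have V: "open V" "V \<subseteq> U" "a \<in> V" "f ` V \<subseteq> U2"
    unfolding V_def using U U2 continuous_open_preimage[OF smooth_on_continuous[OF U(4)] U(1) U2(1)] by auto
  have op: "open (f ` V)"
    by (rule open_image_of_inverse[OF U(3) _ U(6) V(1,2)]) (use U smooth_on_continuous in blast)
  have op2: "open (h ` f ` V)"
    by (rule open_image_of_inverse[OF U2(3) _ U2(6) op V(4)]) (use U2 smooth_on_continuous in blast)
  have sm: "smooth_on V (\<lambda>x. h (f x))"
    by (rule smooth_on_compose[OF U2(4) smooth_on_subset[OF U(4) V(1,2)] V(4)])
  have sm2: "smooth_on (h ` f ` V) (\<lambda>x. g (g2 x))"
  proof (rule smooth_on_compose[where V="f ` V"])
    show "smooth_on (f ` V) g" by (rule smooth_on_subset[OF U(5) op]) (use V in auto)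
    show "smooth_on (h ` f ` V) g2" by (rule smooth_on_subset[OF U2(5) op2]) (use V in auto)
    show "g2 ` h ` f ` V \<subseteq> f ` V" using U2(6) V(4) by force
  qed
  have inv: "\<forall>x\<in>V. g (g2 (h (f x))) = x" using U(6) U2(6) V by (simp add: image_subset_iff subset_iff)
  show ?thesis unfolding local_diffeo_def
    by (rule exI[of _ V], rule exI[of _ "\<lambda>x. g (g2 x)"])
      (use V op2 sm sm2 inv in \<open>simp add: image_image\<close>)
qed

lemma local_diffeo_global:
  assumes "smooth_on UNIV f" "smooth_on UNIV g" "\<And>x. g (f x) = x" "\<And>y. f (g y) = y"
  shows "local_diffeo f a"
proof -
  have "f ` UNIV = UNIV" using assms by (metis surjI)
  then show ?thesis unfolding local_diffeo_def using assms
    by (intro exI[of _ UNIV] exI[of _ g]) auto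
qed

text \<open>A map that changes one coordinate only is inverted by the implicit function theorem for
  G (y, t) - c = 0, with the value c as an additional parameter. All coordinate changes below are
  composed of such maps, swaps, products and globally invertible maps.\<close>

lemma local_diffeo_snd:
  fixes G :: "'b::euclidean_space \<times> real \<Rightarrow> real"
  assumes G: "smooth_on U G" and in_U: "(y0, t0) \<in> U" and Gt: "dd (0, 1) G (y0, t0) \<noteq> 0"
  shows "local_diffeo (\<lambda>w. (fst w, G w)) (y0, t0)"
proof -
  have opU: "open U" using G smooth_on_open by blast
  define H where "H w = G (fst (fst w), snd w) - snd (fst w)" for w :: "('b \<times> real) \<times> real"
  define UH where "UH = (\<lambda>w::('b \<times> real) \<times> real. (fst (fst w), snd w)) -` U"
  have opUH: "open UH" unfolding UH_def
    by (rule open_vimage[OF opU]) (intro continuous_intros)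
  have sH: "smooth_on UH H"
    unfolding H_def
    by (intro smooth_on_diff smooth_on_compose[OF G] smooth_intros opUH) (auto simp: UH_def)
  have in_UH: "((y0, G (y0, t0)), t0) \<in> UH" using in_U by (simp add: UH_def)
  have "(H has_derivative (\<lambda>v. dd (fst (fst v), snd v) G (y0, t0) - snd (fst v))) (at ((y0, G (y0, t0)), t0))"
    unfolding H_def
  proof (rule has_derivative_diff)
    have "((\<lambda>x::('b \<times> real) \<times> real. (fst (fst x), snd x)) has_derivative (\<lambda>v. (fst
        (fst v), snd v)))
        (at ((y0, G (y0, t0)), t0))"
      by (intro has_derivative_Pair has_derivative_fst has_derivative_snd has_derivative_ident)
    from dd_chain[OF _ this, of G] smooth_on_differentiable[OF G in_U]
    show "((\<lambda>x. G (fst (fst x), snd x)) has_derivative (\<lambda>v. dd (fst (fst v), snd v) G (y0, t0)))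
        (at ((y0, G (y0, t0)), t0))" by simp
  qed (auto intro!: derivative_eq_intros)
  from dd_eqI[OF this, of "(0, 1)"] have Ht: "dd (0, 1) H ((y0, G (y0, t0)), t0) \<noteq> 0"
    using Gt by simp
  have H0: "H ((y0, G (y0, t0)), t0) = 0" by (simp add: H_def)
  obtain V a \<xi> where V: "open V" "(y0, G (y0, t0)) \<in> V" "a > 0" "smooth_on V \<xi>"
    and inUH: "\<And>y t. y \<in> V \<Longrightarrow> \<bar>t - t0\<bar> < a \<Longrightarrow> (y, t) \<in> UH"
    and zero: "\<And>y t. y \<in> V \<Longrightarrow> \<bar>t - t0\<bar> < a \<Longrightarrow> H (y, t) = 0
        \<longleftrightarrow> t = \<xi> y"
    and xi: "\<And>y. y \<in> V \<Longrightarrow> \<bar>\<xi> y - t0\<bar> < a"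
    by (rule implicit_function[OF sH in_UH H0 Ht]) (rule that; assumption)
  let ?f = "\<lambda>w. (fst w, G w)"
  define S where "S = (U \<inter> ?f -` V) \<inter> snd -` {t0 - a<..<t0 + a}"
  have sf: "smooth_on U ?f" by (intro smooth_intros G opU)
  have "open (U \<inter> ?f -` V)"
    by (rule continuous_open_preimage[OF smooth_on_continuous[OF sf] opU V(1)])
  then have opS: "open S"
    unfolding S_def by (rule open_Int) (auto intro!: open_vimage continuous_intros)
  have inv: "\<xi> (?f w) = snd w" if "w \<in> S" for w
  proof -
    have "?f w \<in> V" "\<bar>snd w - t0\<bar> < a" using that by (auto simp: S_def)
    moreover have "H (?f w, snd w) = 0" by (simp add: H_def)
    ultimately show ?thesis using zero by metis
  qed
  have im: "?f ` S = V"
  proof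
    show "V \<subseteq> ?f ` S"
    proof
      fix z assume z: "z \<in> V"
      then have "H (z, \<xi> z) = 0" "(z, \<xi> z) \<in> UH" using zero inUH xi by auto
      then have 1: "G (fst z, \<xi> z) = snd z" "(fst z, \<xi> z) \<in> U" by (auto simp: H_def UH_def)
      then have e: "z = ?f (fst z, \<xi> z)" by simp
      have "(fst z, \<xi> z) \<in> S" using 1 z xi[OF z] by (auto simp: S_def)
      then show "z \<in> ?f ` S" by (subst e) (rule imageI)
    qed
  qed (auto simp: S_def)
  show ?thesis unfolding local_diffeo_def
  proof (intro exI conjI)
    show "open S" by fact
    show "(y0, t0) \<in> S" using in_U V by (simp add: S_def)
    show "open (?f ` S)" using im V by simp
    show "smooth_on S ?f" by (rule smooth_on_subset[OF sf opS]) (auto simp: S_def)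
    show "smooth_on (?f ` S) (\<lambda>z. (fst z, \<xi> z))" unfolding im by (intro smooth_intros V)
    show "\<forall>x\<in>S. (fst (?f x), \<xi> (?f x)) = x" using inv by simp
  qed
qed

section \<open>Division of smooth functions\<close>

lemma param_integral_has_derivative:
  fixes \<phi> :: "real \<times> 'a::euclidean_space \<Rightarrow> real"
  assumes f: "smooth_on U \<phi>" and sub: "{0..1} \<times> V \<subseteq> U" and V: "open V" and y0: "y0 \<in> V"
  shows "((\<lambda>y. integral {0..1} (\<lambda>s. \<phi> (s, y))) has_derivative
    (\<lambda>v. integral {0..1} (\<lambda>s. dd (0, v) \<phi> (s, y0)))) (at y0)"
proof -
  obtain r where r: "r > 0" "ball y0 r \<subseteq> V" using V y0 openE by blast
  define fx where "fx y s = Blinfun (\<lambda>v. dd (0, v) \<phi> (s, y))" for y s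
  have inU: "(s, y) \<in> U" if "s \<in> {0..1}" "y \<in> ball y0 r" for s y
    using that(1) subsetD[OF r(2) that(2)] sub by blast
  have bl: "bounded_linear (\<lambda>v. dd (0, v) \<phi> (s, y))" if "s \<in> {0..1}" "y \<in> ball y0 r" for s y
    using bounded_linear_compose[OF has_derivative_bounded_linear[OF smooth_on_has_derivative[OF f inU[OF that]]]
        bounded_linear_Pair[OF bounded_linear_zero bounded_linear_ident]] by simp
  have app: "blinfun_apply (fx y s) = (\<lambda>v. dd (0, v) \<phi> (s, y))" if "s \<in> {0..1}" "y \<in> ball y0
      r" for s y
    unfolding fx_def using bl[OF that] by (rule bounded_linear_Blinfun_apply)
  have contphi: "continuous_on U (dd (0, v) \<phi>)" for v
    by (rule smooth_on_continuous[OF smooth_on_dd[OF f]])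
  have cont: "continuous_on (ball y0 r \<times> cbox 0 1) (\<lambda>(y, s). fx y s)"
  proof (rule continuous_on_blinfun_componentwise)
    fix i :: 'a
    have "continuous_on (ball y0 r \<times> cbox 0 1) (\<lambda>w. dd (0, i) \<phi> (snd w, fst w))"
      by (rule continuous_on_compose2[OF contphi])
        (use inU in \<open>auto intro!: continuous_intros\<close>)
    then show "continuous_on (ball y0 r \<times> cbox 0 1) (\<lambda>x. blinfun_apply (case x of (y, s)
        \<Rightarrow> fx y s) i)"
      by (rule continuous_on_eq) (auto simp: app)
  qed
  have leib: "((\<lambda>y. integral (cbox 0 1) (\<lambda>s. \<phi> (s, y))) has_derivative
      blinfun_apply (integral (cbox 0 1) (fx y0))) (at y0 within ball y0 r)"
  proof (rule leibniz_rule[OF _ _ cont])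
    fix y s assume ys: "y \<in> ball y0 r" "s \<in> cbox 0 (1::real)"
    then have ys': "s \<in> {0..1}" by auto
    have "((\<lambda>y. \<phi> (s, y)) has_derivative (\<lambda>v. dd (0, v) \<phi> (s, y))) (at y)"
      by (rule dd_chain[of \<phi> "\<lambda>y. (s, y)"])
        (use smooth_on_differentiable[OF f inU[OF ys' ys(1)]] in \<open>auto intro!: derivative_intros\<close>)
    then show "((\<lambda>y. \<phi> (s, y)) has_derivative blinfun_apply (fx y s)) (at y within ball y0 r)"
      using app[OF ys' ys(1)] by (simp add: has_derivative_at_withinI)
  next
    fix y assume y: "y \<in> ball y0 r"
    show "(\<lambda>s. \<phi> (s, y)) integrable_on cbox 0 1"
      by (rule integrable_continuous, rule continuous_on_compose2[OF smooth_on_continuous[OF f]])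
        (use inU[OF _ y] in \<open>auto intro!: continuous_intros\<close>)
  qed (use r in auto)
  have B: "blinfun_apply (integral (cbox 0 1) (fx y0)) v = integral {0..1} (\<lambda>s. dd (0, v) \<phi> (s, y0))" for v
  proof -
    have y0b: "y0 \<in> ball y0 r" using r by simp
    have "fx y0 integrable_on cbox 0 1"
    proof (rule integrable_continuous)
      have "continuous_on (cbox 0 1) (\<lambda>s. (\<lambda>(y, s). fx y s) (y0, s))"
        by (rule continuous_on_compose2[OF cont]) (use r in \<open>auto intro!: continuous_intros\<close>)
      then show "continuous_on (cbox 0 1) (fx y0)" by simp
    qed
    then have "blinfun_apply (integral (cbox 0 1) (fx y0)) v = integral (cbox 0 1) (\<lambda>s. blinfun_apply (fx
        y0 s) v)"
      using integral_linear[OF _ blinfun.bounded_linear_left, of "fx y0" "cbox 0 1" v] by (simp add: o_def)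
    also have "\<dots> = integral (cbox 0 1) (\<lambda>s. dd (0, v) \<phi> (s, y0))"
      by (rule integral_cong) (use app[OF _ y0b] in auto)
    finally show ?thesis by simp
  qed
  have "blinfun_apply (integral (cbox 0 1) (fx y0)) = (\<lambda>v. integral {0..1} (\<lambda>s. dd (0, v) \<phi>
      (s, y0)))"
    by (rule ext) (rule B)
  with leib have "((\<lambda>y. integral {0..1} (\<lambda>s. \<phi> (s, y))) has_derivative
    (\<lambda>v. integral {0..1} (\<lambda>s. dd (0, v) \<phi> (s, y0)))) (at y0 within ball y0 r)" by simp
  then show ?thesis using r by (simp add: at_within_open[of y0 "ball y0 r"])
qed

text \<open>By coinduction on the class of integrals over [0, 1] of functions smooth on
  \<open>U\<close>: differentiation under the integral sign stays in this class.\<close>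

lemma smooth_on_param_integral:
  fixes \<phi> :: "real \<times> 'a::euclidean_space \<Rightarrow> real"
  assumes f: "smooth_on U \<phi>" and sub: "{0..1} \<times> V \<subseteq> U" and V: "open V"
  shows "smooth_on V (\<lambda>y. integral {0..1} (\<lambda>s. \<phi> (s, y)))"
proof (rule smooth_on_coinduct[OF V, where X="\<lambda>f. \<exists>\<phi>. smooth_on U \<phi> \<and> f =
    (\<lambda>y. integral {0..1} (\<lambda>s. \<phi> (s, y)))"])
  fix f :: "'a \<Rightarrow> real" assume "\<exists>\<phi>. smooth_on U \<phi> \<and> f = (\<lambda>y. integral
      {0..1} (\<lambda>s. \<phi> (s, y)))"
  then obtain \<phi> where \<phi>: "smooth_on U \<phi>" "f = (\<lambda>y. integral {0..1} (\<lambda>s. \<phi> (s,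
      y)))" by blast
  show "\<exists>D. (\<forall>x\<in>V. (f has_derivative (\<lambda>v. D v x)) (at x)) \<and>
      (\<forall>v. \<exists>\<phi>. smooth_on U \<phi> \<and> D v = (\<lambda>y. integral {0..1} (\<lambda>s.
          \<phi> (s, y))))"
    using param_integral_has_derivative[OF \<phi>(1) sub V] smooth_on_dd[OF \<phi>(1)] unfolding \<phi>(2)
    by (intro exI[of _ "\<lambda>v x. integral {0..1} (\<lambda>s. dd (0, v) \<phi> (s, x))"]) auto
qed (use f in blast)

text \<open>Hadamard's lemma: the quotient is the integral over s in [0, 1] of the derivative of
  \<open>f\<close> in its first variable at (s u, y), by the fundamental theorem along the segment
  from (0, y) to (u, y).\<close>

lemma hadamard_division:
  fixes f :: "real \<times> 'b::euclidean_space \<Rightarrow> real"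
  assumes f: "smooth_on ({-\<eta><..<\<eta>} \<times> V) f" and V: "open V" and f0: "\<And>y. y \<in> V
      \<Longrightarrow> f (0, y) = 0"
    and \<eta>: "\<eta> > 0"
  obtains k where "smooth_on ({-\<eta><..<\<eta>} \<times> V) k"
    "\<And>u y. \<bar>u\<bar> < \<eta> \<Longrightarrow> y \<in> V \<Longrightarrow> f (u, y) = u * k (u, y)"
    "\<And>y. y \<in> V \<Longrightarrow> k (0, y) = dd (1, 0) f (0, y)"
proof -
  let ?B = "{-\<eta><..<\<eta>} \<times> V"
  have opB: "open ?B" by (intro open_Times V open_greaterThanLessThan)
  define g where "g w = (fst w * fst (snd w), snd (snd w))" for w :: "real \<times> real \<times> 'b"
  define U where "U = g -` ?B"
  have opU: "open U" unfolding U_def g_def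
    by (rule open_vimage[OF opB]) (intro continuous_intros)
  define k where "k y = integral {0..1} (\<lambda>s. dd (1, 0) f (g (s, y)))" for y
  have sub: "{0..1} \<times> ?B \<subseteq> U"
  proof
    fix w :: "real \<times> real \<times> 'b" assume w: "w \<in> {0..1} \<times> ?B"
    obtain s u y where [simp]: "w = (s, u, y)" by (metis prod.collapse)
    have s: "0 \<le> s" "s \<le> 1" "\<bar>u\<bar> < \<eta>" "y \<in> V" using w by auto
    then have "\<bar>s * u\<bar> < \<eta>" using mult_left_le_one_le[of "\<bar>u\<bar>" s] by (simp add: abs_mult)
    then show "w \<in> U" using s by (auto simp: U_def g_def)
  qed
  have sk: "smooth_on ?B k" unfolding k_def
  proof (rule smooth_on_param_integral[OF _ sub opB])
    show "smooth_on U (\<lambda>w. dd (1, 0) f (g w))"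
      by (rule smooth_on_compose[OF smooth_on_dd[OF f]])
        (auto simp: U_def g_def[abs_def] intro!: smooth_intros opU[unfolded U_def g_def[abs_def]])
  qed
  have eq: "f (u, y) = u * k (u, y)" if u: "\<bar>u\<bar> < \<eta>" and y: "y \<in> V" for u y
  proof -
    have inB: "(s * u, y) \<in> ?B" if "0 \<le> s" "s \<le> 1" for s :: real
    proof -
      have "(s, u, y) \<in> {0..1} \<times> ?B" using that u y by auto
      then have "(s, u, y) \<in> U" using sub by blast
      then show ?thesis by (simp add: U_def g_def)
    qed
    have "((\<lambda>s. u * dd (1, 0) f (g (s, (u, y)))) has_integral f (1 * u, y) - f (0 * u, y)) {0..1}"
    proof (rule fundamental_theorem_of_calculus)
      fix s :: real assume s: "s \<in> {0..1}"
      have fd: "f differentiable (at (s * u, y))" using smooth_on_differentiable[OF f] inB s by auto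
      have "((\<lambda>s. f (s * u, y)) has_derivative (\<lambda>h. dd (h * u, 0) f (s * u, y))) (at s)"
        by (rule dd_chain[of f "\<lambda>s. (s * u, y)", OF fd]) (auto intro!: derivative_eq_intros)
      moreover have "dd (h * u, 0) f (s * u, y) = h * (u * dd (1, 0) f (s * u, y))" for h
        using dd_linear[OF fd, of "h * u" "(1, 0)" 0 0] by simp
      ultimately show "((\<lambda>s. f (s * u, y)) has_vector_derivative u * dd (1, 0) f (g (s, u, y))) (at s
          within {0..1})"
        unfolding has_vector_derivative_def by (simp add: g_def has_derivative_at_withinI)
    qed simp
    from integral_unique[OF this] show ?thesis using f0[OF y] by (simp add: k_def)
  qed
  have "k (0, y) = dd (1, 0) f (0, y)" for y by (simp add: k_def g_def)
  then show ?thesis using that sk eq by blast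
qed

lemma dd_real: "(f has_real_derivative D) (at x) \<Longrightarrow> dd v f x = v * D"
  unfolding has_field_derivative_def by (auto dest: dd_eqI[of f _ x v])

lemma has_real_derivative_dd:
  fixes f :: "real \<Rightarrow> real"
  assumes "f differentiable (at x)" shows "(f has_real_derivative dd 1 f x) (at x)"
proof -
  have "dd v f x = dd 1 f x * v" for v using dd_linear[OF assms, of v 1 0 0] by simp
  then have "(\<lambda>v. dd v f x) = (*) (dd 1 f x)" by blast
  then show ?thesis using has_derivative_dd[OF assms] unfolding has_field_derivative_def by simp
qed

lemma curve_has_real_derivative:
  fixes f :: "'a::real_normed_vector \<Rightarrow> real" and g :: "real \<Rightarrow> 'a"
  assumes "f differentiable (at (g t))" "(g has_vector_derivative g') (at t)"
  shows "((\<lambda>t. f (g t)) has_real_derivative dd g' f (g t)) (at t)"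
proof -
  have "dd (h *\<^sub>R g') f (g t) = dd g' f (g t) * h" for h
    using dd_linear[OF assms(1), of h g' 0 0] by simp
  then have "(\<lambda>h. dd (h *\<^sub>R g') f (g t)) = (*) (dd g' f (g t))" by blast
  then show ?thesis using dd_chain[OF assms(1) assms(2)[unfolded has_vector_derivative_def]]
    unfolding has_field_derivative_def by simp
qed

lemma hadamard_division2:
  fixes f :: "real \<times> 'b::euclidean_space \<Rightarrow> real"
  assumes f: "smooth_on ({-\<eta><..<\<eta>} \<times> V) f" and V: "open V" and f0: "\<And>y. y \<in> V
      \<Longrightarrow> f (0, y) = 0"
    and f1: "\<And>y. y \<in> V \<Longrightarrow> dd (1, 0) f (0, y) = 0" and \<eta>: "\<eta> > 0"
  obtains k where "smooth_on ({-\<eta><..<\<eta>} \<times> V) k"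
    "\<And>u y. \<bar>u\<bar> < \<eta> \<Longrightarrow> y \<in> V \<Longrightarrow> f (u, y) = u\<^sup>2 * k (u, y)"
    "\<And>y. y \<in> V \<Longrightarrow> 2 * k (0, y) = dd (1, 0) (dd (1, 0) f) (0, y)"
proof -
  let ?B = "{-\<eta><..<\<eta>} \<times> V"
  have opB: "open ?B" by (intro open_Times V open_greaterThanLessThan)
  obtain k where k: "smooth_on ?B k" "\<And>u y. \<bar>u\<bar> < \<eta> \<Longrightarrow> y \<in> V
      \<Longrightarrow> f (u, y) = u * k (u, y)"
    "\<And>y. y \<in> V \<Longrightarrow> k (0, y) = dd (1, 0) f (0, y)"
    using hadamard_division[OF f V f0 \<eta>] by blast
  obtain l where l: "smooth_on ?B l" "\<And>u y. \<bar>u\<bar> < \<eta> \<Longrightarrow> y \<in> V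
      \<Longrightarrow> k (u, y) = u * l (u, y)"
    "\<And>y. y \<in> V \<Longrightarrow> l (0, y) = dd (1, 0) k (0, y)"
    using hadamard_division[OF k(1) V _ \<eta>] k(3) f1 by auto
  have "2 * l (0, y) = dd (1, 0) (dd (1, 0) f) (0, y)" if y: "y \<in> V" for y
  proof -
    have in0: "(0, y) \<in> ?B" using y \<eta> by simp
    have "dd (1, 0) f w = fst w * dd (1, 0) k w + k w" if w: "w \<in> ?B" for w
    proof -
      have "dd (1, 0) f w = dd (1, 0) (\<lambda>w. fst w * k w) w"
        by (rule dd_cong_open[OF opB _ w]) (use k(2) in auto)
      moreover have "((\<lambda>w. fst w * k w) has_derivative (\<lambda>h. fst w * dd h k w + fst h * k w)) (at w)"
        by (intro has_derivative_mult has_derivative_fst has_derivative_ident smooth_on_has_derivative[OF k(1) w])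
      from dd_eqI[OF this, of "(1, 0)"]
      have "dd (1, 0) (\<lambda>w. fst w * k w) w = fst w * dd (1, 0) k w + k w" by simp
      ultimately show ?thesis using \<open>dd (1, 0) f w = dd (1, 0) (\<lambda>w. fst w * k w) w\<close> by simp
    qed
    then have "dd (1, 0) (dd (1, 0) f) (0, y) = dd (1, 0) (\<lambda>w. fst w * dd (1, 0) k w + k w) (0, y)"
      by (intro dd_cong_open[OF opB _ in0]) auto
    moreover have "((\<lambda>w. fst w * dd (1, 0) k w + k w) has_derivative
        (\<lambda>h. fst (0, y) * dd h (dd (1, 0) k) (0, y) + fst h * dd (1, 0) k (0, y) + dd h k (0, y))) (at (0, y))"
      by (intro has_derivative_mult has_derivative_add has_derivative_fst has_derivative_ident
          smooth_on_has_derivative[OF k(1) in0] smooth_on_has_derivative[OF smooth_on_dd[OF k(1)] in0])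
    from dd_eqI[OF this, of "(1, 0)"] have "dd (1, 0) (\<lambda>w. fst w * dd (1, 0) k w + k w) (0, y)
        = dd (1, 0) k (0, y) + dd (1, 0) k (0, y)" by simp
    ultimately show ?thesis using l(3)[OF y] by simp
  qed
  then show ?thesis using that[of l] l k by (simp add: power2_eq_square algebra_simps)
qed

section \<open>The Morse lemma and fold curves\<close>

lemma open_smooth_pos:
  fixes k :: "'a::real_normed_vector \<Rightarrow> real"
  assumes "smooth_on U k" shows "open {w \<in> U. k w > 0}"
proof -
  have "open (U \<inter> k -` {0<..})"
    using smooth_on_continuous[OF assms] smooth_on_open[OF assms] by (rule continuous_open_preimage) auto
  moreover have "{w \<in> U. k w > 0} = U \<inter> k -` {0<..}" by auto
  ultimately show ?thesis by simp
qed

lemma open_smooth_vimage: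
  assumes "smooth_on U g" "open S" shows "open {w \<in> U. g w \<in> S}"
proof -
  have "open (U \<inter> g -` S)"
    using smooth_on_continuous[OF assms(1)] smooth_on_open[OF assms(1)] assms(2) by (rule continuous_open_preimage)
  moreover have "{w \<in> U. g w \<in> S} = U \<inter> g -` S" by auto
  ultimately show ?thesis by simp
qed

lemma dd_scale_Pair:
  fixes f :: "real \<times> real \<Rightarrow> real"
  assumes "f differentiable (at x)" shows "dd (a, b) f x = a * dd (1, 0) f x + b * dd (0, 1) f x"
  using dd_linear[OF assms, of a "(1, 0)" b "(0, 1)"] by simp

lemma has_vector_derivative_graph:
  assumes "(\<rho> has_real_derivative r) (at v)"
  shows "((\<lambda>v. (\<rho> v, v)) has_vector_derivative (r, 1)) (at v)"
  using assms unfolding has_real_derivative_iff_has_vector_derivative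
  by (intro has_vector_derivative_Pair has_vector_derivative_id) 

text \<open>The second derivative of \<open>\<rho>\<close> would enter with the factor
  \<open>dd (1, 0) f (0, 0)\<close>, which is 0; so only \<open>dd 1 \<rho> 0\<close> and the
  Hessian of \<open>f\<close> remain.\<close>

lemma graph_second_derivative:
  fixes f :: "real \<times> real \<Rightarrow> real" and \<rho> :: "real \<Rightarrow> real"
  assumes f: "smooth_on U f" and \<rho>: "smooth_on V \<rho>" and V: "0 \<in> V" "\<rho> 0 = 0"
    and sub: "\<And>v. v \<in> V \<Longrightarrow> (\<rho> v, v) \<in> U"
    and f1: "dd (1, 0) f (0, 0) = 0" and f2: "dd (0, 1) f (0, 0) = 0"
  shows "smooth_on V (\<lambda>v. f (\<rho> v, v))"
    and "dd 1 (\<lambda>v. f (\<rho> v, v)) 0 = 0"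
    and "dd 1 (dd 1 (\<lambda>v. f (\<rho> v, v))) 0 = (dd 1 \<rho> 0)\<^sup>2 * dd (1, 0) (dd (1, 0) f) (0, 0)
      + 2 * dd 1 \<rho> 0 * dd (0, 1) (dd (1, 0) f) (0, 0) + dd (0, 1) (dd (0, 1) f) (0, 0)"
proof -
  have opV: "open V" using \<rho> smooth_on_open by blast
  show sm: "smooth_on V (\<lambda>v. f (\<rho> v, v))"
    by (rule smooth_on_compose[OF f]) (use sub in \<open>auto intro!: smooth_intros \<rho> opV\<close>)
  have \<rho>': "(\<rho> has_real_derivative dd 1 \<rho> v) (at v)" if "v \<in> V" for v
    by (rule has_real_derivative_dd[OF smooth_on_differentiable[OF \<rho> that]])
  have chain: "((\<lambda>v. g (\<rho> v, v)) has_real_derivative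
      dd 1 \<rho> v * dd (1, 0) g (\<rho> v, v) + dd (0, 1) g (\<rho> v, v)) (at v)"
    if g: "smooth_on U g" and v: "v \<in> V" for v g
  proof -
    have gd: "g differentiable (at (\<rho> v, v))" by (rule smooth_on_differentiable[OF g sub[OF v]])
    have "((\<lambda>v. g (\<rho> v, v)) has_real_derivative dd (dd 1 \<rho> v, 1) g (\<rho> v, v)) (at v)"
      by (rule curve_has_real_derivative[OF gd has_vector_derivative_graph[OF \<rho>'[OF v]]])
    then show ?thesis using dd_scale_Pair[OF gd, of "dd 1 \<rho> v" 1] by simp
  qed
  have E1: "dd 1 (\<lambda>v. f (\<rho> v, v)) v = dd 1 \<rho> v * dd (1, 0) f (\<rho> v, v) + dd (0, 1) f (\<rho>
      v, v)"
    if "v \<in> V" for v using dd_real[OF chain[OF f that], of 1] by simp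
  show "dd 1 (\<lambda>v. f (\<rho> v, v)) 0 = 0" using E1[OF V(1)] V f1 f2 by simp
  let ?r = "dd 1 \<rho> 0"
  have "dd 1 (dd 1 (\<lambda>v. f (\<rho> v, v))) 0 =
      dd 1 (\<lambda>v. dd 1 \<rho> v * dd (1, 0) f (\<rho> v, v) + dd (0, 1) f (\<rho> v, v)) 0"
    by (rule dd_cong_open[OF opV E1 V(1)])
  moreover have "((\<lambda>v. dd 1 \<rho> v * dd (1, 0) f (\<rho> v, v) + dd (0, 1) f (\<rho> v, v))
      has_real_derivative
     (dd 1 (dd 1 \<rho>) 0 * dd (1, 0) f (\<rho> 0, 0) + (?r * dd (1, 0) (dd (1, 0) f) (\<rho> 0, 0) + dd (0, 1)
         (dd (1, 0) f) (\<rho> 0, 0)) * dd 1 \<rho> 0)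
     + (?r * dd (1, 0) (dd (0, 1) f) (\<rho> 0, 0) + dd (0, 1) (dd (0, 1) f) (\<rho> 0, 0))) (at 0)"
    by (intro DERIV_add DERIV_mult chain smooth_on_dd f V
        has_real_derivative_dd smooth_on_differentiable[OF smooth_on_dd[OF \<rho>]])
  ultimately have "dd 1 (dd 1 (\<lambda>v. f (\<rho> v, v))) 0 =
     (?r * dd (1, 0) (dd (1, 0) f) (0, 0) + dd (0, 1) (dd (1, 0) f) (0, 0)) * ?r
     + (?r * dd (1, 0) (dd (0, 1) f) (0, 0) + dd (0, 1) (dd (0, 1) f) (0, 0))"
    using dd_real[of _ _ 0 1] f1 V(2) by fastforce
  moreover have "dd (1, 0) (dd (0, 1) f) (0, 0) = dd (0, 1) (dd (1, 0) f) (0, 0)"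
    using dd_commute[OF f] sub[OF V(1)] V(2) by simp
  ultimately show "dd 1 (dd 1 (\<lambda>v. f (\<rho> v, v))) 0 = ?r\<^sup>2 * dd (1, 0) (dd (1, 0) f) (0, 0)
      + 2 * ?r * dd (0, 1) (dd (1, 0) f) (0, 0) + dd (0, 1) (dd (0, 1) f) (0, 0)"
    by (simp add: power2_eq_square algebra_simps)
qed

lemma solve_first:
  fixes G :: "real \<times> real \<Rightarrow> real"
  assumes G: "smooth_on U G" and in_U: "(0, 0) \<in> U" and G0: "G (0, 0) = 0"
    and Gt: "dd (1, 0) G (0, 0) \<noteq> 0"
  obtains V a \<xi> where "open V" "0 \<in> V" "a > 0" "smooth_on V \<xi>" "\<xi> 0 = 0"
    "\<And>u v. v \<in> V \<Longrightarrow> \<bar>u\<bar> < a \<Longrightarrow> (u, v) \<in> U"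
    "\<And>u v. v \<in> V \<Longrightarrow> \<bar>u\<bar> < a \<Longrightarrow> G (u, v) = 0 \<longleftrightarrow>
        u = \<xi> v"
    "\<And>v. v \<in> V \<Longrightarrow> \<bar>\<xi> v\<bar> < a"
    "dd 1 \<xi> 0 = - dd (0, 1) G (0, 0) / dd (1, 0) G (0, 0)"
proof -
  define sw where "sw w = (snd w, fst w)" for w :: "real \<times> real"
  define US where "US = sw -` U"
  have opUS: "open US" unfolding US_def sw_def
    by (rule open_vimage[OF smooth_on_open[OF G]]) (intro continuous_intros)
  have H: "smooth_on US (\<lambda>w. G (sw w))"
    by (rule smooth_on_compose[OF G]) (auto simp: US_def sw_def[abs_def] intro!: smooth_intros opUS[unfolded US_def
        sw_def[abs_def]])
  have "(sw has_derivative sw) (at (0, 0))" unfolding sw_def[abs_def]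
    by (intro has_derivative_Pair has_derivative_fst has_derivative_snd has_derivative_ident)
  from dd_chain[of G sw, OF _ this] smooth_on_differentiable[OF G in_U]
  have "((\<lambda>w. G (sw w)) has_derivative (\<lambda>v. dd (sw v) G (0, 0))) (at (0, 0))" by (simp add: sw_def)
  from dd_eqI[OF this] have d: "dd v (\<lambda>w. G (sw w)) (0, 0) = dd (sw v) G (0, 0)" for v .
  have 1: "(0, 0) \<in> US" "G (sw (0, 0)) = 0" "dd (0, 1) (\<lambda>w. G (sw w)) (0, 0) \<noteq> 0"
    using in_U G0 Gt d by (auto simp: US_def sw_def)
  obtain V a \<xi> where V: "open V" "0 \<in> V" "a > 0" "smooth_on V \<xi>" "\<xi> 0 = 0"
    and inU: "\<And>y t. y \<in> V \<Longrightarrow> \<bar>t - 0\<bar> < a \<Longrightarrow> (y, t) \<in> US"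
    and zero: "\<And>y t. y \<in> V \<Longrightarrow> \<bar>t - 0\<bar> < a \<Longrightarrow> G (sw (y, t)) = 0
        \<longleftrightarrow> t = \<xi> y"
    and xi: "\<And>y. y \<in> V \<Longrightarrow> \<bar>\<xi> y - 0\<bar> < a"
    and dxi: "\<And>y v. y \<in> V \<Longrightarrow> dd v \<xi> y = - dd (v, 0) (\<lambda>w. G (sw w)) (y, \<xi> y)
        / dd (0, 1) (\<lambda>w. G (sw w)) (y, \<xi> y)"
    by (rule implicit_function[OF H 1]) (rule that; assumption)
  show ?thesis
    by (rule that[OF V]) (use inU zero xi dxi[OF V(2), of 1] V(5) d in \<open>auto simp: US_def sw_def\<close>)
qed

lemma dd_fst_comp:
  assumes "g differentiable (at (fst w))"
  shows "dd v (\<lambda>w. g (fst w)) w = dd (fst v) g (fst w)"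
  by (rule dd_eqI[OF dd_chain[OF assms has_derivative_fst[OF has_derivative_ident]]])

lemma dd_snd_comp:
  assumes "g differentiable (at (snd w))"
  shows "dd v (\<lambda>w. g (snd w)) w = dd (snd v) g (snd w)"
  by (rule dd_eqI[OF dd_chain[OF assms has_derivative_snd[OF has_derivative_ident]]])

lemma dd_zero: "f differentiable (at x) \<Longrightarrow> dd 0 f x = 0"
  using dd_linear[of f x 0 0 0 0] by simp

lemma dd_snd: "dd v snd w = snd v"
  by (rule dd_eqI, rule bounded_linear_imp_has_derivative, simp add: bounded_linear_snd)

lemma local_diffeo_swap: "local_diffeo (\<lambda>w. (snd w, fst w)) a"
  by (rule local_diffeo_global[of _ "\<lambda>w. (snd w, fst w)"]) (auto intro!: smooth_intros)

text \<open>Completing the square with a parameter. The critical point \<open>\<rho> v\<close> of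
  \<open>f\<close> in its first variable exists since the pure second derivative does not vanish.
  Hadamard's lemma writes f as (u - \<rho> v)^2 k + h v with h v = v^2 l, and h'' at 0 is the
  determinant divided by that second derivative. The square roots of |k| and |l| are absorbed into
  the coordinates.\<close>

lemma morse_lemma_2d:
  fixes f :: "real \<times> real \<Rightarrow> real"
  assumes f: "smooth_on U f" and in_U: "(0, 0) \<in> U" and f0: "f (0, 0) = 0"
    and f1: "dd (1, 0) f (0, 0) = 0" and f2: "dd (0, 1) f (0, 0) = 0"
    and A: "dd (1, 0) (dd (1, 0) f) (0, 0) \<noteq> 0"
    and det: "dd (1, 0) (dd (1, 0) f) (0, 0) * dd (0, 1) (dd (0, 1) f) (0, 0)
      \<noteq> (dd (0, 1) (dd (1, 0) f) (0, 0))\<^sup>2"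
  obtains \<Phi> N s1 s2 where "local_diffeo \<Phi> (0, 0)" "\<Phi> (0, 0) = (0, 0)" "open N" "(0, 0) \<in> N"
    "s1 \<in> {1, -1}" "s2 \<in> {1, -1}"
    "\<And>w. w \<in> N \<Longrightarrow> f w = s1 * (fst (\<Phi> w))\<^sup>2 + s2 * (snd (\<Phi> w))\<^sup>2"
proof -
  let ?A = "dd (1, 0) (dd (1, 0) f) (0, 0)"
  let ?B = "dd (0, 1) (dd (1, 0) f) (0, 0)"
  let ?C = "dd (0, 1) (dd (0, 1) f) (0, 0)"
  obtain V a \<rho> where V: "open V" "0 \<in> V" "a > 0" "smooth_on V \<rho>" "\<rho> 0 = 0"
    and inU: "\<And>u v. v \<in> V \<Longrightarrow> \<bar>u\<bar> < a \<Longrightarrow> (u, v) \<in> U"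
    and zero: "\<And>u v. v \<in> V \<Longrightarrow> \<bar>u\<bar> < a \<Longrightarrow> dd (1, 0) f (u, v) = 0
        \<longleftrightarrow> u = \<rho> v"
    and rho: "\<And>v. v \<in> V \<Longrightarrow> \<bar>\<rho> v\<bar> < a"
    and rho': "dd 1 \<rho> 0 = - ?B / ?A"
    by (rule solve_first[OF smooth_on_dd[OF f] in_U f1 A]) (rule that; assumption)
  define h where "h v = f (\<rho> v, v)" for v
  note gr = graph_second_derivative[OF f V(4,2,5) inU[OF _ rho] f1 f2]
  have h: "smooth_on V h" "h 0 = 0" "dd 1 h 0 = 0" using gr(1,2) f0 V(5) by (simp_all add: h_def[abs_def])
  have "dd 1 (dd 1 h) 0 = ?C - ?B\<^sup>2 / ?A"
    using gr(3) A unfolding h_def[abs_def] rho' by (simp add: field_simps power2_eq_square)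
  then have h2: "dd 1 (dd 1 h) 0 \<noteq> 0" using A det by (auto simp: field_simps)
  define \<eta> where "\<eta> = a / 2"
  have \<eta>: "\<eta> > 0" using V by (simp add: \<eta>_def)
  define V2 where "V2 = {v \<in> V. \<rho> v \<in> {-\<eta><..<\<eta>}}"
  have V2: "open V2" "0 \<in> V2" "V2 \<subseteq> V"
    using open_smooth_vimage[OF V(4) open_greaterThanLessThan, of "-\<eta>" \<eta>] V(2,5) \<eta> by (auto simp: V2_def)
  have \<rho>2: "smooth_on V2 \<rho>" using smooth_on_subset V V2 by blast
  let ?D = "{-\<eta><..<\<eta>} \<times> V2"
  have opD: "open ?D" by (intro open_Times V2 open_greaterThanLessThan)
  define g where "g w = f (\<rho> (snd w) + fst w, snd w) - f (\<rho> (snd w), snd w)" for w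
  have inU2: "(\<rho> (snd w) + fst w, snd w) \<in> U" "(\<rho> (snd w), snd w) \<in> U" if "w \<in> ?D" for w
    using that by (auto intro!: inU simp: V2_def \<eta>_def)
  have rs: "smooth_on ?D (\<lambda>w. \<rho> (snd w))"
    by (rule smooth_on_compose[OF \<rho>2]) (auto intro!: smooth_intros opD)
  have sg: "smooth_on ?D g" unfolding g_def
    by (intro smooth_on_diff smooth_on_compose[OF f] smooth_intros rs opD) (use inU2 in auto)
  have dg: "dd (1, 0) g w = dd (1, 0) f (\<rho> (snd w) + fst w, snd w)" if w: "w \<in> ?D" for w
  proof -
    note dr = smooth_on_has_derivative[OF rs w]
    have "((\<lambda>w. (\<rho> (snd w) + fst w, snd w)) has_derivative (\<lambda>v. (dd v (\<lambda>w. \<rho> (snd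
        w)) w + fst v, snd v))) (at w)"
      by (intro has_derivative_Pair has_derivative_add dr has_derivative_fst has_derivative_snd has_derivative_ident)
    note d1 = dd_chain[OF smooth_on_differentiable[OF f inU2(1)[OF w]] this]
    have "((\<lambda>w. (\<rho> (snd w), snd w)) has_derivative (\<lambda>v. (dd v (\<lambda>w. \<rho> (snd w)) w,
        snd v))) (at w)"
      by (intro has_derivative_Pair dr has_derivative_snd has_derivative_ident)
    note d2 = dd_chain[OF smooth_on_differentiable[OF f inU2(2)[OF w]] this]
    have "\<rho> differentiable (at (snd w))" using smooth_on_differentiable[OF \<rho>2] w by auto
    then have r0: "dd (1, 0) (\<lambda>w. \<rho> (snd w)) w = 0" by (simp add: dd_snd_comp dd_zero)
    have "dd (0, 0) f (\<rho> (snd w), snd w) = 0"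
      using dd_linear[OF smooth_on_differentiable[OF f inU2(2)[OF w]], of 0 "(0,0)" 0 "(0,0)"] by simp
    with dd_eqI[OF has_derivative_diff[OF d1 d2], of "(1, 0)"] show ?thesis
      unfolding g_def[abs_def] by (simp add: r0)
  qed
  obtain k where k: "smooth_on ?D k" "\<And>u y. \<bar>u\<bar> < \<eta> \<Longrightarrow> y \<in> V2
      \<Longrightarrow> g (u, y) = u\<^sup>2 * k (u, y)"
    "\<And>y. y \<in> V2 \<Longrightarrow> 2 * k (0, y) = dd (1, 0) (dd (1, 0) g) (0, y)"
  proof (rule hadamard_division2[OF sg V2(1) _ _ \<eta>])
    show "g (0, y) = 0" for y by (simp add: g_def)
    show "dd (1, 0) g (0, y) = 0" if "y \<in> V2" for y
      using dg[of "(0, y)"] that \<eta> zero[of y "\<rho> y"] rho V2 by auto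
  qed (rule that; assumption)
  have in0: "(0, 0) \<in> ?D" using \<eta> V2 by simp
  have "dd (1, 0) (dd (1, 0) g) (0, 0) = ?A"
  proof -
    have "dd (1, 0) (dd (1, 0) g) (0, 0) = dd (1, 0) (\<lambda>w. dd (1, 0) f (\<rho> (snd w) + fst w, snd w)) (0, 0)"
      by (rule dd_cong_open[OF opD dg in0])
    note dr = smooth_on_has_derivative[OF rs in0]
    have m: "((\<lambda>w. (\<rho> (snd w) + fst w, snd w)) has_derivative (\<lambda>v. (dd v (\<lambda>w. \<rho>
        (snd w)) (0, 0) + fst v, snd v))) (at (0, 0))"
      by (intro has_derivative_Pair has_derivative_add dr has_derivative_fst has_derivative_snd has_derivative_ident)
    have fd: "dd (1, 0) f differentiable (at (\<rho> (snd (0, 0)) + fst (0, 0), snd (0, 0)))"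
      using smooth_on_differentiable[OF smooth_on_dd[OF f] in_U] V(5) by simp
    have "\<rho> differentiable (at 0)" using smooth_on_differentiable[OF \<rho>2] V2 by auto
    then have r0: "dd (1, 0) (\<lambda>w. \<rho> (snd w)) (0::real, 0) = 0" using dd_snd_comp[of \<rho> "(0::real,
        0)"] by (simp add: dd_zero)
    show ?thesis using dd_eqI[OF dd_chain[OF fd m], of "(1, 0)"] r0 V(5)
      \<open>dd (1, 0) (dd (1, 0) g) (0, 0) = _\<close> by simp
  qed
  then have k0: "2 * k (0, 0) = ?A" using k(3)[OF V2(2)] by simp
  obtain b where b: "b > 0" "{-b<..<b} \<subseteq> V"
  proof -
    obtain b where "b > 0" "ball 0 b \<subseteq> V" using V(1,2) openE by blast
    moreover have "{-b<..<b} \<subseteq> ball 0 b" by (auto simp: dist_real_def)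
    ultimately show thesis using that[of b] by blast
  qed
  \<comment> \<open>A dummy second variable lets the division lemma apply to the function
    \<open>h\<close> of one variable.\<close>
  have sH: "smooth_on ({-b<..<b} \<times> (UNIV::real set)) (\<lambda>w. h (fst w))"
    by (rule smooth_on_compose[OF h(1)]) (use b in \<open>auto intro!: smooth_intros open_Times\<close>)
  have hd: "h differentiable (at u)" if "\<bar>u\<bar> < b" for u
    by (rule smooth_on_differentiable[OF h(1) subsetD[OF b(2)]]) (use that in auto)
  have hd1: "dd (1, 0) (\<lambda>w. h (fst w)) w = dd 1 h (fst w)" if "w \<in> {-b<..<b} \<times> (UNIV::real set)"
      for w
    using dd_fst_comp[of h w] hd[of "fst w"] that by auto
  obtain l where l: "smooth_on ({-b<..<b} \<times> (UNIV::real set)) l"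
    "\<And>u y. \<bar>u\<bar> < b \<Longrightarrow> y \<in> UNIV \<Longrightarrow> h (fst (u, y)) = u\<^sup>2 * l
        (u, y)"
    "\<And>y. y \<in> UNIV \<Longrightarrow> 2 * l (0, y) = dd (1, 0) (dd (1, 0) (\<lambda>w. h (fst w))) (0, y)"
  proof (rule hadamard_division2[OF sH open_UNIV _ _ b(1)])
    show "h (fst (0, y)) = 0" for y :: real using h(2) by simp
    show "dd (1, 0) (\<lambda>w. h (fst w)) (0, y) = 0" for y :: real using hd1[of "(0, y)"] b h(3) by simp
  qed (rule that; assumption)
  have "dd (1, 0) (dd (1, 0) (\<lambda>w. h (fst w))) (0, 0::real) = dd (1, 0) (\<lambda>w. dd 1 h (fst w)) (0,
      0::real)"
    by (rule dd_cong_open[OF _ hd1]) (use b in \<open>auto intro!: open_Times\<close>)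
  also have "\<dots> = dd 1 (dd 1 h) 0"
    using dd_fst_comp[of "dd 1 h" "(0, 0::real)"] smooth_on_differentiable[OF smooth_on_dd[OF h(1)] V(2)] by simp
  finally have l0: "2 * l (0, 0) = dd 1 (dd 1 h) 0" using l(3)[of 0] by simp
  define s1 :: real where "s1 = (if ?A > 0 then 1 else -1)"
  define s2 :: real where "s2 = (if dd 1 (dd 1 h) 0 > 0 then 1 else -1)"
  have s: "s1 \<in> {1, -1}" "s2 \<in> {1, -1}" "s1 * k (0, 0) > 0" "s2 * l (0, 0) > 0"
    using k0 l0 A h2 by (auto simp: s1_def s2_def)
  have kl: "s1 \<noteq> 0" "s2 \<noteq> 0" "k (0, 0) \<noteq> 0" "l (0, 0) \<noteq> 0" using k0 l0 A h2 s(1,2) by auto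
  define l1 where "l1 v = s2 * l (v, 0)" for v
  have sl1: "smooth_on {-b<..<b} l1" unfolding l1_def
    by (intro smooth_intros smooth_on_compose[OF l(1)]) auto
  define k1 where "k1 w = s1 * k w" for w
  have sk1: "smooth_on ?D k1" unfolding k1_def by (intro smooth_intros k(1) opD)
  define KD where "KD = {w \<in> ?D. k1 w > 0}"
  have KD: "open KD" "KD \<subseteq> ?D" using open_smooth_pos[OF sk1] by (auto simp: KD_def)
  \<comment> \<open>From here to the definition of \<open>X\<close> the two coordinates are
    exchanged, since \<open>local_diffeo_snd\<close> changes the last one; \<open>\<Phi>\<close>
    swaps them back.\<close>
  define m where "m w = (snd w - \<rho> (fst w), fst w)" for w
  have opVU: "open (V2 \<times> (UNIV::real set))" by (intro open_Times V2 open_UNIV)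
  have rs': "smooth_on (V2 \<times> UNIV) (\<lambda>w::real \<times> real. \<rho> (fst w))"
    by (rule smooth_on_compose[OF \<rho>2]) (auto intro!: smooth_intros opVU)
  have sm: "smooth_on (V2 \<times> UNIV) m"
    unfolding m_def by (intro smooth_intros rs' opVU)
  define NX where "NX = {w \<in> V2 \<times> UNIV. m w \<in> KD}"
  have opNX: "open NX" unfolding NX_def by (rule open_smooth_vimage[OF sm KD(1)])
  have NX0: "(0, 0) \<in> NX" using V2 V(5) \<eta> s by (simp add: NX_def m_def KD_def k1_def)
  define p where "p w = snd w - \<rho> (fst w)" for w
  define Q where "Q w = sqrt (k1 (m w))" for w
  have sp: "smooth_on NX p" unfolding p_def
    by (intro smooth_intros opNX smooth_on_subset[OF rs' opNX]) (auto simp: NX_def)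
  have sQ: "smooth_on NX Q" unfolding Q_def
  proof (intro smooth_on_sqrt smooth_on_compose[OF smooth_on_subset[OF sk1 KD]])
    show "smooth_on NX m" by (rule smooth_on_subset[OF sm opNX]) (auto simp: NX_def)
  qed (auto simp: NX_def KD_def)
  define X where "X w = p w * Q w" for w
  have sX: "smooth_on NX X" unfolding X_def by (intro smooth_intros sp sQ)
  have pd: "dd (0, 1) p (0, 0) = 1"
  proof -
    have r: "\<rho> differentiable (at 0)" using smooth_on_differentiable[OF \<rho>2] V2 by auto
    have "((\<lambda>w. snd w - \<rho> (fst w)) has_derivative (\<lambda>v. snd v - dd (fst v) \<rho> (fst (0,
        0::real)))) (at (0, 0))"
    proof (intro has_derivative_diff bounded_linear_imp_has_derivative[OF bounded_linear_snd])
      show "((\<lambda>w. \<rho> (fst w)) has_derivative (\<lambda>v. dd (fst v) \<rho> (fst (0, 0::real)))) (at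
          (0, 0::real))"
        using dd_chain[of \<rho> fst "(0, 0::real)" fst, OF _ bounded_linear_imp_has_derivative[OF
            bounded_linear_fst]] r
        by simp
    qed
    from dd_eqI[OF this, of "(0, 1)"] show ?thesis using dd_zero[OF r] by (simp add: p_def[abs_def])
  qed
  have "dd (0, 1) X (0, 0) = p (0, 0) * dd (0, 1) Q (0, 0) + dd (0, 1) p (0, 0) * Q (0, 0)"
    unfolding X_def by (rule dd_mult) (use sp sQ NX0 smooth_on_differentiable in blast)+
  then have dX: "dd (0, 1) X (0, 0) \<noteq> 0"
    using pd kl V(5) by (simp add: p_def Q_def k1_def m_def)
  define Y where "Y w = snd w * sqrt (l1 (snd w))" for w :: "real \<times> real"
  define NY where "NY = {w \<in> (UNIV::real set) \<times> {-b<..<b}. l1 (snd w) > 0}"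
  have sl1': "smooth_on (UNIV \<times> {-b<..<b}) (\<lambda>w::real \<times> real. l1 (snd w))"
    by (rule smooth_on_compose[OF sl1]) (auto intro!: smooth_intros open_Times)
  have opNY: "open NY" unfolding NY_def by (rule open_smooth_pos[OF sl1'])
  have sq: "smooth_on NY (\<lambda>w::real \<times> real. sqrt (l1 (snd w)))"
    by (intro smooth_on_sqrt smooth_on_subset[OF sl1' opNY]) (auto simp: NY_def)
  have sY: "smooth_on NY Y" unfolding Y_def by (intro smooth_intros opNY sq)
  have NY0: "(x, 0) \<in> NY" for x using b s by (simp add: NY_def l1_def)
  have "dd (0, 1) Y (x, 0) = snd (x, 0) * dd (0, 1) (\<lambda>w. sqrt (l1 (snd w))) (x, 0)
      + dd (0, 1) snd (x, 0) * sqrt (l1 (snd (x, 0)))" for x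
    unfolding Y_def
    by (rule dd_mult) (use sq NY0 smooth_on_differentiable in
        \<open>auto intro: bounded_linear_imp_differentiable bounded_linear_snd\<close>)
  then have dY: "dd (0, 1) Y (x, 0) \<noteq> 0" for x using kl by (simp add: dd_snd l1_def)
  define \<Phi> where "\<Phi> w = (X (snd w, fst w), Y (X (snd w, fst w), snd w))" for w
  have X0: "X (0, 0) = 0" using V(5) by (simp add: X_def p_def)
  have c1: "local_diffeo (\<lambda>w. (snd w, X (snd w, fst w))) (0, 0)"
    using local_diffeo_compose[OF local_diffeo_swap, of "\<lambda>w. (fst w, X w)" "(0, 0)"]
      local_diffeo_snd[OF sX NX0 dX] by simp
  have c2: "local_diffeo (\<lambda>w. (X (snd w, fst w), snd w)) (0, 0)"
    using local_diffeo_compose[OF c1 local_diffeo_swap] by simp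
  have "local_diffeo \<Phi> (0, 0)"
    using local_diffeo_compose[OF c2, of "\<lambda>w. (fst w, Y w)"] local_diffeo_snd[OF sY NY0 dY]
    unfolding \<Phi>_def by simp
  moreover have "\<Phi> (0, 0) = (0, 0)" by (simp add: \<Phi>_def X0 Y_def)
  moreover define N where "N = (\<lambda>w. (snd w, fst w)) -` NX \<inter> NY"
  have "open N" unfolding N_def
    by (intro open_Int opNY open_vimage[OF opNX]) (intro continuous_intros)
  moreover have "(0, 0) \<in> N" using NX0 NY0 by (simp add: N_def)
  moreover have "f w = s1 * (fst (\<Phi> w))\<^sup>2 + s2 * (snd (\<Phi> w))\<^sup>2" if w: "w \<in> N" for w
  proof -
    obtain u v where [simp]: "w = (u, v)" by (cases w)
    have 1: "v \<in> V2" "\<bar>u - \<rho> v\<bar> < \<eta>" "k1 (u - \<rho> v, v) > 0" "\<bar>v\<bar> < b" "l1 v > 0"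
      using w by (auto simp: N_def NX_def NY_def m_def KD_def)
    have "f w = g (u - \<rho> v, v) + h v" by (simp add: g_def h_def)
    also have "\<dots> = (u - \<rho> v)\<^sup>2 * k (u - \<rho> v, v) + v\<^sup>2 * l (v, 0)"
      using k(2)[OF 1(2,1)] l(2)[OF 1(4), of 0] by simp
    also have "\<dots> = s1 * (fst (\<Phi> w))\<^sup>2 + s2 * (snd (\<Phi> w))\<^sup>2"
      using 1 s(1,2) by (auto simp: \<Phi>_def X_def p_def Q_def Y_def m_def k1_def l1_def power_mult_distrib)
    finally show ?thesis .
  qed
  ultimately show ?thesis using that s(1,2) by blast
qed

text \<open>On the curve u \<mapsto> z u the parameter is E u, with a strict local extremum at 0: a
  level on one side of e has two preimages near 0, a level on the other side has none. The
  continuous left inverse \<open>l\<close> makes u small as soon as z u is close to q, so distant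
  parts of the curve do not interfere.\<close>

lemma two_born_or_dieI:
  fixes z :: "real \<Rightarrow> plane" and l :: "plane \<Rightarrow> real"
  assumes a: "a > 0" and E: "smooth_on {-a<..<a} E" and E0: "E 0 = e" and E1: "dd 1 E 0 = 0"
    and E2: "dd 1 (dd 1 E) 0 \<noteq> 0" and z: "continuous_on {-a<..<a} z" "z 0 = q"
    and lz: "\<And>u. \<bar>u\<bar> < a \<Longrightarrow> l (z u) = u" and lc: "isCont l q"
    and N: "open N" "(q, e) \<in> N"
    and char: "\<And>y t. (y, t) \<in> N \<Longrightarrow> y \<in> B t \<longleftrightarrow> (\<exists>u.
        \<bar>u\<bar> < a \<and> y = z u \<and> t = E u)"
  shows "two_born_or_die B q e"
proof -
  define s :: real where "s = (if dd 1 (dd 1 E) 0 > 0 then 1 else -1)"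
  have s: "s \<in> {-1, 1}" "s * dd 1 (dd 1 E) 0 > 0" "s * s = 1" using E2 by (auto simp: s_def)
  define F where "F u = s * (E u - e)" for u
  have Ed: "(E has_real_derivative dd 1 E u) (at u)" if "\<bar>u\<bar> < a" for u
    by (rule has_real_derivative_dd[OF smooth_on_differentiable[OF E]]) (use that in auto)
  have Fd: "(F has_real_derivative s * dd 1 E u) (at u)" if "\<bar>u\<bar> < a" for u
    unfolding F_def by (auto intro!: derivative_eq_intros Ed[OF that])
  have "((\<lambda>u. s * dd 1 E u) has_real_derivative s * dd 1 (dd 1 E) 0) (at 0)"
    using has_real_derivative_dd[OF smooth_on_differentiable[OF smooth_on_dd[OF E]]] a
    by (intro DERIV_cmult) auto
  note D = this
  obtain d1 where d1: "d1 > 0" "\<And>h. h > 0 \<Longrightarrow> h < d1 \<Longrightarrow> s * dd 1 E h > 0"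
    using DERIV_pos_inc_right[OF D s(2)] E1 by auto
  obtain d2 where d2: "d2 > 0" "\<And>h. h > 0 \<Longrightarrow> h < d2 \<Longrightarrow> s * dd 1 E (- h) < 0"
    using DERIV_pos_inc_left[OF D s(2)] E1 by auto
  define b where "b = min a (min d1 d2)"
  have b: "b > 0" "b \<le> a" using a d1 d2 by (auto simp: b_def)
  have contF: "continuous_on {u..v} F" if "- b < u" "v < b" for u v
    by (rule continuous_at_imp_continuous_on) (use that b DERIV_isCont[OF Fd] in auto)
  have inc: "F u < F v" if "0 \<le> u" "u < v" "v < b" for u v
  proof (rule DERIV_pos_imp_increasing_open[OF that(2)])
    fix x assume "u < x" "x < v"
    then show "\<exists>y. (F has_real_derivative y) (at x) \<and> 0 < y"
      using that b Fd[of x] d1(2)[of x] by (intro exI[of _ "s * dd 1 E x"]) (auto simp: b_def)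
  qed (use that b contF in auto)
  have dec: "F u > F v" if "v \<le> 0" "u < v" "- b < u" for u v
  proof (rule DERIV_neg_imp_decreasing_open[OF that(2)])
    fix x assume "u < x" "x < v"
    then show "\<exists>y. (F has_real_derivative y) (at x) \<and> y < 0"
      using that b Fd[of x] d2(2)[of "- x"] by (intro exI[of _ "s * dd 1 E x"]) (auto simp: b_def)
  qed (use that b contF in auto)
  have F0: "F 0 = 0" by (simp add: F_def E0)
  have Fpos: "F u > 0" if "\<bar>u\<bar> < b" "u \<noteq> 0" for u
    using inc[of 0 u] dec[of 0 u] that F0 by (cases "u > 0") auto
  have l0: "l q = 0" using lz[of 0] a z by simp
  \<comment> \<open>Within \<open>R1\<close> of q only parameters below \<open>b\<close> occur, that
    is, where \<open>F\<close> decreases up to 0 and increases afterwards.\<close>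
  obtain R1 where R1: "R1 > 0" "\<And>y. dist y q < R1 \<Longrightarrow> \<bar>l y\<bar> < b"
    using lc b(1) l0 unfolding continuous_at_eps_delta by (metis dist_real_def diff_zero)
  obtain R2 where R2: "R2 > 0" "\<And>w. dist w (q, e) < R2 \<Longrightarrow> w \<in> N"
    using N by (metis open_dist)
  define R where "R = min R1 (R2 / 2)"
  have R: "R > 0" using R1 R2 by (simp add: R_def)
  have inN: "(y, t) \<in> N" if "dist y q < R" "\<bar>t - e\<bar> < R2 / 2" for y t
  proof (rule R2)
    have "dist (y, t) (q, e) \<le> dist y q + dist t e"
      unfolding dist_Pair_Pair by (rule sqrt_sum_squares_le_sum) auto
    then show "dist (y, t) (q, e) < R2" using that by (auto simp: R_def dist_real_def)
  qed
  have mem: "y \<in> B t \<longleftrightarrow> (\<exists>u. \<bar>u\<bar> < b \<and> y = z u \<and> t = E u)" if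
      "dist y q < R" "\<bar>t - e\<bar> < R2 / 2" for y t
  proof -
    have "\<bar>l y\<bar> < b" using R1(2) that by (auto simp: R_def)
    then show ?thesis using char[OF inN[OF that]] lz b by fastforce
  qed
  have EF: "E u = e + s * F u" for u using s(3) by (simp add: F_def algebra_simps)
  have "B e \<inter> ball q r = {q} \<and>
        (\<exists>\<delta>>0. \<forall>h. 0 < h \<and> h < \<delta> \<longrightarrow>
           card (B (e + s * h) \<inter> ball q r) = 2 \<and> B (e - s * h) \<inter> ball q r = {})"
    if r: "0 < r" "r < R" for r
  proof
    have ballD: "dist y q < R" if "y \<in> ball q r" for y using that r by (simp add: dist_commute)
    have sE0: "u = 0" if "\<bar>u\<bar> < b" "E u = e" for u
    proof (rule ccontr)
      assume "u \<noteq> 0"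
      then have "F u > 0" using Fpos that by blast
      moreover have "F u = 0" using that by (simp add: F_def)
      ultimately show False by simp
    qed
    show "B e \<inter> ball q r = {q}"
    proof
      show "B e \<inter> ball q r \<subseteq> {q}"
        using mem[OF ballD, of _ e] R2 sE0 z(2) by fastforce
      have "q \<in> B e" using mem[of q e] R R2 b z(2) E0 by (auto intro!: exI[of _ 0])
      then show "{q} \<subseteq> B e \<inter> ball q r" using r by simp
    qed
    have "isCont z 0" using z(1) a by (simp add: continuous_on_eq_continuous_at)
    then obtain d where d: "d > 0" "\<And>u. \<bar>u\<bar> < d \<Longrightarrow> dist (z u) q < r"
      using r(1) z(2) unfolding continuous_at_eps_delta by (metis dist_real_def diff_zero)
    define c where "c = min b d / 2"
    have c: "c > 0" "c < b" "c < d" using b d by (auto simp: c_def)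
    \<comment> \<open>Below F c and F (- c) the intermediate value theorem finds both preimages
      inside [-c, c], which \<open>z\<close> maps into the ball; R2 / 2 keeps the parameter inside
      \<open>N\<close>.\<close>
    define \<delta> where "\<delta> = min (R2 / 2) (min (F c) (F (- c)))"
    have \<delta>: "\<delta> > 0" using R2 Fpos[of c] Fpos[of "-c"] c by (simp add: \<delta>_def)
    show "\<exists>\<delta>>0. \<forall>h. 0 < h \<and> h < \<delta> \<longrightarrow>
           card (B (e + s * h) \<inter> ball q r) = 2 \<and> B (e - s * h) \<inter> ball q r = {}"
    proof (intro exI[of _ \<delta>] conjI allI impI \<delta>)
      fix h assume h: "0 < h \<and> h < \<delta>"
      have sh: "\<bar>s * h\<bar> < R2 / 2" using h s(1) by (auto simp: \<delta>_def abs_mult)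
      obtain u1 where u1: "0 \<le> u1" "u1 \<le> c" "F u1 = h"
        using IVT'[of F 0 h c] h c F0 contF[of 0 c] b by (auto simp: \<delta>_def)
      obtain u2 where u2: "- c \<le> u2" "u2 \<le> 0" "F u2 = h"
        using IVT2'[of F 0 h "- c"] h c F0 contF[of "-c" 0] b by (auto simp: \<delta>_def)
      have ne: "u1 \<noteq> u2" using u1 u2 F0 h by (metis order.antisym less_irrefl)
      have uniq: "u = u1 \<or> u = u2" if "\<bar>u\<bar> < b" "F u = h" for u
        using inc[of u u1] inc[of u1 u] dec[of u u2] dec[of u2 u] that u1 u2 c
        by (smt (verit))
      have zb: "z u1 \<in> ball q r" "z u2 \<in> ball q r"
        using d(2)[of u1] d(2)[of u2] u1 u2 c by (auto simp: dist_commute)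
      have "B (e + s * h) \<inter> ball q r = {z u1, z u2}"
      proof
        show "B (e + s * h) \<inter> ball q r \<subseteq> {z u1, z u2}"
        proof
          fix y assume y: "y \<in> B (e + s * h) \<inter> ball q r"
          then obtain u where u: "\<bar>u\<bar> < b" "y = z u" "e + s * h = E u"
            using mem[OF ballD, of y "e + s * h"] sh by auto
          have "F u = s * s * h" unfolding F_def u(3)[symmetric] by (simp add: mult.assoc)
          then have "F u = h" using s(3) by simp
          then show "y \<in> {z u1, z u2}" using uniq u by auto
        qed
        have "z u \<in> B (e + s * h)" if "z u \<in> ball q r" "\<bar>u\<bar> < b" "F u = h" for u
        proof -
          have "\<bar>e + s * h - e\<bar> < R2 / 2" using sh by simp
          moreover have "e + s * h = E u" using EF[of u] that(3) by simp
          ultimately show ?thesis using mem[OF ballD[OF that(1)]] that(2) by metis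
        qed
        then show "{z u1, z u2} \<subseteq> B (e + s * h) \<inter> ball q r"
          using zb u1 u2 c by auto
      qed
      moreover have "z u1 \<noteq> z u2" using lz[of u1] lz[of u2] ne u1 u2 c b by auto
      ultimately show "card (B (e + s * h) \<inter> ball q r) = 2" by simp
      show "B (e - s * h) \<inter> ball q r = {}"
      proof (rule ccontr)
        assume "B (e - s * h) \<inter> ball q r \<noteq> {}"
        then obtain y where y: "y \<in> B (e - s * h)" "y \<in> ball q r" by blast
        then obtain u where u: "\<bar>u\<bar> < b" "e - s * h = E u"
          using mem[OF ballD, of y "e - s * h"] sh by auto
        have "F u = - (s * s * h)" unfolding F_def u(2)[symmetric] by (simp add: mult.assoc)
        then have "F u = - h" using s(3) by simp
        then show False using Fpos[OF u(1)] F0 h by (cases "u = 0") auto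
      qed
    qed
  qed
  then have "\<forall>r. 0 < r \<and> r < R \<longrightarrow> B e \<inter> ball q r = {q} \<and>
        (\<exists>\<delta>>0. \<forall>h. 0 < h \<and> h < \<delta> \<longrightarrow>
           card (B (e + s * h) \<inter> ball q r) = 2 \<and> B (e - s * h) \<inter> ball q r = {})"
    by (intro allI impI) (erule conjE)
  then show ?thesis unfolding two_born_or_die_def
    by (intro bexI[OF _ s(1)] exI[of _ R] conjI[OF R])
qed

section \<open>Characteristics and inflections\<close>

text \<open>Picard's theorem by a contraction of the bounded continuous functions on the whole line.
  The clamps \<open>cx\<close>, \<open>cy\<close> and \<open>ch\<close> make the right side bounded
  and Lipschitz everywhere. The fixed point stays within d of y0, so the clamps have no effect for
  |x - x0| < h and it solves the original equation.\<close>

lemma ode_solution: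
  fixes P :: "real \<times> real \<Rightarrow> real"
  assumes P: "smooth_on U P" and in_U: "(x0, y0) \<in> U"
  obtains h Y where "h > 0" "smooth_on {x0 - h<..<x0 + h} Y" "Y x0 = y0"
    "\<And>x. \<bar>x - x0\<bar> < h \<Longrightarrow> (x, Y x) \<in> U"
    "\<And>x. \<bar>x - x0\<bar> < h \<Longrightarrow> (Y has_real_derivative P (x, Y x)) (at x)"
proof -
  obtain A B where AB: "open A" "open B" "x0 \<in> A" "y0 \<in> B" "A \<times> B \<subseteq> U"
    using open_prod_elim[OF smooth_on_open[OF P] in_U] by (metis mem_Sigma_iff)
  obtain d1 where d1: "d1 > 0" "cball x0 d1 \<subseteq> A" using AB open_contains_cball by blast
  obtain d2 where d2: "d2 > 0" "cball y0 d2 \<subseteq> B" using AB open_contains_cball by blast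
  define d where "d = min d1 d2"
  have d: "d > 0" using d1 d2 by (simp add: d_def)
  define R where "R = {x0 - d..x0 + d} \<times> {y0 - d..y0 + d}"
  have R: "R \<subseteq> U"
  proof
    fix w assume w: "w \<in> R"
    have "fst w \<in> cball x0 d1" "snd w \<in> cball y0 d2"
      using w by (auto simp: R_def d_def dist_real_def)
    then show "w \<in> U" using d1 d2 AB by (metis mem_Sigma_iff prod.collapse subsetD)
  qed
  have cR: "compact R" unfolding R_def by (intro compact_Times compact_Icc)
  have cP: "continuous_on R P" "continuous_on R (dd (0, 1) P)"
    using smooth_on_continuous P smooth_on_dd[OF P] R continuous_on_subset by blast+
  obtain M where M: "M > 0" "\<And>w. w \<in> R \<Longrightarrow> norm (P w) \<le> M"
    using compact_imp_bounded[OF compact_continuous_image[OF cP(1) cR]] unfolding bounded_pos by blast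
  obtain L where L: "L > 0" "\<And>w. w \<in> R \<Longrightarrow> norm (dd (0, 1) P w) \<le> L"
    using compact_imp_bounded[OF compact_continuous_image[OF cP(2) cR]] unfolding bounded_pos by blast
  define cx where "cx s = max (x0 - d) (min (x0 + d) s)" for s
  define cy where "cy y = max (y0 - d) (min (y0 + d) y)" for y
  define Q where "Q s y = P (cx s, cy y)" for s y
  have cR': "(cx s, cy y) \<in> R" for s y using d by (auto simp: R_def cx_def cy_def)
  have cyb: "cy y \<in> {y0 - d..y0 + d}" for y using d by (auto simp: cy_def)
  have QM: "\<bar>Q s y\<bar> \<le> M" for s y using M(2)[OF cR'] by (simp add: Q_def)
  have QL: "\<bar>Q s y - Q s y'\<bar> \<le> L * \<bar>y - y'\<bar>" for s y y'
  proof -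
    have "norm (P (cx s, cy y) - P (cx s, cy y')) \<le> L * norm (cy y - cy y')"
    proof (rule field_differentiable_bound[where f="\<lambda>y. P (cx s, y)" and f'="\<lambda>y. dd (0, 1) P (cx s,
        y)" and S="{y0 - d..y0 + d}"])
      fix t assume t: "t \<in> {y0 - d..y0 + d}"
      have w: "(cx s, t) \<in> R" using t cR'[of s] by (auto simp: R_def)
      have "((\<lambda>y. P (cx s, y)) has_real_derivative dd (0, 1) P (cx s, t)) (at t)"
      proof (rule curve_has_real_derivative)
        show "P differentiable (at (cx s, t))" using smooth_on_differentiable[OF P] w R by blast
        show "((\<lambda>y. (cx s, y)) has_vector_derivative (0, 1)) (at t)"
          by (intro has_vector_derivative_Pair has_vector_derivative_const has_vector_derivative_id)
      qed
      then show "((\<lambda>y. P (cx s, y)) has_real_derivative dd (0, 1) P (cx s, t)) (at t within {y0 - d..y0 + d})"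
        by (rule has_field_derivative_at_within)
      show "norm (dd (0, 1) P (cx s, t)) \<le> L" using L(2)[OF w] .
    qed (use cyb in auto)
    also have "\<dots> \<le> L * \<bar>y - y'\<bar>" using L(1) by (intro mult_left_mono) (auto simp: cy_def)
    finally show ?thesis by (simp add: Q_def)
  qed
  have Qcont: "continuous_on UNIV (\<lambda>s. Q s (u s))" if "continuous_on UNIV u" for u
    unfolding Q_def
    by (rule continuous_on_compose2[OF cP(1)])
      (use that cR' in \<open>auto simp: cx_def cy_def intro!: continuous_intros\<close>)
  \<comment> \<open>The first bound gives 4 h M < d, so solutions stay in the rectangle; the second
    gives 4 h L \<le> 1/2, the contraction constant.\<close>
  define h where "h = min d (min (d / (4 * (M + 1))) (1 / (8 * (L + 1))))"
  have h: "h > 0" "h \<le> d" using d M L by (auto simp: h_def)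
  have hM: "4 * h * M < d"
  proof -
    have "h \<le> d / (4 * (M + 1))" by (simp add: h_def)
    then have "4 * h * (M + 1) \<le> d" using M by (simp add: field_simps)
    then show ?thesis using h by (simp add: algebra_simps)
  qed
  have hL: "4 * h * L \<le> 1 / 2"
  proof -
    have "h \<le> 1 / (8 * (L + 1))" by (simp add: h_def)
    then have "8 * h * (L + 1) \<le> 1" using L by (simp add: field_simps)
    then show ?thesis using h by (simp add: algebra_simps)
  qed
  define I where "I u t = integral {x0 - h..t} (\<lambda>s. Q s (u s))" for u :: "real \<Rightarrow> real" and t
  define ch where "ch s = max (x0 - h) (min (x0 + h) s)" for s
  have ch: "x0 - h \<le> ch s" "ch s \<le> x0 + h" for s using h by (auto simp: ch_def)
  have chc: "continuous_on UNIV ch" unfolding ch_def by (intro continuous_intros)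
  have int: "(\<lambda>s. Q s (u s)) integrable_on {a..b}" if "continuous_on UNIV u" for u a b
    by (rule integrable_continuous_interval) (use Qcont[OF that] continuous_on_subset in blast)
  have IM: "\<bar>I u t\<bar> \<le> 2 * h * M" if "continuous_on UNIV u" "x0 - h \<le> t" "t \<le> x0 + h" for u t
  proof -
    have "norm (I u t) \<le> M * (t - (x0 - h))"
      unfolding I_def by (rule integral_bound) (use that QM continuous_on_subset[OF Qcont[OF that(1)] subset_UNIV]
          in auto)
    also have "\<dots> \<le> M * (2 * h)" using that M by (intro mult_left_mono) auto
    finally show ?thesis by (simp add: mult.commute mult.left_commute)
  qed
  have Icont: "continuous_on {x0 - h..x0 + h} (I u)" if "continuous_on UNIV u" for u
    unfolding I_def by (rule indefinite_integral_continuous_1[OF int[OF that]])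
  have Idiff: "\<bar>I u t - I v t\<bar> \<le> 2 * h * (L * D)"
    if "continuous_on UNIV u" "continuous_on UNIV v" "x0 - h \<le> t" "t \<le> x0 + h" "\<And>s. \<bar>u s - v
        s\<bar> \<le> D" for u v t D
  proof -
    have D: "D \<ge> 0" using that(5)[of 0] by linarith
    have "norm (integral {x0 - h..t} (\<lambda>s. Q s (u s) - Q s (v s))) \<le> L * D * (t - (x0 - h))"
    proof (rule integral_bound)
      show "continuous_on {x0 - h..t} (\<lambda>s. Q s (u s) - Q s (v s))"
        using Qcont[OF that(1)] Qcont[OF that(2)] continuous_on_subset by (intro continuous_on_diff) blast+
      fix s
      show "norm (Q s (u s) - Q s (v s)) \<le> L * D"
        using QL[of s "u s" "v s"] that(5)[of s] L(1)
        by (metis (no_types, opaque_lifting) dual_order.trans less_eq_real_def mult_left_mono real_norm_def)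
    qed (use that in auto)
    also have "integral {x0 - h..t} (\<lambda>s. Q s (u s) - Q s (v s)) = I u t - I v t"
      unfolding I_def by (rule integral_diff) (use int that in auto)
    also have "L * D * (t - (x0 - h)) \<le> L * D * (2 * h)"
      using that D L h by (intro mult_left_mono mult_nonneg_nonneg) auto
    finally show ?thesis by (simp add: mult.commute mult.left_commute)
  qed
  \<comment> \<open>All integrals start at x0 - h and the value at x0 is subtracted, which avoids
    integrals with reversed limits. Two integrals over intervals of length at most 2 h account for
    the factor 4.\<close>
  define \<Psi> where "\<Psi> u s = y0 + (I u (ch s) - I u x0)" for u s
  have \<Psi>bc: "\<Psi> u \<in> bcontfun" if u: "continuous_on UNIV u" for u
  proof (rule bcontfun_normI)
    show "continuous_on UNIV (\<Psi> u)"
      unfolding \<Psi>_def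
      by (intro continuous_intros continuous_on_compose2[OF Icont[OF u], of UNIV ch])
        (use ch chc in auto)
    show "norm (\<Psi> u s) \<le> \<bar>y0\<bar> + 4 * h * M" for s
      using IM[OF u, of "ch s"] IM[OF u, of x0] ch[of s] h unfolding \<Psi>_def by auto
  qed
  define G where "G u = Bcontfun (\<Psi> (apply_bcontfun u))" for u :: "real \<Rightarrow>\<^sub>C real"
  have Gapp: "apply_bcontfun (G u) = \<Psi> (apply_bcontfun u)" for u
    unfolding G_def by (rule Bcontfun_inverse[OF \<Psi>bc]) simp
  have "\<exists>!u. G u = u"
  proof (rule banach_fix_type[of "1/2"])
    show "\<forall>u v. dist (G u) (G v) \<le> 1 / 2 * dist u v"
    proof (intro allI dist_bound)
      fix u v :: "real \<Rightarrow>\<^sub>C real" and s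
      have uv: "\<bar>u s - v s\<bar> \<le> dist u v" for s using dist_bounded[of u s v] by (simp add: dist_real_def)
      have c: "continuous_on UNIV (apply_bcontfun u)" "continuous_on UNIV (apply_bcontfun v)" by auto
      have "\<bar>I u (ch s) - I v (ch s)\<bar> \<le> 2 * h * (L * dist u v)" "\<bar>I u x0 - I v x0\<bar> \<le> 2
          * h * (L * dist u v)"
        using Idiff[OF c _ _ uv] ch h by auto
      then have "\<bar>\<Psi> u s - \<Psi> v s\<bar> \<le> 4 * h * L * dist u v" unfolding \<Psi>_def by (simp add:
          algebra_simps)
      also have "\<dots> \<le> 1 / 2 * dist u v" using hL by (intro mult_right_mono) auto
      finally show "dist (G u s) (G v s) \<le> 1 / 2 * dist u v" by (simp add: Gapp dist_real_def)
    qed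
  qed auto
  then obtain u where u: "G u = u" by blast
  define Y where "Y = apply_bcontfun u"
  have Yc: "continuous_on UNIV Y" by (simp add: Y_def)
  have Yeq: "Y s = \<Psi> Y s" for s using Gapp[of u] u by (simp add: Y_def)
  have Yx0: "Y x0 = y0" using Yeq[of x0] h by (simp add: \<Psi>_def ch_def)
  have Yd: "\<bar>Y s - y0\<bar> < d" for s
    using IM[OF Yc, of "ch s"] IM[OF Yc, of x0] ch[of s] h hM Yeq[of s] by (simp add: \<Psi>_def)
  have QP: "Q s (Y s) = P (s, Y s)" if "\<bar>s - x0\<bar> < h" for s
  proof -
    have "cx s = s" "cy (Y s) = Y s" using that h Yd[of s] by (auto simp: cx_def cy_def)
    then show ?thesis by (simp add: Q_def)
  qed
  have inU: "(s, Y s) \<in> U" if "\<bar>s - x0\<bar> < h" for s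
  proof -
    have "(s, Y s) \<in> R" using Yd[of s] that h by (auto simp: R_def)
    then show ?thesis using R by blast
  qed
  have der: "(Y has_real_derivative P (s, Y s)) (at s)" if s: "\<bar>s - x0\<bar> < h" for s
  proof -
    have "(I Y has_real_derivative Q s (Y s)) (at s within {x0 - h..x0 + h})"
      unfolding I_def by (rule integral_has_real_derivative)
        (use continuous_on_subset[OF Qcont[OF Yc] subset_UNIV] s in auto)
    moreover have "x0 - h < s" "s < x0 + h" using s by auto
    ultimately have "(I Y has_real_derivative Q s (Y s)) (at s)" using at_within_Icc_at by metis
    then have "((\<lambda>s. y0 + (I Y s - I Y x0)) has_real_derivative P (s, Y s)) (at s)"
      using QP[OF s] by (auto intro!: derivative_eq_intros)
    then show ?thesis
    proof (rule has_field_derivative_transform_within_open[of _ _ _ "{x0 - h<..<x0 + h}"])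
      show "y0 + (I Y r - I Y x0) = Y r" if "r \<in> {x0 - h<..<x0 + h}" for r
        using Yeq[of r] that by (simp add: \<Psi>_def ch_def)
    qed (use s in auto)
  qed
  let ?T = "{x0 - h<..<x0 + h}"
  have "ck n ?T Y" for n
  proof (induction n)
    case (Suc n)
    show ?case
    proof (rule ck_SucI)
      show "(Y has_derivative (\<lambda>v. v * P (s, Y s))) (at s)" if "s \<in> ?T" for s
      proof -
        have "\<bar>s - x0\<bar> < h" using that by auto
        from der[OF this] show ?thesis unfolding has_field_derivative_def
          by (rule has_derivative_eq_rhs) (simp add: fun_eq_iff)
      qed
      have "ck n ?T (\<lambda>s. P (s, Y s))"
      proof (rule ck_compose[where V=U])
        show "ck n U P" using P by (simp add: smooth_on_iff_ck)
        show "ck n ?T (\<lambda>s. (s, Y s))"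
          by (intro ck_Pair ck_bounded_linear[OF _ bounded_linear_ident] Suc) auto
      qed (use inU in auto)
      then show "ck n ?T (\<lambda>s. v * P (s, Y s))" for v
        by (intro ck_bilinear[OF bounded_bilinear_mult] ck_const) auto
    qed auto
  qed simp
  then have "smooth_on ?T Y" by (simp add: smooth_on_iff_ck)
  then show ?thesis using that h(1) Yx0 inU der by blast
qed

definition fibre_deriv :: "(jet \<Rightarrow> real) \<Rightarrow> jet \<Rightarrow> real" where
  "fibre_deriv F m = dd (1, snd (snd m), 0) F m"

lemma dd_jet:
  fixes F :: "jet \<Rightarrow> real"
  assumes "F differentiable (at m)"
  shows "dd (a, b, c) F m = a * dd (1, 0, 0) F m + b * dd (0, 1, 0) F m + c * dd (0, 0, 1) F m"
  using dd_linear[OF assms, of 1 "(a, b, 0)" c "(0, 0, 1)"] dd_linear[OF assms, of a "(1, 0, 0)" b "(0, 1, 0)"]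
  by simp

lemma smooth_on_fibre_deriv:
  assumes F: "smooth_on U F" shows "smooth_on U (fibre_deriv F)"
proof -
  have op: "open U" using F smooth_on_open by blast
  have "smooth_on U (\<lambda>m. dd (1, 0, 0) F m + snd (snd m) * dd (0, 1, 0) F m)"
    by (intro smooth_intros smooth_on_dd F op)
  then show ?thesis
  proof (rule smooth_on_cong)
    fix m assume "m \<in> U"
    from dd_jet[OF smooth_on_differentiable[OF F this], of 1 "snd (snd m)" 0]
    show "dd (1, 0, 0) F m + snd (snd m) * dd (0, 1, 0) F m = fibre_deriv F m"
      by (simp add: fibre_deriv_def)
  qed
qed

lemma deriv_cong_open:
  assumes "open T" "\<And>s. s \<in> T \<Longrightarrow> f s = g s" "s \<in> T" "(g has_real_derivative D) (at s)"
  shows "deriv f s = D"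
  by (rule DERIV_imp_deriv, rule has_field_derivative_transform_within_open[OF assms(4,1,3)])
    (use assms(2) in auto)

text \<open>On a characteristic y' = p x', so immersion means x' \<noteq> 0, and the contact
  function has derivative x'(t) x'(s) (p(s) - p(t)). Contact of order 3 is p' = 0, of order 4 also
  p'' = 0. Differentiating F = 0 along the curve expresses p' and p'' by the fibre derivatives of
  \<open>F\<close>.\<close>

lemma characteristic_contact:
  assumes F: "smooth_on UNIV F" and ch: "characteristic F T \<gamma>" and t: "t \<in> T"
    and ne: "vector_derivative (base_proj \<circ> \<gamma>) (at t) \<noteq> 0"
  shows "tangent_contact (base_proj \<circ> \<gamma>) t 3 \<longleftrightarrow> fibre_deriv F (\<gamma> t) = 0"
    and "tangent_contact (base_proj \<circ> \<gamma>) t 4 \<longleftrightarrow>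
      fibre_deriv F (\<gamma> t) = 0 \<and> fibre_deriv (fibre_deriv F) (\<gamma> t) = 0"
    and "fibre_deriv F (\<gamma> t) = 0 \<Longrightarrow> dd (0, 0, 1) F (\<gamma> t) \<noteq> 0"
proof -
  have \<gamma>: "smooth_on T \<gamma>" and "open T" using ch smooth_on_open by (auto simp: characteristic_def)
  define x where "x s = fst (\<gamma> s)" for s
  define y where "y s = fst (snd (\<gamma> s))" for s
  define p where "p s = snd (snd (\<gamma> s))" for s
  have \<gamma>eq: "\<gamma> s = (x s, y s, p s)" for s by (simp add: x_def y_def p_def)
  have sx: "smooth_on T x" and sy: "smooth_on T y" and sp: "smooth_on T p"
    unfolding x_def y_def p_def by (intro smooth_intros \<gamma>)+
  let ?x = "dd 1 x" let ?y = "dd 1 y" let ?p = "dd 1 p"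
  have D: "(f has_real_derivative dd 1 f s) (at s)" if "smooth_on T f" "s \<in> T" for f s
    using has_real_derivative_dd[OF smooth_on_differentiable[OF that]] .
  have Dg: "(\<gamma> has_vector_derivative (?x s, ?y s, ?p s)) (at s)" if "s \<in> T" for s
  proof -
    have "((\<lambda>s. (x s, y s, p s)) has_vector_derivative (?x s, ?y s, ?p s)) (at s)"
      using D[OF sx that] D[OF sy that] D[OF sp that]
      unfolding has_real_derivative_iff_has_vector_derivative
      by (intro has_vector_derivative_Pair)
    moreover have "(\<lambda>s. (x s, y s, p s)) = \<gamma>" using \<gamma>eq by auto
    ultimately show ?thesis by simp
  qed
  have \<sigma>: "base_proj \<circ> \<gamma> = (\<lambda>s. (x s, y s))" by (auto simp: \<gamma>eq)
  have Dsig: "vector_derivative (base_proj \<circ> \<gamma>) (at s) = (?x s, ?y s)" if "s \<in> T" for s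
    unfolding \<sigma> using D[OF sx that] D[OF sy that]
    unfolding has_real_derivative_iff_has_vector_derivative
    by (intro vector_derivative_at has_vector_derivative_Pair)
  have tan: "?y s = p s * ?x s" "dd (?x s, ?y s, ?p s) F (\<gamma> s) = 0" if "s \<in> T" for s
    using ch that vector_derivative_at[OF Dg[OF that]]
    by (auto simp: characteristic_def surface_tangent_def \<gamma>eq[of s] dd_def)
  have Fd: "F differentiable (at m)" for m using smooth_on_differentiable[OF F] by simp
  let ?I = "fibre_deriv F" let ?J = "fibre_deriv (fibre_deriv F)" let ?Fp = "dd (0, 0, 1) F"
  have sI: "smooth_on UNIV ?I" by (rule smooth_on_fibre_deriv[OF F])
  \<comment> \<open>The tangency condition dF = 0 along the curve, split into its fibre component
    and its p-component.\<close>
  have rel: "?x s * ?I (\<gamma> s) + ?p s * ?Fp (\<gamma> s) = 0" if "s \<in> T" for s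
  proof -
    have "dd (?x s, ?y s, ?p s) F (\<gamma> s) = ?x s * ?I (\<gamma> s) + ?p s * ?Fp (\<gamma> s)"
      using tan(1)[OF that] dd_jet[OF Fd, of 1 "p s" 0 "\<gamma> s"] dd_jet[OF Fd, of "?x s" "?y s" "?p s" "\<gamma> s"]
      by (simp add: fibre_deriv_def p_def[symmetric] algebra_simps)
    then show ?thesis using tan(2)[OF that] by simp
  qed
  have xne: "?x t \<noteq> 0" using ne Dsig[OF t] tan(1)[OF t] by (auto simp: zero_prod_def)
  show Fp: "?Fp (\<gamma> t) \<noteq> 0" if I0: "?I (\<gamma> t) = 0"
  proof
    assume F0: "?Fp (\<gamma> t) = 0"
    \<comment> \<open>If both the fibre derivative and the p-derivative vanish, dF is
      \<open>b\<close> times dy - p dx: the tangent plane is the contact plane or dF is 0, and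
      characteristics avoid both.\<close>
    define b where "b = dd (0, 1, 0) F (\<gamma> t)"
    have Fx: "dd (1, 0, 0) F (\<gamma> t) = - p t * b"
      using I0 dd_jet[OF Fd, of 1 "p t" 0 "\<gamma> t"] by (simp add: fibre_deriv_def p_def[symmetric] b_def)
    have all: "dd (u, v, w) F (\<gamma> t) = b * (v - p t * u)" for u v w
      using dd_jet[OF Fd, of u v w "\<gamma> t"] Fx F0 by (simp add: b_def algebra_simps)
    have "b \<noteq> 0"
    proof
      assume "b = 0"
      then have "frechet_derivative F (at (\<gamma> t)) = (\<lambda>_. 0)" using all by (auto simp: fun_eq_iff dd_def)
      then show False using ch t by (auto simp: characteristic_def)
    qed
    then have "surface_tangent F (\<gamma> t) = contact_plane (\<gamma> t)"
      using all by (auto simp: surface_tangent_def dd_def \<gamma>eq[of t])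
    then show False using ch t by (auto simp: characteristic_def)
  qed
  define c where "c s = cross2 (vector_derivative (base_proj \<circ> \<gamma>) (at t)) ((base_proj \<circ>
      \<gamma>) s - (base_proj \<circ> \<gamma>) t)" for s
  have ceq: "c s = ?x t * (y s - y t) - ?y t * (x s - x t)" for s
    unfolding c_def Dsig[OF t] unfolding \<sigma> by simp
  have d1: "deriv c s = ?x t * (?x s * (p s - p t))" if s: "s \<in> T" for s
  proof -
    have "(c has_real_derivative ?x t * ?y s - ?y t * ?x s) (at s)"
      unfolding ceq[abs_def] by (auto intro!: derivative_eq_intros D[OF sx s] D[OF sy s])
    from DERIV_imp_deriv[OF this] show ?thesis
      using tan(1)[OF s] tan(1)[OF t] by (simp add: algebra_simps)
  qed
  have d2: "deriv (deriv c) s = ?x t * (dd 1 ?x s * (p s - p t) + ?x s * ?p s)" if s: "s \<in> T" for s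
    by (rule deriv_cong_open[OF \<open>open T\<close> d1 s])
      (auto intro!: derivative_eq_intros D[OF smooth_on_dd[OF sx] s] D[OF sp s] simp: algebra_simps)
  have d3: "deriv (deriv (deriv c)) t = ?x t * (2 * dd 1 ?x t * ?p t + ?x t * dd 1 ?p t)"
    by (rule deriv_cong_open[OF \<open>open T\<close> d2 t])
      (auto intro!: derivative_eq_intros D[OF smooth_on_dd[OF smooth_on_dd[OF sx]] t] D[OF smooth_on_dd[OF sx] t]
        D[OF sp t] D[OF smooth_on_dd[OF sp] t] simp: algebra_simps)
  have c0: "c t = 0" "deriv c t = 0" using ceq d1[OF t] by auto
  have contact: "tangent_contact (base_proj \<circ> \<gamma>) t k \<longleftrightarrow> (\<forall>j<k. (deriv ^^ j)
      c t = 0)" for k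
    unfolding tangent_contact_def c_def[abs_def] using ne by simp
  have k3: "tangent_contact (base_proj \<circ> \<gamma>) t 3 \<longleftrightarrow> ?p t = 0"
    unfolding contact using c0 d2[OF t] xne by (auto simp: numeral_3_eq_3 All_less_Suc)
  have k4: "tangent_contact (base_proj \<circ> \<gamma>) t 4 \<longleftrightarrow> ?p t = 0 \<and> dd 1 ?p t = 0"
    unfolding contact using c0 d2[OF t] d3 xne by (auto simp: eval_nat_numeral All_less_Suc)
  have pI: "?p t = 0 \<longleftrightarrow> ?I (\<gamma> t) = 0" using rel[OF t] xne Fp by auto
  show "tangent_contact (base_proj \<circ> \<gamma>) t 3 \<longleftrightarrow> ?I (\<gamma> t) = 0" using k3 pI by simp
  \<comment> \<open>The relation \<open>rel\<close> is differentiated once more. As p' = 0, the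
    velocity at t is x' times the fibre direction, so the derivative of \<open>?I\<close> along the
    curve is x' \<open>?J\<close>.\<close>
  have "dd 1 ?p t = 0 \<longleftrightarrow> ?J (\<gamma> t) = 0" if p0: "?p t = 0"
  proof -
    have chain: "((\<lambda>s. g (\<gamma> s)) has_real_derivative dd (?x t, ?y t, ?p t) g (\<gamma> t)) (at t)" if
        "smooth_on UNIV g" for g
      by (rule curve_has_real_derivative[OF _ Dg[OF t]]) (use smooth_on_differentiable[OF that] in auto)
    have "((\<lambda>s. ?x s * ?I (\<gamma> s) + ?p s * ?Fp (\<gamma> s)) has_real_derivative
      (dd 1 ?x t * ?I (\<gamma> t) + dd (?x t, ?y t, ?p t) ?I (\<gamma> t) * ?x t)
      + (dd 1 ?p t * ?Fp (\<gamma> t) + dd (?x t, ?y t, ?p t) ?Fp (\<gamma> t) * ?p t)) (at t)"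
      by (intro DERIV_add DERIV_mult chain sI smooth_on_dd F D[OF _ t] sx sp)
    moreover have "((\<lambda>s. ?x s * ?I (\<gamma> s) + ?p s * ?Fp (\<gamma> s)) has_real_derivative 0) (at t)"
      by (rule has_field_derivative_transform_within_open[of "\<lambda>s. 0", OF _ \<open>open T\<close> t]) (use
          rel in auto)
    ultimately have "dd (?x t, ?y t, ?p t) ?I (\<gamma> t) * ?x t + dd 1 ?p t * ?Fp (\<gamma> t) = 0"
      using DERIV_unique p0 pI by fastforce
    moreover have "dd (?x t, ?y t, ?p t) ?I (\<gamma> t) = ?x t * ?J (\<gamma> t)"
      using p0 tan(1)[OF t] dd_linear[OF smooth_on_differentiable[OF sI], of "\<gamma> t" "?x t" "(1, p t, 0)" 0 0]
      by (simp add: fibre_deriv_def[of ?I] p_def[symmetric] mult.commute)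
    ultimately show ?thesis using xne Fp pI p0 by auto
  qed
  then show "tangent_contact (base_proj \<circ> \<gamma>) t 4 \<longleftrightarrow> ?I (\<gamma> t) = 0 \<and> ?J
      (\<gamma> t) = 0"
    using k4 pI by auto
qed

text \<open>Where the p-derivative does not vanish the surface is a graph p = \<open>\<xi>\<close>
  (x, y), and the lift of a solution of y' = \<open>\<xi>\<close> (x, y) is a characteristic
  immersed in the plane.\<close>

lemma characteristic_through:
  assumes F: "smooth_on UNIV F" and m: "F (x0, y0, p0) = 0" "dd (0, 0, 1) F (x0, y0, p0) \<noteq> 0"
  obtains T \<gamma> where "characteristic F T \<gamma>" "x0 \<in> T" "\<gamma> x0 = (x0, y0, p0)"
    "vector_derivative (base_proj \<circ> \<gamma>) (at x0) \<noteq> 0"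
proof -
  define r where "r w = (fst (fst w), snd (fst w), snd w)" for w :: "(real \<times> real) \<times> real"
  have sG: "smooth_on UNIV (\<lambda>w. F (r w))"
    by (rule smooth_on_compose[OF F]) (auto simp: r_def[abs_def] intro!: smooth_intros)
  have rd: "(r has_derivative r) (at w)" for w
    unfolding r_def[abs_def] by (intro has_derivative_Pair has_derivative_fst has_derivative_snd has_derivative_ident)
  have dG: "dd v (\<lambda>w. F (r w)) w = dd (r v) F (r w)" for v w
    by (rule dd_eqI[OF dd_chain[OF smooth_on_differentiable[OF F UNIV_I] rd]])
  have 1: "((x0, y0), p0) \<in> UNIV" "F (r ((x0, y0), p0)) = 0" "dd (0, 1) (\<lambda>w. F (r w)) ((x0, y0), p0)
      \<noteq> 0"
    using m dG by (auto simp: r_def zero_prod_def)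
  obtain V a \<xi> where V: "open V" "(x0, y0) \<in> V" "a > 0" "smooth_on V \<xi>" "\<xi> (x0, y0) = p0"
    and Fp: "\<And>y t. y \<in> V \<Longrightarrow> \<bar>t - p0\<bar> < a \<Longrightarrow> dd (0, 1) (\<lambda>w.
        F (r w)) (y, t) \<noteq> 0"
    and zero: "\<And>y t. y \<in> V \<Longrightarrow> \<bar>t - p0\<bar> < a \<Longrightarrow> F (r (y, t)) = 0
        \<longleftrightarrow> t = \<xi> y"
    and xi: "\<And>y. y \<in> V \<Longrightarrow> \<bar>\<xi> y - p0\<bar> < a"
    by (rule implicit_function[OF sG 1]) (rule that; assumption)
  obtain h Y where hY: "h > 0" "smooth_on {x0 - h<..<x0 + h} Y" "Y x0 = y0"
    "\<And>x. \<bar>x - x0\<bar> < h \<Longrightarrow> (x, Y x) \<in> V"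
    "\<And>x. \<bar>x - x0\<bar> < h \<Longrightarrow> (Y has_real_derivative \<xi> (x, Y x)) (at x)"
    by (rule ode_solution[OF V(4,2)]) (rule that; assumption)
  let ?T = "{x0 - h<..<x0 + h}"
  define \<gamma> where "\<gamma> s = (s, Y s, \<xi> (s, Y s))" for s
  have sp: "smooth_on ?T (\<lambda>s. \<xi> (s, Y s))"
    by (rule smooth_on_compose[OF V(4)]) (use hY in \<open>auto intro!: smooth_intros\<close>)
  have s\<gamma>: "smooth_on ?T \<gamma>" unfolding \<gamma>_def by (intro smooth_intros hY sp) auto
  have Dg: "(\<gamma> has_vector_derivative (1, \<xi> (s, Y s), dd 1 (\<lambda>s. \<xi> (s, Y s)) s)) (at s)" if s:
      "\<bar>s - x0\<bar> < h" for s
  proof -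
    have "s \<in> ?T" using s by auto
    from has_real_derivative_dd[OF smooth_on_differentiable[OF sp this]] hY(5)[OF s]
    show ?thesis unfolding \<gamma>_def has_real_derivative_iff_has_vector_derivative
      by (intro has_vector_derivative_Pair has_vector_derivative_id)
  qed
  have F0: "F (\<gamma> s) = 0" if "\<bar>s - x0\<bar> < h" for s
    using zero[OF hY(4)[OF that] xi[OF hY(4)[OF that]]] by (simp add: \<gamma>_def r_def)
  have Fpg: "dd (0, 0, 1) F (\<gamma> s) \<noteq> 0" if "\<bar>s - x0\<bar> < h" for s
    using Fp[OF hY(4)[OF that] xi[OF hY(4)[OF that]]] dG by (simp add: \<gamma>_def r_def zero_prod_def)
  have "characteristic F ?T \<gamma>"
    unfolding characteristic_def
  proof (intro conjI ballI)
    fix s assume "s \<in> ?T"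
    then have s: "\<bar>s - x0\<bar> < h" by auto
    show "\<gamma> s \<in> jet_surface F" using F0[OF s] by (simp add: jet_surface_def)
    show "frechet_derivative F (at (\<gamma> s)) \<noteq> (\<lambda>_. 0)" using Fpg[OF s] by (auto simp: dd_def)
    have "(0, 0, 1) \<in> contact_plane (\<gamma> s)" "(0, 0, 1) \<notin> surface_tangent F (\<gamma> s)"
      using Fpg[OF s] by (auto simp: \<gamma>_def surface_tangent_def dd_def)
    then show "surface_tangent F (\<gamma> s) \<noteq> contact_plane (\<gamma> s)" by blast
    note vd = vector_derivative_at[OF Dg[OF s]]
    show "vector_derivative \<gamma> (at s) \<noteq> 0" unfolding vd by (simp add: zero_prod_def)
    have "((\<lambda>s. F (\<gamma> s)) has_real_derivative dd (1, \<xi> (s, Y s), dd 1 (\<lambda>s. \<xi> (s, Y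
        s)) s) F (\<gamma> s)) (at s)"
      by (rule curve_has_real_derivative[OF _ Dg[OF s]]) (use smooth_on_differentiable[OF F] in auto)
    moreover have "((\<lambda>s. F (\<gamma> s)) has_real_derivative 0) (at s)"
      by (rule has_field_derivative_transform_within_open[of "\<lambda>s. 0" _ _ ?T]) (use F0 s in auto)
    ultimately have "dd (1, \<xi> (s, Y s), dd 1 (\<lambda>s. \<xi> (s, Y s)) s) F (\<gamma> s) = 0" using
        DERIV_unique by blast
    then show "vector_derivative \<gamma> (at s) \<in> surface_tangent F (\<gamma> s) \<inter> contact_plane
        (\<gamma> s)"
      unfolding vd by (auto simp: surface_tangent_def dd_def \<gamma>_def)
  qed (use s\<gamma> in auto)
  moreover have "vector_derivative (base_proj \<circ> \<gamma>) (at x0) \<noteq> 0"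
  proof -
    have "((\<lambda>s. (s, Y s)) has_vector_derivative (1, \<xi> (x0, Y x0))) (at x0)"
      using hY(5)[of x0] hY(1) unfolding has_real_derivative_iff_has_vector_derivative
      by (intro has_vector_derivative_Pair has_vector_derivative_id) auto
    moreover have "base_proj \<circ> \<gamma> = (\<lambda>s. (s, Y s))" by (auto simp: \<gamma>_def)
    ultimately show ?thesis using vector_derivative_at by (fastforce simp: zero_prod_def)
  qed
  ultimately show ?thesis using that hY V by (auto simp: \<gamma>_def)
qed

text \<open>The condition on the p-derivative is automatic at a contact of order 3 by the last part
  of \<open>characteristic_contact\<close>; conversely it provides a characteristic through the
  point.\<close>

lemma inflection_curve_iff:
  assumes F: "smooth_on UNIV F"
  shows "(x, y) \<in> inflection_curve F \<longleftrightarrow>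
    (\<exists>p. F (x, y, p) = 0 \<and> fibre_deriv F (x, y, p) = 0 \<and> dd (0, 0, 1) F (x, y, p) \<noteq> 0)"
    and "(x, y) \<in> bi_inflections F \<longleftrightarrow>
    (\<exists>p. F (x, y, p) = 0 \<and> fibre_deriv F (x, y, p) = 0 \<and> fibre_deriv (fibre_deriv F) (x, y, p) = 0
      \<and> dd (0, 0, 1) F (x, y, p) \<noteq> 0)"
proof -
  have fw: "\<exists>p. \<gamma> t = (x, y, p) \<and> F (x, y, p) = 0 \<and> vector_derivative (base_proj \<circ>
      \<gamma>) (at t) \<noteq> 0"
    if "characteristic F T \<gamma>" "t \<in> T" "base_proj (\<gamma> t) = (x, y)" "tangent_contact (base_proj
        \<circ> \<gamma>) t k" for T \<gamma> t k
    using that unfolding characteristic_def jet_surface_def tangent_contact_def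
    by (cases "\<gamma> t") auto
  show "(x, y) \<in> inflection_curve F \<longleftrightarrow>
    (\<exists>p. F (x, y, p) = 0 \<and> fibre_deriv F (x, y, p) = 0 \<and> dd (0, 0, 1) F (x, y, p) \<noteq> 0)"
        (is "?l \<longleftrightarrow> ?r")
  proof
    assume ?l
    then obtain T \<gamma> t where a: "characteristic F T \<gamma>" "t \<in> T" "base_proj (\<gamma> t) = (x, y)"
        "tangent_contact (base_proj \<circ> \<gamma>) t 3"
      by (auto simp: inflection_curve_def contact_points_def)
    from fw[OF a] obtain p where "\<gamma> t = (x, y, p)" "F (x, y, p) = 0" "vector_derivative (base_proj \<circ>
        \<gamma>) (at t) \<noteq> 0" by blast
    then show ?r using characteristic_contact[OF F a(1,2)] a(4) by metis
  next
    assume ?r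
    then obtain p where p: "F (x, y, p) = 0" "fibre_deriv F (x, y, p) = 0" "dd (0, 0, 1) F (x, y, p) \<noteq> 0" by
        blast
    obtain T \<gamma> where g: "characteristic F T \<gamma>" "x \<in> T" "\<gamma> x = (x, y, p)"
      "vector_derivative (base_proj \<circ> \<gamma>) (at x) \<noteq> 0"
      by (rule characteristic_through[OF F p(1,3)]) (rule that; assumption)
    then have "tangent_contact (base_proj \<circ> \<gamma>) x 3" using characteristic_contact(1)[OF F g(1,2,4)] p
        by simp
    then show ?l unfolding inflection_curve_def contact_points_def using g
      by (auto intro!: exI[of _ T] exI[of _ \<gamma>] exI[of _ x])
  qed
  show "(x, y) \<in> bi_inflections F \<longleftrightarrow>
    (\<exists>p. F (x, y, p) = 0 \<and> fibre_deriv F (x, y, p) = 0 \<and> fibre_deriv (fibre_deriv F) (x, y, p) = 0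
      \<and> dd (0, 0, 1) F (x, y, p) \<noteq> 0)" (is "?l \<longleftrightarrow> ?r")
  proof
    assume ?l
    then obtain T \<gamma> t where a: "characteristic F T \<gamma>" "t \<in> T" "base_proj (\<gamma> t) = (x, y)"
        "tangent_contact (base_proj \<circ> \<gamma>) t 4"
      by (auto simp: bi_inflections_def contact_points_def)
    from fw[OF a] obtain p where "\<gamma> t = (x, y, p)" "F (x, y, p) = 0" "vector_derivative (base_proj \<circ>
        \<gamma>) (at t) \<noteq> 0" by blast
    then show ?r using characteristic_contact[OF F a(1,2)] a(4) by metis
  next
    assume ?r
    then obtain p where p: "F (x, y, p) = 0" "fibre_deriv F (x, y, p) = 0" "fibre_deriv (fibre_deriv F) (x, y, p) = 0"
      "dd (0, 0, 1) F (x, y, p) \<noteq> 0" by blast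
    obtain T \<gamma> where g: "characteristic F T \<gamma>" "x \<in> T" "\<gamma> x = (x, y, p)"
      "vector_derivative (base_proj \<circ> \<gamma>) (at x) \<noteq> 0"
      by (rule characteristic_through[OF F p(1,4)]) (rule that; assumption)
    then have "tangent_contact (base_proj \<circ> \<gamma>) x 4" using characteristic_contact(2)[OF F g(1,2,4)] p
        by simp
    then show ?l unfolding bi_inflections_def contact_points_def using g
      by (auto intro!: exI[of _ T] exI[of _ \<gamma>] exI[of _ x])
  qed
qed

section \<open>Jets of surfaces with a singular dual projection\<close>

lemma dd_eq_0_of_snd:
  fixes g :: "real \<times> 'b::real_normed_vector \<Rightarrow> real"
  assumes W: "open W" and w: "w \<in> W" and g: "g differentiable (at w)"
    and dep: "\<And>w w'. w \<in> W \<Longrightarrow> w' \<in> W \<Longrightarrow> snd w = snd w' \<Longrightarrow>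
        g w = g w'"
  shows "dd (1, 0) g w = 0"
proof -
  have "((\<lambda>t. g (w + t *\<^sub>R (1, 0))) has_real_derivative dd (1, 0) g (w + 0 *\<^sub>R (1, 0))) (at 0)"
    by (rule line_has_derivative) (use g in \<open>simp add: zero_prod_def[symmetric]\<close>)
  moreover have "((\<lambda>t. g (w + t *\<^sub>R (1, 0))) has_real_derivative 0) (at 0)"
  proof (rule has_field_derivative_transform_within_open[of "\<lambda>t. g w"])
    show "open ((\<lambda>t. w + t *\<^sub>R (1, 0)) -` W)"
      by (rule open_vimage[OF W]) (intro continuous_intros)
    show "g w = g (w + t *\<^sub>R (1, 0))" if "t \<in> (\<lambda>t. w + t *\<^sub>R (1, 0)) -` W" for t
      using that by (intro dep[OF w]) auto
  qed (use w in \<open>auto simp: zero_prod_def[symmetric]\<close>)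
  ultimately have "dd (1, 0) g (w + 0 *\<^sub>R (1, 0)) = 0" by (rule DERIV_unique)
  then show ?thesis by (simp add: zero_prod_def[symmetric])
qed

lemma dd_comp:
  assumes "f differentiable (at (g x))" "g differentiable (at x)"
  shows "dd v (\<lambda>x. f (g x)) x = dd (dd v g x) f (g x)"
  by (rule dd_eqI[OF dd_chain[OF assms(1) has_derivative_dd[OF assms(2)]]])

text \<open>The inverse \<open>\<Theta>\<close> of the chart straightens the fibres:
  \<open>dual_proj\<close> after \<open>\<Theta>\<close> depends on the last two coordinates only,
  so the x-derivative of \<open>\<Theta>\<close> lies in the kernel (1, p, 0) of the differential of
  \<open>dual_proj\<close>. The factor \<open>\<mu>\<close> is nonzero because
  \<open>\<Theta>\<close> is a diffeomorphism. Thus fibre derivatives can be computed as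
  x-derivatives in the normal form.\<close>

lemma dual_projection_chart:
  assumes "dual_projection_equiv f m {(x, y, z). z = s x y}"
  obtains \<Theta> \<Phi> \<mu> U W where "open W" "(0, 0, 0) \<in> W" "smooth_on W \<Theta>" "\<Theta> (0, 0, 0) = m"
    "smooth_on U \<Phi>" "m \<in> U" "\<And>u. u \<in> U \<Longrightarrow> \<Phi> u \<in> W \<and> \<Theta> (\<Phi>
        u) = u"
    "\<And>w. w \<in> W \<Longrightarrow> \<Theta> w \<in> U \<and> \<Phi> (\<Theta> w) = w"
    "\<And>x y z. (x, y, z) \<in> W \<Longrightarrow> f (\<Theta> (x, y, z)) = 0 \<longleftrightarrow> z = s x y"
    "smooth_on W \<mu>" "\<And>w. w \<in> W \<Longrightarrow> \<mu> w \<noteq> 0"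
    "\<And>w. w \<in> W \<Longrightarrow> dd (1, 0, 0) \<Theta> w = (\<mu> w, snd (snd (\<Theta> w)) * \<mu> w, 0)"
    "\<And>v w. w \<in> W \<Longrightarrow> dd (dd v \<Theta> w) \<Phi> (\<Theta> w) = v"
    "\<And>v u. u \<in> U \<Longrightarrow> dd (dd v \<Phi> u) \<Theta> (\<Phi> u) = v"
proof -
  obtain U W \<Phi> U' W' \<phi> where \<Phi>: "diffeo_between U W \<Phi>" "m \<in> U" "\<Phi> m = (0, 0, 0)"
    and \<phi>: "diffeo_between U' W' \<phi>" "dual_proj ` U \<subseteq> U'"
    and comm: "\<forall>u\<in>U. snd (\<Phi> u) = \<phi> (dual_proj u)"
    and im: "\<Phi> ` (jet_surface f \<inter> U) = {(x, y, z). z = s x y} \<inter> W"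
    using assms unfolding dual_projection_equiv_def by blast
  define \<Theta> where "\<Theta> = inv_into U \<Phi>"
  have bij: "bij_betw \<Phi> U W" and s\<Phi>: "smooth_on U \<Phi>" and s\<Theta>: "smooth_on W \<Theta>"
    using \<Phi>(1) by (auto simp: diffeo_between_def \<Theta>_def)
  have opW: "open W" and opU: "open U" using s\<Theta> s\<Phi> smooth_on_open by auto
  have U: "\<Phi> u \<in> W \<and> \<Theta> (\<Phi> u) = u" if "u \<in> U" for u
    unfolding \<Theta>_def using bij_betw_apply[OF bij that] bij_betw_inv_into_left[OF bij that] by blast
  have W: "\<Theta> w \<in> U \<and> \<Phi> (\<Theta> w) = w" if "w \<in> W" for w
    unfolding \<Theta>_def using bij_betw_apply[OF bij_betw_inv_into[OF bij] that] bij_betw_inv_into_right[OF bij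
        that] by blast
  have W0: "(0, 0, 0) \<in> W" "\<Theta> (0, 0, 0) = m" using U[OF \<Phi>(2)] \<Phi>(3) by auto
  have surf: "f (\<Theta> (x, y, z)) = 0 \<longleftrightarrow> z = s x y" if w: "(x, y, z) \<in> W" for x y z
  proof
    assume "f (\<Theta> (x, y, z)) = 0"
    then have "\<Theta> (x, y, z) \<in> jet_surface f \<inter> U" using W[OF w] by (simp add: jet_surface_def)
    then have "\<Phi> (\<Theta> (x, y, z)) \<in> \<Phi> ` (jet_surface f \<inter> U)" by (rule imageI)
    then have "\<Phi> (\<Theta> (x, y, z)) \<in> {(x, y, z). z = s x y} \<inter> W" unfolding im .
    then show "z = s x y" using W[OF w] by simp
  next
    assume "z = s x y"
    then have "(x, y, z) \<in> \<Phi> ` (jet_surface f \<inter> U)" using im w by simp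
    then obtain u where "u \<in> jet_surface f" "u \<in> U" "\<Phi> u = (x, y, z)" by auto
    then show "f (\<Theta> (x, y, z)) = 0" using U[of u] by (simp add: jet_surface_def)
  qed
  have dep: "dual_proj (\<Theta> w) = dual_proj (\<Theta> w')" if "w \<in> W" "w' \<in> W" "snd w = snd w'" for w w'
  proof -
    have "\<phi> (dual_proj (\<Theta> w)) = \<phi> (dual_proj (\<Theta> w'))" using comm W that by metis
    moreover have "inj_on \<phi> U'" using \<phi>(1) by (auto simp: diffeo_between_def bij_betw_def)
    moreover have "dual_proj (\<Theta> w) \<in> U'" "dual_proj (\<Theta> w') \<in> U'"
      using \<phi>(2) W[OF that(1)] W[OF that(2)] by (simp_all add: image_subset_iff)
    ultimately show ?thesis by (auto dest: inj_onD)
  qed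
  have dp: "dual_proj u = (snd (snd u), snd (snd u) * fst u - fst (snd u))" for u
    by (cases u) auto
  define X where "X w = fst (\<Theta> w)" for w
  define Y where "Y w = fst (snd (\<Theta> w))" for w
  define P where "P w = snd (snd (\<Theta> w))" for w
  have sX: "smooth_on W X" and sY: "smooth_on W Y" and sP: "smooth_on W P"
    unfolding X_def Y_def P_def by (intro smooth_intros s\<Theta>)+
  define \<mu> where "\<mu> = dd (1, 0, 0) X"
  have s\<mu>: "smooth_on W \<mu>" unfolding \<mu>_def by (rule smooth_on_dd[OF sX])
  have comp: "dd v \<Theta> w = (dd v X w, dd v Y w, dd v P w)" if w: "w \<in> W" for v w
  proof -
    note D = smooth_on_has_derivative[OF s\<Theta> w]
    have "dd v X w = fst (dd v \<Theta> w)" "dd v Y w = fst (snd (dd v \<Theta> w))" "dd v P w = snd (snd (dd v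
        \<Theta> w))"
      unfolding X_def Y_def P_def
      by (rule dd_eqI[OF has_derivative_fst[OF D]] dd_eqI[OF has_derivative_fst[OF has_derivative_snd[OF D]]]
          dd_eqI[OF has_derivative_snd[OF has_derivative_snd[OF D]]])+
    then show ?thesis by (simp add: prod_eq_iff)
  qed
  have z: "(1, 0, 0) = (1::real, 0::real \<times> real)" by (simp add: zero_prod_def)
  have \<Theta>x: "dd (1, 0, 0) \<Theta> w = (\<mu> w, snd (snd (\<Theta> w)) * \<mu> w, 0)" if w: "w \<in> W" for w
  proof -
    have Pd: "dd (1, 0, 0) P w = 0" unfolding z
    proof (rule dd_eq_0_of_snd[OF opW w smooth_on_differentiable[OF sP w]])
      show "P w = P w'" if "w \<in> W" "w' \<in> W" "snd w = snd w'" for w w'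
        using dep[OF that] unfolding dp P_def by simp
    qed
    \<comment> \<open>\<open>P\<close> and \<open>P w * X w - Y w\<close> are the two components of
      \<open>dual_proj\<close>; their vanishing x-derivatives give P_x = 0 and Y_x = P X_x.\<close>
    have sPX: "smooth_on W (\<lambda>w. P w * X w - Y w)" by (intro smooth_intros sP sX sY)
    have "dd (1, 0, 0) (\<lambda>w. P w * X w - Y w) w = 0" unfolding z
    proof (rule dd_eq_0_of_snd[OF opW w smooth_on_differentiable[OF sPX w]])
      show "P w * X w - Y w = P w' * X w' - Y w'" if "w \<in> W" "w' \<in> W" "snd w = snd w'" for w w'
        using dep[OF that] unfolding dp P_def X_def Y_def prod.inject by (rule conjunct2)
    qed
    moreover have B: "((\<lambda>w. P w * X w - Y w) has_derivative
        (\<lambda>v. P w * dd v X w + dd v P w * X w - dd v Y w)) (at w)"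
      by (intro has_derivative_diff has_derivative_mult smooth_on_has_derivative[OF _ w] sP sX sY)
    ultimately have "P w * dd (1, 0, 0) X w + dd (1, 0, 0) P w * X w - dd (1, 0, 0) Y w = 0"
      using dd_eqI[OF B, of "(1, 0, 0)"] by simp
    then show ?thesis using comp[OF w] Pd by (simp add: \<mu>_def P_def)
  qed
  have inv1: "dd (dd v \<Theta> w) \<Phi> (\<Theta> w) = v" if w: "w \<in> W" for v w
  proof -
    have "dd v (\<lambda>w. \<Phi> (\<Theta> w)) w = dd (dd v \<Theta> w) \<Phi> (\<Theta> w)"
      by (rule dd_comp) (use s\<Phi> s\<Theta> w W smooth_on_differentiable in blast)+
    moreover have "dd v (\<lambda>w. \<Phi> (\<Theta> w)) w = dd v (\<lambda>w. w) w"
      by (rule dd_cong_open[OF opW _ w]) (use W in auto)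
    moreover have "dd v (\<lambda>w. w) w = v" by (rule dd_eqI[OF has_derivative_ident])
    ultimately show ?thesis by simp
  qed
  have inv2: "dd (dd v \<Phi> u) \<Theta> (\<Phi> u) = v" if u: "u \<in> U" for v u
  proof -
    have "dd v (\<lambda>u. \<Theta> (\<Phi> u)) u = dd (dd v \<Phi> u) \<Theta> (\<Phi> u)"
      by (rule dd_comp) (use s\<Phi> s\<Theta> u U smooth_on_differentiable in blast)+
    moreover have "dd v (\<lambda>u. \<Theta> (\<Phi> u)) u = dd v (\<lambda>w. w) u"
      by (rule dd_cong_open[OF opU _ u]) (use U in auto)
    moreover have "dd v (\<lambda>w. w) u = v" by (rule dd_eqI[OF has_derivative_ident])
    ultimately show ?thesis by simp
  qed
  have \<mu>0: "\<mu> w \<noteq> 0" if w: "w \<in> W" for w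
  proof
    assume "\<mu> w = 0"
    then have "dd (1, 0, 0) \<Theta> w = 0" using \<Theta>x[OF w] by (simp add: zero_prod_def)
    moreover have "dd 0 \<Phi> (\<Theta> w) = 0" by (rule dd_zero) (use s\<Phi> W[OF w] smooth_on_differentiable in
        blast)
    ultimately show False using inv1[OF w, of "(1, 0, 0)"] by (simp add: zero_prod_def)
  qed
  show ?thesis
    by (rule that[OF opW W0(1) s\<Theta> W0(2) s\<Phi> \<Phi>(2)]) (use U W surf s\<mu> \<mu>0 \<Theta>x inv1 inv2
        in blast)+
qed

text \<open>Comparison of Taylor terms of order 0 and 1. It carries the vanishing of a normal form
  to second order over to \<open>g\<close> through the nonvanishing factor \<open>u\<close>.\<close>

lemma deriv_zero_of_square:
  assumes "(g has_real_derivative g') (at 0)" "(u has_real_derivative u') (at 0)" "(r has_real_derivative r') (at 0)"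
    and "\<forall>\<^sub>F t in nhds 0. u t * g t = t\<^sup>2 * r t" and "u 0 \<noteq> 0"
  shows "g 0 = 0" "g' = 0"
proof -
  have "u 0 * g 0 = 0" using eventually_nhds_x_imp_x[OF assms(4)] by simp
  then show g0: "g 0 = 0" using assms(5) by simp
  have "((\<lambda>t. u t * g t) has_real_derivative u' * g 0 + g' * u 0) (at 0)"
    by (rule DERIV_mult[OF assms(2,1)])
  moreover have "((\<lambda>t. t\<^sup>2 * r t) has_real_derivative 0) (at 0)"
    by (auto intro!: derivative_eq_intros assms(3))
  then have "((\<lambda>t. u t * g t) has_real_derivative 0) (at 0)"
    using DERIV_cong_ev[OF refl assms(4) refl] by simp
  ultimately have "u' * g 0 + g' * u 0 = 0" by (rule DERIV_unique)
  then show "g' = 0" using g0 assms(5) by simp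
qed

text \<open>\<open>H\<close> vanishes on the graph z = s x y, so its differential there is a
  multiple of dz - ds.\<close>

lemma graph_partials:
  fixes s :: "real \<Rightarrow> real \<Rightarrow> real"
  assumes H: "smooth_on W H" and w: "(x, y, s x y) \<in> W"
    and H0: "\<And>x y. (x, y, s x y) \<in> W \<Longrightarrow> H (x, y, s x y) = 0"
    and ds: "((\<lambda>w. s (fst w) (snd w)) has_derivative (\<lambda>v. sx * fst v + sy * snd v)) (at (x, y))"
    and sc: "continuous_on UNIV (\<lambda>w. s (fst w) (snd w))"
  shows "dd (1, 0, 0) H (x, y, s x y) = - sx * dd (0, 0, 1) H (x, y, s x y)"
    and "dd (0, 1, 0) H (x, y, s x y) = - sy * dd (0, 0, 1) H (x, y, s x y)"
proof -
  define g where "g w = (fst w, snd w, s (fst w) (snd w))" for w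
  have Hd: "H differentiable (at (g (x, y)))" using smooth_on_differentiable[OF H w] by (simp add: g_def)
  have gd: "(g has_derivative (\<lambda>v. (fst v, snd v, sx * fst v + sy * snd v))) (at (x, y))"
    unfolding g_def by (intro has_derivative_Pair ds has_derivative_fst has_derivative_snd has_derivative_ident)
  have opg: "open (g -` W)"
    by (rule open_vimage[OF smooth_on_open[OF H]]) (use sc in \<open>auto simp: g_def[abs_def] intro!:
        continuous_intros\<close>)
  have "((\<lambda>w. H (g w)) has_derivative (\<lambda>v. dd (fst v, snd v, sx * fst v + sy * snd v) H (g (x,
      y)))) (at (x, y))"
    by (rule dd_chain[OF Hd gd])
  moreover have "((\<lambda>w. H (g w)) has_derivative (\<lambda>v. 0)) (at (x, y))"
    by (rule has_derivative_transform_within_open[OF _ opg, of "\<lambda>w. 0"])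
      (use H0 w in \<open>auto simp: g_def\<close>)
  ultimately have "(\<lambda>v. dd (fst v, snd v, sx * fst v + sy * snd v) H (g (x, y))) = (\<lambda>v. 0)"
    by (rule has_derivative_unique)
  then have e: "dd (fst v, snd v, sx * fst v + sy * snd v) H (g (x, y)) = 0" for v by meson
  show "dd (1, 0, 0) H (x, y, s x y) = - sx * dd (0, 0, 1) H (x, y, s x y)"
    using e[of "(1, 0)"] dd_jet[OF Hd, of 1 0 sx] by (simp add: g_def)
  show "dd (0, 1, 0) H (x, y, s x y) = - sy * dd (0, 0, 1) H (x, y, s x y)"
    using e[of "(0, 1)"] dd_jet[OF Hd, of 0 1 sy] by (simp add: g_def)
qed

lemma dd_chart_fibre:
  assumes g: "smooth_on UNIV g" and \<Theta>: "smooth_on W \<Theta>" and w: "w \<in> W"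
    and x: "dd (1, 0, 0) \<Theta> w = (\<mu> w, snd (snd (\<Theta> w)) * \<mu> w, 0)"
  shows "dd (1, 0, 0) (\<lambda>w. g (\<Theta> w)) w = \<mu> w * fibre_deriv g (\<Theta> w)"
proof -
  have gd: "g differentiable (at (\<Theta> w))" using smooth_on_differentiable[OF g] by simp
  have "dd (1, 0, 0) (\<lambda>w. g (\<Theta> w)) w = dd (dd (1, 0, 0) \<Theta> w) g (\<Theta> w)"
    by (rule dd_comp[OF gd smooth_on_differentiable[OF \<Theta> w]])
  also have "\<dots> = \<mu> w * fibre_deriv g (\<Theta> w)"
    unfolding x using dd_linear[OF gd, of "\<mu> w" "(1, snd (snd (\<Theta> w)), 0)" 0 0]
    by (simp add: fibre_deriv_def mult.commute)
  finally show ?thesis .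
qed

text \<open>The vanishing of the first two fibre derivatives says that both df and the differential
  of \<open>fibre_deriv f\<close> kill the fibre direction. The last equation, the determinant of
  their y- and p-components, then makes the two differentials linearly dependent.\<close>

definition morse_jet :: "(jet \<Rightarrow> real) \<Rightarrow> jet \<Rightarrow> bool" where
  "morse_jet f m \<longleftrightarrow> f m = 0 \<and> fibre_deriv f m = 0 \<and> fibre_deriv (fibre_deriv f) m = 0
      \<and>
     dd (0, 1, 0) (fibre_deriv f) m * dd (0, 0, 1) f m = dd (0, 0, 1) (fibre_deriv f) m * dd (0, 1, 0) f m"

text \<open>In the chart \<open>fibre_deriv f\<close> on the surface is (3 x^2 + \<sigma> y^2) times
  a smooth function. Its vanishing to second order gives the jet. The zero set of the quadratic form
  is a point for \<sigma> = 1 and a pair of lines for \<sigma> = -1, which gives the statements on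
  isolated points; only the first needs the other factor nonzero, hence the assumption on
  \<open>dd v f m\<close>.\<close>

lemma cubic_singularity_jet:
  assumes f: "smooth_on UNIV f"
    and eq: "dual_projection_equiv f m {(x, y, z). z = x ^ 3 + \<sigma> * x * y\<^sup>2}"
  shows "morse_jet f m"
    and "\<sigma> = 1 \<Longrightarrow> dd v f m \<noteq> 0 \<Longrightarrow> \<exists>N. open N \<and> m \<in> N
        \<and> (\<forall>u\<in>N. f u = 0 \<and> fibre_deriv f u = 0 \<longrightarrow> u = m)"
    and "\<sigma> = -1 \<Longrightarrow> open N \<Longrightarrow> m \<in> N \<Longrightarrow> \<exists>u\<in>N. u
        \<noteq> m \<and> f u = 0 \<and> fibre_deriv f u = 0"
proof -
  define s where "s x y = x ^ 3 + \<sigma> * x * y\<^sup>2" for x y :: real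
  have eq': "dual_projection_equiv f m {(x, y, z). z = s x y}" using eq by (simp add: s_def)
  obtain \<Theta> \<Phi> \<mu> U W where W: "open W" "(0, 0, 0) \<in> W" "smooth_on W \<Theta>" "\<Theta> (0, 0, 0) = m"
    and U: "smooth_on U \<Phi>" "m \<in> U" "\<And>u. u \<in> U \<Longrightarrow> \<Phi> u \<in> W \<and> \<Theta>
        (\<Phi> u) = u"
    and WU: "\<And>w. w \<in> W \<Longrightarrow> \<Theta> w \<in> U \<and> \<Phi> (\<Theta> w) = w"
    and surf: "\<And>x y z. (x, y, z) \<in> W \<Longrightarrow> f (\<Theta> (x, y, z)) = 0 \<longleftrightarrow> z
        = s x y"
    and \<mu>: "smooth_on W \<mu>" "\<And>w. w \<in> W \<Longrightarrow> \<mu> w \<noteq> 0"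
    and \<Theta>x: "\<And>w. w \<in> W \<Longrightarrow> dd (1, 0, 0) \<Theta> w = (\<mu> w, snd (snd (\<Theta> w))
        * \<mu> w, 0)"
    and inv1: "\<And>v w. w \<in> W \<Longrightarrow> dd (dd v \<Theta> w) \<Phi> (\<Theta> w) = v"
    and inv2: "\<And>v u. u \<in> U \<Longrightarrow> dd (dd v \<Phi> u) \<Theta> (\<Phi> u) = v"
    by (rule dual_projection_chart[OF eq']) (rule that; assumption)
  define H where "H w = f (\<Theta> w)" for w
  have sH: "smooth_on W H" unfolding H_def by (rule smooth_on_compose[OF f W(3)]) auto
  define q where "q = dd (0, 0, 1) H"
  have sq: "smooth_on W q" unfolding q_def by (rule smooth_on_dd[OF sH])
  let ?I = "fibre_deriv f" let ?J = "fibre_deriv (fibre_deriv f)"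
  have sI: "smooth_on UNIV ?I" by (rule smooth_on_fibre_deriv[OF f])
  have ds: "((\<lambda>w. s (fst w) (snd w)) has_derivative (\<lambda>v. (3 * x\<^sup>2 + \<sigma> * y\<^sup>2) *
      fst v + (2 * \<sigma> * x * y) * snd v)) (at (x, y))" for x y
    unfolding s_def by (auto intro!: derivative_eq_intros simp: algebra_simps power2_eq_square)
  have sc: "continuous_on UNIV (\<lambda>w. s (fst w) (snd w))" unfolding s_def by (intro continuous_intros)
  have H0: "H (x, y, s x y) = 0" if "(x, y, s x y) \<in> W" for x y using surf[OF that] by (simp add: H_def)
  have Hx: "\<mu> (x, y, s x y) * ?I (\<Theta> (x, y, s x y)) = - (3 * x\<^sup>2 + \<sigma> * y\<^sup>2) * q (x, y,
      s x y)"
    if w: "(x, y, s x y) \<in> W" for x y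
    using graph_partials(1)[OF sH w H0 ds sc] dd_chart_fibre[where g=f and \<mu>=\<mu>, OF f W(3) w \<Theta>x[OF w]]
    by (simp add: q_def H_def[abs_def])
  have Hy: "dd (0, 1, 0) H (0, 0, 0) = 0"
    using graph_partials(2)[where W=W and H=H and x=0 and y=0 and s=s, OF sH _ H0 ds sc] W(2) by (simp add: s_def)
  have I0: "?I m = 0" using Hx[of 0 0] \<mu>(2)[OF W(2)] W(2,4) by (simp add: s_def)
  have f0: "f m = 0" using surf[of 0 0 0] W by (simp add: s_def)
  have sIT: "smooth_on W (\<lambda>w. ?I (\<Theta> w))" by (rule smooth_on_compose[OF sI W(3)]) auto
  have evW: "\<forall>\<^sub>F t in nhds 0. c t \<in> W" if "c 0 = (0, 0, 0)" "isCont c 0" for c :: "real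
      \<Rightarrow> jet"
    using topological_tendstoD[OF that(2)[unfolded continuous_at] W(1)] that(1) W(2)
    by (simp add: tendsto_def eventually_nhds_conv_at)
  have chain: "((\<lambda>t. g (c t)) has_real_derivative dd c' g (0, 0, 0)) (at 0)"
    if "smooth_on W g" "(c has_vector_derivative c') (at 0)" "c 0 = (0, 0, 0)" for g :: "jet \<Rightarrow> real"
        and c c'
    using curve_has_real_derivative[of g c 0 c'] smooth_on_differentiable[OF that(1) W(2)] that by simp
  have Jm: "?J m = 0"
  proof -
    \<comment> \<open>The curve y = 0 of the normal form; its velocity at 0 is the fibre
      direction.\<close>
    define c where "c x = (x, 0::real, x ^ 3)" for x :: real
    have c: "(c has_vector_derivative (1, 0, 0)) (at 0)"
      unfolding c_def has_vector_derivative_def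
      by (auto intro!: derivative_eq_intros simp: zero_prod_def)
    have c0: "c 0 = (0, 0, 0)" by (simp add: c_def)
    have "\<forall>\<^sub>F t in nhds 0. \<mu> (c t) * ?I (\<Theta> (c t)) = t\<^sup>2 * (- 3 * q (c t))"
      using evW[OF c0 has_vector_derivative_continuous[OF c]]
    proof eventually_elim
      case (elim t)
      then show ?case using Hx[of t 0] by (simp add: c_def s_def)
    qed
    note * = deriv_zero_of_square(2)[OF chain[OF sIT c c0] chain[OF \<mu>(1) c c0]
        DERIV_cmult[OF chain[OF sq c c0]] this]
    have "dd (1, 0, 0) (\<lambda>w. ?I (\<Theta> w)) (0, 0, 0) = 0" by (rule *) (use \<mu>(2) W(2) c0 in simp)
    then have "\<mu> (0, 0, 0) * ?J m = 0"
      using dd_chart_fibre[where g="?I" and \<mu>=\<mu>, OF sI W(3,2) \<Theta>x[OF W(2)]] W(4) by simp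
    then show ?thesis using \<mu>(2)[OF W(2)] by simp
  qed
  have Iy: "dd (0, 1, 0) (\<lambda>w. ?I (\<Theta> w)) (0, 0, 0) = 0"
  proof -
    define c where "c y = (0::real, y, 0::real)" for y :: real
    have c: "(c has_vector_derivative (0, 1, 0)) (at 0)"
      unfolding c_def has_vector_derivative_def
      by (auto intro!: derivative_eq_intros simp: zero_prod_def)
    have c0: "c 0 = (0, 0, 0)" by (simp add: c_def)
    have "\<forall>\<^sub>F t in nhds 0. \<mu> (c t) * ?I (\<Theta> (c t)) = t\<^sup>2 * (- \<sigma> * q (c t))"
      using evW[OF c0 has_vector_derivative_continuous[OF c]]
    proof eventually_elim
      case (elim t)
      then show ?case using Hx[of 0 t] by (simp add: c_def s_def)
    qed
    note * = deriv_zero_of_square(2)[OF chain[OF sIT c c0] chain[OF \<mu>(1) c c0]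
        DERIV_cmult[OF chain[OF sq c c0]] this]
    show ?thesis by (rule *) (use \<mu>(2) W(2) c0 in simp)
  qed
  have fd: "f differentiable (at m)" "?I differentiable (at m)"
    using smooth_on_differentiable f sI by blast+
  have \<Theta>d: "\<Theta> differentiable (at (0, 0, 0))" using smooth_on_differentiable[OF W(3,2)] .
  obtain a b c where abc: "dd (0, 1, 0) \<Theta> (0, 0, 0) = (a, b, c)" by (metis prod.collapse)
  obtain x0 y0 p where m: "m = (x0, y0, p)" by (metis prod.collapse)
  have e1: "dd (a, b, c) f m = 0"
    using Hy dd_comp[of f \<Theta> "(0, 0, 0)" "(0, 1, 0)", unfolded W(4), OF fd(1) \<Theta>d] abc by (simp add:
        H_def[abs_def])
  have e2: "dd (a, b, c) ?I m = 0"
    using Iy dd_comp[of ?I \<Theta> "(0, 0, 0)" "(0, 1, 0)", unfolded W(4), OF fd(2) \<Theta>d] abc by simp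
  \<comment> \<open>The image (a, b, c) of the y-direction is not a multiple of the fibre direction
    (1, p, 0). Hence (b - p a, c) is a nonzero solution of the linear system \<open>r1\<close>,
    \<open>r2\<close>, and its determinant vanishes.\<close>
  have ne: "b - p * a \<noteq> 0 \<or> c \<noteq> 0"
  proof (rule ccontr)
    assume "\<not> ?thesis"
    then have bc: "b = p * a" "c = 0" by auto
    define k where "k = a / \<mu> (0, 0, 0)"
    have "dd (0, 1, 0) \<Theta> (0, 0, 0) = k *\<^sub>R dd (1, 0, 0) \<Theta> (0, 0, 0)"
      using abc bc \<Theta>x[OF W(2)] \<mu>(2)[OF W(2)] W(4) m by (simp add: k_def)
    also have "\<dots> = dd (k, 0, 0) \<Theta> (0, 0, 0)" using dd_linear[OF \<Theta>d, of k "(1, 0, 0)" 0 0] by simp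
    finally have "dd (0, 1, 0) \<Theta> (0, 0, 0) = dd (k, 0, 0) \<Theta> (0, 0, 0)" .
    then have "(0, 1, 0) = (k, 0::real, 0::real)" using inv1[OF W(2)] by metis
    then show False by simp
  qed
  have j1: "dd (1, 0, 0) f m = - p * dd (0, 1, 0) f m"
    using I0 dd_jet[OF fd(1), of 1 p 0] m by (simp add: fibre_deriv_def)
  have j2: "dd (1, 0, 0) ?I m = - p * dd (0, 1, 0) ?I m"
    using Jm dd_jet[OF fd(2), of 1 p 0] m by (simp add: fibre_deriv_def[of ?I])
  have r1: "(b - p * a) * dd (0, 1, 0) f m + c * dd (0, 0, 1) f m = 0"
    using e1 dd_jet[OF fd(1), of a b c] j1 by (simp add: algebra_simps)
  have r2: "(b - p * a) * dd (0, 1, 0) ?I m + c * dd (0, 0, 1) ?I m = 0"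
    using e2 dd_jet[OF fd(2), of a b c] j2 by (simp add: algebra_simps)
  have det: "B * i = C * h" if "u * h + c * i = 0" "u * B + c * C = 0" "u \<noteq> 0 \<or> c \<noteq> 0" for u c h
      i B C :: real
  proof -
    have "u * (B * i - C * h) = 0" "c * (B * i - C * h) = 0" using that(1,2) by algebra+
    then show ?thesis using that(3) by auto
  qed
  show "morse_jet f m" unfolding morse_jet_def using f0 I0 Jm det[OF r1 r2 ne] by simp
  show "\<exists>N. open N \<and> m \<in> N \<and> (\<forall>u\<in>N. f u = 0 \<and> ?I u = 0 \<longrightarrow> u =
      m)" if \<sigma>: "\<sigma> = 1" and v: "dd v f m \<noteq> 0"
  proof -
    \<comment> \<open>With q = 0 all partial derivatives of \<open>H\<close> at the origin would
      vanish, and so would df at m, against \<open>v\<close>.\<close>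
    have q0: "q (0, 0, 0) \<noteq> 0"
    proof
      assume "q (0, 0, 0) = 0"
      moreover have "dd (1, 0, 0) H (0, 0, 0) = 0"
        using dd_chart_fibre[where g=f and \<mu>=\<mu>, OF f W(3,2) \<Theta>x[OF W(2)]] I0 W(4) by (simp add:
            H_def[abs_def])
      ultimately have "dd (a, b, c) H (0, 0, 0) = 0" for a b c
        using dd_jet[OF smooth_on_differentiable[OF sH W(2)], of a b c] Hy by (simp add: q_def)
      then have all: "dd w H (0, 0, 0) = 0" for w by (metis prod.collapse)
      have "\<Phi> m = (0, 0, 0)" using WU[OF W(2)] W(4) by simp
      then have "dd (dd v \<Phi> m) \<Theta> (0, 0, 0) = v" using inv2[OF U(2), of v] by simp
      moreover have "dd (dd v \<Phi> m) H (0, 0, 0) = dd (dd (dd v \<Phi> m) \<Theta> (0, 0, 0)) f m"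
        using dd_comp[of f \<Theta> "(0, 0, 0)" "dd v \<Phi> m", unfolded W(4), OF fd(1) \<Theta>d] by (simp add:
            H_def[abs_def])
      ultimately show False using all v by simp
    qed
    define Wq where "Wq = {w \<in> W. q w \<in> - {0}}"
    have "open Wq" unfolding Wq_def by (rule open_smooth_vimage[OF sq]) auto
    then have opN: "open {u \<in> U. \<Phi> u \<in> Wq}" by (rule open_smooth_vimage[OF U(1)])
    have \<Phi>m: "\<Phi> m = (0, 0, 0)" using WU[OF W(2)] W(4) by simp
    show ?thesis
    proof (intro exI[of _ "{u \<in> U. \<Phi> u \<in> Wq}"] conjI opN ballI impI)
      show "m \<in> {u \<in> U. \<Phi> u \<in> Wq}" using U(2) \<Phi>m q0 W(2) by (simp add: Wq_def)
      fix u assume u: "u \<in> {u \<in> U. \<Phi> u \<in> Wq}" and fu: "f u = 0 \<and> ?I u = 0"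
      obtain x y z where xyz: "\<Phi> u = (x, y, z)" by (metis prod.collapse)
      have w: "(x, y, z) \<in> W" "\<Theta> (x, y, z) = u" "q (x, y, z) \<noteq> 0" using u U(3)[of u] xyz by (auto
          simp: Wq_def)
      then have zs: "z = s x y" using surf fu by metis
      have "(3 * x\<^sup>2 + \<sigma> * y\<^sup>2) = 0" using Hx[of x y] w zs fu by simp
      then have "x = 0" "y = 0" using \<sigma> by (auto simp: add_nonneg_eq_0_iff)
      then have "\<Phi> u = (0, 0, 0)" using xyz zs by (simp add: s_def)
      then show "u = m" using w(2) xyz W(4) by simp
    qed
  qed
  show "\<exists>u\<in>N. u \<noteq> m \<and> f u = 0 \<and> ?I u = 0" if \<sigma>: "\<sigma> = -1" and N: "open N"
      "m \<in> N"
  proof -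
    \<comment> \<open>On the line y = sqrt 3 x the form 3 x^2 - y^2 vanishes.\<close>
    define c where "c t = (t, sqrt 3 * t, s t (sqrt 3 * t))" for t :: real
    have cc: "isCont c 0" unfolding c_def s_def by (intro continuous_intros)
    have c0: "c 0 = (0, 0, 0)" by (simp add: c_def s_def)
    have opWN: "open {w \<in> W. \<Theta> w \<in> N}" by (rule open_smooth_vimage[OF W(3) N(1)])
    have "(c \<longlongrightarrow> c 0) (at 0)" using cc by (simp add: continuous_at)
    then have "\<forall>\<^sub>F t in at 0. c t \<in> {w \<in> W. \<Theta> w \<in> N}"
      by (rule topological_tendstoD[OF _ opWN]) (use c0 W N in auto)
    then have "\<exists>t. t \<noteq> 0 \<and> c t \<in> {w \<in> W. \<Theta> w \<in> N}"
      using eventually_happens[of _ "at (0::real)"] eventually_conj[OF _ eventually_neq_at_within[of 0 0 UNIV]]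
      by (metis (mono_tags, lifting) at_neq_bot)
    then obtain t where t: "t \<noteq> 0" "c t \<in> W" "\<Theta> (c t) \<in> N" by auto
    have "f (\<Theta> (c t)) = 0" using surf t(2) by (simp add: c_def)
    moreover have "?I (\<Theta> (c t)) = 0" using Hx[of t "sqrt 3 * t"] t(2) \<mu>(2)[OF t(2)] \<sigma>
      by (simp add: c_def power_mult_distrib)
    moreover have "\<Theta> (c t) \<noteq> m"
    proof
      assume "\<Theta> (c t) = m"
      then have "c t = (0, 0, 0)" using WU[OF t(2)] WU[OF W(2)] W(4) by metis
      then show False using t(1) by (simp add: c_def)
    qed
    ultimately show ?thesis using t(3) by blast
  qed
qed

text \<open>Over the curve y = 0 of the normal form the first fibre derivative is t^3 times a smooth
  function, and each further fibre derivative lowers the order by one. The curve (t, 0, t^4)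
  deviates from the fibre direction only by 4 t^3, too little to matter.\<close>

lemma quartic_singularity_jet:
  assumes f: "smooth_on UNIV f"
    and eq: "dual_projection_equiv f m {(x, y, z). z = x ^ 4 + x * y}"
  shows "f m = 0" "fibre_deriv f m = 0" "fibre_deriv (fibre_deriv f) m = 0"
    "fibre_deriv (fibre_deriv (fibre_deriv f)) m = 0"
proof -
  define s where "s x y = x ^ 4 + x * y" for x y :: real
  have eq': "dual_projection_equiv f m {(x, y, z). z = s x y}" using eq by (simp add: s_def)
  obtain \<Theta> \<Phi> \<mu> U W where W: "open W" "(0, 0, 0) \<in> W" "smooth_on W \<Theta>" "\<Theta> (0, 0, 0) = m"
    and U: "smooth_on U \<Phi>" "m \<in> U" "\<And>u. u \<in> U \<Longrightarrow> \<Phi> u \<in> W \<and> \<Theta>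
        (\<Phi> u) = u"
    and WU: "\<And>w. w \<in> W \<Longrightarrow> \<Theta> w \<in> U \<and> \<Phi> (\<Theta> w) = w"
    and surf: "\<And>x y z. (x, y, z) \<in> W \<Longrightarrow> f (\<Theta> (x, y, z)) = 0 \<longleftrightarrow> z
        = s x y"
    and \<mu>: "smooth_on W \<mu>" "\<And>w. w \<in> W \<Longrightarrow> \<mu> w \<noteq> 0"
    and \<Theta>x: "\<And>w. w \<in> W \<Longrightarrow> dd (1, 0, 0) \<Theta> w = (\<mu> w, snd (snd (\<Theta> w))
        * \<mu> w, 0)"
    and inv1: "\<And>v w. w \<in> W \<Longrightarrow> dd (dd v \<Theta> w) \<Phi> (\<Theta> w) = v"
    and inv2: "\<And>v u. u \<in> U \<Longrightarrow> dd (dd v \<Phi> u) \<Theta> (\<Phi> u) = v"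
    by (rule dual_projection_chart[OF eq']) (rule that; assumption)
  define H where "H w = f (\<Theta> w)" for w
  have sH: "smooth_on W H" unfolding H_def by (rule smooth_on_compose[OF f W(3)]) auto
  define q where "q = dd (0, 0, 1) H"
  have sq: "smooth_on W q" unfolding q_def by (rule smooth_on_dd[OF sH])
  let ?I = "fibre_deriv f" let ?J = "fibre_deriv (fibre_deriv f)" let ?K = "fibre_deriv (fibre_deriv (fibre_deriv f))"
  have sI: "smooth_on UNIV ?I" by (rule smooth_on_fibre_deriv[OF f])
  have sJ: "smooth_on UNIV ?J" by (rule smooth_on_fibre_deriv[OF sI])
  have ds: "((\<lambda>w. s (fst w) (snd w)) has_derivative (\<lambda>v. (4 * x ^ 3 + y) * fst v + x * snd v)) (at
      (x, y))" for x y
    unfolding s_def by (auto intro!: derivative_eq_intros simp: algebra_simps)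
  have sc: "continuous_on UNIV (\<lambda>w. s (fst w) (snd w))" unfolding s_def by (intro continuous_intros)
  have H0: "H (x, y, s x y) = 0" if "(x, y, s x y) \<in> W" for x y using surf[OF that] by (simp add: H_def)
  have Hx: "\<mu> (x, y, s x y) * ?I (\<Theta> (x, y, s x y)) = - (4 * x ^ 3 + y) * q (x, y, s x y)"
    if w: "(x, y, s x y) \<in> W" for x y
    using graph_partials(1)[OF sH w H0 ds sc] dd_chart_fibre[where g=f and \<mu>=\<mu>, OF f W(3) w \<Theta>x[OF w]]
    by (simp add: q_def H_def[abs_def])
  show I0: "?I m = 0" using Hx[of 0 0] \<mu>(2)[OF W(2)] W(2,4) by (simp add: s_def)
  show f0: "f m = 0" using surf[of 0 0 0] W by (simp add: s_def)
  have sIT: "smooth_on W (\<lambda>w. ?I (\<Theta> w))" by (rule smooth_on_compose[OF sI W(3)]) auto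
  have sJT: "smooth_on W (\<lambda>w. ?J (\<Theta> w))" by (rule smooth_on_compose[OF sJ W(3)]) auto
  define c where "c x = (x, 0::real, x ^ 4)" for x :: real
  have sc: "smooth_on UNIV c" unfolding c_def by (intro smooth_intros open_UNIV)
  define T where "T = c -` W"
  have opT: "open T" unfolding T_def
    by (rule open_vimage[OF W(1)]) (use smooth_on_continuous[OF sc] in simp)
  have c0: "c 0 = (0, 0, 0)" by (simp add: c_def)
  have T0: "0 \<in> T" using c0 W by (simp add: T_def)
  have comp: "smooth_on T (\<lambda>t. g (c t))" if "smooth_on W g" for g :: "jet \<Rightarrow> real"
    by (rule smooth_on_compose[OF that smooth_on_subset[OF sc opT]]) (auto simp: T_def)
  have dc: "(c has_vector_derivative (1, 0, 4 * t ^ 3)) (at t)" for t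
    unfolding c_def has_vector_derivative_def
    by (auto intro!: derivative_eq_intros simp: zero_prod_def)
  have chain: "((\<lambda>t. g (c t)) has_real_derivative dd (1, 0, 4 * t ^ 3) g (c t)) (at t)"
    if "smooth_on W g" "t \<in> T" for g :: "jet \<Rightarrow> real" and t
    using curve_has_real_derivative[OF _ dc] smooth_on_differentiable[OF that(1)] that(2) by (simp add: T_def)
  have evT: "\<forall>\<^sub>F t in nhds 0. t \<in> T" using opT T0 by (rule eventually_nhds_in_open)
  define k where "k t = - 4 * q (c t) / \<mu> (c t)" for t
  have sk: "smooth_on T k" unfolding k_def
    by (intro smooth_intros comp sq \<mu>(1) opT) (use \<mu>(2) in \<open>auto simp: T_def\<close>)
  have Ik: "?I (\<Theta> (c t)) = t ^ 3 * k t" if "t \<in> T" for t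
    using Hx[of t 0] \<mu>(2)[of "c t"] that by (simp add: T_def c_def s_def k_def field_simps)
  note D = has_real_derivative_dd[OF smooth_on_differentiable]
  have "?I (\<Theta> (c t)) = t\<^sup>2 * (t * k t)" if "t \<in> T" for t
    using Ik[OF that] by (simp add: power2_eq_square power3_eq_cube)
  then have ev1: "\<forall>\<^sub>F t in nhds 0. 1 * ?I (\<Theta> (c t)) = t\<^sup>2 * (t * k t)"
    by (intro eventually_mono[OF evT]) simp
  have "dd (1, 0, 4 * 0 ^ 3) (\<lambda>w. ?I (\<Theta> w)) (c 0) = 0"
    by (rule deriv_zero_of_square(2)[OF chain[OF sIT T0] DERIV_const DERIV_mult[OF DERIV_ident D[OF sk T0]] ev1]) simp
  then have "\<mu> (0, 0, 0) * ?J m = 0"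
    using dd_chart_fibre[where g="?I" and \<mu>=\<mu>, OF sI W(3,2) \<Theta>x[OF W(2)]] W(4) c0 by simp
  then show "?J m = 0" using \<mu>(2)[OF W(2)] by simp
  define r where "r w = dd (0, 0, 1) (\<lambda>w. ?I (\<Theta> w)) w" for w
  have sr: "smooth_on W r" unfolding r_def by (rule smooth_on_dd[OF sIT])
  \<comment> \<open>The derivative of t^3 k along the curve, minus the contribution 4 t^3 r of the
    z-component of the velocity, is still divisible by t^2.\<close>
  have Jt: "\<mu> (c t) * ?J (\<Theta> (c t)) = t\<^sup>2 * (3 * k t + t * dd 1 k t - 4 * t * r (c t))" if t: "t
      \<in> T" for t
  proof -
    have w: "c t \<in> W" using t by (simp add: T_def)
    have "((\<lambda>t. ?I (\<Theta> (c t))) has_real_derivative dd (1, 0, 4 * t ^ 3) (\<lambda>w. ?I (\<Theta> w))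
        (c t)) (at t)"
      by (rule chain[OF sIT t])
    moreover have "((\<lambda>t. t ^ 3 * k t) has_real_derivative 3 * t\<^sup>2 * k t + t ^ 3 * dd 1 k t) (at t)"
      by (auto intro!: derivative_eq_intros D[OF sk t])
    then have "((\<lambda>t. ?I (\<Theta> (c t))) has_real_derivative 3 * t\<^sup>2 * k t + t ^ 3 * dd 1 k t) (at t)"
      by (rule has_field_derivative_transform_within_open[OF _ opT t]) (use Ik in simp)
    ultimately have "dd (1, 0, 4 * t ^ 3) (\<lambda>w. ?I (\<Theta> w)) (c t) = 3 * t\<^sup>2 * k t + t ^ 3 * dd 1 k t"
      by (rule DERIV_unique)
    moreover have "dd (1, 0, 4 * t ^ 3) (\<lambda>w. ?I (\<Theta> w)) (c t) = \<mu> (c t) * ?J (\<Theta> (c t)) + 4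
        * t ^ 3 * r (c t)"
      using dd_jet[OF smooth_on_differentiable[OF sIT w], of 1 0 "4 * t ^ 3"]
        dd_chart_fibre[where g="?I" and \<mu>=\<mu>, OF sI W(3) w \<Theta>x[OF w]] by (simp add: r_def)
    ultimately show ?thesis by (simp add: algebra_simps power2_eq_square power3_eq_cube)
  qed
  have ev2: "\<forall>\<^sub>F t in nhds 0. \<mu> (c t) * ?J (\<Theta> (c t)) = t\<^sup>2 * (3 * k t + t * dd 1 k t
      - 4 * t * r (c t))"
    by (intro eventually_mono[OF evT] Jt)
  have srr: "smooth_on T (\<lambda>t. 3 * k t + t * dd 1 k t - 4 * t * r (c t))"
    by (intro smooth_intros sk smooth_on_dd comp sr opT)
  have "dd (1, 0, 4 * 0 ^ 3) (\<lambda>w. ?J (\<Theta> w)) (c 0) = 0"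
    by (rule deriv_zero_of_square(2)[OF chain[OF sJT T0] chain[OF \<mu>(1) T0] D[OF srr T0] ev2])
      (use \<mu>(2) W(2) c0 in simp)
  then have "\<mu> (0, 0, 0) * ?K m = 0"
    using dd_chart_fibre[where g="?J" and \<mu>=\<mu>, OF sJ W(3,2) \<Theta>x[OF W(2)]] W(4) c0 by simp
  then show "?K m = 0" using \<mu>(2)[OF W(2)] by simp
qed

section \<open>One-parameter families of plane curves\<close>

lemma local_diffeo_prod:
  assumes "local_diffeo f a" "local_diffeo g b"
  shows "local_diffeo (\<lambda>w. (f (fst w), g (snd w))) (a, b)"
proof -
  obtain U f' where U: "open U" "a \<in> U" "open (f ` U)" "smooth_on U f" "smooth_on (f ` U) f'"
    "\<forall>x\<in>U. f' (f x) = x" using assms unfolding local_diffeo_def by blast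
  obtain V g' where V: "open V" "b \<in> V" "open (g ` V)" "smooth_on V g" "smooth_on (g ` V) g'"
    "\<forall>x\<in>V. g' (g x) = x" using assms unfolding local_diffeo_def by blast
  have im: "(\<lambda>w. (f (fst w), g (snd w))) ` (U \<times> V) = f ` U \<times> g ` V" by force
  have op: "open (U \<times> V)" "open (f ` U \<times> g ` V)" using U V by (auto intro: open_Times)
  show ?thesis unfolding local_diffeo_def
  proof (intro exI[of _ "U \<times> V"] exI[of _ "\<lambda>w. (f' (fst w), g' (snd w))"] conjI)
    show "smooth_on (U \<times> V) (\<lambda>w. (f (fst w), g (snd w)))"
      by (intro smooth_on_Pair smooth_on_compose[OF U(4)] smooth_on_compose[OF V(4)] smooth_intros op) auto
    show "smooth_on ((\<lambda>w. (f (fst w), g (snd w))) ` (U \<times> V)) (\<lambda>w. (f' (fst w), g' (snd w)))"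
      unfolding im
      by (intro smooth_on_Pair smooth_on_compose[OF U(5)] smooth_on_compose[OF V(5)] smooth_intros op) auto
  qed (use im op U V in auto)
qed

lemma families_equivI:
  assumes \<Psi>: "local_diffeo \<Psi> (q, e)" "\<Psi> (q, e) = (q', e')" and \<tau>: "\<And>w. snd (\<Psi> w) =
      \<tau> (snd w)"
    and N: "open N" "(q, e) \<in> N"
    and eq: "\<And>w. w \<in> N \<Longrightarrow> fst w \<in> \<Gamma> (snd w) \<longleftrightarrow> fst (\<Psi> w)
        \<in> \<Delta> (snd (\<Psi> w))"
  shows "families_equiv \<Gamma> q e \<Delta> q' e'"
proof -
  obtain U where U: "(q, e) \<in> U" "U \<subseteq> N" "open U" "open (\<Psi> ` U)" "diffeo_between U (\<Psi> ` U)
      \<Psi>"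
    by (rule local_diffeo_diffeo_between[OF \<Psi>(1) N]) (rule that; assumption)
  have "\<Psi> ` {w \<in> U. fst w \<in> \<Gamma> (snd w)} = {w \<in> \<Psi> ` U. fst w \<in> \<Delta> (snd w)}"
    using eq U(2) by auto
  then show ?thesis unfolding families_equiv_def using U \<Psi>(2) \<tau> by blast
qed

text \<open>Near \<open>w0\<close> the set is a curve \<open>u \<mapsto> (z u, E u)\<close> on which the parameter has a nondegenerate
  critical point; continuity of \<open>l\<close> keeps the curve from returning to \<open>fst w0\<close>.\<close>

definition fold_at :: "(plane \<times> real) set \<Rightarrow> plane \<times> real \<Rightarrow> bool" where
  "fold_at S w0 \<longleftrightarrow> (\<exists>b E z (l :: plane \<Rightarrow> real) N. b > 0 \<and> smooth_on
      {-b<..<b} E \<and> E 0 = snd w0 \<and> dd 1 E 0 = 0 \<and>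
     dd 1 (dd 1 E) 0 \<noteq> 0 \<and> continuous_on {-b<..<b} z \<and> z 0 = fst w0 \<and>
     (\<forall>u. \<bar>u\<bar> < b \<longrightarrow> l (z u) = u) \<and> isCont l (fst w0) \<and> open N \<and> w0
         \<in> N \<and>
     (\<forall>y t. (y, t) \<in> N \<longrightarrow> ((y, t) \<in> S \<longleftrightarrow> (\<exists>u.
         \<bar>u\<bar> < b \<and> y = z u \<and> t = E u))))"

lemma fold_atI:
  fixes z :: "real \<Rightarrow> plane" and l :: "plane \<Rightarrow> real"
  assumes "b > 0" "smooth_on {-b<..<b} E" "E 0 = t0" "dd 1 E 0 = 0" "dd 1 (dd 1 E) 0 \<noteq> 0"
    "continuous_on {-b<..<b} z" "z 0 = y0" "\<And>u. \<bar>u\<bar> < b \<Longrightarrow> l (z u) = u" "isCont l y0"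
    "open N" "(y0, t0) \<in> N"
    "\<And>y t. (y, t) \<in> N \<Longrightarrow> (y, t) \<in> S \<longleftrightarrow> (\<exists>u. \<bar>u\<bar> <
        b \<and> y = z u \<and> t = E u)"
  shows "fold_at S (y0, t0)"
  unfolding fold_at_def using assms
  by (intro exI[of _ b] exI[of _ E] exI[of _ z] exI[of _ l] exI[of _ N]) simp

lemma fold_at_two_born_or_die:
  assumes "fold_at {w. fst w \<in> B (snd w)} (q, e)"
  shows "two_born_or_die B q e"
  using assms unfolding fold_at_def fst_conv snd_conv
proof (elim exE conjE)
  fix b E z and l :: "plane \<Rightarrow> real" and N
  assume *: "b > 0" "smooth_on {-b<..<b} E" "E 0 = e" "dd 1 E 0 = 0"
     "dd 1 (dd 1 E) 0 \<noteq> 0" "continuous_on {-b<..<b} z" "z 0 = q"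
     "\<forall>u. \<bar>u\<bar> < b \<longrightarrow> l (z u) = u" "isCont l q" "open N" "(q, e) \<in> N"
    and c: "\<forall>y t. (y, t) \<in> N \<longrightarrow> ((y, t) \<in> {w. fst w \<in> B (snd w)}
        \<longleftrightarrow> (\<exists>u. \<bar>u\<bar> < b \<and> y = z u \<and> t = E u))"
  show ?thesis
  proof (rule two_born_or_dieI[OF *(1-7) _ *(9-11)])
    show "l (z u) = u" if "\<bar>u\<bar> < b" for u using *(8) that by simp
    show "y \<in> B t \<longleftrightarrow> (\<exists>u. \<bar>u\<bar> < b \<and> y = z u \<and> t = E u)" if "(y,
        t) \<in> N" for y t
      using c[rule_format, OF that] by simp
  qed
qed

abbreviation eu :: "plane \<times> real" where "eu \<equiv> ((1, 0), 0)"
abbreviation ev :: "plane \<times> real" where "ev \<equiv> ((0, 1), 0)"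
abbreviation ee :: "plane \<times> real" where "ee \<equiv> (0, 1)"

lemma dd_plane_real:
  fixes f :: "plane \<times> real \<Rightarrow> real"
  assumes "f differentiable (at x)"
  shows "dd ((a, b), c) f x = a * dd eu f x + b * dd ev f x + c * dd ee f x"
  using dd_linear[OF assms, of a eu b ev] dd_linear[OF assms, of 1 "((a, b), 0)" c ee]
  by simp

text \<open>\<open>G\<close> stands for the first fibre derivative on the surface and
  \<open>Jt\<close> for the second. As the parameter derivative of \<open>G\<close> is nonzero, the
  zero set is a graph t = \<open>\<gamma>\<close> y. The identity \<open>id\<close> replaces G_uu
  and G_uv at the origin by the derivatives of \<open>Jt\<close>, so the single inequality
  \<open>det\<close> says both that \<open>\<gamma>\<close> is a Morse function and that the
  parameter has a nondegenerate extremum along the curve of bi-inflections.\<close>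

lemma morse_family:
  fixes G Jt P M :: "plane \<times> real \<Rightarrow> real"
  assumes G: "smooth_on N G" and J: "smooth_on N Jt" and P: "smooth_on N P" and M: "smooth_on N M"
    and N0: "((0, 0), 0) \<in> N"
    and id: "\<And>w. w \<in> N \<Longrightarrow> dd eu G w + P w * dd ev G w = Jt w + M w * G w"
    and P0: "P ((0, 0), 0) = 0"
    and G0: "G ((0, 0), 0) = 0" "dd eu G ((0, 0), 0) = 0" "dd ev G ((0, 0), 0) = 0" "dd ee G ((0, 0), 0) \<noteq> 0"
    and Ju: "dd eu Jt ((0, 0), 0) \<noteq> 0"
    and det: "dd eu Jt ((0, 0), 0) * dd ev (dd ev G) ((0, 0), 0) \<noteq> (dd ev Jt ((0, 0), 0))\<^sup>2"
  obtains \<Phi> N' s1 s2 where "local_diffeo \<Phi> (0, 0)" "\<Phi> (0, 0) = (0, 0)" "open N'" "((0, 0), 0) \<in> N'"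
    "s1 \<in> {1, -1}" "s2 \<in> {1, -1}"
    "\<And>y t. (y, t) \<in> N' \<Longrightarrow> G (y, t) = 0 \<longleftrightarrow> t = s1 * (fst (\<Phi>
        y))\<^sup>2 + s2 * (snd (\<Phi> y))\<^sup>2"
    "fold_at {w. G w = 0 \<and> Jt w = 0} ((0, 0), 0)"
proof -
  let ?O = "((0, 0), 0) :: plane \<times> real"
  define g where "g = dd ee G ?O"
  have opN: "open N" using G smooth_on_open by blast
  obtain V a \<gamma> where V: "open V" "(0, 0) \<in> V" "a > 0" "smooth_on V \<gamma>" "\<gamma> (0, 0) = 0"
    and inN: "\<And>y t. y \<in> V \<Longrightarrow> \<bar>t - 0\<bar> < a \<Longrightarrow> (y, t) \<in> N"
    and Ge: "\<And>y t. y \<in> V \<Longrightarrow> \<bar>t - 0\<bar> < a \<Longrightarrow> dd (0, 1) G (y, t)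
        \<noteq> 0"
    and zero: "\<And>y t. y \<in> V \<Longrightarrow> \<bar>t - 0\<bar> < a \<Longrightarrow> G (y, t) = 0
        \<longleftrightarrow> t = \<gamma> y"
    and ga: "\<And>y. y \<in> V \<Longrightarrow> \<bar>\<gamma> y - 0\<bar> < a"
    and dg: "\<And>y v. y \<in> V \<Longrightarrow> dd v \<gamma> y = - dd (v, 0) G (y, \<gamma> y) / dd (0, 1) G
        (y, \<gamma> y)"
    by (rule implicit_function[OF G N0 G0(1,4)]) (rule that; assumption)
  have inN': "(y, \<gamma> y) \<in> N" if "y \<in> V" for y using inN[OF that ga[OF that]] .
  have d\<gamma>: "dd v \<gamma> (0, 0) = 0" for v
  proof -
    have "dd (v, 0) G ?O = 0"
      using dd_plane_real[OF smooth_on_differentiable[OF G N0], of "fst v" "snd v" 0] G0 by simp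
    then show ?thesis using dg[OF V(2), of v] V(5) by simp
  qed
  have m: "((\<lambda>y. (y, \<gamma> y)) has_derivative (\<lambda>v. (v, 0))) (at (0, 0))"
    using smooth_on_has_derivative[OF V(4,2)] d\<gamma> by (auto intro!: derivative_intros)
  have comp: "dd v (\<lambda>y. h (y, \<gamma> y)) (0, 0) = dd (v, 0) h ?O" if "smooth_on N h" for h :: "plane
      \<times> real \<Rightarrow> real" and v
    using dd_eqI[OF dd_chain[OF _ m, of h]] smooth_on_differentiable[OF that N0] V(5) by simp
  have scomp: "smooth_on V (\<lambda>y. h (y, \<gamma> y))" if "smooth_on N h" for h :: "plane \<times> real
      \<Rightarrow> real"
    by (rule smooth_on_compose[OF that]) (use inN' in \<open>auto intro!: smooth_intros V\<close>)
  \<comment> \<open>G (y, \<gamma> y) = 0 differentiated twice; the remaining terms contain first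
    derivatives of \<open>\<gamma>\<close>, which vanish at the origin.\<close>
  have second: "dd v (dd w \<gamma>) (0, 0) * g = - dd (v, 0) (dd (w, 0) G) ?O" for v w
  proof -
    have "dd v (\<lambda>y. dd w \<gamma> y * dd (0, 1) G (y, \<gamma> y)) (0, 0) = dd v (\<lambda>y. - dd (w, 0) G
        (y, \<gamma> y)) (0, 0)"
      by (rule dd_cong_open[OF V(1) _ V(2)]) (use dg Ge ga in auto)
    also have "\<dots> = - dd (v, 0) (dd (w, 0) G) ?O"
      by (rule comp[OF smooth_on_minus[OF smooth_on_dd[OF G]], of v, THEN trans])
        (rule dd_eqI[OF has_derivative_minus[OF smooth_on_has_derivative[OF smooth_on_dd[OF G] N0]]])
    finally have *: "dd v (\<lambda>y. dd w \<gamma> y * dd (0, 1) G (y, \<gamma> y)) (0, 0) = - dd (v, 0) (dd (w,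
        0) G) ?O" .
    have "dd w \<gamma> differentiable (at (0, 0))" "(\<lambda>y. dd (0, 1) G (y, \<gamma> y)) differentiable (at
        (0, 0))"
      by (rule smooth_on_differentiable[OF smooth_on_dd[OF V(4)] V(2)]
          smooth_on_differentiable[OF scomp[OF smooth_on_dd[OF G]] V(2)])+
    from dd_mult[OF this, of v] show ?thesis using * d\<gamma> V(5) by (simp add: g_def)
  qed
  have J0: "Jt ?O = 0" using id[OF N0] G0 P0 by simp
  \<comment> \<open>Differentiate \<open>id\<close> at the origin: P, G and the spatial first
    derivatives of \<open>G\<close> vanish there, so the products drop out.\<close>
  have dJ: "dd (v, 0) (dd eu G) ?O = dd (v, 0) Jt ?O" for v
  proof -
    have "dd (v, 0) G ?O = 0"
      using dd_plane_real[OF smooth_on_differentiable[OF G N0], of "fst v" "snd v" 0] G0 by simp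
    moreover have "dd (v, 0) (\<lambda>w. dd eu G w + P w * dd ev G w) ?O = dd (v, 0) (\<lambda>w. Jt w + M w * G w) ?O"
      by (rule dd_cong_open[OF opN id N0])
    moreover have "((\<lambda>w. dd eu G w + P w * dd ev G w) has_derivative
        (\<lambda>h. dd h (dd eu G) ?O + (P ?O * dd h (dd ev G) ?O + dd h P ?O * dd ev G ?O))) (at ?O)"
      by (intro has_derivative_add has_derivative_mult smooth_on_has_derivative[OF _ N0] smooth_on_dd G P)
    note dd_eqI[OF this, of "(v, 0)"]
    moreover have "((\<lambda>w. Jt w + M w * G w) has_derivative
        (\<lambda>h. dd h Jt ?O + (M ?O * dd h G ?O + dd h M ?O * G ?O))) (at ?O)"
      by (intro has_derivative_add has_derivative_mult smooth_on_has_derivative[OF _ N0] G J M)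
    note dd_eqI[OF this, of "(v, 0)"]
    ultimately show ?thesis using G0 P0 by simp
  qed
  let ?Ju = "dd eu Jt ?O" let ?Jv = "dd ev Jt ?O" let ?C = "dd ev (dd ev G) ?O"
  have g0: "g \<noteq> 0" using G0 by (simp add: g_def)
  have A: "dd (1, 0) (dd (1, 0) \<gamma>) (0, 0) = - ?Ju / g"
    using second[of "(1, 0)" "(1, 0)"] dJ g0 by (simp add: field_simps)
  have B: "dd (0, 1) (dd (1, 0) \<gamma>) (0, 0) = - ?Jv / g"
    using second[of "(0, 1)" "(1, 0)"] dJ g0 by (simp add: field_simps)
  have C: "dd (0, 1) (dd (0, 1) \<gamma>) (0, 0) = - ?C / g"
    using second[of "(0, 1)" "(0, 1)"] g0 by (simp add: field_simps)
  have A0: "dd (1, 0) (dd (1, 0) \<gamma>) (0, 0) \<noteq> 0" using A Ju g0 by simp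
  have det': "dd (1, 0) (dd (1, 0) \<gamma>) (0, 0) * dd (0, 1) (dd (0, 1) \<gamma>) (0, 0)
      \<noteq> (dd (0, 1) (dd (1, 0) \<gamma>) (0, 0))\<^sup>2"
    unfolding A B C using det g0 by (simp add: field_simps power2_eq_square)
  obtain \<Phi> N1 s1 s2 where \<Phi>: "local_diffeo \<Phi> (0, 0)" "\<Phi> (0, 0) = (0, 0)" "open N1" "(0, 0) \<in> N1"
    "s1 \<in> {1, -1}" "s2 \<in> {1, -1}"
    "\<And>w. w \<in> N1 \<Longrightarrow> \<gamma> w = s1 * (fst (\<Phi> w))\<^sup>2 + s2 * (snd (\<Phi> w))\<^sup>2"
    by (rule morse_lemma_2d[OF V(4,2,5) d\<gamma> d\<gamma> A0 det']) (rule that; assumption)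
  \<comment> \<open>Bi-inflections are the zeros of \<open>\<kappa>\<close> on the graph of
    \<open>\<gamma>\<close>. Since its u-derivative is nonzero they form a curve u =
    \<open>\<rho>\<close> v, along which the parameter is \<open>E\<close>.\<close>
  define \<kappa> where "\<kappa> y = Jt (y, \<gamma> y)" for y
  have s\<kappa>: "smooth_on V \<kappa>" unfolding \<kappa>_def by (rule scomp[OF J])
  have \<kappa>0: "\<kappa> (0, 0) = 0" "dd (1, 0) \<kappa> (0, 0) = ?Ju" "dd (0, 1) \<kappa> (0, 0) = ?Jv"
    using J0 V(5) comp[OF J] by (simp_all add: \<kappa>_def[abs_def])
  have \<kappa>u: "dd (1, 0) \<kappa> (0, 0) \<noteq> 0" using \<kappa>0 Ju by simp
  obtain V2 a2 \<rho> where V2: "open V2" "0 \<in> V2" "a2 > 0" "smooth_on V2 \<rho>" "\<rho> 0 = 0"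
    and inV: "\<And>u v. v \<in> V2 \<Longrightarrow> \<bar>u\<bar> < a2 \<Longrightarrow> (u, v) \<in> V"
    and kz: "\<And>u v. v \<in> V2 \<Longrightarrow> \<bar>u\<bar> < a2 \<Longrightarrow> \<kappa> (u, v) = 0
        \<longleftrightarrow> u = \<rho> v"
    and ra: "\<And>v. v \<in> V2 \<Longrightarrow> \<bar>\<rho> v\<bar> < a2"
    and r': "dd 1 \<rho> 0 = - dd (0, 1) \<kappa> (0, 0) / dd (1, 0) \<kappa> (0, 0)"
    by (rule solve_first[OF s\<kappa> V(2) \<kappa>0(1) \<kappa>u]) (rule that; assumption)
  define E where "E v = \<gamma> (\<rho> v, v)" for v
  note gr = graph_second_derivative[OF V(4) V2(4,2,5) inV[OF _ ra] d\<gamma> d\<gamma>]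
  obtain b where b: "b > 0" "{-b<..<b} \<subseteq> V2"
  proof -
    obtain b where "b > 0" "ball 0 b \<subseteq> V2" using V2(1,2) openE by blast
    moreover have "{-b<..<b} \<subseteq> ball 0 b" by (auto simp: dist_real_def)
    ultimately show thesis using that[of b] by blast
  qed
  have sE: "smooth_on {-b<..<b} E" using smooth_on_subset[OF gr(1) _ b(2)] by (simp add: E_def[abs_def])
  have E0: "E 0 = 0" "dd 1 E 0 = 0" using V2(5) V(5) gr(2) by (simp_all add: E_def[abs_def])
  have "dd 1 (dd 1 E) 0 = (?Jv\<^sup>2 - ?Ju * ?C) / (?Ju * g)"
    using gr(3) Ju g0 unfolding E_def[abs_def] r' \<kappa>0 A B C by (simp add: field_simps power2_eq_square)
  then have E2: "dd 1 (dd 1 E) 0 \<noteq> 0" using det Ju g0 by simp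
  have "fold_at {w. G w = 0 \<and> Jt w = 0} ((0, 0), 0)"
  proof (rule fold_atI[OF b(1) sE E0 E2, where z="\<lambda>r. (\<rho> r, r)" and l=snd])
    show "continuous_on {-b<..<b} (\<lambda>r. (\<rho> r, r))"
      by (intro continuous_on_Pair continuous_on_id continuous_on_subset[OF smooth_on_continuous[OF V2(4)] b(2)])
    show "open (({-a2<..<a2} \<times> {-b<..<b}) \<times> {-a<..<a})" by (intro open_Times open_greaterThanLessThan)
    show "((0, 0), 0) \<in> ({-a2<..<a2} \<times> {-b<..<b}) \<times> {-a<..<a}" using V V2 b by simp
    fix y :: plane and t assume "(y, t) \<in> ({-a2<..<a2} \<times> {-b<..<b}) \<times> {-a<..<a}"
    then obtain u v where y: "y = (u, v)" and uv: "\<bar>u\<bar> < a2" "\<bar>v\<bar> < b" "\<bar>t - 0\<bar> < a"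
        by auto
    have v: "v \<in> V2" by (rule subsetD[OF b(2)]) (use uv in auto)
    have yV: "(u, v) \<in> V" by (rule inV[OF v uv(1)])
    have "(y, t) \<in> {w. G w = 0 \<and> Jt w = 0} \<longleftrightarrow> t = \<gamma> (u, v) \<and> \<kappa> (u,
        v) = 0"
      using zero[OF yV uv(3)] by (auto simp: y \<kappa>_def)
    also have "\<dots> \<longleftrightarrow> (\<exists>r. \<bar>r\<bar> < b \<and> y = (\<rho> r, r) \<and> t = E r)"
      using kz[OF v uv(1)] uv(2) by (auto simp: y E_def)
    finally show "(y, t) \<in> {w. G w = 0 \<and> Jt w = 0} \<longleftrightarrow> (\<exists>r. \<bar>r\<bar> < b
        \<and> y = (\<rho> r, r) \<and> t = E r)" .
  qed (use V2 in auto)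
  moreover have "open ((V \<inter> N1) \<times> {-a<..<a})" using V \<Phi>(3) by (intro open_Times open_Int) auto
  moreover have "((0, 0), 0) \<in> (V \<inter> N1) \<times> {-a<..<a}" using V \<Phi> by simp
  moreover have "G (y, t) = 0 \<longleftrightarrow> t = s1 * (fst (\<Phi> y))\<^sup>2 + s2 * (snd (\<Phi> y))\<^sup>2"
    if "(y, t) \<in> (V \<inter> N1) \<times> {-a<..<a}" for y t
    using zero[of y t] \<Phi>(7)[of y] that by auto
  ultimately show ?thesis using that[OF \<Phi>(1,2) _ _ \<Phi>(5,6)] by blast
qed

text \<open>Solving G = 0 for v gives v = \<open>Y\<close> (u, t). On this surface the function k =
  \<open>Jt\<close> has u-derivative \<open>Kt\<close> - k \<open>h\<close>, and by
  \<open>det\<close> its t-derivative is nonzero, so k = 0 is a graph t = \<open>E\<close> u. There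
  E' k_t = - \<open>Kt\<close>, and since \<open>Kt\<close> vanishes at the origin with nonzero
  u-derivative, \<open>E\<close> has a nondegenerate critical point.\<close>

lemma swallowtail_family:
  fixes G Jt Kt P M M2 :: "plane \<times> real \<Rightarrow> real"
  assumes G: "smooth_on N G" and J: "smooth_on N Jt" and K: "smooth_on N Kt" and P: "smooth_on N P"
    and N0: "((0, 0), 0) \<in> N"
    and id: "\<And>w. w \<in> N \<Longrightarrow> dd eu G w + P w * dd ev G w = Jt w + M w * G w"
    and id2: "\<And>w. w \<in> N \<Longrightarrow> dd eu Jt w + P w * dd ev Jt w = Kt w + M2 w * G w"
    and P0: "P ((0, 0), 0) = 0"
    and G0: "G ((0, 0), 0) = 0" "Jt ((0, 0), 0) = 0" "Kt ((0, 0), 0) = 0" "dd ev G ((0, 0), 0) \<noteq> 0"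
    and Ku: "dd eu Kt ((0, 0), 0) \<noteq> 0"
    and det: "dd ev G ((0, 0), 0) * dd ee Jt ((0, 0), 0) \<noteq> dd ee G ((0, 0), 0) * dd ev Jt ((0, 0), 0)"
  shows "fold_at {w. G w = 0 \<and> Jt w = 0} ((0, 0), 0)"
proof -
  let ?O = "((0, 0), 0) :: plane \<times> real"
  \<comment> \<open>Exchanges v and the parameter, so that \<open>implicit_function\<close> solves
    for v.\<close>
  define sw where "sw w = ((fst (fst w), snd w), snd (fst w))" for w :: "plane \<times> real"
  define NS where "NS = sw -` N"
  have opN: "open N" using G smooth_on_open by blast
  have opNS: "open NS" unfolding NS_def sw_def by (rule open_vimage[OF opN]) (intro continuous_intros)
  have swd: "(sw has_derivative sw) (at w)" for w
    unfolding sw_def[abs_def] by (intro has_derivative_Pair has_derivative_fst has_derivative_snd has_derivative_ident)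
  have ssw: "smooth_on UNIV sw" unfolding sw_def by (intro smooth_intros open_UNIV)
  have sS: "smooth_on NS (\<lambda>w. h (sw w))" if "smooth_on N h" for h :: "plane \<times> real \<Rightarrow> real"
    by (rule smooth_on_compose[OF that smooth_on_subset[OF ssw opNS]]) (auto simp: NS_def)
  have dS: "dd v (\<lambda>w. h (sw w)) w = dd (sw v) h (sw w)" if "smooth_on N h" "w \<in> NS" for h :: "plane
      \<times> real \<Rightarrow> real" and v w
    by (rule dd_eqI[OF dd_chain[OF smooth_on_differentiable[OF that(1)] swd]]) (use that in \<open>simp add:
        NS_def\<close>)
  have NS0: "(0, 0) \<in> NS" using N0 by (simp add: NS_def sw_def zero_prod_def)
  have 1: "G (sw (0, 0)) = 0" "dd (0, 1) (\<lambda>w. G (sw w)) (0, 0) \<noteq> 0"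
    using G0 dS[OF G NS0] by (simp_all add: sw_def zero_prod_def)
  obtain V a Y where V: "open V" "0 \<in> V" "a > 0" "smooth_on V Y" "Y 0 = 0"
    and inNS: "\<And>y t. y \<in> V \<Longrightarrow> \<bar>t - 0\<bar> < a \<Longrightarrow> (y, t) \<in> NS"
    and Gv: "\<And>y t. y \<in> V \<Longrightarrow> \<bar>t - 0\<bar> < a \<Longrightarrow> dd (0, 1) (\<lambda>w.
        G (sw w)) (y, t) \<noteq> 0"
    and zero: "\<And>y t. y \<in> V \<Longrightarrow> \<bar>t - 0\<bar> < a \<Longrightarrow> G (sw (y, t)) = 0
        \<longleftrightarrow> t = Y y"
    and Ya: "\<And>y. y \<in> V \<Longrightarrow> \<bar>Y y - 0\<bar> < a"
    and dY: "\<And>y v. y \<in> V \<Longrightarrow> dd v Y y = - dd (v, 0) (\<lambda>w. G (sw w)) (y, Y y) / dd (0,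
        1) (\<lambda>w. G (sw w)) (y, Y y)"
    by (rule implicit_function[OF sS[OF G] NS0 1]) (rule that; assumption)
  define m where "m y = ((fst y, Y y), snd y)" for y
  have msw: "m y = sw (y, Y y)" for y by (simp add: m_def sw_def)
  have mN: "m y \<in> N" if "y \<in> V" for y using inNS[OF that Ya[OF that]] by (simp add: msw NS_def)
  have mNS: "(y, Y y) \<in> NS" if "y \<in> V" for y using inNS[OF that Ya[OF that]] .
  have m0: "m 0 = ?O" using V(5) by (simp add: m_def zero_prod_def)
  have Gm: "G (m y) = 0" if "y \<in> V" for y using zero[OF that Ya[OF that]] by (simp add: msw)
  have Gvm: "dd ev G (m y) \<noteq> 0" if "y \<in> V" for y
    using Gv[OF that Ya[OF that]] dS[OF G mNS[OF that], of "(0, 1)"] by (simp add: msw sw_def zero_prod_def)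
  have dYu: "dd (1, 0) Y y = P (m y) - Jt (m y) / dd ev G (m y)" if y: "y \<in> V" for y
  proof -
    have "dd (1, 0) Y y = - dd eu G (m y) / dd ev G (m y)"
      using dY[OF y, of "(1, 0)"] dS[OF G mNS[OF y]] by (simp add: msw sw_def zero_prod_def)
    then show ?thesis using id[OF mN[OF y]] Gm[OF y] Gvm[OF y] by (simp add: field_simps)
  qed
  have dYe: "dd (0, 1) Y 0 = - dd ee G ?O / dd ev G ?O"
    using dY[OF V(2), of "(0, 1)"] dS[OF G mNS[OF V(2)]] msw[of 0] m0 by (simp add: sw_def zero_prod_def)
  have md: "(m has_derivative (\<lambda>v. ((fst v, dd v Y y), snd v))) (at y)" if "y \<in> V" for y
    unfolding m_def[abs_def]
    by (intro has_derivative_Pair has_derivative_fst has_derivative_snd has_derivative_ident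
        smooth_on_has_derivative[OF V(4) that])
  have sm: "smooth_on V m" unfolding m_def by (intro smooth_intros V)
  have scomp: "smooth_on V (\<lambda>y. h (m y))" if "smooth_on N h" for h :: "plane \<times> real \<Rightarrow> real"
    by (rule smooth_on_compose[OF that sm]) (use mN in auto)
  have dcomp: "dd (c, d) (\<lambda>y. h (m y)) y = c * dd eu h (m y) + dd (c, d) Y y * dd ev h (m y) + d * dd ee h
      (m y)"
    if "smooth_on N h" "y \<in> V" for h :: "plane \<times> real \<Rightarrow> real" and c d y
  proof -
    have hd: "h differentiable (at (m y))" using smooth_on_differentiable[OF that(1) mN[OF that(2)]] .
    from dd_eqI[OF dd_chain[OF hd md[OF that(2)]], of "(c, d)"] show ?thesis
      using dd_plane_real[OF hd, of c "dd (c, d) Y y" d] by simp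
  qed
  define k where "k y = Jt (m y)" for y
  have sk: "smooth_on V k" unfolding k_def by (rule scomp[OF J])
  define h where "h y = dd ev Jt (m y) / dd ev G (m y)" for y
  have ku: "dd (1, 0) k y = Kt (m y) - k y * h y" if y: "y \<in> V" for y
  proof -
    have "dd (1, 0) k y = dd eu Jt (m y) + dd (1, 0) Y y * dd ev Jt (m y)"
      unfolding k_def using dcomp[OF J y, of 1 0] by simp
    then show ?thesis using dYu[OF y] id2[OF mN[OF y]] Gm[OF y] by (simp add: k_def h_def algebra_simps)
  qed
  have k0: "k (0, 0) = 0" using m0 G0 by (simp add: k_def zero_prod_def)
  have ke: "dd (0, 1) k (0, 0) \<noteq> 0"
  proof -
    have "dd (0, 1) k 0 = - dd ee G ?O / dd ev G ?O * dd ev Jt ?O + dd ee Jt ?O"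
      unfolding k_def using dcomp[OF J V(2), of 0 1] dYe m0 by simp
    then show ?thesis using det G0(4) by (auto simp: zero_prod_def field_simps)
  qed
  have V00: "(0, 0) \<in> V" using V(2) by (simp add: zero_prod_def)
  obtain V2 a2 E where V2: "open V2" "0 \<in> V2" "a2 > 0" "smooth_on V2 E" "E 0 = 0"
    and inV: "\<And>y t. y \<in> V2 \<Longrightarrow> \<bar>t - 0\<bar> < a2 \<Longrightarrow> (y, t) \<in> V"
    and ke': "\<And>y t. y \<in> V2 \<Longrightarrow> \<bar>t - 0\<bar> < a2 \<Longrightarrow> dd (0, 1) k (y, t)
        \<noteq> 0"
    and kz: "\<And>y t. y \<in> V2 \<Longrightarrow> \<bar>t - 0\<bar> < a2 \<Longrightarrow> k (y, t) = 0
        \<longleftrightarrow> t = E y"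
    and Ea: "\<And>y. y \<in> V2 \<Longrightarrow> \<bar>E y - 0\<bar> < a2"
    and dE: "\<And>y v. y \<in> V2 \<Longrightarrow> dd v E y = - dd (v, 0) k (y, E y) / dd (0, 1) k (y, E y)"
    by (rule implicit_function[OF sk V00 k0 ke]) (rule that; assumption)
  have EV: "(u, E u) \<in> V" if "u \<in> V2" for u by (rule inV[OF that Ea[OF that]])
  have kE: "k (u, E u) = 0" if "u \<in> V2" for u using kz[OF that Ea[OF that]] by simp
  have E1: "dd 1 E u * dd (0, 1) k (u, E u) = - Kt (m (u, E u))" if u: "u \<in> V2" for u
    using dE[OF u, of 1] ke'[OF u Ea[OF u]] ku[OF EV[OF u]] kE[OF u] by simp
  have m00: "m (0, 0) = ?O" using m0 by (simp add: zero_prod_def)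
  have E10: "dd 1 E 0 = 0" using E1[OF V2(2)] V2(5) m00 G0 ke by simp
  have Ed: "((\<lambda>u. (u, E u)) has_vector_derivative (1, 0)) (at 0)"
    using has_real_derivative_dd[OF smooth_on_differentiable[OF V2(4,2)]] E10
    unfolding has_real_derivative_iff_has_vector_derivative
    by (intro has_vector_derivative_Pair has_vector_derivative_id) simp
  have ch: "((\<lambda>u. f (u, E u)) has_real_derivative dd (1, 0) f (0, 0)) (at 0)" if "smooth_on V f" for f
    using curve_has_real_derivative[OF _ Ed, of f] smooth_on_differentiable[OF that V00] V2(5) by simp
  have "((\<lambda>u. dd 1 E u * dd (0, 1) k (u, E u)) has_real_derivative
      dd 1 (dd 1 E) 0 * dd (0, 1) k (0, E 0) + dd (1, 0) (dd (0, 1) k) (0, 0) * dd 1 E 0) (at 0)"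
    by (intro DERIV_mult ch smooth_on_dd sk has_real_derivative_dd smooth_on_differentiable[OF smooth_on_dd[OF
        V2(4)] V2(2)])
  moreover have "((\<lambda>u. dd 1 E u * dd (0, 1) k (u, E u)) has_real_derivative - dd (1, 0) (\<lambda>y. Kt (m
      y)) (0, 0)) (at 0)"
    by (rule has_field_derivative_transform_within_open[OF DERIV_minus[OF ch[OF scomp[OF K]]] V2(1,2)])
      (use E1 in simp)
  ultimately have "dd 1 (dd 1 E) 0 * dd (0, 1) k (0, E 0) + dd (1, 0) (dd (0, 1) k) (0, 0) * dd 1 E 0
      = - dd (1, 0) (\<lambda>y. Kt (m y)) (0, 0)" by (rule DERIV_unique)
  moreover have "dd (1, 0) (\<lambda>y. Kt (m y)) (0, 0) = dd eu Kt ?O"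
    using dcomp[OF K V00, of 1 0] dYu[OF V00] m00 P0 G0 by simp
  ultimately have E2: "dd 1 (dd 1 E) 0 \<noteq> 0" using Ku E10 by auto
  obtain b where b: "b > 0" "{-b<..<b} \<subseteq> V2"
  proof -
    obtain b where "b > 0" "ball 0 b \<subseteq> V2" using V2(1,2) openE by blast
    moreover have "{-b<..<b} \<subseteq> ball 0 b" by (auto simp: dist_real_def)
    ultimately show thesis using that[of b] by blast
  qed
  have sE: "smooth_on {-b<..<b} E" by (rule smooth_on_subset[OF V2(4) _ b(2)]) auto
  show ?thesis
  proof (rule fold_atI[OF b(1) sE V2(5) E10 E2, where z="\<lambda>r. (r, Y (r, E r))" and l=fst])
    show "continuous_on {-b<..<b} (\<lambda>r. (r, Y (r, E r)))"
      by (intro continuous_on_Pair continuous_on_id continuous_on_compose2[OF smooth_on_continuous[OF V(4)]]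
          continuous_on_subset[OF smooth_on_continuous[OF V2(4)] b(2)]) (use EV b in auto)
    show "(0, Y (0, E 0)) = (0, 0)" using V(5) V2(5) by (simp add: zero_prod_def)
    show "open (({-b<..<b} \<times> {-a<..<a}) \<times> {-a2<..<a2})" by (intro open_Times open_greaterThanLessThan)
    show "((0, 0), 0) \<in> ({-b<..<b} \<times> {-a<..<a}) \<times> {-a2<..<a2}" using V V2 b by simp
    fix y :: plane and t assume "(y, t) \<in> ({-b<..<b} \<times> {-a<..<a}) \<times> {-a2<..<a2}"
    then obtain u v where y: "y = (u, v)" and uv: "\<bar>u\<bar> < b" "\<bar>v - 0\<bar> < a" "\<bar>t - 0\<bar> <
        a2" by auto
    have u: "u \<in> V2" by (rule subsetD[OF b(2)]) (use uv in auto)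
    have utV: "(u, t) \<in> V" by (rule inV[OF u uv(3)])
    have "(y, t) \<in> {w. G w = 0 \<and> Jt w = 0} \<longleftrightarrow> v = Y (u, t) \<and> k (u, t) = 0"
      using zero[OF utV uv(2)] by (auto simp: y k_def m_def sw_def)
    also have "\<dots> \<longleftrightarrow> (\<exists>r. \<bar>r\<bar> < b \<and> y = (r, Y (r, E r)) \<and> t = E r)"
      using kz[OF u uv(3)] uv(1) by (auto simp: y)
    finally show "(y, t) \<in> {w. G w = 0 \<and> Jt w = 0} \<longleftrightarrow> (\<exists>r. \<bar>r\<bar> < b
        \<and> y = (r, Y (r, E r)) \<and> t = E r)" .
  qed auto
qed

section \<open>Families of equations near a regular point of the surface\<close>

type_synonym jet_family = "(plane \<times> real) \<times> real"

abbreviation dX :: jet_family where "dX \<equiv> (((1, 0), 0), 0)"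
abbreviation dY :: jet_family where "dY \<equiv> (((0, 1), 0), 0)"
abbreviation dE :: jet_family where "dE \<equiv> (((0, 0), 1), 0)"
abbreviation dP :: jet_family where "dP \<equiv> (0, 1)"

text \<open>The vector field \<open>xi\<close> spans the kernel of the differential of \<open>dual_proj\<close>. At a zero of \<open>xi
  (xi F)\<close> the condition \<open>jdet F = 0\<close> says that \<open>xi F\<close> restricted to the surface is critical.\<close>

definition xi :: "(jet_family \<Rightarrow> real) \<Rightarrow> jet_family \<Rightarrow> real" where
  "xi F w = dd dX F w + snd w * dd dY F w"

definition jdet :: "(jet_family \<Rightarrow> real) \<Rightarrow> jet_family \<Rightarrow> real" where
  "jdet F w = dd dY (xi F) w * dd dP F w - dd dP (xi F) w * dd dY F w"

text \<open>The equation as one function on the four-dimensional space of (x, y, \<epsilon>, p),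
  with p as the last factor so that \<open>implicit_function\<close> can solve for it.\<close>

definition F4 :: "bde_family \<Rightarrow> jet_family \<Rightarrow> real" where
  "F4 A w = A (fst w) \<bullet> (1, 2 * snd w, (snd w)\<^sup>2)"

definition slice :: "real \<Rightarrow> jet \<Rightarrow> jet_family" where
  "slice e m = (((fst m, fst (snd m)), e), snd (snd m))"

lemma bde_eq_F4: "bde A e = (\<lambda>m. F4 A (slice e m))"
  by (auto simp: bde_def F4_def slice_def fun_eq_iff inner_prod_def algebra_simps split: prod.splits)

lemma dd_jet_family:
  fixes f :: "jet_family \<Rightarrow> real"
  assumes "f differentiable (at x)"
  shows "dd (((a, b), c), d) f x = a * dd dX f x + b * dd dY f x + c * dd dE f x + d * dd dP f x"
  using dd_linear[OF assms, of a dX b dY] dd_linear[OF assms, of 1 "(((a, b), 0), 0)" c dE]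
    dd_linear[OF assms, of 1 "(((a, b), c), 0)" d dP]
  by (simp add: zero_prod_def)

lemma smooth_on_xi: "smooth_on U F \<Longrightarrow> smooth_on U (xi F)"
  unfolding xi_def using smooth_on_open by (intro smooth_intros smooth_on_dd) auto

lemma smooth_on_jdet: "smooth_on U F \<Longrightarrow> smooth_on U (jdet F)"
  unfolding jdet_def by (intro smooth_intros smooth_on_dd smooth_on_xi)

lemma smooth_on_F4:
  assumes "smooth_on UNIV A" shows "smooth_on UNIV (F4 A)"
proof -
  have "smooth_on UNIV (\<lambda>w::jet_family. A (fst w))"
    by (rule smooth_on_compose[OF assms]) (auto intro!: smooth_intros)
  then show ?thesis unfolding F4_def by (intro smooth_intros open_UNIV)
qed

lemma smooth_on_slice:
  assumes "smooth_on UNIV F" shows "smooth_on UNIV (\<lambda>m. F (slice e m))"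
  by (rule smooth_on_compose[OF assms]) (auto simp: slice_def intro!: smooth_intros)

lemma dd_slice:
  assumes "smooth_on UNIV F"
  shows "dd (a, b, c) (\<lambda>m. F (slice e m)) m = dd (((a, b), 0), c) F (slice e m)"
proof -
  have "((\<lambda>m. slice e m) has_derivative (\<lambda>v. (((fst v, fst (snd v)), 0), snd (snd v)))) (at m)"
    unfolding slice_def
    by (intro has_derivative_Pair has_derivative_fst has_derivative_snd has_derivative_ident has_derivative_const)
  from dd_eqI[OF dd_chain[OF smooth_on_differentiable[OF assms UNIV_I] this], of "(a, b, c)"]
  show ?thesis by simp
qed

lemma fibre_deriv_slice:
  assumes "smooth_on UNIV F"
  shows "fibre_deriv (\<lambda>m. F (slice e m)) = (\<lambda>m. xi F (slice e m))"
proof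
  fix m
  show "fibre_deriv (\<lambda>m. F (slice e m)) m = xi F (slice e m)"
    unfolding fibre_deriv_def dd_slice[OF assms]
    using dd_jet_family[OF smooth_on_differentiable[OF assms UNIV_I], of 1 "snd (snd m)" 0 0 "slice e m"]
    by (simp add: xi_def slice_def)
qed

lemma dd_dP_inner:
  fixes A :: "plane \<times> real \<Rightarrow> 'a::euclidean_space"
  assumes A: "smooth_on UNIV A" and g: "(g has_vector_derivative g') (at (snd w))"
  shows "dd dP (\<lambda>w. A (fst w) \<bullet> g (snd w)) w = A (fst w) \<bullet> g'"
proof -
  have Ad: "A differentiable (at (fst w))" using smooth_on_differentiable[OF A] by simp
  note 1 = dd_chain[OF Ad has_derivative_fst[OF has_derivative_ident]]
  have gd: "g differentiable (at (snd w))" using g unfolding has_vector_derivative_def by (rule differentiableI)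
  note 2 = dd_chain[OF gd has_derivative_snd[OF has_derivative_ident]]
  have "dd 1 g (snd w) = g'" using dd_eqI[OF g[unfolded has_vector_derivative_def], of 1] by simp
  with dd_eqI[OF has_derivative_inner[OF 1 2], of dP] dd_zero[OF Ad] show ?thesis by simp
qed

lemma F4_quadratic:
  assumes A: "smooth_on UNIV A"
  shows "dd dP (F4 A) (z, p) = A z \<bullet> (0, 2, 2 * p)"
    and "dd dP (dd dP (F4 A)) (z, p) = A z \<bullet> (0, 0, 2)"
    and "F4 A (z, p') = F4 A (z, p) + A z \<bullet> (0, 2, 2 * p) * (p' - p) + A z \<bullet> (0, 0, 2) / 2 * (p' -
        p)\<^sup>2"
proof -
  have 1: "dd dP (F4 A) = (\<lambda>w. A (fst w) \<bullet> (0, 2, 2 * snd w))"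
  proof
    fix w :: jet_family
    have "((\<lambda>p. (1, 2 * p, p\<^sup>2)) has_vector_derivative (0, 2, 2 * snd w)) (at (snd w))"
      unfolding has_vector_derivative_def
      by (auto intro!: derivative_eq_intros simp: zero_prod_def)
    from dd_dP_inner[OF A this] show "dd dP (F4 A) w = A (fst w) \<bullet> (0, 2, 2 * snd w)"
      unfolding F4_def[abs_def] .
  qed
  then show "dd dP (F4 A) (z, p) = A z \<bullet> (0, 2, 2 * p)" by simp
  have "((\<lambda>p. (0, 2, 2 * p)) has_vector_derivative (0, 0, 2)) (at p)"
    unfolding has_vector_derivative_def
    by (auto intro!: derivative_eq_intros simp: zero_prod_def)
  then show "dd dP (dd dP (F4 A)) (z, p) = A z \<bullet> (0, 0, 2)"
    unfolding 1 using dd_dP_inner[OF A, of "\<lambda>p. (0, 2, 2 * p)" _ "(z, p)"] by simp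
  show "F4 A (z, p') = F4 A (z, p) + A z \<bullet> (0, 2, 2 * p) * (p' - p) + A z \<bullet> (0, 0, 2) / 2 * (p' -
      p)\<^sup>2"
    by (simp add: F4_def inner_prod_def algebra_simps power2_eq_square)
qed

text \<open>\<open>F\<close> is quadratic in \<open>p\<close>; the conditions on its second root keep the discriminant and the
  inflections of the other branch of solutions away.\<close>

locale jet_chart =
  fixes F :: "jet_family \<Rightarrow> real" and x0 y0 e p0 :: real and P :: "plane \<times> real \<Rightarrow>
      real" and V :: "(plane \<times> real) set"
  assumes sF: "smooth_on UNIV F" and sP: "smooth_on V P" and z0: "((x0, y0), e) \<in> V" and P0: "P ((x0, y0), e) = p0"
    and roots: "\<And>z p. z \<in> V \<Longrightarrow> F (z, p) = 0 \<longleftrightarrow>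
      p = P z \<or> p = P z - 2 * dd dP F (z, P z) / dd dP (dd dP F) (z, P z)"
    and Fp: "\<And>z. z \<in> V \<Longrightarrow> dd dP F (z, P z) \<noteq> 0"
    and Fpp: "\<And>z. z \<in> V \<Longrightarrow> dd dP (dd dP F) (z, P z) \<noteq> 0"
    and Fp2: "\<And>z. z \<in> V \<Longrightarrow> dd dP F (z, P z - 2 * dd dP F (z, P z) / dd dP (dd dP F) (z, P
        z)) \<noteq> 0"
    and other: "\<And>z. z \<in> V \<Longrightarrow> xi F (z, P z - 2 * dd dP F (z, P z) / dd dP (dd dP F) (z, P
        z)) \<noteq> 0"
    and dP_eq: "\<And>v z. z \<in> V \<Longrightarrow> dd v P z = - dd (v, 0) F (z, P z) / dd dP F (z, P z)"
begin

abbreviation "I \<equiv> xi F" abbreviation "J \<equiv> xi (xi F)" abbreviation "K \<equiv> xi (xi (xi F))"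
abbreviation "w0 \<equiv> (((x0, y0), e), p0)"
abbreviation "Fx \<equiv> dd dX F" abbreviation "Fy \<equiv> dd dY F" abbreviation "Fe \<equiv> dd dE F"
    abbreviation "Fq \<equiv> dd dP F"

section \<open>Calculus on the surface as a graph over the plane and the parameter\<close>

definition lift :: "(jet_family \<Rightarrow> real) \<Rightarrow> plane \<times> real \<Rightarrow> real" where
  "lift h z = h (z, P z)"

lemma sI: "smooth_on UNIV I" and sJ: "smooth_on UNIV J" and sK: "smooth_on UNIV K"
  by (intro smooth_on_xi sF)+

lemma opV: "open V" using sP smooth_on_open by blast

lemma s_lift: "smooth_on UNIV h \<Longrightarrow> smooth_on V (lift h)"
  unfolding lift_def by (rule smooth_on_compose[of UNIV]) (auto intro!: smooth_intros sP opV)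

lemma dd_lift:
  assumes h: "smooth_on UNIV h" and z: "z \<in> V"
  shows "dd v (lift h) z = dd (v, 0) h (z, P z) - dd (v, 0) F (z, P z) / Fq (z, P z) * dd dP h (z, P z)"
proof -
  have hd: "h differentiable (at (z, P z))" using smooth_on_differentiable[OF h] by simp
  have "((\<lambda>z. (z, P z)) has_derivative (\<lambda>v. (v, dd v P z))) (at z)"
    by (intro has_derivative_Pair has_derivative_ident smooth_on_has_derivative[OF sP z])
  from dd_eqI[OF dd_chain[OF hd this], of v]
  have "dd v (lift h) z = dd (v, dd v P z) h (z, P z)" by (simp add: lift_def[abs_def])
  also have "\<dots> = dd (v, 0) h (z, P z) + dd v P z * dd dP h (z, P z)"
    using dd_linear[OF hd, of 1 "(v, 0)" "dd v P z" dP] by simp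
  finally show ?thesis using dP_eq[OF z] by simp
qed

text \<open>The field \<open>xi\<close> is not tangent to the surface; its tangential part along ker
  dp-direction is \<open>xi\<close> - (I / Fq) d/dp. The correction is a multiple of
  \<open>I\<close>, so it disappears on the inflections.\<close>

lemma dd_lift_xi:
  assumes h: "smooth_on UNIV h" and z: "z \<in> V"
  shows "dd eu (lift h) z + P z * dd ev (lift h) z = lift (xi h) z + (- dd dP h (z, P z) / Fq (z, P z)) * lift I z"
  using Fp[OF z] unfolding dd_lift[OF h z] lift_def xi_def by (simp add: field_simps)

text \<open>Over each point there are the two roots of \<open>roots\<close>. The second one is no
  inflection by \<open>other\<close>, and neither is a double root by \<open>Fp\<close> and
  \<open>Fp2\<close>; what remains are conditions at p = P z.\<close>

lemma char_inflection:
  assumes A: "bde A t = (\<lambda>m. F (slice t m))" and z: "((x, y), t) \<in> V"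
  shows "(x, y) \<in> inflection_curve (bde A t) \<longleftrightarrow> lift I ((x, y), t) = 0"
    and "(x, y) \<in> bi_inflections (bde A t) \<longleftrightarrow> lift I ((x, y), t) = 0 \<and> lift J ((x, y),
        t) = 0"
    and "(x, y) \<notin> discriminant_curve (bde A t)"
proof -
  let ?z = "((x, y), t)"
  let ?p2 = "P ?z - 2 * Fq (?z, P ?z) / dd dP (dd dP F) (?z, P ?z)"
  have sl: "slice t (x, y, p) = (?z, p)" for p by (simp add: slice_def)
  have zz: "(((0::real, 0::real), 0::real), 1::real) = dP" by (simp add: zero_prod_def)
  show "(x, y) \<in> inflection_curve (bde A t) \<longleftrightarrow> lift I ?z = 0"
    unfolding A inflection_curve_iff(1)[OF smooth_on_slice[OF sF]] fibre_deriv_slice[OF sF] dd_slice[OF sF] sl zz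
        lift_def
    using roots[OF z] Fp[OF z] other[OF z] by metis
  show "(x, y) \<in> bi_inflections (bde A t) \<longleftrightarrow> lift I ?z = 0 \<and> lift J ?z = 0"
    unfolding A inflection_curve_iff(2)[OF smooth_on_slice[OF sF]] fibre_deriv_slice[OF sF] fibre_deriv_slice[OF sI]
      dd_slice[OF sF] sl zz lift_def
    using roots[OF z] Fp[OF z] other[OF z] by metis
  show "(x, y) \<notin> discriminant_curve (bde A t)"
  proof
    assume "(x, y) \<in> discriminant_curve (bde A t)"
    then obtain p where "F (slice t (x, y, p)) = 0" "dd (0, 0, 1) (\<lambda>m. F (slice t m)) (x, y, p) = 0"
      by (auto simp: discriminant_curve_def A jet_surface_def surface_tangent_def dd_def)
    then have "F (?z, p) = 0" "Fq (?z, p) = 0" unfolding dd_slice[OF sF] sl zz by auto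
    then show False using roots[OF z] Fp[OF z] Fp2[OF z] by metis
  qed
qed

lemma only_inflections_chart:
  assumes A: "\<And>t. bde A t = (\<lambda>m. F (slice t m))"
  shows "only_inflections A (x0, y0) e"
  unfolding only_inflections_def
proof (rule eventually_mono[OF eventually_nhds_in_open[OF opV z0]])
  fix w assume "w \<in> V"
  then show "fst w \<notin> discriminant_curve (bde A (snd w))"
    using char_inflection(3)[OF A, of "fst (fst w)" "snd (fst w)" "snd w"] by simp
qed

text \<open>An affine change of coordinates, hence compatible with inflections, after which the solution
  through the base point has slope \<open>0\<close> there.\<close>

definition shear :: "plane \<times> real \<Rightarrow> plane \<times> real" where
  "shear w = ((x0 + fst (fst w), y0 + snd (fst w) + p0 * fst (fst w)), e + snd w)"

definition unshear :: "plane \<times> real \<Rightarrow> plane \<times> real" where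
  "unshear w = ((fst (fst w) - x0, snd (fst w) - y0 - p0 * (fst (fst w) - x0)), snd w - e)"

lemma unshear_shear [simp]: "unshear (shear w) = w" and shear_unshear [simp]: "shear (unshear w) = w"
  by (simp_all add: shear_def unshear_def prod_eq_iff)

lemma shear_0: "shear ((0, 0), 0) = ((x0, y0), e)" and unshear_0: "unshear ((x0, y0), e) = ((0, 0), 0)"
  by (simp_all add: shear_def unshear_def)

lemma s_shear: "smooth_on UNIV shear" and s_unshear: "smooth_on UNIV unshear"
  unfolding shear_def unshear_def by (intro smooth_intros open_UNIV)+

definition NV :: "(plane \<times> real) set" where "NV = {w \<in> UNIV. shear w \<in> V}"

lemma opNV: "open NV" unfolding NV_def by (rule open_smooth_vimage[OF s_shear opV])

lemma NV0: "((0, 0), 0) \<in> NV" by (simp add: NV_def shear_0 z0)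

lemma s_hat: "smooth_on V f \<Longrightarrow> smooth_on NV (\<lambda>w. f (shear w))"
  by (rule smooth_on_compose[OF _ smooth_on_subset[OF s_shear opNV]]) (auto simp: NV_def)

lemma dd_hat:
  fixes f :: "plane \<times> real \<Rightarrow> real"
  assumes f: "smooth_on V f" and w: "w \<in> NV"
  shows "dd eu (\<lambda>w. f (shear w)) w = dd eu f (shear w) + p0 * dd ev f (shear w)"
    and "dd ev (\<lambda>w. f (shear w)) w = dd ev f (shear w)"
    and "dd ee (\<lambda>w. f (shear w)) w = dd ee f (shear w)"
proof -
  have fd: "f differentiable (at (shear w))" using smooth_on_differentiable[OF f] w by (simp add: NV_def)
  have "(shear has_derivative (\<lambda>v. ((fst (fst v), snd (fst v) + p0 * fst (fst v)), snd v))) (at w)"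
    unfolding shear_def[abs_def]
    by (intro has_derivative_Pair) (auto intro!: derivative_eq_intros)
  from dd_eqI[OF dd_chain[OF fd this]]
  have *: "dd v (\<lambda>w. f (shear w)) w = dd ((fst (fst v), snd (fst v) + p0 * fst (fst v)), snd v) f (shear
      w)" for v .
  show "dd eu (\<lambda>w. f (shear w)) w = dd eu f (shear w) + p0 * dd ev f (shear w)"
    unfolding * using dd_plane_real[OF fd, of 1 p0 0] by simp
  show "dd ev (\<lambda>w. f (shear w)) w = dd ev f (shear w)" unfolding * by simp
  show "dd ee (\<lambda>w. f (shear w)) w = dd ee f (shear w)" unfolding * by (simp add: zero_prod_def)
qed

lemma fold_at_shear:
  assumes "fold_at {w. T (shear w)} ((0, 0), 0)" and N: "open N" "((x0, y0), e) \<in> N"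
    and eq: "\<And>w. w \<in> N \<Longrightarrow> T w \<longleftrightarrow> w \<in> S"
  shows "fold_at S ((x0, y0), e)"
  using assms(1)[unfolded fold_at_def fst_conv snd_conv]
proof (elim exE conjE)
  fix b E z and l :: "plane \<Rightarrow> real" and N'
  assume *: "b > 0" "smooth_on {-b<..<b} E" "E 0 = 0" "dd 1 E 0 = 0"
     "dd 1 (dd 1 E) 0 \<noteq> 0" "continuous_on {-b<..<b} z" "z 0 = (0, 0)"
     "\<forall>u. \<bar>u\<bar> < b \<longrightarrow> l (z u) = u" "isCont l (0, 0)" "open N'" "((0, 0), 0) \<in> N'"
    and c: "\<forall>y t. (y, t) \<in> N' \<longrightarrow> ((y, t) \<in> {w. T (shear w)} \<longleftrightarrow>
        (\<exists>u. \<bar>u\<bar> < b \<and> y = z u \<and> t = E u))"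
  define z' where "z' u = fst (shear (z u, 0))" for u
  define un where "un y = fst (unshear (y, 0))" for y
  define E' where "E' u = e + E u" for u
  have sh: "shear (y, t) = (fst (shear (y, 0)), e + t)" for y t by (simp add: shear_def)
  have unz: "un (z' u) = z u" for u by (simp add: un_def z'_def shear_def unshear_def prod_eq_iff)
  have dE: "dd 1 E' u = dd 1 E u" if "\<bar>u\<bar> < b" for u
  proof -
    have "E differentiable (at u)" by (rule smooth_on_differentiable[OF *(2)]) (use that in auto)
    from dd_eqI[OF has_derivative_add[OF has_derivative_const has_derivative_dd[OF this]], of 1 e]
    show ?thesis by (simp add: E'_def[abs_def])
  qed
  show "fold_at S ((x0, y0), e)"
  proof (rule fold_atI[OF *(1), where E=E' and z=z' and l="\<lambda>y. l (un y)"])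
    show "smooth_on {-b<..<b} E'" unfolding E'_def by (intro smooth_intros *(2)) auto
    show "E' 0 = e" "dd 1 E' 0 = 0" using *(1,3,4) dE[of 0] by (auto simp: E'_def)
    have "dd 1 (dd 1 E') 0 = dd 1 (dd 1 E) 0"
      by (rule dd_cong_open[of "{-b<..<b}"]) (use dE *(1) in auto)
    then show "dd 1 (dd 1 E') 0 \<noteq> 0" using *(5) by simp
    show "continuous_on {-b<..<b} z'" unfolding z'_def shear_def
      using *(6) by (simp) (intro continuous_intros)
    show "z' 0 = (x0, y0)" using *(7) by (simp add: z'_def shear_def)
    show "l (un (z' u)) = u" if "\<bar>u\<bar> < b" for u using *(8) that unz by simp
    have "isCont un (x0, y0)" unfolding un_def unshear_def by simp
    moreover have "un (x0, y0) = (0, 0)" by (simp add: un_def unshear_def)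
    ultimately show "isCont (\<lambda>y. l (un y)) (x0, y0)" using *(9) isCont_o2 by metis
    show "open (N \<inter> {w \<in> UNIV. unshear w \<in> N'})" by (intro open_Int N open_smooth_vimage[OF
        s_unshear *(10)])
    show "((x0, y0), e) \<in> N \<inter> {w \<in> UNIV. unshear w \<in> N'}" using N *(11) unshear_0 by simp
    fix y t assume yt: "(y, t) \<in> N \<inter> {w \<in> UNIV. unshear w \<in> N'}"
    obtain y' t' where u: "unshear (y, t) = (y', t')" by (cases "unshear (y, t)")
    then have s: "shear (y', t') = (y, t)" using shear_unshear[of "(y, t)"] by simp
    have "(y, t) \<in> S \<longleftrightarrow> T (shear (y', t'))" using eq yt s by simp
    also have "\<dots> \<longleftrightarrow> (\<exists>u. \<bar>u\<bar> < b \<and> y' = z u \<and> t' = E u)"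
      using c[rule_format, of y' t'] yt u by simp
    also have "\<dots> \<longleftrightarrow> (\<exists>u. \<bar>u\<bar> < b \<and> y = z' u \<and> t = E' u)"
    proof -
      have "y' = z u \<and> t' = E u \<longleftrightarrow> y = z' u \<and> t = E' u" for u
        using s by (auto simp: z'_def E'_def shear_def prod_eq_iff)
      then show ?thesis by blast
    qed
    finally show "(y, t) \<in> S \<longleftrightarrow> (\<exists>u. \<bar>u\<bar> < b \<and> y = z' u \<and> t = E'
        u)" .
  qed
qed

lemma dd_lift_y:
  assumes "smooth_on UNIV h"
  shows "dd ev (lift h) ((x0, y0), e) = (dd dY h w0 * Fq w0 - dd dP h w0 * Fy w0) / Fq w0"
    and "dd ee (lift h) ((x0, y0), e) = (dd dE h w0 * Fq w0 - dd dP h w0 * Fe w0) / Fq w0"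
  using Fp[OF z0] unfolding dd_lift[OF assms z0] P0 by (simp_all add: field_simps zero_prod_def)

text \<open>Supplies the hypotheses \<open>id\<close> and \<open>id2\<close> of
  \<open>morse_family\<close> and \<open>swallowtail_family\<close>; after the shear the coefficient
  P - p0 vanishes at the base point.\<close>

lemma hat_identity:
  assumes h: "smooth_on UNIV h" and w: "w \<in> NV"
  shows "dd eu (\<lambda>w. lift h (shear w)) w + (P (shear w) - p0) * dd ev (\<lambda>w. lift h (shear w)) w
    = lift (xi h) (shear w) + (- dd dP h (shear w, P (shear w)) / Fq (shear w, P (shear w))) * lift I (shear w)"
  using dd_lift_xi[OF h, of "shear w"] w unfolding dd_hat[OF s_lift[OF h] w]
  by (simp add: NV_def algebra_simps)

lemma s_quot:
  assumes "smooth_on UNIV h"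
  shows "smooth_on NV (\<lambda>w. - dd dP h (shear w, P (shear w)) / Fq (shear w, P (shear w)))"
proof -
  have "smooth_on V (\<lambda>z. - lift (dd dP h) z / lift Fq z)"
    by (intro smooth_intros s_lift smooth_on_dd assms sF) (use Fp in \<open>simp add: lift_def\<close>)
  from s_hat[OF this] show ?thesis by (simp add: lift_def)
qed

lemma s_Phat: "smooth_on NV (\<lambda>w. P (shear w) - p0)"
  by (intro smooth_intros s_hat sP opNV)

definition jet_at :: "plane \<Rightarrow> jet" where
  "jet_at y = (fst (fst (shear (y, 0))), snd (fst (shear (y, 0))), P (shear (y, 0)))"

text \<open>The sign of the Morse point is left open here. The last two conclusions tie it to
  whether the base point is isolated among the critical points of the dual projection, which is what
  the normal forms of types 3 and 4 reveal.\<close>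

lemma morse_transition:
  assumes A: "\<And>t. bde A t = (\<lambda>m. F (slice t m))"
    and I0: "I w0 = 0" and J0: "J w0 = 0" and D0: "jdet F w0 = 0" and K0: "K w0 \<noteq> 0"
    and Ie: "dd dE I w0 * Fq w0 \<noteq> dd dP I w0 * Fe w0"
    and det: "K w0 * (dd dY (jdet F) w0 * Fq w0 - dd dP (jdet F) w0 * Fy w0) \<noteq> (dd dY J w0 * Fq w0 - dd dP J
        w0 * Fy w0)\<^sup>2"
  obtains s where "s = 1 \<or> s = -1" "two_born_or_die (\<lambda>t. bi_inflections (bde A t)) (x0, y0) e"
    "families_equiv (\<lambda>t. inflection_curve (bde A t)) (x0, y0) e (\<lambda>t. {(x, y). x\<^sup>2 + s *
        y\<^sup>2 - t = 0}) (0, 0) 0"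
    "\<And>N. s = -1 \<Longrightarrow> open N \<Longrightarrow> (x0, y0, p0) \<in> N \<Longrightarrow>
        \<exists>u\<in>N. u \<noteq> (x0, y0, p0) \<and> bde A e u = 0 \<and> fibre_deriv (bde A e) u = 0"
    "s = 1 \<Longrightarrow> \<exists>N. open N \<and> (x0, y0, p0) \<in> N \<and> (\<forall>u\<in>N. bde A e u = 0
        \<and> fibre_deriv (bde A e) u = 0 \<longrightarrow> u = (x0, y0, p0))"
proof -
  let ?z0 = "((x0, y0), e)" let ?O = "((0, 0), 0) :: plane \<times> real"
  define G where "G w = lift I (shear w)" for w
  define Jt where "Jt w = lift J (shear w)" for w
  define M where "M w = - dd dP I (shear w, P (shear w)) / Fq (shear w, P (shear w))" for w
  have sG: "smooth_on NV G" and sJt: "smooth_on NV Jt" and sM: "smooth_on NV M"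
    unfolding G_def Jt_def M_def by (intro s_hat s_lift sI sJ s_quot)+
  have id: "dd eu G w + (P (shear w) - p0) * dd ev G w = Jt w + M w * G w" if "w \<in> NV" for w
    using hat_identity[OF sI that] by (simp add: G_def[abs_def] Jt_def M_def)
  have P00: "P (shear ?O) - p0 = 0" by (simp add: shear_0 P0)
  have Fq0: "Fq w0 \<noteq> 0" using Fp[OF z0] P0 by simp
  have G0: "G ?O = 0" and Jt0: "Jt ?O = 0" using I0 J0 by (simp_all add: G_def Jt_def lift_def shear_0 P0)
  have Gv: "dd ev G ?O = 0"
    using D0 unfolding G_def dd_hat(2)[OF s_lift[OF sI] NV0] shear_0 dd_lift_y(1)[OF sI] by (simp add: jdet_def)
  have Gu: "dd eu G ?O = 0" using id[OF NV0] P00 G0 Jt0 by simp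
  have Ge: "dd ee G ?O \<noteq> 0"
    using Ie Fq0 unfolding G_def dd_hat(3)[OF s_lift[OF sI] NV0] shear_0 dd_lift_y(2)[OF sI] by simp
  have Ju: "dd eu Jt ?O = K w0"
    using hat_identity[OF sJ NV0] P00 G0 unfolding Jt_def by (simp add: G_def lift_def shear_0 P0)
  have Jv: "dd ev Jt ?O = (dd dY J w0 * Fq w0 - dd dP J w0 * Fy w0) / Fq w0"
    unfolding Jt_def dd_hat(2)[OF s_lift[OF sJ] NV0] shear_0 dd_lift_y(1)[OF sJ] ..
  have Gvv: "dd ev (dd ev G) ?O = (dd dY (jdet F) w0 * Fq w0 - dd dP (jdet F) w0 * Fy w0) / (Fq w0)\<^sup>2"
  proof -
    have sq: "smooth_on UNIV Fq" and sD: "smooth_on UNIV (jdet F)"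
      by (intro smooth_on_dd sF smooth_on_jdet)+
    have sGy: "smooth_on V (dd ev (lift I))" by (rule smooth_on_dd[OF s_lift[OF sI]])
    have "dd ev (dd ev G) ?O = dd ev (\<lambda>w. dd ev (lift I) (shear w)) ?O"
      by (rule dd_cong_open[OF opNV _ NV0]) (simp add: G_def[abs_def] dd_hat(2)[OF s_lift[OF sI]])
    also have "\<dots> = dd ev (dd ev (lift I)) ?z0" unfolding dd_hat(2)[OF sGy NV0] shear_0 ..
    finally have 1: "dd ev (dd ev G) ?O = dd ev (dd ev (lift I)) ?z0" .
    \<comment> \<open>This product rule yields the second derivative of \<open>I\<close> along the
      surface from the first derivative of \<open>jdet F\<close>: at the base point the factor
      \<open>dd ev (lift I)\<close> vanishes.\<close>
    have "dd ev (lift I) z * lift Fq z = lift (jdet F) z" if "z \<in> V" for z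
      using Fp[OF that] unfolding dd_lift[OF sI that] by (simp add: lift_def jdet_def field_simps)
    then have "dd ev (\<lambda>z. dd ev (lift I) z * lift Fq z) ?z0 = dd ev (lift (jdet F)) ?z0"
      by (intro dd_cong_open[OF opV _ z0])
    moreover have "dd ev (\<lambda>z. dd ev (lift I) z * lift Fq z) ?z0 =
        dd ev (lift I) ?z0 * dd ev (lift Fq) ?z0 + dd ev (dd ev (lift I)) ?z0 * lift Fq ?z0"
      by (rule dd_mult) (use smooth_on_differentiable[OF _ z0] sGy s_lift[OF sq] in blast)+
    moreover have "dd ev (lift I) ?z0 = 0" using D0 unfolding dd_lift_y(1)[OF sI] by (simp add: jdet_def)
    moreover have "lift Fq ?z0 = Fq w0" by (simp add: lift_def P0)
    ultimately have "dd ev (dd ev (lift I)) ?z0 * Fq w0 = dd ev (lift (jdet F)) ?z0" by simp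
    then show ?thesis unfolding 1 dd_lift_y(1)[OF sD] using Fq0 by (simp add: field_simps power2_eq_square)
  qed
  have "K w0 * (dd dY (jdet F) w0 * Fq w0 - dd dP (jdet F) w0 * Fy w0) / (Fq w0)\<^sup>2
      \<noteq> (dd dY J w0 * Fq w0 - dd dP J w0 * Fy w0)\<^sup>2 / (Fq w0)\<^sup>2"
    using det Fq0 by simp
  then have det': "dd eu Jt ?O * dd ev (dd ev G) ?O \<noteq> (dd ev Jt ?O)\<^sup>2"
    unfolding Ju Jv Gvv by (simp add: power_divide)
  have Ju0: "dd eu Jt ?O \<noteq> 0" using Ju K0 by simp
  obtain \<Phi> N' s1 s2 where \<Phi>: "local_diffeo \<Phi> (0, 0)" "\<Phi> (0, 0) = (0, 0)" and N': "open N'" "?O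
      \<in> N'"
    and s1: "s1 \<in> {1, -1}" and s2: "s2 \<in> {1, -1}"
    and zero: "\<And>y t. (y, t) \<in> N' \<Longrightarrow> G (y, t) = 0 \<longleftrightarrow> t = s1 * (fst
        (\<Phi> y))\<^sup>2 + s2 * (snd (\<Phi> y))\<^sup>2"
    and fold: "fold_at {w. G w = 0 \<and> Jt w = 0} ?O"
    by (rule morse_family[OF sG sJt s_Phat sM NV0 id P00 G0 Gu Gv Ge Ju0 det']) (assumption, (rule that; assumption))
  \<comment> \<open>Multiplying t = s1 X^2 + s2 Y^2 by s1 leaves the sign s1 on the parameter, where
    a reversal of orientation is permitted.\<close>
  define s where "s = s1 * s2"
  have s: "s = 1 \<or> s = -1" "s1 * s1 = 1" using s1 s2 by (auto simp: s_def)
  have "fold_at {w. fst w \<in> bi_inflections (bde A (snd w))} ?z0"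
  proof (rule fold_at_shear[of "\<lambda>w. lift I w = 0 \<and> lift J w = 0", OF _ opV z0])
    show "fold_at {w. lift I (shear w) = 0 \<and> lift J (shear w) = 0} ?O" using fold by (simp add: G_def Jt_def)
    show "lift I w = 0 \<and> lift J w = 0 \<longleftrightarrow> w \<in> {w. fst w \<in> bi_inflections (bde A (snd
        w))}" if "w \<in> V" for w
      using char_inflection(2)[OF A, of "fst (fst w)" "snd (fst w)" "snd w"] that by simp
  qed
  then have born: "two_born_or_die (\<lambda>t. bi_inflections (bde A t)) (x0, y0) e" by (rule fold_at_two_born_or_die)
  define N where "N = V \<inter> {w \<in> UNIV. unshear w \<in> N'}"
  have N: "open N" "?z0 \<in> N" unfolding N_def
    using opV open_smooth_vimage[OF s_unshear N'(1)] z0 N'(2) unshear_0 by auto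
  have zero': "lift I w = 0 \<longleftrightarrow> (fst (\<Phi> (fst (unshear w))))\<^sup>2 + s * (snd (\<Phi> (fst
      (unshear w))))\<^sup>2 - s1 * snd (unshear w) = 0"
    if "w \<in> N" for w
  proof -
    obtain y t where u: "unshear w = (y, t)" by (cases "unshear w")
    then have w: "w = shear (y, t)" using shear_unshear[of w] by simp
    have "lift I w = 0 \<longleftrightarrow> t = s1 * (fst (\<Phi> y))\<^sup>2 + s2 * (snd (\<Phi> y))\<^sup>2"
      using zero[of y t] that u w by (simp add: N_def G_def)
    also have "\<dots> \<longleftrightarrow> (fst (\<Phi> y))\<^sup>2 + s * (snd (\<Phi> y))\<^sup>2 - s1 * t = 0"
      using s1 s2 by (auto simp: s_def)
    finally show ?thesis by (simp add: u)
  qed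
  define \<Psi> where "\<Psi> w = (\<Phi> (fst (unshear w)), s1 * snd (unshear w))" for w
  have fam: "families_equiv (\<lambda>t. inflection_curve (bde A t)) (x0, y0) e (\<lambda>t. {(x, y). x\<^sup>2 + s
      * y\<^sup>2 - t = 0}) (0, 0) 0"
  proof (rule families_equivI[where \<Psi>=\<Psi> and \<tau>="\<lambda>t. s1 * (t - e)", OF _ _ _ N])
    have a: "local_diffeo unshear ?z0" by (rule local_diffeo_global[OF s_unshear s_shear]) auto
    have b: "local_diffeo (\<lambda>t. s1 * t) 0"
      by (rule local_diffeo_global[of _ "\<lambda>t. s1 * t"])
        (use s(2) in \<open>auto intro!: smooth_intros simp: mult.assoc[symmetric]\<close>)
    show "local_diffeo \<Psi> ?z0"
      using local_diffeo_compose[OF a, of "\<lambda>w. (\<Phi> (fst w), s1 * snd w)"] local_diffeo_prod[OF \<Phi>(1) b]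
      by (simp add: unshear_0 \<Psi>_def[abs_def])
    show "\<Psi> ?z0 = ((0, 0), 0)" by (simp add: \<Psi>_def unshear_0 \<Phi>(2))
    show "snd (\<Psi> w) = s1 * (snd w - e)" for w by (simp add: \<Psi>_def unshear_def)
    show "fst w \<in> inflection_curve (bde A (snd w)) \<longleftrightarrow> fst (\<Psi> w) \<in> {(x, y).
        x\<^sup>2 + s * y\<^sup>2 - snd (\<Psi> w) = 0}"
      if "w \<in> N" for w
    proof -
      have "fst w \<in> inflection_curve (bde A (snd w)) \<longleftrightarrow> lift I w = 0"
        using char_inflection(1)[OF A, of "fst (fst w)" "snd (fst w)" "snd w"] that by (simp add: N_def)
      also note zero'[OF that]
      finally show ?thesis by (simp add: \<Psi>_def case_prod_beta)
    qed
  qed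
  have f: "bde A e (x, y, p) = F (((x, y), e), p)" "fibre_deriv (bde A e) (x, y, p) = I (((x, y), e), p)" for x y p
    unfolding A fibre_deriv_slice[OF sF] by (simp_all add: slice_def)
  have non_isolated: "\<exists>u\<in>O'. u \<noteq> (x0, y0, p0) \<and> bde A e u = 0 \<and> fibre_deriv (bde A e)
      u = 0"
    if sm: "s = -1" and O': "open O'" "(x0, y0, p0) \<in> O'" for O'
  proof -
    have spair: "smooth_on UNIV (\<lambda>y. shear (y, 0))"
      by (rule smooth_on_compose[OF s_shear]) (auto intro!: smooth_intros)
    define Y where "Y = {y \<in> UNIV. shear (y, 0) \<in> N}"
    have opY: "open Y" unfolding Y_def by (rule open_smooth_vimage[OF spair N(1)])
    have sh: "smooth_on Y (\<lambda>y. shear (y, 0))" by (rule smooth_on_subset[OF spair opY]) simp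
    have "smooth_on Y jet_at" unfolding jet_at_def
      by (intro smooth_intros sh smooth_on_compose[OF sP]) (auto simp: Y_def N_def)
    then have opY': "open {y \<in> Y. jet_at y \<in> O'}" using O'(1) by (rule open_smooth_vimage)
    have in0: "(0, 0) \<in> {y \<in> Y. jet_at y \<in> O'}" using N(2) O'(2) by (simp add: Y_def jet_at_def shear_0 P0)
    obtain U where U: "(0, 0) \<in> U" "U \<subseteq> {y \<in> Y. jet_at y \<in> O'}" "open (\<Phi> ` U)"
      by (rule local_diffeo_diffeo_between[OF \<Phi>(1) opY' in0]) (rule that; assumption)
    have "(0, 0) \<in> \<Phi> ` U" using U(1) \<Phi>(2) by force
    then obtain r where r: "r > 0" "ball (0, 0) r \<subseteq> \<Phi> ` U" using U(3) openE by blast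
    \<comment> \<open>For s = -1 the point (r / 3, r / 3) lies on X^2 = Y^2 at parameter 0; the
      divisor 3 keeps it inside the ball.\<close>
    have "sqrt ((r / 3)\<^sup>2 + (r / 3)\<^sup>2) \<le> \<bar>r / 3\<bar> + \<bar>r / 3\<bar>" by (rule
        sqrt_sum_squares_le_sum_abs)
    then have "dist (0, 0) (r / 3, r / 3) < r" using r(1) by (simp add: dist_Pair_Pair dist_real_def)
    then have "(r / 3, r / 3) \<in> \<Phi> ` U" by (intro subsetD[OF r(2)]) simp
    then obtain y where y: "y \<in> U" "\<Phi> y = (r / 3, r / 3)" by force
    then have yN: "shear (y, 0) \<in> N" "jet_at y \<in> O'" using U(2) by (auto simp: Y_def)
    have "lift I (shear (y, 0)) = 0" using zero'[OF yN(1)] y(2) sm by simp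
    then have I1: "I (shear (y, 0), P (shear (y, 0))) = 0" by (simp add: lift_def)
    have "shear (y, 0) \<in> V" using yN by (simp add: N_def)
    then have F1: "F (shear (y, 0), P (shear (y, 0))) = 0" using roots by blast
    have zeq: "shear (y, 0) = ((fst (fst (shear (y, 0))), snd (fst (shear (y, 0)))), e)"
      by (simp add: shear_def)
    have "bde A e (jet_at y) = 0 \<and> fibre_deriv (bde A e) (jet_at y) = 0"
      unfolding jet_at_def f zeq[symmetric] using F1 I1 by simp
    moreover have "jet_at y \<noteq> (x0, y0, p0)"
    proof
      assume "jet_at y = (x0, y0, p0)"
      then have "y = (0, 0)" by (auto simp: jet_at_def shear_def prod_eq_iff)
      then show False using y(2) \<Phi>(2) r(1) by simp
    qed
    ultimately show ?thesis using yN(2) by blast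
  qed
  have isolated: "\<exists>N. open N \<and> (x0, y0, p0) \<in> N \<and> (\<forall>u\<in>N. bde A e u = 0 \<and>
      fibre_deriv (bde A e) u = 0 \<longrightarrow> u = (x0, y0, p0))"
    if sp: "s = 1"
  proof -
    obtain U where U: "(0, 0) \<in> U" "open U" "diffeo_between U (\<Phi> ` U) \<Phi>"
      by (rule local_diffeo_diffeo_between[OF \<Phi>(1) open_UNIV UNIV_I]) (rule that; assumption)
    have inj: "inj_on \<Phi> U" using U(3) by (simp add: diffeo_between_def bij_betw_def)
    define zz where "zz u = ((fst u, fst (snd u)), e)" for u :: jet
    have szz: "smooth_on UNIV zz" unfolding zz_def by (intro smooth_intros open_UNIV)
    define N2 where "N2 = N \<inter> {w \<in> UNIV. unshear w \<in> U \<times> UNIV}"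
    have opN2: "open N2" unfolding N2_def
      by (intro open_Int N open_smooth_vimage[OF s_unshear] open_Times U open_UNIV)
    define B where "B = {u \<in> UNIV. zz u \<in> N2}"
    have opB: "open B" unfolding B_def by (rule open_smooth_vimage[OF szz opN2])
    have szB: "smooth_on B zz" by (rule smooth_on_subset[OF szz opB]) simp
    \<comment> \<open>The distance, with sign, of the p-coordinate from the second root; where it is
      nonzero a zero of \<open>F\<close> lies on the branch p = P.\<close>
    define r where "r u = snd (snd u) - (lift snd (zz u) - 2 * lift Fq (zz u) / lift (dd dP Fq) (zz u))" for u :: jet
    have sl: "smooth_on B (\<lambda>u. lift h (zz u))" if "smooth_on UNIV h" for h
      by (rule smooth_on_compose[OF s_lift[OF that] szB]) (auto simp: B_def N2_def N_def)
    have "smooth_on B r" unfolding r_def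
      by (intro smooth_intros sl smooth_on_dd sF opB smooth_on_bounded_linear[OF open_UNIV bounded_linear_snd])
        (use Fpp in \<open>auto simp: B_def N2_def N_def lift_def\<close>)
    then have opR: "open {u \<in> B. r u \<in> - {0}}" by (rule open_smooth_vimage) auto
    show ?thesis
    proof (intro exI[of _ "{u \<in> B. r u \<in> - {0}}"] conjI opR ballI impI)
      have "zz (x0, y0, p0) = ?z0" by (simp add: zz_def)
      then show "(x0, y0, p0) \<in> {u \<in> B. r u \<in> - {0}}"
        using N(2) U(1) unshear_0 Fp[OF z0] Fpp[OF z0] by (simp add: B_def N2_def r_def lift_def P0)
      fix u assume u: "u \<in> {u \<in> B. r u \<in> - {0}}" and fu: "bde A e u = 0 \<and> fibre_deriv (bde A e) u = 0"
      have ueq: "u = (fst u, fst (snd u), snd (snd u))" by simp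
      have uN: "zz u \<in> N" "unshear (zz u) \<in> U \<times> UNIV" "r u \<noteq> 0" using u by (auto simp: B_def
          N2_def)
      then have uV: "zz u \<in> V" by (simp add: N_def)
      have FI: "F (zz u, snd (snd u)) = 0" "I (zz u, snd (snd u)) = 0"
        using fu f[of "fst u" "fst (snd u)" "snd (snd u)"] by (simp_all add: zz_def)
      have p: "snd (snd u) = P (zz u)" using roots[OF uV] FI(1) uN(3) by (auto simp: r_def lift_def)
      then have "lift I (zz u) = 0" using FI(2) by (simp add: lift_def)
      moreover have "snd (unshear (zz u)) = 0" by (simp add: zz_def unshear_def)
      ultimately have "\<Phi> (fst (unshear (zz u))) = (0, 0)"
        using zero'[OF uN(1)] sp by (simp add: prod_eq_iff sum_power2_eq_zero_iff)
      then have "fst (unshear (zz u)) = (0, 0)"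
        using inj_onD[OF inj, of "fst (unshear (zz u))" "(0, 0)"] uN(2) U(1) \<Phi>(2) by (auto simp: mem_Times_iff)
      then have "fst u = x0" "fst (snd u) = y0" by (auto simp: zz_def unshear_def)
      moreover from this have "snd (snd u) = p0" using p P0 by (simp add: zz_def)
      ultimately show "u = (x0, y0, p0)" using ueq by simp
    qed
  qed
  show ?thesis by (rule that[OF s(1) born fam non_isolated isolated])
qed

text \<open>Since \<open>jdet F\<close> is nonzero, \<open>lift I\<close> has nonzero y-derivative.
  It can serve as second coordinate, which straightens the curve of inflections for all parameters
  at once.\<close>

lemma swallowtail_chart:
  assumes A: "\<And>t. bde A t = (\<lambda>m. F (slice t m))"
    and I0: "I w0 = 0" and J0: "J w0 = 0" and K0: "K w0 = 0" and D0: "jdet F w0 \<noteq> 0" and L0: "xi K w0 \<noteq> 0"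
    and det: "jdet F w0 * (dd dE J w0 * Fq w0 - dd dP J w0 * Fe w0)
      \<noteq> (dd dE I w0 * Fq w0 - dd dP I w0 * Fe w0) * (dd dY J w0 * Fq w0 - dd dP J w0 * Fy w0)"
  shows "swallowtail_transition A (x0, y0) e"
proof -
  let ?z0 = "((x0, y0), e)" let ?O = "((0, 0), 0) :: plane \<times> real"
  define G where "G w = lift I (shear w)" for w
  define Jt where "Jt w = lift J (shear w)" for w
  define Kt where "Kt w = lift K (shear w)" for w
  define M where "M h w = - dd dP h (shear w, P (shear w)) / Fq (shear w, P (shear w))" for h w
  have sG: "smooth_on NV G" and sJt: "smooth_on NV Jt" and sKt: "smooth_on NV Kt"
    unfolding G_def Jt_def Kt_def by (intro s_hat s_lift sI sJ sK)+
  have id: "dd eu G w + (P (shear w) - p0) * dd ev G w = Jt w + M I w * G w"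
    "dd eu Jt w + (P (shear w) - p0) * dd ev Jt w = Kt w + M J w * G w" if "w \<in> NV" for w
    using hat_identity[OF sI that] hat_identity[OF sJ that] by (simp_all add: G_def[abs_def] Jt_def[abs_def] Kt_def
        M_def)
  have P00: "P (shear ?O) - p0 = 0" by (simp add: shear_0 P0)
  have Fq0: "Fq w0 \<noteq> 0" using Fp[OF z0] P0 by simp
  have G0: "G ?O = 0" "Jt ?O = 0" "Kt ?O = 0" using I0 J0 K0 by (simp_all add: G_def Jt_def Kt_def lift_def shear_0 P0)
  have Gv': "dd ev (lift I) ?z0 = jdet F w0 / Fq w0" unfolding dd_lift_y(1)[OF sI] by (simp add: jdet_def)
  have Gv: "dd ev G ?O = jdet F w0 / Fq w0"
    unfolding G_def dd_hat(2)[OF s_lift[OF sI] NV0] shear_0 by (rule Gv')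
  have Ge: "dd ee G ?O = (dd dE I w0 * Fq w0 - dd dP I w0 * Fe w0) / Fq w0"
    unfolding G_def dd_hat(3)[OF s_lift[OF sI] NV0] shear_0 dd_lift_y(2)[OF sI] by simp
  have Je: "dd ee Jt ?O = (dd dE J w0 * Fq w0 - dd dP J w0 * Fe w0) / Fq w0"
    unfolding Jt_def dd_hat(3)[OF s_lift[OF sJ] NV0] shear_0 dd_lift_y(2)[OF sJ] by simp
  have Jv: "dd ev Jt ?O = (dd dY J w0 * Fq w0 - dd dP J w0 * Fy w0) / Fq w0"
    unfolding Jt_def dd_hat(2)[OF s_lift[OF sJ] NV0] shear_0 dd_lift_y(1)[OF sJ] ..
  have Ku: "dd eu Kt ?O \<noteq> 0"
    using hat_identity[OF sK NV0] P00 G0 L0 unfolding Kt_def by (simp add: G_def lift_def shear_0 P0)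
  have Gv0: "dd ev G ?O \<noteq> 0" using Gv D0 Fq0 by simp
  have det': "dd ev G ?O * dd ee Jt ?O \<noteq> dd ee G ?O * dd ev Jt ?O"
    unfolding Gv Ge Je Jv using det Fq0 by simp
  have fold: "fold_at {w. G w = 0 \<and> Jt w = 0} ?O"
    by (rule swallowtail_family[OF sG sJt sKt s_Phat NV0 id P00 G0 Gv0 Ku det'])
  have "fold_at {w. fst w \<in> bi_inflections (bde A (snd w))} ?z0"
  proof (rule fold_at_shear[of "\<lambda>w. lift I w = 0 \<and> lift J w = 0", OF _ opV z0])
    show "fold_at {w. lift I (shear w) = 0 \<and> lift J (shear w) = 0} ?O" using fold by (simp add: G_def Jt_def)
    show "lift I w = 0 \<and> lift J w = 0 \<longleftrightarrow> w \<in> {w. fst w \<in> bi_inflections (bde A (snd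
        w))}" if "w \<in> V" for w
      using char_inflection(2)[OF A, of "fst (fst w)" "snd (fst w)" "snd w"] that by simp
  qed
  then have born: "two_born_or_die (\<lambda>t. bi_inflections (bde A t)) (x0, y0) e" by (rule fold_at_two_born_or_die)
  define sw where "sw w = ((fst (fst w), snd w), snd (fst w))" for w :: "plane \<times> real"
  have ssw: "smooth_on UNIV sw" unfolding sw_def by (intro smooth_intros open_UNIV)
  have swsw: "sw (sw w) = w" for w by (simp add: sw_def)
  define VS where "VS = {w \<in> UNIV. sw w \<in> V}"
  have opVS: "open VS" unfolding VS_def by (rule open_smooth_vimage[OF ssw opV])
  have sGS: "smooth_on VS (\<lambda>w. lift I (sw w))"
    by (rule smooth_on_compose[OF s_lift[OF sI] smooth_on_subset[OF ssw opVS]]) (auto simp: VS_def)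
  have swz: "sw ?z0 = ((x0, e), y0)" "sw ((x0, e), y0) = ?z0" by (simp_all add: sw_def)
  have inVS: "((x0, e), y0) \<in> VS" using z0 swz by (simp add: VS_def)
  have "(sw has_derivative sw) (at ((x0, e), y0))"
    unfolding sw_def[abs_def] by (intro has_derivative_Pair has_derivative_fst has_derivative_snd has_derivative_ident)
  from dd_eqI[OF dd_chain[OF _ this, of "lift I"], of "(0, 1)"] smooth_on_differentiable[OF s_lift[OF sI] z0]
  have "dd (0, 1) (\<lambda>w. lift I (sw w)) ((x0, e), y0) = dd ev (lift I) ?z0" by (simp add: swz) (simp add: sw_def)
  then have GS: "dd (0, 1) (\<lambda>w. lift I (sw w)) ((x0, e), y0) \<noteq> 0" using Gv' D0 Fq0 by simp
  \<comment> \<open>Composed of a swap, a change of the last coordinate by \<open>lift I\<close>,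
    and a translation with the swap undone.\<close>
  define \<Psi> where "\<Psi> w = ((fst (fst w) - x0, lift I w), snd w - e)" for w
  define tr where "tr w = ((fst (fst w) - x0, snd w), snd (fst w) - e)" for w :: "plane \<times> real"
  have a: "local_diffeo sw ?z0" by (rule local_diffeo_global[OF ssw ssw swsw swsw])
  have b: "local_diffeo (\<lambda>w. (fst w, lift I (sw w))) (sw ?z0)"
    unfolding swz by (rule local_diffeo_snd[OF sGS inVS GS])
  have c: "local_diffeo tr w" for w
    by (rule local_diffeo_global[of _ "\<lambda>w. ((fst (fst w) + x0, snd w + e), snd (fst w))"])
      (auto simp: tr_def[abs_def] intro!: smooth_intros)
  have ab: "local_diffeo (\<lambda>w. (fst (sw w), lift I w)) ?z0"
    using local_diffeo_compose[OF a b] by (simp add: swsw)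
  have "local_diffeo \<Psi> ?z0"
    using local_diffeo_compose[OF ab c] by (simp add: tr_def sw_def \<Psi>_def[abs_def])
  then have "families_equiv (\<lambda>t. inflection_curve (bde A t)) (x0, y0) e (\<lambda>t. {(x, y). y = 0}) (0, 0) 0"
  proof (rule families_equivI[where \<tau>="\<lambda>t. t - e", OF _ _ _ opV z0])
    show "\<Psi> ?z0 = ((0, 0), 0)" using I0 by (simp add: \<Psi>_def lift_def P0)
    show "fst w \<in> inflection_curve (bde A (snd w)) \<longleftrightarrow> fst (\<Psi> w) \<in> {(x, y). y = 0}"
        if "w \<in> V" for w
      using char_inflection(1)[OF A, of "fst (fst w)" "snd (fst w)" "snd w"] that by (simp add: \<Psi>_def)
  qed (simp add: \<Psi>_def)
  then show ?thesis unfolding swallowtail_transition_def using born by simp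
qed

end

section \<open>Nondegeneracy conditions\<close>

type_synonym jet_operator = "(jet_family \<Rightarrow> real) \<Rightarrow> jet_family \<Rightarrow> real"

text \<open>Up to a nonzero factor, the value of the cubic \<open>xi F\<close> at the second root of the quadratic
  \<open>F\<close>.\<close>

definition other_root_inflection :: jet_operator where
  "other_root_inflection F w = dd dP (xi F) w * (dd dP (dd dP F) w)\<^sup>2
     - dd dP (dd dP (xi F)) w * dd dP F w * dd dP (dd dP F) w
     + 2 / 3 * dd dP (dd dP (dd dP (xi F))) w * (dd dP F w)\<^sup>2"

text \<open>By \<open>dd_lift_y\<close> this is F_p times the y-derivative of T F along the surface
  p = P; \<open>parameter_det\<close> is the same with the parameter in place of y.\<close>

definition tangential_det :: "jet_operator \<Rightarrow> jet_operator" where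
  "tangential_det T F w = dd dY (T F) w * dd dP F w - dd dP (T F) w * dd dY F w"

definition parameter_det :: "jet_operator \<Rightarrow> jet_operator" where
  "parameter_det T F w = dd dE (T F) w * dd dP F w - dd dP (T F) w * dd dE F w"

text \<open>At a critical zero of \<open>xi F\<close> on the surface this is F_p^2 times the
  determinant required in \<open>morse_family\<close>.\<close>

definition hessian_det :: jet_operator where
  "hessian_det F w = xi (xi (xi F)) w * tangential_det jdet F w - (tangential_det (\<lambda>F. xi (xi F)) F w)\<^sup>2"

text \<open>F_p^2 times the Jacobian with respect to (y, \<epsilon>) of \<open>xi F\<close> and
  \<open>xi (xi F)\<close> restricted to the surface, as required in
  \<open>swallowtail_family\<close>.\<close>

definition versality_det :: jet_operator where
  "versality_det F w = jdet F w * parameter_det (\<lambda>F. xi (xi F)) F w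
     - parameter_det xi F w * tangential_det (\<lambda>F. xi (xi F)) F w"

text \<open>A quadruple \<open>(E1, E2, B1, B2)\<close> stands for the five equations \<open>F = xi F = xi (xi F) = E1 = E2
  = 0\<close> in the four variables \<open>(x, y, \<epsilon>, p)\<close>. They are independent only where \<open>B1\<close> and \<open>B2\<close> do not
  vanish; the zeros of \<open>B1\<close> and \<open>B2\<close> are covered by other quadruples.\<close>

definition degeneracies :: "(jet_operator \<times> jet_operator \<times> jet_operator \<times> jet_operator) set" where
  "degeneracies = (let one = (\<lambda>F w. 1); Fp = dd dP; Fpp = (\<lambda>F. dd dP (dd dP F)); K = (\<lambda>F.
      xi (xi (xi F))) in
    {(Fp, dd dY, one, one), (Fp, \<lambda>F. dd dP (xi F), one, one), (Fp, K, one, one),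
     (K, \<lambda>F. xi (xi (xi (xi F))), one, one), (K, Fpp, one, one),
     (jdet, K, Fp, one), (jdet, hessian_det, Fp, K), (jdet, parameter_det xi, Fp, one),
     (jdet, Fpp, Fp, one), (jdet, other_root_inflection, Fp, Fpp),
     (K, versality_det, Fp, jdet), (K, other_root_inflection, Fp, Fpp)})"

definition generic_family :: "(jet_family \<Rightarrow> real) \<Rightarrow> bool" where
  "generic_family F \<longleftrightarrow> (\<forall>(E1, E2, B1, B2) \<in> degeneracies. \<forall>w. \<not> (F w =
      0 \<and> xi F w = 0 \<and> xi (xi F) w = 0 \<and>
     E1 F w = 0 \<and> E2 F w = 0 \<and> B1 F w \<noteq> 0 \<and> B2 F w \<noteq> 0))"

text \<open>Differentiating the quadratic in x and y and multiplying by p gives degree three in p,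
  so the Taylor formula of order three is exact.\<close>

lemma xi_F4_cubic:
  assumes A: "smooth_on UNIV A"
  shows "xi (F4 A) (z, p + d) = xi (F4 A) (z, p) + dd dP (xi (F4 A)) (z, p) * d
    + dd dP (dd dP (xi (F4 A))) (z, p) * d\<^sup>2 / 2 + dd dP (dd dP (dd dP (xi (F4 A)))) (z, p) * d ^ 3 / 6"
proof -
  define B where "B z = (dd eu A z, dd ev A z)" for z
  have sB: "smooth_on UNIV B" unfolding B_def by (intro smooth_intros smooth_on_dd A)
  have D: "dd (v, 0) (F4 A) w = dd v A (fst w) \<bullet> (1, 2 * snd w, (snd w)\<^sup>2)" for v w
  proof -
    have Ad: "A differentiable (at (fst w))" using smooth_on_differentiable[OF A] by simp
    have "((\<lambda>p. (1, 2 * p, p\<^sup>2)) has_derivative (\<lambda>h. (0, 2 * h, 2 * snd w * h))) (at (snd w))"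
      by (auto intro!: derivative_eq_intros)
    then have "((\<lambda>w. (1, 2 * snd w, (snd w)\<^sup>2)) has_derivative (\<lambda>v. (0, 2 * snd v, 2 * snd w
        * snd v))) (at w)"
      by (auto intro!: derivative_eq_intros)
    from dd_eqI[OF has_derivative_inner[OF dd_chain[OF Ad has_derivative_fst[OF has_derivative_ident]] this], of
        "(v, 0)"]
    show ?thesis by (simp add: F4_def[abs_def] zero_prod_def[symmetric])
  qed
  have 0: "xi (F4 A) = (\<lambda>w. B (fst w) \<bullet> ((1, 2 * snd w, (snd w)\<^sup>2), (snd w, 2 * (snd
      w)\<^sup>2, (snd w) ^ 3)))"
    by (auto simp: fun_eq_iff xi_def D B_def inner_prod_def algebra_simps power2_eq_square power3_eq_cube)
  have 1: "dd dP (xi (F4 A)) = (\<lambda>w. B (fst w) \<bullet> ((0, 2, 2 * snd w), (1, 4 * snd w, 3 * (snd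
      w)\<^sup>2)))"
  proof
    fix w :: jet_family
    have "((\<lambda>p. ((1, 2 * p, p\<^sup>2), (p, 2 * p\<^sup>2, p ^ 3))) has_vector_derivative ((0, 2, 2 * snd
        w), (1, 4 * snd w, 3 * (snd w)\<^sup>2))) (at (snd w))"
      unfolding has_vector_derivative_def
      by (auto intro!: derivative_eq_intros simp: zero_prod_def)
    from dd_dP_inner[OF sB this] show "dd dP (xi (F4 A)) w = B (fst w) \<bullet> ((0, 2, 2 * snd w), (1, 4 * snd w,
        3 * (snd w)\<^sup>2))"
      unfolding 0 .
  qed
  have 2: "dd dP (dd dP (xi (F4 A))) = (\<lambda>w. B (fst w) \<bullet> ((0, 0, 2), (0, 4, 6 * snd w)))"
  proof
    fix w :: jet_family
    have "((\<lambda>p. ((0, 2, 2 * p), (1, 4 * p, 3 * p\<^sup>2))) has_vector_derivative ((0, 0, 2), (0, 4, 6 *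
        snd w))) (at (snd w))"
      unfolding has_vector_derivative_def
      by (auto intro!: derivative_eq_intros simp: zero_prod_def)
    from dd_dP_inner[OF sB this] show "dd dP (dd dP (xi (F4 A))) w = B (fst w) \<bullet> ((0, 0, 2), (0, 4, 6 * snd w))"
      unfolding 1 .
  qed
  have 3: "dd dP (dd dP (dd dP (xi (F4 A)))) = (\<lambda>w. B (fst w) \<bullet> ((0, 0, 0), (0, 0, 6)))"
  proof
    fix w :: jet_family
    have "((\<lambda>p. ((0, 0, 2), (0, 4, 6 * p))) has_vector_derivative ((0, 0, 0), (0, 0, 6))) (at (snd w))"
      unfolding has_vector_derivative_def
      by (auto intro!: derivative_eq_intros simp: zero_prod_def)
    from dd_dP_inner[OF sB this] show "dd dP (dd dP (dd dP (xi (F4 A)))) w = B (fst w) \<bullet> ((0, 0, 0), (0, 0, 6))"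
      unfolding 2 .
  qed
  show ?thesis unfolding 3 unfolding 2 unfolding 1 unfolding 0
    by (simp add: inner_prod_def algebra_simps power2_eq_square power3_eq_cube)
qed

lemma other_root_inflection_iff:
  assumes A: "smooth_on UNIV A" and F: "F = F4 A"
    and I: "xi F (z, p) = 0" and Fp: "dd dP F (z, p) \<noteq> 0" and Fpp: "dd dP (dd dP F) (z, p) \<noteq> 0"
  shows "xi F (z, p - 2 * dd dP F (z, p) / dd dP (dd dP F) (z, p)) = 0 \<longleftrightarrow> other_root_inflection
      F (z, p) = 0"
proof -
  have alg: "a * (- 2 * f / g) + b * (- 2 * f / g)\<^sup>2 / 2 + c * (- 2 * f / g) ^ 3 / 6
      = - 2 * f / g ^ 3 * (a * g\<^sup>2 - b * f * g + 2 / 3 * c * f\<^sup>2)" if "g \<noteq> 0" for a b c f g :: real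
    using that by (simp add: field_simps power2_eq_square power3_eq_cube)
  have "xi F (z, p + (- 2 * dd dP F (z, p) / dd dP (dd dP F) (z, p)))
      = - 2 * dd dP F (z, p) / dd dP (dd dP F) (z, p) ^ 3 * other_root_inflection F (z, p)"
    unfolding F xi_F4_cubic[OF A] unfolding F[symmetric] I other_root_inflection_def
    using alg[OF Fpp, of "dd dP (xi F) (z, p)" "dd dP F (z, p)" "dd dP (dd dP (xi F)) (z, p)" "dd dP (dd dP (dd dP
        (xi F))) (z, p)"]
    by simp
  then show ?thesis using Fp Fpp by simp
qed

text \<open>The implicit function theorem gives one root of the quadratic, and the vanishing of the
  other factor gives the second. All further conditions hold at the base point and are open, so the
  neighbourhood is shrunk until they hold throughout.\<close>

lemma jet_chart_exists:
  assumes A: "smooth_on UNIV A" and F: "F = F4 A" and F0: "F (((x0, y0), e), p0) = 0"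
    and I0: "xi F (((x0, y0), e), p0) = 0" and Fp0: "dd dP F (((x0, y0), e), p0) \<noteq> 0"
    and Fpp0: "dd dP (dd dP F) (((x0, y0), e), p0) \<noteq> 0"
    and oth: "other_root_inflection F (((x0, y0), e), p0) \<noteq> 0"
  shows "\<exists>P V. jet_chart F x0 y0 e p0 P V"
proof -
  let ?z0 = "((x0, y0), e)"
  have sF: "smooth_on UNIV F" unfolding F by (rule smooth_on_F4[OF A])
  obtain V a P where V: "open V" "?z0 \<in> V" "a > 0" "smooth_on V P" "P ?z0 = p0"
    and Fp: "\<And>y t. y \<in> V \<Longrightarrow> \<bar>t - p0\<bar> < a \<Longrightarrow> dd (0, 1) F (y, t)
        \<noteq> 0"
    and zero: "\<And>y t. y \<in> V \<Longrightarrow> \<bar>t - p0\<bar> < a \<Longrightarrow> F (y, t) = 0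
        \<longleftrightarrow> t = P y"
    and Pa: "\<And>y. y \<in> V \<Longrightarrow> \<bar>P y - p0\<bar> < a"
    and dP: "\<And>y v. y \<in> V \<Longrightarrow> dd v P y = - dd (v, 0) F (y, P y) / dd (0, 1) F (y, P y)"
    by (rule implicit_function[OF sF UNIV_I F0 Fp0]) (rule that; assumption)
  define pl where "pl z = (z, P z)" for z
  have spl: "smooth_on V pl" unfolding pl_def by (intro smooth_intros V)
  have sl: "smooth_on V (\<lambda>z. h (pl z))" if "smooth_on UNIV h" for h :: "jet_family \<Rightarrow> real"
    by (rule smooth_on_compose[OF that spl]) auto
  define V1 where "V1 = {z \<in> V. dd dP (dd dP F) (pl z) \<in> - {0}}"
  have op1: "open V1" unfolding V1_def
    by (rule open_smooth_vimage[OF sl[OF smooth_on_dd[OF smooth_on_dd[OF sF]]]]) auto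
  define p2 where "p2 z = P z - 2 * dd dP F (pl z) / dd dP (dd dP F) (pl z)" for z
  have sub1: "V1 \<subseteq> V" by (auto simp: V1_def)
  have sp2: "smooth_on V1 p2" unfolding p2_def
    by (intro smooth_intros op1 smooth_on_subset[OF V(4) op1 sub1]
        smooth_on_subset[OF sl[OF smooth_on_dd[OF sF]] op1 sub1]
        smooth_on_subset[OF sl[OF smooth_on_dd[OF smooth_on_dd[OF sF]]] op1 sub1]) (simp add: V1_def)
  have "smooth_on V1 (\<lambda>z. xi F (z, p2 z))"
    by (rule smooth_on_compose[OF smooth_on_xi[OF sF]]) (auto intro!: smooth_intros sp2 op1)
  then have op2: "open {z \<in> V1. xi F (z, p2 z) \<in> - {0}}" by (rule open_smooth_vimage) auto
  define V2 where "V2 = {z \<in> V1. xi F (z, p2 z) \<in> - {0}}"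
  have z1: "?z0 \<in> V1" using V(2,5) Fpp0 by (simp add: V1_def pl_def)
  have "xi F (?z0, p2 ?z0) \<noteq> 0"
    using other_root_inflection_iff[OF A F I0 Fp0 Fpp0] oth V(5) by (simp add: p2_def pl_def)
  then have z2: "?z0 \<in> V2" using z1 by (simp add: V2_def)
  have V2D: "z \<in> V" "dd dP (dd dP F) (z, P z) \<noteq> 0" "xi F (z, p2 z) \<noteq> 0" if "z \<in> V2" for z
    using that by (auto simp: V2_def V1_def pl_def)
  have Fp': "dd dP F (z, P z) \<noteq> 0" if "z \<in> V2" for z using Fp[OF V2D(1)[OF that] Pa[OF V2D(1)[OF that]]] .
  have FP: "F (z, P z) = 0" if "z \<in> V2" for z using zero[OF V2D(1)[OF that] Pa[OF V2D(1)[OF that]]] by simp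
  note q = F4_quadratic[OF A, folded F]
  have quad: "F (z, p) = (p - P z) * (dd dP F (z, P z) + dd dP (dd dP F) (z, P z) / 2 * (p - P z))" if "z \<in> V2"
      for z p
  proof -
    have alg: "a * d + b / 2 * d\<^sup>2 = d * (a + b / 2 * d)" for a b d :: real
      by (simp add: algebra_simps power2_eq_square)
    show ?thesis using q(3)[of z p "P z"] FP[OF that] unfolding q(1,2) by (simp only: alg add_0_left)
  qed
  have "jet_chart F x0 y0 e p0 P V2"
  proof
    show "smooth_on UNIV F" by (rule sF)
    show "smooth_on V2 P"
    proof (rule smooth_on_subset[OF V(4)])
      show "open V2" unfolding V2_def by (rule op2)
      show "V2 \<subseteq> V" using V2D(1) by (rule subsetI)
    qed
    show "?z0 \<in> V2" "P ?z0 = p0" by (fact z2 V(5))+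
    fix z assume z: "z \<in> V2"
    show "dd dP F (z, P z) \<noteq> 0" "dd dP (dd dP F) (z, P z) \<noteq> 0" using Fp' V2D z by auto
    show "F (z, p) = 0 \<longleftrightarrow> p = P z \<or> p = P z - 2 * dd dP F (z, P z) / dd dP (dd dP F) (z, P
        z)" for p
    proof -
      have "a + b / 2 * (p - q) = 0 \<longleftrightarrow> p = q - 2 * a / b" if "b \<noteq> 0" for a b q :: real
        using that by (auto simp: field_simps)
      from this[OF V2D(2)[OF z]] show ?thesis unfolding quad[OF z] mult_eq_0_iff by simp
    qed
    show "dd dP F (z, P z - 2 * dd dP F (z, P z) / dd dP (dd dP F) (z, P z)) \<noteq> 0"
    proof -
      \<comment> \<open>The p-derivative is affine in p, so at the second root it takes the opposite
        value.\<close>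
      have "dd dP F (z, p') = dd dP F (z, p) + dd dP (dd dP F) (z, p) * (p' - p)" for p p'
        unfolding q(1,2) by (simp add: inner_prod_def algebra_simps)
      from this[of "P z - 2 * dd dP F (z, P z) / dd dP (dd dP F) (z, P z)" "P z"]
      show ?thesis using Fp'[OF z] V2D(2)[OF z] by simp
    qed
    show "xi F (z, P z - 2 * dd dP F (z, P z) / dd dP (dd dP F) (z, P z)) \<noteq> 0"
      using V2D(3)[OF z] by (simp add: p2_def pl_def)
    show "dd v P z = - dd (v, 0) F (z, P z) / dd dP F (z, P z)" for v using dP[OF V2D(1)[OF z]] .
  qed
  then show ?thesis by blast
qed

lemma generic_familyD:
  assumes "generic_family F" "F w = 0" "xi F w = 0" "xi (xi F) w = 0"
  shows "dd dP F w = 0 \<Longrightarrow> dd dY F w \<noteq> 0" "dd dP F w = 0 \<Longrightarrow> dd dP (xi F) w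
      \<noteq> 0"
    "dd dP F w = 0 \<Longrightarrow> xi (xi (xi F)) w \<noteq> 0" "xi (xi (xi F)) w = 0 \<Longrightarrow> xi (xi
        (xi (xi F))) w \<noteq> 0"
    "xi (xi (xi F)) w = 0 \<Longrightarrow> dd dP (dd dP F) w \<noteq> 0"
    "dd dP F w \<noteq> 0 \<Longrightarrow> jdet F w = 0 \<Longrightarrow> xi (xi (xi F)) w \<noteq> 0"
    "dd dP F w \<noteq> 0 \<Longrightarrow> xi (xi (xi F)) w \<noteq> 0 \<Longrightarrow> jdet F w = 0
        \<Longrightarrow> hessian_det F w \<noteq> 0"
    "dd dP F w \<noteq> 0 \<Longrightarrow> jdet F w = 0 \<Longrightarrow> parameter_det xi F w \<noteq> 0"
    "dd dP F w \<noteq> 0 \<Longrightarrow> jdet F w = 0 \<Longrightarrow> dd dP (dd dP F) w \<noteq> 0"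
    "dd dP F w \<noteq> 0 \<Longrightarrow> dd dP (dd dP F) w \<noteq> 0 \<Longrightarrow> jdet F w = 0
        \<Longrightarrow> other_root_inflection F w \<noteq> 0"
    "dd dP F w \<noteq> 0 \<Longrightarrow> jdet F w \<noteq> 0 \<Longrightarrow> xi (xi (xi F)) w = 0
        \<Longrightarrow> versality_det F w \<noteq> 0"
    "dd dP F w \<noteq> 0 \<Longrightarrow> dd dP (dd dP F) w \<noteq> 0 \<Longrightarrow> xi (xi (xi F)) w = 0
        \<Longrightarrow> other_root_inflection F w \<noteq> 0"
proof -
  have nb: "E1 F w = 0 \<Longrightarrow> E2 F w = 0 \<Longrightarrow> B1 F w \<noteq> 0 \<Longrightarrow> B2 F w
      \<noteq> 0 \<Longrightarrow> False"
    if "(E1, E2, B1, B2) \<in> degeneracies" for E1 E2 B1 B2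
    using assms that unfolding generic_family_def by fast
  let ?one = "\<lambda>(F :: jet_family \<Rightarrow> real) (w :: jet_family). 1 :: real"
  let ?Fpp = "\<lambda>F :: jet_family \<Rightarrow> real. dd dP (dd dP F)" let ?K = "\<lambda>F. xi (xi (xi F))"
  have b: "(dd dP, dd dY, ?one, ?one) \<in> degeneracies" "(dd dP, \<lambda>F. dd dP (xi F), ?one, ?one) \<in>
      degeneracies"
    "(dd dP, ?K, ?one, ?one) \<in> degeneracies" "(?K, \<lambda>F. xi (xi (xi (xi F))), ?one, ?one) \<in> degeneracies"
    "(?K, ?Fpp, ?one, ?one) \<in> degeneracies" "(jdet, ?K, dd dP, ?one) \<in> degeneracies" "(jdet, hessian_det,
        dd dP, ?K) \<in> degeneracies"
    "(jdet, parameter_det xi, dd dP, ?one) \<in> degeneracies" "(jdet, ?Fpp, dd dP, ?one) \<in> degeneracies"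
    "(jdet, other_root_inflection, dd dP, ?Fpp) \<in> degeneracies" "(?K, versality_det, dd dP, jdet) \<in>
        degeneracies"
    "(?K, other_root_inflection, dd dP, ?Fpp) \<in> degeneracies"
    unfolding degeneracies_def Let_def by (intro insertI1 insertI2)+
  show "dd dP F w = 0 \<Longrightarrow> dd dY F w \<noteq> 0" using nb[OF b(1)] by auto
  show "dd dP F w = 0 \<Longrightarrow> dd dP (xi F) w \<noteq> 0" using nb[OF b(2)] by auto
  show "dd dP F w = 0 \<Longrightarrow> xi (xi (xi F)) w \<noteq> 0" using nb[OF b(3)] by auto
  show "xi (xi (xi F)) w = 0 \<Longrightarrow> xi (xi (xi (xi F))) w \<noteq> 0" using nb[OF b(4)] by auto
  show "xi (xi (xi F)) w = 0 \<Longrightarrow> dd dP (dd dP F) w \<noteq> 0" using nb[OF b(5)] by auto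
  show "dd dP F w \<noteq> 0 \<Longrightarrow> jdet F w = 0 \<Longrightarrow> xi (xi (xi F)) w \<noteq> 0" using
      nb[OF b(6)] by auto
  show "dd dP F w \<noteq> 0 \<Longrightarrow> xi (xi (xi F)) w \<noteq> 0 \<Longrightarrow> jdet F w = 0
      \<Longrightarrow> hessian_det F w \<noteq> 0"
    using nb[OF b(7)] by auto
  show "dd dP F w \<noteq> 0 \<Longrightarrow> jdet F w = 0 \<Longrightarrow> parameter_det xi F w \<noteq> 0"
      using nb[OF b(8)] by auto
  show "dd dP F w \<noteq> 0 \<Longrightarrow> jdet F w = 0 \<Longrightarrow> dd dP (dd dP F) w \<noteq> 0" using
      nb[OF b(9)] by auto
  show "dd dP F w \<noteq> 0 \<Longrightarrow> dd dP (dd dP F) w \<noteq> 0 \<Longrightarrow> jdet F w = 0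
      \<Longrightarrow> other_root_inflection F w \<noteq> 0"
    using nb[OF b(10)] by auto
  show "dd dP F w \<noteq> 0 \<Longrightarrow> jdet F w \<noteq> 0 \<Longrightarrow> xi (xi (xi F)) w = 0
      \<Longrightarrow> versality_det F w \<noteq> 0"
    using nb[OF b(11)] by auto
  show "dd dP F w \<noteq> 0 \<Longrightarrow> dd dP (dd dP F) w \<noteq> 0 \<Longrightarrow> xi (xi (xi F)) w = 0
      \<Longrightarrow> other_root_inflection F w \<noteq> 0"
    using nb[OF b(12)] by auto
qed

text \<open>The singularity type supplies the equations on the jet, and genericity turns each of
  them into the inequalities required by the charts. That the surface is a graph p = P near m is one
  of the conclusions, since F_p = 0 would be a further equation.\<close>

theorem transitions_of_generic_family:
  assumes A: "smooth_on UNIV A" and gen: "generic_family (F4 A)"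
  shows "type3 (bde A e) m \<Longrightarrow> lips_transition A (base_proj m) e"
    and "type4 (bde A e) m \<Longrightarrow> bec_a_bec_transition A (base_proj m) e"
    and "type5 (bde A e) m \<Longrightarrow> swallowtail_transition A (base_proj m) e"
proof -
  define F where "F = F4 A"
  have sF: "smooth_on UNIV F" unfolding F_def by (rule smooth_on_F4[OF A])
  obtain x0 y0 p0 where m: "m = (x0, y0, p0)" by (metis prod.collapse)
  let ?w = "(((x0, y0), e), p0)"
  have bde: "bde A t = (\<lambda>m. F (slice t m))" for t unfolding F_def by (rule bde_eq_F4)
  have sb: "smooth_on UNIV (bde A e)" unfolding bde by (rule smooth_on_slice[OF sF])
  have sl: "slice e m = ?w" by (simp add: slice_def m)
  have zz: "(((0::real, 0::real), 0::real), 1::real) = dP" by (simp add: zero_prod_def)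
  note gD = generic_familyD[OF gen[folded F_def], of ?w]
  have sxi: "smooth_on UNIV (xi F)" "smooth_on UNIV (xi (xi F))" by (intro smooth_on_xi sF)+
  have conv: "bde A e m = F ?w" "fibre_deriv (bde A e) m = xi F ?w"
    "fibre_deriv (fibre_deriv (bde A e)) m = xi (xi F) ?w"
    "fibre_deriv (fibre_deriv (fibre_deriv (bde A e))) m = xi (xi (xi F)) ?w"
    unfolding bde fibre_deriv_slice[OF sF] fibre_deriv_slice[OF sxi(1)] fibre_deriv_slice[OF sxi(2)] sl by simp_all
  have ddc: "dd (0, 1, 0) (bde A e) m = dd dY F ?w" "dd (0, 0, 1) (bde A e) m = dd dP F ?w"
    "dd (0, 1, 0) (fibre_deriv (bde A e)) m = dd dY (xi F) ?w" "dd (0, 0, 1) (fibre_deriv (bde A e)) m = dd dP (xi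
        F) ?w"
    unfolding bde fibre_deriv_slice[OF sF] dd_slice[OF sF] dd_slice[OF sxi(1)] sl zz by simp_all
  have morse: "\<exists>s. (s = 1 \<or> s = -1) \<and> two_born_or_die (\<lambda>t. bi_inflections (bde A t)) (x0,
      y0) e \<and>
      only_inflections A (x0, y0) e \<and>
      families_equiv (\<lambda>t. inflection_curve (bde A t)) (x0, y0) e (\<lambda>t. {(x, y). x\<^sup>2 + s *
          y\<^sup>2 - t = 0}) (0, 0) 0 \<and>
      (s = -1 \<longrightarrow> (\<forall>N. open N \<and> m \<in> N \<longrightarrow> (\<exists>u\<in>N. u
          \<noteq> m \<and> bde A e u = 0 \<and> fibre_deriv (bde A e) u = 0))) \<and>
      (s = 1 \<longrightarrow> (\<exists>N. open N \<and> m \<in> N \<and> (\<forall>u\<in>N. bde A e u = 0 \<and>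
          fibre_deriv (bde A e) u = 0 \<longrightarrow> u = m))) \<and>
      dd (0, 0, 1) (bde A e) m \<noteq> 0"
    if mj: "morse_jet (bde A e) m"
  proof -
    have j: "F ?w = 0" "xi F ?w = 0" "xi (xi F) ?w = 0" "jdet F ?w = 0"
      using mj unfolding morse_jet_def conv ddc by (simp_all add: jdet_def)
    note g = gD[OF j(1-3)]
    \<comment> \<open>With F_p = 0 the equation \<open>jdet\<close> = 0 reduces to a product of two
      factors, each excluded by genericity.\<close>
    have Fp: "dd dP F ?w \<noteq> 0" using g(1,2) j(4) by (auto simp: jdet_def)
    have K: "xi (xi (xi F)) ?w \<noteq> 0" using g(6) Fp j by blast
    have Fpp: "dd dP (dd dP F) ?w \<noteq> 0" using g(9) Fp j by blast
    have oth: "other_root_inflection F ?w \<noteq> 0" using g(10) Fp Fpp j by blast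
    obtain P V where ch: "jet_chart F x0 y0 e p0 P V"
      using jet_chart_exists[OF A F_def j(1,2) Fp Fpp oth] by blast
    have Ie: "dd dE (xi F) ?w * dd dP F ?w \<noteq> dd dP (xi F) ?w * dd dE F ?w"
      using g(8)[OF Fp j(4)] by (simp add: parameter_det_def)
    have det: "xi (xi (xi F)) ?w * (dd dY (jdet F) ?w * dd dP F ?w - dd dP (jdet F) ?w * dd dY F ?w)
        \<noteq> (dd dY (xi (xi F)) ?w * dd dP F ?w - dd dP (xi (xi F)) ?w * dd dY F ?w)\<^sup>2"
      using g(7)[OF Fp K j(4)] by (simp add: hessian_det_def tangential_det_def)
    obtain s where "s = 1 \<or> s = -1" "two_born_or_die (\<lambda>t. bi_inflections (bde A t)) (x0, y0) e"
      "families_equiv (\<lambda>t. inflection_curve (bde A t)) (x0, y0) e (\<lambda>t. {(x, y). x\<^sup>2 + s *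
          y\<^sup>2 - t = 0}) (0, 0) 0"
      "\<And>N. s = -1 \<Longrightarrow> open N \<Longrightarrow> (x0, y0, p0) \<in> N \<Longrightarrow>
          \<exists>u\<in>N. u \<noteq> (x0, y0, p0) \<and> bde A e u = 0 \<and> fibre_deriv (bde A e) u = 0"
      "s = 1 \<Longrightarrow> \<exists>N. open N \<and> (x0, y0, p0) \<in> N \<and> (\<forall>u\<in>N. bde A e u =
          0 \<and> fibre_deriv (bde A e) u = 0 \<longrightarrow> u = (x0, y0, p0))"
      by (rule jet_chart.morse_transition[OF ch bde j(2,3,4) K Ie det]) (rule that; assumption)
    moreover have "only_inflections A (x0, y0) e" by (rule jet_chart.only_inflections_chart[OF ch bde])
    ultimately show ?thesis unfolding m[symmetric] ddc using Fp by blast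
  qed
  show "lips_transition A (base_proj m) e" if t: "type3 (bde A e) m"
  proof -
    have eq: "dual_projection_equiv (bde A e) m {(x, y, z). z = x ^ 3 + 1 * x * y\<^sup>2}"
      using t by (simp add: type3_def)
    note c = cubic_singularity_jet[OF sb eq]
    obtain s where s: "s = 1 \<or> s = -1" "two_born_or_die (\<lambda>t. bi_inflections (bde A t)) (x0, y0) e"
      "only_inflections A (x0, y0) e"
      "families_equiv (\<lambda>t. inflection_curve (bde A t)) (x0, y0) e (\<lambda>t. {(x, y). x\<^sup>2 + s *
          y\<^sup>2 - t = 0}) (0, 0) 0"
      "s = -1 \<longrightarrow> (\<forall>N. open N \<and> m \<in> N \<longrightarrow> (\<exists>u\<in>N. u
          \<noteq> m \<and> bde A e u = 0 \<and> fibre_deriv (bde A e) u = 0))"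
      "dd (0, 0, 1) (bde A e) m \<noteq> 0"
      using morse[OF c(1)] by blast
    \<comment> \<open>For s = -1 critical points of the dual projection would accumulate at m, but
      type 3 makes m isolated. For type 4 the argument is the converse one.\<close>
    have "s = 1" using c(2)[OF refl s(6)] s(1,5) by blast
    then show ?thesis unfolding lips_transition_def using s(2,3,4) m by simp
  qed
  show "bec_a_bec_transition A (base_proj m) e" if t: "type4 (bde A e) m"
  proof -
    have eq: "dual_projection_equiv (bde A e) m {(x, y, z). z = x ^ 3 + (-1) * x * y\<^sup>2}"
      using t by (simp add: type4_def)
    note c = cubic_singularity_jet[OF sb eq]
    obtain s where s: "s = 1 \<or> s = -1" "two_born_or_die (\<lambda>t. bi_inflections (bde A t)) (x0, y0) e"
      "only_inflections A (x0, y0) e"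
      "families_equiv (\<lambda>t. inflection_curve (bde A t)) (x0, y0) e (\<lambda>t. {(x, y). x\<^sup>2 + s *
          y\<^sup>2 - t = 0}) (0, 0) 0"
      "s = 1 \<longrightarrow> (\<exists>N. open N \<and> m \<in> N \<and> (\<forall>u\<in>N. bde A e u = 0 \<and>
          fibre_deriv (bde A e) u = 0 \<longrightarrow> u = m))"
      using morse[OF c(1)] by blast
    have "s = -1" using c(3)[OF refl] s(1,5) by blast
    then show ?thesis unfolding bec_a_bec_transition_def using s(2,3,4) m by simp
  qed
  show "swallowtail_transition A (base_proj m) e" if t: "type5 (bde A e) m"
  proof -
    have eq: "dual_projection_equiv (bde A e) m {(x, y, z). z = x ^ 4 + x * y}"
      using t by (simp add: type5_def)
    note c = quartic_singularity_jet[OF sb eq, unfolded conv]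
    note g = gD[OF c(1-3)]
    have Fp: "dd dP F ?w \<noteq> 0" using g(3) c(4) by blast
    have Fpp: "dd dP (dd dP F) ?w \<noteq> 0" using g(5) c(4) by blast
    have oth: "other_root_inflection F ?w \<noteq> 0" using g(12) Fp Fpp c(4) by blast
    have D: "jdet F ?w \<noteq> 0" using g(6) Fp c(4) by blast
    have L: "xi (xi (xi (xi F))) ?w \<noteq> 0" using g(4) c(4) by blast
    obtain P V where ch: "jet_chart F x0 y0 e p0 P V"
      using jet_chart_exists[OF A F_def c(1,2) Fp Fpp oth] by blast
    have det: "jdet F ?w * (dd dE (xi (xi F)) ?w * dd dP F ?w - dd dP (xi (xi F)) ?w * dd dE F ?w)
      \<noteq> (dd dE (xi F) ?w * dd dP F ?w - dd dP (xi F) ?w * dd dE F ?w) *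
        (dd dY (xi (xi F)) ?w * dd dP F ?w - dd dP (xi (xi F)) ?w * dd dY F ?w)"
      using g(11)[OF Fp D c(4)] by (simp add: versality_det_def parameter_det_def tangential_det_def)
    show ?thesis using jet_chart.swallowtail_chart[OF ch bde c(2,3,4) D L det] by (simp add: m)
  qed
qed

section \<open>Open conditions in the Whitney topology\<close>

lemma smooth_on_iter_deriv: "smooth_on U f \<Longrightarrow> smooth_on U (iter_deriv vs f)"
proof (induction vs)
  case (Cons v vs)
  then show ?case unfolding iter_deriv_Cons_dd by (intro smooth_on_dd)
qed simp

lemma dd_plus:
  "smooth_on UNIV f \<Longrightarrow> smooth_on UNIV g \<Longrightarrow> dd v (\<lambda>x. f x + g x) =
      (\<lambda>x. dd v f x + dd v g x)"
  by (intro ext dd_add) (auto intro: smooth_on_differentiable)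

lemma dd_scale:
  assumes "smooth_on UNIV f" shows "dd v (\<lambda>x. c *\<^sub>R f x) = (\<lambda>x. c *\<^sub>R dd v f x)"
proof
  fix x
  show "dd v (\<lambda>x. c *\<^sub>R f x) x = c *\<^sub>R dd v f x"
    by (rule dd_eqI[OF has_derivative_scaleR_right[OF smooth_on_has_derivative[OF assms UNIV_I]]])
qed

lemma iter_deriv_plus:
  assumes "smooth_on UNIV f" "smooth_on UNIV g"
  shows "iter_deriv vs (\<lambda>x. f x + g x) = (\<lambda>x. iter_deriv vs f x + iter_deriv vs g x)"
proof (induction vs)
  case (Cons v vs)
  show ?case unfolding iter_deriv_Cons_dd Cons.IH
    by (rule dd_plus[OF smooth_on_iter_deriv[OF assms(1)] smooth_on_iter_deriv[OF assms(2)]])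
qed simp

lemma iter_deriv_scale:
  assumes "smooth_on UNIV f"
  shows "iter_deriv vs (\<lambda>x. c *\<^sub>R f x) = (\<lambda>x. c *\<^sub>R iter_deriv vs f x)"
proof (induction vs)
  case (Cons v vs)
  show ?case unfolding iter_deriv_Cons_dd Cons.IH
    by (rule dd_scale[OF smooth_on_iter_deriv[OF assms]])
qed simp

lemma iter_deriv_const0: "iter_deriv vs (\<lambda>x. 0) = (\<lambda>x. 0)"
proof (induction vs)
  case (Cons v vs)
  show ?case unfolding iter_deriv_Cons_dd Cons.IH by auto
qed simp

lemma iter_deriv_sum:
  assumes "\<And>i. i \<in> I \<Longrightarrow> smooth_on UNIV (f i)"
  shows "iter_deriv vs (\<lambda>x. \<Sum>i\<in>I. f i x) = (\<lambda>x. \<Sum>i\<in>I. iter_deriv vs (f i) x)"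
  using assms
proof (induction I rule: infinite_finite_induct)
  case (insert i I)
  have "smooth_on UNIV (\<lambda>x. \<Sum>i\<in>I. f i x)" by (rule smooth_on_sum) (use insert in auto)
  then show ?case using insert iter_deriv_plus[of "f i" "\<lambda>x. \<Sum>i\<in>I. f i x"] by simp
qed (simp_all add: iter_deriv_const0)

lemma iter_deriv_cong_open:
  assumes "open U" "\<And>x. x \<in> U \<Longrightarrow> f x = g x"
  shows "\<forall>x\<in>U. iter_deriv vs f x = iter_deriv vs g x"
proof (induction vs)
  case (Cons v vs)
  show ?case unfolding iter_deriv_Cons_dd using dd_cong_open[OF assms(1)] Cons.IH by blast
qed (use assms in simp)

lemma iter_deriv_fst:
  assumes "smooth_on UNIV f"
  shows "iter_deriv vs (\<lambda>w. f (fst w)) = (\<lambda>w. iter_deriv (map fst vs) f (fst w))"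
proof (induction vs)
  case (Cons v vs)
  show ?case unfolding iter_deriv_Cons_dd Cons.IH list.map
    by (intro ext dd_fst_comp smooth_on_differentiable[OF smooth_on_iter_deriv[OF assms]]) simp
qed simp

text \<open>Continuous convergence of all derivatives: for a smooth limit this is uniform
  convergence on compact sets in every order. In this form it passes through sums, products and
  derivatives without estimates.\<close>

definition jconv :: "(nat \<Rightarrow> 'a::euclidean_space \<Rightarrow> 'b::euclidean_space) \<Rightarrow> ('a
    \<Rightarrow> 'b) \<Rightarrow> bool" where
  "jconv fs f \<longleftrightarrow> (\<forall>vs ws w. ws \<longlonglongrightarrow> w \<longrightarrow>
      (\<lambda>m. iter_deriv vs (fs m) (ws m)) \<longlonglongrightarrow> iter_deriv vs f w)"

lemma jconvD: "jconv fs f \<Longrightarrow> ws \<longlonglongrightarrow> w \<Longrightarrow> (\<lambda>m.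
    iter_deriv vs (fs m) (ws m)) \<longlonglongrightarrow> iter_deriv vs f w"
  unfolding jconv_def by blast

lemma jconv_tendsto: "jconv fs f \<Longrightarrow> ws \<longlonglongrightarrow> w \<Longrightarrow> (\<lambda>m. fs
    m (ws m)) \<longlonglongrightarrow> f w"
  using jconvD[of fs f ws w "[]"] by simp

lemma jconv_dd: "jconv fs f \<Longrightarrow> jconv (\<lambda>m. dd v (fs m)) (dd v f)"
  unfolding jconv_def iter_deriv_snoc[symmetric] by blast

lemma jconv_same: "smooth_on UNIV f \<Longrightarrow> jconv (\<lambda>m. f) f"
  unfolding jconv_def using smooth_on_isCont[OF smooth_on_iter_deriv] isCont_tendsto_compose by blast

lemma jconv_plus:
  assumes "\<And>m. smooth_on UNIV (fs m)" "smooth_on UNIV f" "\<And>m. smooth_on UNIV (gs m)" "smooth_on UNIV g"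
    "jconv fs f" "jconv gs g"
  shows "jconv (\<lambda>m x. fs m x + gs m x) (\<lambda>x. f x + g x)"
  unfolding jconv_def
proof (intro allI impI)
  fix vs ws and w :: 'a assume "ws \<longlonglongrightarrow> w"
  then show "(\<lambda>m. iter_deriv vs (\<lambda>x. fs m x + gs m x) (ws m)) \<longlonglongrightarrow> iter_deriv
      vs (\<lambda>x. f x + g x) w"
    unfolding iter_deriv_plus[OF assms(1,3)] iter_deriv_plus[OF assms(2,4)]
    by (intro tendsto_add jconvD assms)
qed

lemma jconv_bilinear:
  fixes B :: "'b::euclidean_space \<Rightarrow> 'c::euclidean_space \<Rightarrow> 'd::euclidean_space"
    and f :: "'a::euclidean_space \<Rightarrow> 'b"
  assumes B: "bounded_bilinear B"
    and "\<And>m. smooth_on UNIV (fs m)" "smooth_on UNIV f" "\<And>m. smooth_on UNIV (gs m)" "smooth_on UNIV g"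
    "jconv fs f" "jconv gs g"
  shows "jconv (\<lambda>m x. B (fs m x) (gs m x)) (\<lambda>x. B (f x) (g x))"
proof -
  have dB: "dd v (\<lambda>x. B (f x) (g x)) = (\<lambda>x. B (f x) (dd v g x) + B (dd v f x) (g x))"
    if "smooth_on UNIV f" "smooth_on UNIV g" for f :: "'a \<Rightarrow> 'b" and g v
    by (intro ext dd_eqI[OF bounded_bilinear.FDERIV[OF B]] smooth_on_has_derivative[OF that(1)]
        smooth_on_has_derivative[OF that(2)]) auto
  have "(\<lambda>m. iter_deriv vs (\<lambda>x. B (fs m x) (gs m x)) (ws m)) \<longlonglongrightarrow> iter_deriv
      vs (\<lambda>x. B (f x) (g x)) w"
    if "length vs = n" "ws \<longlonglongrightarrow> w" "\<And>m. smooth_on UNIV (fs m)" "smooth_on UNIV f"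
      "\<And>m. smooth_on UNIV (gs m)" "smooth_on UNIV g" "jconv fs f" "jconv gs g"
    for n vs ws and w :: 'a and fs f gs g
    using that
  proof (induction n arbitrary: vs fs f gs g)
    case 0
    then show ?case using bounded_bilinear.tendsto[OF B jconv_tendsto jconv_tendsto] by simp
  next
    case (Suc n)
    obtain us v where vs: "vs = us @ [v]" using Suc.prems(1) by (cases vs rule: rev_cases) auto
    have len: "length us = n" using Suc.prems(1) vs by simp
    note s = Suc.prems(3-6) and j = Suc.prems(7,8)
    have e: "iter_deriv vs (\<lambda>x. B (f x) (g x)) = (\<lambda>x. iter_deriv us (\<lambda>x. B (f x) (dd v g
        x)) x + iter_deriv us (\<lambda>x. B (dd v f x) (g x)) x)"
      if "smooth_on UNIV f" "smooth_on UNIV g" for f :: "'a \<Rightarrow> 'b" and g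
      unfolding vs iter_deriv_snoc dB[OF that]
      by (rule iter_deriv_plus) (intro smooth_on_bilinear[OF B] smooth_on_dd that)+
    show ?case unfolding e[OF s(1,3)] e[OF s(2,4)]
      by (intro tendsto_add Suc.IH len Suc.prems(2) s j smooth_on_dd jconv_dd)
  qed
  note main = this
  show ?thesis unfolding jconv_def by (intro allI impI main[OF refl] assms)
qed

lemma jconv_fst:
  assumes "\<And>m. smooth_on UNIV (fs m)" "smooth_on UNIV f" "jconv fs f"
  shows "jconv (\<lambda>m w. fs m (fst w)) (\<lambda>w. f (fst w))"
  unfolding jconv_def iter_deriv_fst[OF assms(1)] iter_deriv_fst[OF assms(2)]
  by (intro allI impI jconvD[OF assms(3)] tendsto_fst)

lemma dd_basis:
  fixes f :: "'a::euclidean_space \<Rightarrow> 'b::euclidean_space"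
  assumes "smooth_on UNIV f"
  shows "dd v f = (\<lambda>x. \<Sum>b\<in>Basis. (v \<bullet> b) *\<^sub>R dd b f x)"
proof
  fix x
  interpret f: bounded_linear "\<lambda>v. dd v f x"
    by (rule has_derivative_bounded_linear[OF smooth_on_has_derivative[OF assms UNIV_I]])
  have "dd v f x = dd (\<Sum>b\<in>Basis. (v \<bullet> b) *\<^sub>R b) f x" by (simp add: euclidean_representation)
  then show "dd v f x = (\<Sum>b\<in>Basis. (v \<bullet> b) *\<^sub>R dd b f x)" unfolding f.sum by (simp add: f.scaleR)
qed

text \<open>Whitney neighbourhoods control derivatives along basis vectors only. Arbitrary
  directions are expanded in the basis one at a time, beginning with the derivative taken
  first.\<close>

lemma jconv_basisI:
  fixes f :: "'a::euclidean_space \<Rightarrow> 'b::euclidean_space"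
  assumes "\<And>m. smooth_on UNIV (fs m)" "smooth_on UNIV f"
    "\<And>vs ws w. vs \<in> lists Basis \<Longrightarrow> ws \<longlonglongrightarrow> w \<Longrightarrow>
        (\<lambda>m. iter_deriv vs (fs m) (ws m)) \<longlonglongrightarrow> iter_deriv vs f w"
  shows "jconv fs f"
proof -
  have "(\<lambda>m. iter_deriv vs (fs m) (ws m)) \<longlonglongrightarrow> iter_deriv vs f w"
    if "length vs = n" "ws \<longlonglongrightarrow> w" "\<And>m. smooth_on UNIV (fs m)" "smooth_on UNIV f"
      "\<And>vs ws w. vs \<in> lists Basis \<Longrightarrow> ws \<longlonglongrightarrow> w \<Longrightarrow>
          (\<lambda>m. iter_deriv vs (fs m) (ws m)) \<longlonglongrightarrow> iter_deriv vs f w"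
    for n vs ws and w :: 'a and fs and f :: "'a \<Rightarrow> 'b"
    using that
  proof (induction n arbitrary: vs fs f)
    case 0
    then show ?case using 0(5)[of "[]"] by simp
  next
    case (Suc n)
    obtain us v where vs: "vs = us @ [v]" using Suc.prems(1) by (cases vs rule: rev_cases) auto
    have len: "length us = n" using Suc.prems(1) vs by simp
    have e: "iter_deriv vs f = (\<lambda>x. \<Sum>b\<in>Basis. (v \<bullet> b) *\<^sub>R iter_deriv us (dd b f) x)"
      if s: "smooth_on UNIV f" for f :: "'a \<Rightarrow> 'b"
    proof -
      have "smooth_on UNIV (\<lambda>x. (v \<bullet> b) *\<^sub>R dd b f x)" for b
        by (intro smooth_on_scaleR smooth_on_const smooth_on_dd s open_UNIV)
      then show ?thesis
        unfolding vs iter_deriv_snoc dd_basis[OF s, of v]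
        by (subst iter_deriv_sum) (auto simp: iter_deriv_scale[OF smooth_on_dd[OF s]])
    qed
    have "(\<lambda>m. iter_deriv us (dd b (fs m)) (ws m)) \<longlonglongrightarrow> iter_deriv us (dd b f) w" if
        b: "b \<in> Basis" for b
    proof (rule Suc.IH[OF len Suc.prems(2)])
      show "smooth_on UNIV (dd b (fs m))" "smooth_on UNIV (dd b f)" for m
        using Suc.prems(3,4) smooth_on_dd by blast+
      show "(\<lambda>m. iter_deriv vs (dd b (fs m)) (ws m)) \<longlonglongrightarrow> iter_deriv vs (dd b f) w"
        if "vs \<in> lists Basis" "ws \<longlonglongrightarrow> w" for vs ws w
        unfolding iter_deriv_snoc[symmetric] by (rule Suc.prems(5)) (use that b in auto)
    qed
    then show ?case unfolding e[OF Suc.prems(3)] e[OF Suc.prems(4)]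
      by (intro tendsto_sum tendsto_scaleR tendsto_const)
  qed
  note main = this
  show ?thesis unfolding jconv_def
  proof (intro allI impI)
    fix vs ws and w :: 'a assume ws: "ws \<longlonglongrightarrow> w"
    show "(\<lambda>m. iter_deriv vs (fs m) (ws m)) \<longlonglongrightarrow> iter_deriv vs f w"
      by (rule main[OF refl ws assms])
  qed
qed

text \<open>What is used of a polynomial in the partial derivatives of the coefficients: it maps
  smooth to smooth, it is continuous for \<open>jconv\<close> (for openness), and it depends only on
  the germ of \<open>A\<close> over the base point (so that a cut-off elsewhere is
  invisible).\<close>

definition jet_op :: "(bde_family \<Rightarrow> jet_family \<Rightarrow> real) \<Rightarrow> bool" where
  "jet_op T \<longleftrightarrow> (\<forall>A. smooth_on UNIV A \<longrightarrow> smooth_on UNIV (T A)) \<and>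
     (\<forall>As A. (\<forall>m. smooth_on UNIV (As m)) \<and> smooth_on UNIV A \<and> jconv As A
         \<longrightarrow> jconv (\<lambda>m. T (As m)) (T A)) \<and>
     (\<forall>A A' U. open U \<and> (\<forall>z\<in>U. A z = A' z) \<longrightarrow> (\<forall>w. fst w \<in> U
         \<longrightarrow> T A w = T A' w))"

lemma jet_op_local:
  assumes "jet_op T" "open U" "\<And>z. z \<in> U \<Longrightarrow> A z = A' z" "fst w \<in> U"
  shows "T A w = T A' w"
  using assms(1)[unfolded jet_op_def, THEN conjunct2, THEN conjunct2, rule_format, of U A A' w] assms(2-4) by simp

lemma jet_op_F4: "jet_op F4"
  unfolding jet_op_def
proof (intro conjI allI impI)
  show "smooth_on UNIV (F4 A)" if "smooth_on UNIV A" for A by (rule smooth_on_F4[OF that])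
  fix As A assume *: "(\<forall>m. smooth_on UNIV (As m)) \<and> smooth_on UNIV A \<and> jconv As (A :: bde_family)"
  have g: "smooth_on UNIV (\<lambda>w::jet_family. (1::real, 2 * snd w, (snd w)\<^sup>2))" by (intro smooth_intros
      open_UNIV)
  have f: "smooth_on UNIV (\<lambda>w::jet_family. A (fst w))" if "smooth_on UNIV A" for A :: bde_family
    by (rule smooth_on_compose[OF that]) (auto intro!: smooth_intros)
  show "jconv (\<lambda>m. F4 (As m)) (F4 A)"
    unfolding F4_def[abs_def]
    by (rule jconv_bilinear[OF bounded_bilinear_inner _ _ _ _ jconv_fst jconv_same]) (use * f g in auto)
qed (auto simp: F4_def)

lemma jet_op_dd:
  assumes T: "jet_op T" shows "jet_op (\<lambda>A. dd v (T A))"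
  unfolding jet_op_def
proof (intro conjI allI impI)
  show "smooth_on UNIV (dd v (T A))" if "smooth_on UNIV A" for A
    using T that smooth_on_dd unfolding jet_op_def by blast
  show "jconv (\<lambda>m. dd v (T (As m))) (dd v (T A))"
    if "(\<forall>m. smooth_on UNIV (As m)) \<and> smooth_on UNIV A \<and> jconv As A" for As A
    by (rule jconv_dd) (use T that in \<open>unfold jet_op_def, blast\<close>)
  fix A A' :: bde_family and U and w :: jet_family
  assume U: "open U \<and> (\<forall>z\<in>U. A z = A' z)" and w: "fst w \<in> U"
  show "dd v (T A) w = dd v (T A') w"
  proof (rule dd_cong_open[of "U \<times> UNIV"])
    show "open (U \<times> (UNIV :: real set))" using U by (intro open_Times) auto
    show "T A x = T A' x" if "x \<in> U \<times> UNIV" for x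
    proof -
      have "fst x \<in> U" using that by auto
      then show ?thesis by (intro jet_op_local[OF T, of U]) (use U in auto)
    qed
  qed (use w in \<open>auto simp: mem_Times_iff\<close>)
qed

section \<open>Closure of the jet operators under algebra and differentiation\<close>

lemma jet_op_plus:
  assumes T: "jet_op T" and S: "jet_op S" shows "jet_op (\<lambda>A w. T A w + S A w)"
  unfolding jet_op_def
proof (intro conjI allI impI)
  show "smooth_on UNIV (\<lambda>w. T A w + S A w)" if "smooth_on UNIV A" for A
    by (intro smooth_on_add) (use T S that in \<open>auto simp: jet_op_def\<close>)
  show "jconv (\<lambda>m w. T (As m) w + S (As m) w) (\<lambda>w. T A w + S A w)"
    if "(\<forall>m. smooth_on UNIV (As m)) \<and> smooth_on UNIV A \<and> jconv As A" for As A
    by (rule jconv_plus) (use T S that in \<open>simp_all add: jet_op_def\<close>)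
  show "T A w + S A w = T A' w + S A' w" if "open U \<and> (\<forall>z\<in>U. A z = A' z)" "fst w \<in> U" for A A' U w
  proof -
    have "T A w = T A' w" "S A w = S A' w"
      by (rule jet_op_local[OF T, of U] jet_op_local[OF S, of U]; use that in simp)+
    then show ?thesis by simp
  qed
qed

lemma jet_op_mult:
  assumes T: "jet_op T" and S: "jet_op S" shows "jet_op (\<lambda>A w. T A w * S A w)"
  unfolding jet_op_def
proof (intro conjI allI impI)
  show "smooth_on UNIV (\<lambda>w. T A w * S A w)" if "smooth_on UNIV A" for A
    by (intro smooth_on_mult) (use T S that in \<open>auto simp: jet_op_def\<close>)
  show "jconv (\<lambda>m w. T (As m) w * S (As m) w) (\<lambda>w. T A w * S A w)"
    if "(\<forall>m. smooth_on UNIV (As m)) \<and> smooth_on UNIV A \<and> jconv As A" for As A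
    by (rule jconv_bilinear[OF bounded_bilinear_mult]) (use T S that in \<open>simp_all add: jet_op_def\<close>)
  show "T A w * S A w = T A' w * S A' w" if "open U \<and> (\<forall>z\<in>U. A z = A' z)" "fst w \<in> U" for A A' U w
  proof -
    have "T A w = T A' w" "S A w = S A' w"
      by (rule jet_op_local[OF T, of U] jet_op_local[OF S, of U]; use that in simp)+
    then show ?thesis by simp
  qed
qed

lemma jet_op_fixed: "smooth_on UNIV g \<Longrightarrow> jet_op (\<lambda>A. g)"
  unfolding jet_op_def using jconv_same by blast

lemma jet_op_const: "jet_op (\<lambda>A w. c)"
  by (rule jet_op_fixed) (rule smooth_on_const[OF open_UNIV])

lemma jet_op_diff:
  assumes "jet_op T" "jet_op S" shows "jet_op (\<lambda>A w. T A w - S A w)"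
  using jet_op_plus[OF assms(1) jet_op_mult[OF jet_op_const[of "-1"] assms(2)]] by simp

lemma jet_op_power2: "jet_op T \<Longrightarrow> jet_op (\<lambda>A w. (T A w)\<^sup>2)"
  unfolding power2_eq_square by (intro jet_op_mult)

lemma jet_op_xi: "jet_op T \<Longrightarrow> jet_op (\<lambda>A. xi (T A))"
  unfolding xi_def[abs_def]
  by (intro jet_op_plus jet_op_mult jet_op_dd jet_op_fixed[OF smooth_on_snd[OF smooth_on_id[OF open_UNIV]]])

lemma jet_op_tangential:
  assumes "jet_op T" "jet_op (\<lambda>A. S (T A))" shows "jet_op (\<lambda>A. tangential_det S (T A))"
  unfolding tangential_det_def[abs_def] by (intro jet_op_diff jet_op_mult jet_op_dd assms)

lemma jet_op_parameter:
  assumes "jet_op T" "jet_op (\<lambda>A. S (T A))" shows "jet_op (\<lambda>A. parameter_det S (T A))"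
  unfolding parameter_det_def[abs_def] by (intro jet_op_diff jet_op_mult jet_op_dd assms)

lemma jet_op_jdet: "jet_op T \<Longrightarrow> jet_op (\<lambda>A. jdet (T A))"
  unfolding jdet_def[abs_def] by (intro jet_op_diff jet_op_mult jet_op_dd jet_op_xi)

lemma jet_op_degeneracies:
  assumes "(E1, E2, B1, B2) \<in> degeneracies" and T: "jet_op T"
  shows "jet_op (\<lambda>A. E1 (T A)) \<and> jet_op (\<lambda>A. E2 (T A)) \<and> jet_op (\<lambda>A. B1 (T A))
      \<and> jet_op (\<lambda>A. B2 (T A))"
proof -
  have o: "jet_op (\<lambda>A. other_root_inflection (T A))"
    unfolding other_root_inflection_def[abs_def]
    by (intro jet_op_diff jet_op_plus jet_op_mult jet_op_power2 jet_op_dd jet_op_xi jet_op_const T)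
  have j2: "jet_op (\<lambda>A. (\<lambda>F. xi (xi F)) (T A))" using jet_op_xi[OF jet_op_xi[OF T]] by simp
  have t: "jet_op (\<lambda>A. tangential_det (\<lambda>F. xi (xi F)) (T A))" by (rule jet_op_tangential[OF T j2])
  have h: "jet_op (\<lambda>A. hessian_det (T A))"
    unfolding hessian_det_def[abs_def]
    by (intro jet_op_diff jet_op_mult jet_op_power2 jet_op_xi jet_op_tangential[OF T jet_op_jdet[OF T]] t T)
  have p: "jet_op (\<lambda>A. parameter_det xi (T A))" by (rule jet_op_parameter[OF T jet_op_xi[OF T]])
  have v: "jet_op (\<lambda>A. versality_det (T A))"
    unfolding versality_det_def[abs_def]
    by (intro jet_op_diff jet_op_mult jet_op_jdet[OF T] jet_op_parameter[OF T j2] p t)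
  note ops = T jet_op_const jet_op_dd[OF T] jet_op_dd[OF jet_op_dd[OF T]] jet_op_dd[OF jet_op_xi[OF T]]
    jet_op_xi[OF jet_op_xi[OF jet_op_xi[OF T]]] jet_op_xi[OF jet_op_xi[OF jet_op_xi[OF jet_op_xi[OF T]]]]
    jet_op_jdet[OF T] o h p v
  show ?thesis using assms(1) unfolding degeneracies_def Let_def
    by (elim insertE emptyE) (auto intro: ops)
qed

text \<open>Otherwise maps tending to \<open>A\<close> violate the condition at points of \<open>K\<close>, and by compactness so
  does \<open>A\<close> at a limit of these points.\<close>

lemma openin_avoid:
  assumes Es: "\<And>E. E \<in> Es \<Longrightarrow> jet_op E" and Bs: "\<And>B. B \<in> Bs \<Longrightarrow>
      jet_op B" and K: "compact K"
  shows "openin whitney_topology {A. smooth_on UNIV A \<and>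
    (\<forall>w\<in>K. \<not> ((\<forall>E\<in>Es. E A w = 0) \<and> (\<forall>B\<in>Bs. \<delta> \<le> \<bar>B A
        w\<bar>)))}" (is "openin _ ?U")
  unfolding openin_subopen[of _ ?U]
proof
  fix A assume A: "A \<in> ?U"
  then have sA: "smooth_on UNIV A" by simp
  \<comment> \<open>Constant tolerances suffice for openness because only points of the compact set
    \<open>K\<close> matter.\<close>
  let ?nb = "\<lambda>n. whitney_nbhd n (\<lambda>_. 1 / real (Suc n)) A"
  have op: "openin whitney_topology (?nb n)" for n
    unfolding whitney_topology_def
    by (rule topology_generated_by_Basis, rule CollectI, intro exI conjI)
      (rule refl sA continuous_on_const allI zero_less_divide_1_iff[THEN iffD2] of_nat_0_less_iff[THEN iffD2]
          zero_less_Suc)+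
  have mem: "A \<in> ?nb n" for n using sA by (simp add: whitney_nbhd_def)
  have "\<exists>n. ?nb n \<subseteq> ?U"
  proof (rule ccontr)
    assume "\<nexists>n. ?nb n \<subseteq> ?U"
    then have "\<forall>n. \<exists>A'. A' \<in> ?nb n \<and> A' \<notin> ?U" by blast
    from choice[OF this] obtain As where "\<forall>n. As n \<in> ?nb n \<and> As n \<notin> ?U" ..
    then have As: "\<And>n. As n \<in> ?nb n" "\<And>n. As n \<notin> ?U" by simp_all
    have sAs: "smooth_on UNIV (As n)" for n using As(1)[of n] by (simp add: whitney_nbhd_def)
    have "\<forall>n. \<exists>w. w \<in> K \<and> (\<forall>E\<in>Es. E (As n) w = 0) \<and> (\<forall>B\<in>Bs.
        \<delta> \<le> \<bar>B (As n) w\<bar>)"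
      using As(2) sAs by blast
    then obtain ws where ws: "\<And>n. ws n \<in> K" "\<And>n E. E \<in> Es \<Longrightarrow> E (As n) (ws n) = 0"
      "\<And>n B. B \<in> Bs \<Longrightarrow> \<delta> \<le> \<bar>B (As n) (ws n)\<bar>" by metis
    obtain w r where w: "w \<in> K" and r: "strict_mono r" "(ws \<circ> r) \<longlonglongrightarrow> w"
      using K ws(1) unfolding compact_def by metis
    have conv: "jconv (\<lambda>m. As (r m)) A"
    proof (rule jconv_basisI[OF sAs sA])
      fix vs :: "(plane \<times> real) list" and zs and z :: "plane \<times> real" assume vs: "vs \<in> lists
          Basis" and zs: "zs \<longlonglongrightarrow> z"
      have "(\<lambda>m. iter_deriv vs (As (r m)) (zs m) - iter_deriv vs A (zs m)) \<longlonglongrightarrow> 0"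
      proof (rule Lim_null_comparison)
        show "\<forall>\<^sub>F m in sequentially. norm (iter_deriv vs (As (r m)) (zs m) - iter_deriv vs A (zs m))
            \<le> 1 / real (Suc m)"
        proof (rule eventually_sequentiallyI)
          fix m assume m: "length vs \<le> m"
          have rm: "m \<le> r m" using r(1) by (rule seq_suble)
          have "\<forall>x. \<forall>vs\<in>lists Basis. length vs \<le> r m \<longrightarrow>
              norm (iter_deriv vs (As (r m)) x - iter_deriv vs A x) < 1 / real (Suc (r m))"
            using As(1)[of "r m"] unfolding whitney_nbhd_def by blast
          then have "norm (iter_deriv vs (As (r m)) (zs m) - iter_deriv vs A (zs m)) < 1 / real (Suc (r m))"
            using vs m rm order_trans by blast
          also have "\<dots> \<le> 1 / real (Suc m)" using rm by (intro divide_left_mono) auto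
          finally show "norm (iter_deriv vs (As (r m)) (zs m) - iter_deriv vs A (zs m)) \<le> 1 / real (Suc m)" by simp
        qed
        show "(\<lambda>m. 1 / real (Suc m)) \<longlonglongrightarrow> 0" using LIMSEQ_inverse_real_of_nat by (simp
            add: inverse_eq_divide)
      qed
      moreover have "(\<lambda>m. iter_deriv vs A (zs m)) \<longlonglongrightarrow> iter_deriv vs A z"
        by (rule isCont_tendsto_compose[OF smooth_on_isCont[OF smooth_on_iter_deriv[OF sA] UNIV_I] zs])
      ultimately show "(\<lambda>m. iter_deriv vs (As (r m)) (zs m)) \<longlonglongrightarrow> iter_deriv vs A z"
        using tendsto_add by fastforce
    qed
    have lim: "(\<lambda>m. T (As (r m)) (ws (r m))) \<longlonglongrightarrow> T A w" if "jet_op T" for T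
    proof -
      have "jconv (\<lambda>m. T (As (r m))) (T A)"
        using that[unfolded jet_op_def, THEN conjunct2, THEN conjunct1, rule_format, of "\<lambda>m. As (r m)" A]
          sAs sA conv by simp
      from jconv_tendsto[OF this r(2)] show ?thesis by (simp add: o_def)
    qed
    have "E A w = 0" if "E \<in> Es" for E
    proof -
      have "(\<lambda>m. 0) \<longlonglongrightarrow> E A w" using lim[OF Es[OF that]] ws(2)[OF that] by simp
      then show ?thesis using LIMSEQ_const_iff by metis
    qed
    \<comment> \<open>The weak inequality with a fixed \<open>\<delta>\<close> survives the limit; B
      \<noteq> 0 would not.\<close>
    moreover have "\<delta> \<le> \<bar>B A w\<bar>" if "B \<in> Bs" for B
      by (rule tendsto_lowerbound[OF tendsto_rabs[OF lim[OF Bs[OF that]]]]) (use ws(3)[OF that] in auto)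
    ultimately show False using A w by blast
  qed
  then show "\<exists>T. openin whitney_topology T \<and> A \<in> T \<and> T \<subseteq> ?U" using op mem by blast
qed

text \<open>The perturbations live in a fixed ball: outside it nothing changes, and on it the margin
  left by the tolerance has a positive minimum. The claim is proved for all members of an open set
  simultaneously, so that it passes through finite intersections and unions of basic
  neighbourhoods.\<close>

lemma perturbation_in_open:
  fixes f :: "'a::euclidean_space \<Rightarrow> 'b::euclidean_space" and hb :: "'p::euclidean_space \<Rightarrow>
      'a \<Rightarrow> 'b"
  assumes W: "openin whitney_topology W" and f: "f \<in> W"
    and hb: "\<And>b. smooth_on UNIV (hb b)" "\<And>b x. norm x > R \<Longrightarrow> hb b x = 0"
  shows "\<forall>\<^sub>F t in nhds 0. (\<lambda>x. f x + (\<Sum>b\<in>Basis. (t \<bullet> b) *\<^sub>R hb b x))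
      \<in> W"
proof -
  let ?p = "\<lambda>f t x. f x + (\<Sum>b\<in>Basis. (t \<bullet> b) *\<^sub>R hb b x)"
  have sh: "smooth_on UNIV (\<lambda>x. (t \<bullet> b) *\<^sub>R hb b x)" for t b
    by (intro smooth_on_scaleR smooth_on_const hb open_UNIV)
  have shs: "smooth_on UNIV (\<lambda>x. \<Sum>b\<in>Basis. (t \<bullet> b) *\<^sub>R hb b x)" for t
    by (intro smooth_on_sum sh open_UNIV)
  have "generate_topology_on {whitney_nbhd k \<delta> (f :: 'a \<Rightarrow> 'b) | k \<delta> f. smooth_on UNIV f
      \<and> continuous_on UNIV \<delta> \<and> (\<forall>x. \<delta> x > 0)} W"
    using W unfolding whitney_topology_def openin_topology_generated_by_iff .
  then have "\<forall>f\<in>W. \<forall>\<^sub>F t in nhds 0. ?p f t \<in> W"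
  proof induction
    case Empty
    then show ?case by simp
  next
    case (Int a b)
    then show ?case by (auto intro: eventually_conj)
  next
    case (UN K)
    show ?case
    proof
      fix f assume "f \<in> \<Union> K"
      then obtain k where k: "k \<in> K" "f \<in> k" by blast
      then have "\<forall>\<^sub>F t in nhds 0. ?p f t \<in> k" using UN by blast
      then show "\<forall>\<^sub>F t in nhds 0. ?p f t \<in> \<Union> K" by (rule eventually_mono) (use k in blast)
    qed
  next
    case (Basis s)
    then obtain k \<delta> g where s: "s = whitney_nbhd k \<delta> g" and g: "smooth_on UNIV (g :: 'a \<Rightarrow> 'b)"
      and \<delta>: "continuous_on UNIV \<delta>" "\<forall>x. \<delta> x > 0" by blast
    show ?case unfolding s
    proof
      fix f assume f: "f \<in> whitney_nbhd k \<delta> g"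
      have sf: "smooth_on UNIV f" using f by (simp add: whitney_nbhd_def)
      have it: "iter_deriv vs (?p f t) x = iter_deriv vs f x + (\<Sum>b\<in>Basis. (t \<bullet> b) *\<^sub>R
          iter_deriv vs (hb b) x)" for vs t x
        unfolding iter_deriv_plus[OF sf shs] iter_deriv_sum[OF sh] iter_deriv_scale[OF hb(1)] ..
      let ?L = "{vs. set vs \<subseteq> (Basis :: 'a set) \<and> length vs \<le> k}"
      have fin: "finite ?L" by (rule finite_lists_length_le) auto
      have "\<forall>vs\<in>?L. \<forall>\<^sub>F t in nhds 0. \<forall>x. norm (iter_deriv vs (?p f t) x -
          iter_deriv vs g x) < \<delta> x"
      proof
        fix vs assume vs: "vs \<in> ?L"
        have base: "norm (iter_deriv vs f x - iter_deriv vs g x) < \<delta> x" for x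
          using f vs by (auto simp: whitney_nbhd_def in_lists_conv_set)
        \<comment> \<open>The margin still available at x; \<open>S\<close> bounds the effect at x
          of a parameter of norm 1.\<close>
        define \<mu> where "\<mu> x = \<delta> x - norm (iter_deriv vs f x - iter_deriv vs g x)" for x
        have c\<mu>: "continuous_on (cball 0 R) \<mu>" unfolding \<mu>_def
          by (intro continuous_intros continuous_on_subset[OF \<delta>(1)]
              continuous_on_subset[OF smooth_on_continuous[OF smooth_on_iter_deriv[OF sf]]]
              continuous_on_subset[OF smooth_on_continuous[OF smooth_on_iter_deriv[OF g]]]) auto
        define S where "S x = (\<Sum>b\<in>Basis. norm (iter_deriv vs (hb b) x))" for x
        have cS: "continuous_on (cball 0 R) S" unfolding S_def
          by (intro continuous_intros continuous_on_subset[OF smooth_on_continuous[OF smooth_on_iter_deriv[OF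
            hb(1)]]]) auto
        have S0: "S x \<ge> 0" for x unfolding S_def by (intro sum_nonneg) auto
        have bd: "norm (iter_deriv vs (?p f t) x - iter_deriv vs g x) \<le> norm (iter_deriv vs f x - iter_deriv vs
            g x) + norm t * S x" for t x
        proof -
          have "iter_deriv vs (?p f t) x - iter_deriv vs g x
              = (iter_deriv vs f x - iter_deriv vs g x) + (\<Sum>b\<in>Basis. (t \<bullet> b) *\<^sub>R iter_deriv
            vs (hb b) x)"
            unfolding it by simp
          moreover have "norm (\<Sum>b\<in>Basis. (t \<bullet> b) *\<^sub>R iter_deriv vs (hb b) x) \<le>
            (\<Sum>b\<in>Basis. norm t * norm (iter_deriv vs (hb b) x))"
            by (rule order_trans[OF norm_sum]) (auto intro!: sum_mono mult_right_mono Basis_le_norm)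
          ultimately show ?thesis unfolding S_def sum_distrib_left
            by (metis (no_types, lifting) add_left_mono norm_triangle_le)
        qed
        obtain M where M: "M > 0" "\<And>x. x \<in> cball 0 R \<Longrightarrow> norm (S x) \<le> M"
          using compact_imp_bounded[OF compact_continuous_image[OF cS compact_cball]] unfolding bounded_pos by auto
        obtain m where m: "m > 0" "\<And>x. x \<in> cball 0 R \<Longrightarrow> m \<le> \<mu> x"
        proof (cases "cball (0::'a) R = {}")
          case True
          then show thesis using that[of 1] by auto
        next
          case False
          obtain x0 where "x0 \<in> cball 0 R" "\<forall>x\<in>cball 0 R. \<mu> x0 \<le> \<mu> x"
            using continuous_attains_inf[OF compact_cball False c\<mu>] by blast
          then show thesis using that[of "\<mu> x0"] base by (auto simp: \<mu>_def)
        qed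
        show "\<forall>\<^sub>F t in nhds 0. \<forall>x. norm (iter_deriv vs (?p f t) x - iter_deriv vs g x) <
            \<delta> x"
          unfolding eventually_nhds_metric
        proof (intro exI[of _ "m / M"] conjI allI impI)
          show "m / M > 0" using m M by simp
          fix t :: 'p and x assume "dist t 0 < m / M"
          then have t: "norm t * M < m" using M by (simp add: field_simps)
          show "norm (iter_deriv vs (?p f t) x - iter_deriv vs g x) < \<delta> x"
          proof (cases "x \<in> cball 0 R")
            case True
            have "norm t * S x \<le> norm t * M" using M(2)[OF True] S0[of x] by (intro mult_left_mono) auto
            then show ?thesis using bd[of t x] t m(2)[OF True] by (simp add: \<mu>_def)
          next
            case False
            have "iter_deriv vs (hb b) x = 0" for b
            proof -
              have "\<forall>x\<in>- cball 0 R. iter_deriv vs (hb b) x = iter_deriv vs (\<lambda>x. 0) x"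
                by (rule iter_deriv_cong_open) (use hb(2) in auto)
              then show ?thesis using False by (simp add: iter_deriv_const0)
            qed
            then show ?thesis unfolding it using base by simp
          qed
        qed
      qed
      then have "\<forall>\<^sub>F t in nhds 0. \<forall>vs\<in>?L. \<forall>x. norm (iter_deriv vs (?p f t) x -
          iter_deriv vs g x) < \<delta> x"
        by (rule eventually_ball_finite[OF fin])
      then show "\<forall>\<^sub>F t in nhds 0. ?p f t \<in> whitney_nbhd k \<delta> g"
      proof eventually_elim
        case (elim t)
        have "smooth_on UNIV (?p f t)" by (intro smooth_on_add sf shs)
        then show ?case using elim by (auto simp: whitney_nbhd_def in_lists_conv_set subset_iff)
      qed
    qed
  qed
  then show ?thesis using f by blast
qed

section \<open>A transversal family of perturbations\<close>

type_synonym par = "(real \<times> real \<times> real \<times> real) \<times> (real \<times> real \<times> real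
    \<times> real) \<times>
  (real \<times> real \<times> real \<times> real) \<times> (real \<times> real \<times> real \<times> real)"

text \<open>Normalised so that the parameters can be recovered, one after the other, from the values at
  any single point of the quantities in \<open>jet_values\<close>.\<close>

fun pert :: "par \<Rightarrow> bde_family" where
  "pert ((t0, t1, t2, t3), (t4, s1, s2, s3), (s4, s5, u1, u2), (u3, r0, r1, c)) ((x, y), e) =
    (t0 + t1 * x + t2 * x\<^sup>2 / 2 + t3 * x ^ 3 / 6 + t4 * x ^ 4 / 24 + s1 * y + s2 * x * y + s3 * x\<^sup>2 * y / 2
       + s4 * y\<^sup>2 / 2 + s5 * x * y\<^sup>2 / 2 + u1 * e + u2 * x * e + u3 * x\<^sup>2 * e / 2,
     (r0 + r1 * x) / 2, c)"

text \<open>The sixteen jet coordinates occurring in the degeneracies that \<open>pert\<close> moves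
  independently. The other jets that occur are determined by these and by the unperturbed function
  through \<open>pert_relations\<close>.\<close>

definition jet_values :: "(jet_family \<Rightarrow> real) \<Rightarrow> jet_family \<Rightarrow> par" where
  "jet_values F w = ((F w, xi F w, xi (xi F) w, xi (xi (xi F)) w),
     (xi (xi (xi (xi F))) w, dd dY F w, dd dY (xi F) w, dd dY (xi (xi F)) w),
     (dd dY (dd dY F) w, dd dY (dd dY (xi F)) w, dd dE F w, dd dE (xi F) w),
     (dd dE (xi (xi F)) w, dd dP F w, dd dP (xi F) w, dd dP (dd dP F) w))"

lemma par_cases:
  fixes t :: par
  obtains t0 t1 t2 t3 t4 s1 s2 s3 s4 s5 u1 u2 u3 r0 r1 c
  where "t = ((t0, t1, t2, t3), (t4, s1, s2, s3), (s4, s5, u1, u2), (u3, r0, r1, c))"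
proof -
  obtain a b c d where t: "t = (a, b, c, d)" by (rule prod_cases4)
  obtain a1 a2 a3 a4 where a: "a = (a1, a2, a3, a4)" by (rule prod_cases4)
  obtain b1 b2 b3 b4 where b: "b = (b1, b2, b3, b4)" by (rule prod_cases4)
  obtain c1 c2 c3 c4 where c: "c = (c1, c2, c3, c4)" by (rule prod_cases4)
  obtain d1 d2 d3 d4 where d: "d = (d1, d2, d3, d4)" by (rule prod_cases4)
  show thesis by (rule that) (simp only: t a b c d)
qed

lemma linear_pert: "linear (\<lambda>t. pert t z)"
proof (rule linearI)
  obtain x y e where z: "z = ((x, y), e)" by (metis prod.collapse)
  show "pert (t + t') z = pert t z + pert t' z" for t t'
    by (rule par_cases[of t], rule par_cases[of t'])
      (simp only: z pert.simps add_Pair, simp add: algebra_simps add_divide_distrib)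
  show "pert (r *\<^sub>R t) z = r *\<^sub>R pert t z" for r t
    by (rule par_cases[of t]) (simp only: z pert.simps scaleR_Pair, simp add: algebra_simps)
qed

lemma pert_basis: "pert t z = (\<Sum>b\<in>Basis. (t \<bullet> b) *\<^sub>R pert b z)"
proof -
  interpret linear "\<lambda>t. pert t z" by (rule linear_pert)
  have "pert t z = pert (\<Sum>b\<in>Basis. (t \<bullet> b) *\<^sub>R b) z" by (simp add: euclidean_representation)
  also have "\<dots> = (\<Sum>b\<in>Basis. (t \<bullet> b) *\<^sub>R pert b z)" unfolding sum by (simp add: scale)
  finally show ?thesis .
qed

lemma smooth_on_pert: "smooth_on UNIV (pert t)"
proof -
  obtain t0 t1 t2 t3 t4 s1 s2 s3 s4 s5 u1 u2 u3 r0 r1 c where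
    t: "t = ((t0, t1, t2, t3), (t4, s1, s2, s3), (s4, s5, u1, u2), (u3, r0, r1, c))"
    by (rule par_cases)
  define x where "x z = fst (fst z)" for z :: "plane \<times> real"
  define y where "y z = snd (fst z)" for z :: "plane \<times> real"
  define e where "e z = snd z" for z :: "plane \<times> real"
  have s: "smooth_on UNIV x" "smooth_on UNIV y" "smooth_on UNIV e"
    unfolding x_def y_def e_def by (intro smooth_intros open_UNIV)+
  have "pert t z = (t0 + t1 * x z + t2 * (x z)\<^sup>2 / 2 + t3 * (x z) ^ 3 / 6 + t4 * (x z) ^ 4 / 24 + s1 * y z +
      s2 * x z * y z + s3 * (x z)\<^sup>2 * y z / 2
       + s4 * (y z)\<^sup>2 / 2 + s5 * x z * (y z)\<^sup>2 / 2 + u1 * e z + u2 * x z * e z + u3 * (x z)\<^sup>2 * e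
           z / 2,
     (r0 + r1 * x z) / 2, c)" for z
    by (cases z) (auto simp: t x_def y_def e_def)
  then have eq: "pert t = (\<lambda>z. (t0 + t1 * x z + t2 * (x z)\<^sup>2 / 2 + t3 * (x z) ^ 3 / 6 + t4 * (x z) ^
      4 / 24 + s1 * y z + s2 * x z * y z + s3 * (x z)\<^sup>2 * y z / 2
       + s4 * (y z)\<^sup>2 / 2 + s5 * x z * (y z)\<^sup>2 / 2 + u1 * e z + u2 * x z * e z + u3 * (x z)\<^sup>2 * e
           z / 2,
     (r0 + r1 * x z) / 2, c))" by (rule ext)
  show ?thesis unfolding eq
    by (intro smooth_on_Pair smooth_on_add smooth_on_divide smooth_on_mult smooth_on_power s smooth_on_const
        open_UNIV) auto
qed

section \<open>Explicit jets of the polynomial family\<close>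

lemma F4_plus: "F4 (\<lambda>z. A z + T z) = (\<lambda>w. F4 A w + F4 T w)"
  by (simp add: F4_def fun_eq_iff inner_add_left)

lemma xi_plus:
  assumes "smooth_on UNIV f" "smooth_on UNIV g"
  shows "xi (\<lambda>w. f w + g w) = (\<lambda>w. xi f w + xi g w)"
  unfolding xi_def[abs_def] dd_plus[OF assms] by (simp add: algebra_simps)

lemma poly_derivs:
  fixes f :: "real \<Rightarrow> real \<Rightarrow> real \<Rightarrow> real \<Rightarrow> real"
  assumes "\<And>x y e p. ((\<lambda>x. f x y e p) has_real_derivative fx x y e p) (at x)"
    and "\<And>x y e p. ((\<lambda>y. f x y e p) has_real_derivative fy x y e p) (at y)"
    and "\<And>x y e p. ((\<lambda>e. f x y e p) has_real_derivative fe x y e p) (at e)"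
    and "\<And>x y e p. ((\<lambda>p. f x y e p) has_real_derivative fp x y e p) (at p)"
    and s: "smooth_on UNIV (\<lambda>w. f (fst (fst (fst w))) (snd (fst (fst w))) (snd (fst w)) (snd w))"
  shows "dd dX (\<lambda>w. f (fst (fst (fst w))) (snd (fst (fst w))) (snd (fst w)) (snd w))
      = (\<lambda>w. fx (fst (fst (fst w))) (snd (fst (fst w))) (snd (fst w)) (snd w))"
    and "dd dY (\<lambda>w. f (fst (fst (fst w))) (snd (fst (fst w))) (snd (fst w)) (snd w))
      = (\<lambda>w. fy (fst (fst (fst w))) (snd (fst (fst w))) (snd (fst w)) (snd w))"
    and "dd dE (\<lambda>w. f (fst (fst (fst w))) (snd (fst (fst w))) (snd (fst w)) (snd w))
      = (\<lambda>w. fe (fst (fst (fst w))) (snd (fst (fst w))) (snd (fst w)) (snd w))"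
    and "dd dP (\<lambda>w. f (fst (fst (fst w))) (snd (fst (fst w))) (snd (fst w)) (snd w))
      = (\<lambda>w. fp (fst (fst (fst w))) (snd (fst (fst w))) (snd (fst w)) (snd w))"
proof -
  let ?F = "\<lambda>w. f (fst (fst (fst w))) (snd (fst (fst w))) (snd (fst w)) (snd w)"
  have l: "((\<lambda>t. ?F (w + t *\<^sub>R v)) has_real_derivative dd v ?F w) (at 0)" for v w
    using line_has_derivative[of ?F w 0 v] smooth_on_differentiable[OF s] by simp
  have g: "dd v ?F w = D" if "((\<lambda>t. g (a + t)) has_real_derivative D) (at 0)" "\<And>t. ?F (w + t *\<^sub>R
      v) = g (a + t)" for v w g D and a :: real
    using DERIV_unique[OF l[of w v, unfolded that(2)] that(1)] .
  have sh: "((\<lambda>t. g (a + t)) has_real_derivative D) (at 0)" if "(g has_real_derivative D) (at a)" for g D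
      and a :: real
    using that DERIV_shift[of g D 0 a] by (simp add: add.commute)
  show "dd dX ?F = (\<lambda>w. fx (fst (fst (fst w))) (snd (fst (fst w))) (snd (fst w)) (snd w))"
    by (rule ext, rule g[OF sh[OF assms(1)]]) simp
  show "dd dY ?F = (\<lambda>w. fy (fst (fst (fst w))) (snd (fst (fst w))) (snd (fst w)) (snd w))"
    by (rule ext, rule g[OF sh[OF assms(2)]]) simp
  show "dd dE ?F = (\<lambda>w. fe (fst (fst (fst w))) (snd (fst (fst w))) (snd (fst w)) (snd w))"
    by (rule ext, rule g[OF sh[OF assms(3)]]) simp
  show "dd dP ?F = (\<lambda>w. fp (fst (fst (fst w))) (snd (fst (fst w))) (snd (fst w)) (snd w))"
    by (rule ext, rule g[OF sh[OF assms(4)]]) simp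
qed

abbreviation lift4 :: "(real \<Rightarrow> real \<Rightarrow> real \<Rightarrow> real \<Rightarrow> real)
    \<Rightarrow> jet_family \<Rightarrow> real" where
  "lift4 f \<equiv> (\<lambda>w. f (fst (fst (fst w))) (snd (fst (fst w))) (snd (fst w)) (snd w))"

text \<open>The coordinates of \<open>jet_values\<close> form a triangular system in the parameters:
  the highest jets contain a single parameter, each lower one adds one new parameter to known
  terms.\<close>

lemma pert_jet:
  fixes t0 t1 t2 t3 t4 s1 s2 s3 s4 s5 u1 u2 u3 r0 r1 c :: real
  defines "Q \<equiv> F4 (pert ((t0, t1, t2, t3), (t4, s1, s2, s3), (s4, s5, u1, u2), (u3, r0, r1, c)))"
  shows "Q = lift4 (\<lambda>x y e p. t0 + t1 * x + t2 * x\<^sup>2 / 2 + t3 * x ^ 3 / 6 + t4 * x ^ 4 / 24 + s1 * y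
      + s2 * x * y + s3 * x\<^sup>2 * y / 2
       + s4 * y\<^sup>2 / 2 + s5 * x * y\<^sup>2 / 2 + u1 * e + u2 * x * e + u3 * x\<^sup>2 * e / 2 + (r0 + r1 * x)
           * p + c * p\<^sup>2)" (is ?A)
    and "xi Q = lift4 (\<lambda>x y e p. t1 + t2 * x + t3 * x\<^sup>2 / 2 + t4 * x ^ 3 / 6 + s2 * y + s3 * x * y +
        s5 * y\<^sup>2 / 2
       + u2 * e + u3 * x * e + r1 * p + p * (s1 + s2 * x + s3 * x\<^sup>2 / 2 + s4 * y + s5 * x * y))" (is ?B)
    and "xi (xi Q) = lift4 (\<lambda>x y e p. t2 + t3 * x + t4 * x\<^sup>2 / 2 + s3 * y + u3 * e + 2 * p * (s2 + s3
        * x + s5 * y) + p\<^sup>2 * (s4 + s5 * x))" (is ?C)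
    and "xi (xi (xi Q)) = lift4 (\<lambda>x y e p. t3 + t4 * x + 3 * p * s3 + 3 * p\<^sup>2 * s5)" (is ?D)
    and "xi (xi (xi (xi Q))) = lift4 (\<lambda>x y e p. t4)" (is ?E)
    and "dd dY Q = lift4 (\<lambda>x y e p. s1 + s2 * x + s3 * x\<^sup>2 / 2 + s4 * y + s5 * x * y)" (is ?Y0)
    and "dd dY (xi Q) = lift4 (\<lambda>x y e p. s2 + s3 * x + s5 * y + p * (s4 + s5 * x))" (is ?Y1)
    and "dd dY (xi (xi Q)) = lift4 (\<lambda>x y e p. s3 + 2 * p * s5)" (is ?Y2)
    and "dd dY (dd dY Q) = lift4 (\<lambda>x y e p. s4 + s5 * x)"
    and "dd dY (dd dY (xi Q)) = lift4 (\<lambda>x y e p. s5)"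
    and "dd dE Q = lift4 (\<lambda>x y e p. u1 + u2 * x + u3 * x\<^sup>2 / 2)"
    and "dd dE (xi Q) = lift4 (\<lambda>x y e p. u2 + u3 * x)"
    and "dd dE (xi (xi Q)) = lift4 (\<lambda>x y e p. u3)"
    and "dd dP Q = lift4 (\<lambda>x y e p. r0 + r1 * x + 2 * c * p)" (is ?P0)
    and "dd dP (xi Q) = lift4 (\<lambda>x y e p. r1 + (s1 + s2 * x + s3 * x\<^sup>2 / 2 + s4 * y + s5 * x * y))"
        (is ?P1)
    and "dd dP (xi (xi Q)) = lift4 (\<lambda>x y e p. 2 * (s2 + s3 * x + s5 * y) + 2 * p * (s4 + s5 * x))"
    and "dd dP (dd dP Q) = lift4 (\<lambda>x y e p. 2 * c)"
    and "dd dY (dd dP Q) = lift4 (\<lambda>x y e p. 0)"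
    and "dd dP (dd dY Q) = lift4 (\<lambda>x y e p. 0)"
    and "dd dY (dd dP (xi Q)) = lift4 (\<lambda>x y e p. s4 + s5 * x)"
    and "dd dP (dd dP (xi Q)) = lift4 (\<lambda>x y e p. 0)" (is ?P2)
    and "dd dP (dd dP (dd dP (xi Q))) = lift4 (\<lambda>x y e p. 0)"
    and "dd dP (dd dY (xi Q)) = lift4 (\<lambda>x y e p. s4 + s5 * x)"
proof -
  have sQ: "smooth_on UNIV Q" unfolding Q_def by (rule smooth_on_F4[OF smooth_on_pert])
  note sx = smooth_on_xi[OF sQ] smooth_on_xi[OF smooth_on_xi[OF sQ]] smooth_on_xi[OF smooth_on_xi[OF
      smooth_on_xi[OF sQ]]]
  show A: ?A
    unfolding Q_def by (rule ext) (auto simp: F4_def inner_prod_def algebra_simps split: prod.splits)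
  note dA = poly_derivs[OF _ _ _ _ sQ[unfolded A], folded A,
      where fx="\<lambda>x y e p. t1 + t2 * x + t3 * x\<^sup>2 / 2 + t4 * x ^ 3 / 6 + s2 * y + s3 * x * y + s5 *
          y\<^sup>2 / 2 + u2 * e + u3 * x * e + r1 * p"
      and fy="\<lambda>x y e p. s1 + s2 * x + s3 * x\<^sup>2 / 2 + s4 * y + s5 * x * y"
      and fe="\<lambda>x y e p. u1 + u2 * x + u3 * x\<^sup>2 / 2"
      and fp="\<lambda>x y e p. r0 + r1 * x + 2 * c * p"]
  have dA': "dd dX Q = lift4 (\<lambda>x y e p. t1 + t2 * x + t3 * x\<^sup>2 / 2 + t4 * x ^ 3 / 6 + s2 * y + s3 * x
      * y + s5 * y\<^sup>2 / 2 + u2 * e + u3 * x * e + r1 * p)"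
    "dd dY Q = lift4 (\<lambda>x y e p. s1 + s2 * x + s3 * x\<^sup>2 / 2 + s4 * y + s5 * x * y)"
    "dd dE Q = lift4 (\<lambda>x y e p. u1 + u2 * x + u3 * x\<^sup>2 / 2)"
    "dd dP Q = lift4 (\<lambda>x y e p. r0 + r1 * x + 2 * c * p)"
    by (rule dA; auto intro!: derivative_eq_intros simp: power2_eq_square power3_eq_cube field_simps)+
  show ?Y0 ?P0 "dd dE Q = lift4 (\<lambda>x y e p. u1 + u2 * x + u3 * x\<^sup>2 / 2)" by (fact dA')+
  show B: ?B unfolding xi_def[of Q, abs_def] dA' by (simp add: algebra_simps)
  note dB = poly_derivs[OF _ _ _ _ sx(1)[unfolded B], folded B,
      where fx="\<lambda>x y e p. t2 + t3 * x + t4 * x\<^sup>2 / 2 + s3 * y + u3 * e + p * (s2 + s3 * x + s5 * y)"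
      and fy="\<lambda>x y e p. s2 + s3 * x + s5 * y + p * (s4 + s5 * x)"
      and fe="\<lambda>x y e p. u2 + u3 * x"
      and fp="\<lambda>x y e p. r1 + (s1 + s2 * x + s3 * x\<^sup>2 / 2 + s4 * y + s5 * x * y)"]
  have dB': "dd dX (xi Q) = lift4 (\<lambda>x y e p. t2 + t3 * x + t4 * x\<^sup>2 / 2 + s3 * y + u3 * e + p * (s2 +
      s3 * x + s5 * y))"
    "dd dY (xi Q) = lift4 (\<lambda>x y e p. s2 + s3 * x + s5 * y + p * (s4 + s5 * x))"
    "dd dE (xi Q) = lift4 (\<lambda>x y e p. u2 + u3 * x)"
    "dd dP (xi Q) = lift4 (\<lambda>x y e p. r1 + (s1 + s2 * x + s3 * x\<^sup>2 / 2 + s4 * y + s5 * x * y))"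
    by (rule dB; auto intro!: derivative_eq_intros simp: power2_eq_square power3_eq_cube field_simps)+
  show ?Y1 ?P1 "dd dE (xi Q) = lift4 (\<lambda>x y e p. u2 + u3 * x)" by (fact dB')+
  show C: ?C unfolding xi_def[of "xi Q", abs_def] dB' by (simp add: algebra_simps power2_eq_square)
  note dC = poly_derivs[OF _ _ _ _ sx(2)[unfolded C], folded C,
      where fx="\<lambda>x y e p. t3 + t4 * x + 2 * p * s3 + p\<^sup>2 * s5"
      and fy="\<lambda>x y e p. s3 + 2 * p * s5"
      and fe="\<lambda>x y e p. u3"
      and fp="\<lambda>x y e p. 2 * (s2 + s3 * x + s5 * y) + 2 * p * (s4 + s5 * x)"]
  have dC': "dd dX (xi (xi Q)) = lift4 (\<lambda>x y e p. t3 + t4 * x + 2 * p * s3 + p\<^sup>2 * s5)"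
    "dd dY (xi (xi Q)) = lift4 (\<lambda>x y e p. s3 + 2 * p * s5)"
    "dd dE (xi (xi Q)) = lift4 (\<lambda>x y e p. u3)"
    "dd dP (xi (xi Q)) = lift4 (\<lambda>x y e p. 2 * (s2 + s3 * x + s5 * y) + 2 * p * (s4 + s5 * x))"
    by (rule dC; auto intro!: derivative_eq_intros simp: power2_eq_square power3_eq_cube field_simps)+
  show ?Y2 "dd dE (xi (xi Q)) = lift4 (\<lambda>x y e p. u3)"
    "dd dP (xi (xi Q)) = lift4 (\<lambda>x y e p. 2 * (s2 + s3 * x + s5 * y) + 2 * p * (s4 + s5 * x))" by (fact dC')+
  show D: ?D unfolding xi_def[of "xi (xi Q)", abs_def] dC' by (simp add: algebra_simps power2_eq_square)
  note dD = poly_derivs[OF _ _ _ _ sx(3)[unfolded D], folded D,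
      where fx="\<lambda>x y e p. t4" and fy="\<lambda>x y e p. 0" and fe="\<lambda>x y e p. 0" and fp="\<lambda>x
          y e p. 3 * s3 + 6 * p * s5"]
  have dD': "dd dX (xi (xi (xi Q))) = lift4 (\<lambda>x y e p. t4)" "dd dY (xi (xi (xi Q))) = lift4 (\<lambda>x y e
      p. 0)"
    by (rule dD; auto intro!: derivative_eq_intros simp: power2_eq_square field_simps)+
  show ?E unfolding xi_def[of "xi (xi (xi Q))", abs_def] dD' by simp
  note dY0 = poly_derivs[OF _ _ _ _ smooth_on_dd[OF sQ, of dY, unfolded dA'(2)], folded dA'(2),
      where fx="\<lambda>x y e p. s2 + s3 * x + s5 * y" and fy="\<lambda>x y e p. s4 + s5 * x" and fe="\<lambda>x y
          e p. 0" and fp="\<lambda>x y e p. 0"]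
  show "dd dY (dd dY Q) = lift4 (\<lambda>x y e p. s4 + s5 * x)" "dd dP (dd dY Q) = lift4 (\<lambda>x y e p. 0)"
    by (rule dY0; auto intro!: derivative_eq_intros simp: power2_eq_square field_simps)+
  note dP0 = poly_derivs[OF _ _ _ _ smooth_on_dd[OF sQ, of dP, unfolded dA'(4)], folded dA'(4),
      where fx="\<lambda>x y e p. r1" and fy="\<lambda>x y e p. 0" and fe="\<lambda>x y e p. 0" and fp="\<lambda>x
          y e p. 2 * c"]
  show "dd dP (dd dP Q) = lift4 (\<lambda>x y e p. 2 * c)" "dd dY (dd dP Q) = lift4 (\<lambda>x y e p. 0)"
    by (rule dP0; auto intro!: derivative_eq_intros simp: power2_eq_square field_simps)+
  note dY1 = poly_derivs[OF _ _ _ _ smooth_on_dd[OF sx(1), of dY, unfolded dB'(2)], folded dB'(2),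
      where fx="\<lambda>x y e p. s3 + p * s5" and fy="\<lambda>x y e p. s5" and fe="\<lambda>x y e p. 0" and
          fp="\<lambda>x y e p. s4 + s5 * x"]
  show "dd dY (dd dY (xi Q)) = lift4 (\<lambda>x y e p. s5)" "dd dP (dd dY (xi Q)) = lift4 (\<lambda>x y e p. s4 +
      s5 * x)"
    by (rule dY1; auto intro!: derivative_eq_intros simp: power2_eq_square field_simps)+
  note dP1 = poly_derivs[OF _ _ _ _ smooth_on_dd[OF sx(1), of dP, unfolded dB'(4)], folded dB'(4),
      where fx="\<lambda>x y e p. s2 + s3 * x + s5 * y" and fy="\<lambda>x y e p. s4 + s5 * x" and fe="\<lambda>x y
          e p. 0" and fp="\<lambda>x y e p. 0"]
  show "dd dY (dd dP (xi Q)) = lift4 (\<lambda>x y e p. s4 + s5 * x)" and P2: ?P2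
    by (rule dP1; auto intro!: derivative_eq_intros simp: power2_eq_square field_simps)+
  show "dd dP (dd dP (dd dP (xi Q))) = lift4 (\<lambda>x y e p. 0)" unfolding P2 by (simp add: fun_eq_iff)
qed

lemma jet_values_plus:
  assumes "smooth_on UNIV F" "smooth_on UNIV G"
  shows "jet_values (\<lambda>w. F w + G w) w = jet_values F w + jet_values G w"
  by (simp add: jet_values_def xi_plus dd_plus smooth_on_xi smooth_on_dd assms)

type_synonym free = "(real \<times> real \<times> real \<times> real) \<times> (real \<times> real \<times> real
    \<times> real) \<times> (real \<times> real \<times> real)"

lemma smooth_on_jet_values:
  assumes F: "smooth_on UNIV F" shows "smooth_on UNIV (jet_values F)"
  unfolding jet_values_def by (intro smooth_on_Pair smooth_on_dd smooth_on_xi F)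

text \<open>Jets are additive, so the jets of the perturbation must be the prescribed ones minus
  those of \<open>F\<close>. The triangular system then determines the parameter as a smooth
  function \<open>\<tau>\<close> of the point of \<open>\<Omega>\<close>, whose dimension is 4 + 11
  = 15.\<close>

lemma negligible_parametrised:
  fixes V :: "jet_family \<times> free \<Rightarrow> par"
  assumes F: "smooth_on UNIV F" and V: "smooth_on \<Omega> V"
  shows "negligible {t. \<exists>\<omega>\<in>\<Omega>. jet_values (\<lambda>w. F w + F4 (pert t) w) (fst \<omega>)
      = V \<omega>}"
proof -
  have op: "open \<Omega>" using V smooth_on_open by blast
  define d where "d \<omega> = V \<omega> - jet_values F (fst \<omega>)" for \<omega>
  have sF: "smooth_on \<Omega> (\<lambda>\<omega>. jet_values F (fst \<omega>))"
    by (rule smooth_on_compose[OF smooth_on_jet_values[OF F]]) (auto intro!: smooth_intros op)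
  have sd: "smooth_on \<Omega> d" unfolding d_def by (intro smooth_on_diff V sF)
  define a where "a \<omega> = fst (d \<omega>)" for \<omega>
  define b where "b \<omega> = fst (snd (d \<omega>))" for \<omega>
  define c where "c \<omega> = fst (snd (snd (d \<omega>)))" for \<omega>
  define g where "g \<omega> = snd (snd (snd (d \<omega>)))" for \<omega>
  define x where "x \<omega> = fst (fst (fst (fst \<omega>)))" for \<omega> :: "jet_family \<times> free"
  define y where "y \<omega> = snd (fst (fst (fst \<omega>)))" for \<omega> :: "jet_family \<times> free"
  define e where "e \<omega> = snd (fst (fst \<omega>))" for \<omega> :: "jet_family \<times> free"
  define p where "p \<omega> = snd (fst \<omega>)" for \<omega> :: "jet_family \<times> free"
  have s0: "smooth_on \<Omega> a" "smooth_on \<Omega> b" "smooth_on \<Omega> c" "smooth_on \<Omega> g"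
    "smooth_on \<Omega> x" "smooth_on \<Omega> y" "smooth_on \<Omega> e" "smooth_on \<Omega> p"
    unfolding a_def b_def c_def g_def x_def y_def e_def p_def by (intro smooth_intros op sd)+
  \<comment> \<open>Back substitution, each group starting from a parameter that is a jet coordinate
    by itself up to a constant factor: s5, u3, c0 and t4.\<close>
  define s5 where "s5 \<omega> = fst (snd (c \<omega>))" for \<omega>
  have s1: "smooth_on \<Omega> s5" unfolding s5_def by (intro smooth_intros s0)
  define s4 where "s4 \<omega> = fst (c \<omega>) - s5 \<omega> * x \<omega>" for \<omega>
  have s2: "smooth_on \<Omega> s4" unfolding s4_def by (intro smooth_intros s0 s1)
  define s3 where "s3 \<omega> = snd (snd (snd (b \<omega>))) - 2 * p \<omega> * s5 \<omega>" for \<omega>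
  have s3': "smooth_on \<Omega> s3" unfolding s3_def by (intro smooth_intros s0 s1 op)
  define s2 where "s2 \<omega> = fst (snd (snd (b \<omega>))) - s3 \<omega> * x \<omega> - s5 \<omega> * y \<omega>
      - p \<omega> * (s4 \<omega> + s5 \<omega> * x \<omega>)" for \<omega>
  have s4': "smooth_on \<Omega> s2" unfolding s2_def by (intro smooth_intros s0 s1 s2 s3' op)
  define Fy where "Fy \<omega> = fst (snd (b \<omega>))" for \<omega>
  have s5': "smooth_on \<Omega> Fy" unfolding Fy_def by (intro smooth_intros s0)
  define s1 where "s1 \<omega> = Fy \<omega> - (s2 \<omega> * x \<omega> + s3 \<omega> * (x \<omega>)\<^sup>2 / 2 +
      s4 \<omega> * y \<omega> + s5 \<omega> * x \<omega> * y \<omega>)" for \<omega>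
  have s6: "smooth_on \<Omega> s1" unfolding s1_def by (intro smooth_intros s0 s1 s2 s3' s4' s5' op) auto
  define u3 where "u3 \<omega> = fst (g \<omega>)" for \<omega>
  have s7: "smooth_on \<Omega> u3" unfolding u3_def by (intro smooth_intros s0)
  define u2 where "u2 \<omega> = snd (snd (snd (c \<omega>))) - u3 \<omega> * x \<omega>" for \<omega>
  have s8: "smooth_on \<Omega> u2" unfolding u2_def by (intro smooth_intros s0 s7)
  define u1 where "u1 \<omega> = fst (snd (snd (c \<omega>))) - u2 \<omega> * x \<omega> - u3 \<omega> * (x
      \<omega>)\<^sup>2 / 2" for \<omega>
  have s9: "smooth_on \<Omega> u1" unfolding u1_def by (intro smooth_intros s0 s7 s8 op) auto
  define c0 where "c0 \<omega> = snd (snd (snd (g \<omega>))) / 2" for \<omega>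
  have s10: "smooth_on \<Omega> c0" unfolding c0_def by (intro smooth_intros s0 op) auto
  define r1 where "r1 \<omega> = fst (snd (snd (g \<omega>))) - Fy \<omega>" for \<omega>
  have s11: "smooth_on \<Omega> r1" unfolding r1_def by (intro smooth_intros s0 s5')
  define r0 where "r0 \<omega> = fst (snd (g \<omega>)) - r1 \<omega> * x \<omega> - 2 * c0 \<omega> * p \<omega>"
      for \<omega>
  have s12: "smooth_on \<Omega> r0" unfolding r0_def by (intro smooth_intros s0 s10 s11 op)
  define t4 where "t4 \<omega> = fst (b \<omega>)" for \<omega>
  have s13: "smooth_on \<Omega> t4" unfolding t4_def by (intro smooth_intros s0)
  define t3 where "t3 \<omega> = snd (snd (snd (a \<omega>))) - t4 \<omega> * x \<omega> - 3 * p \<omega> * s3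
      \<omega> - 3 * (p \<omega>)\<^sup>2 * s5 \<omega>" for \<omega>
  have s14: "smooth_on \<Omega> t3" unfolding t3_def by (intro smooth_intros s0 s1 s3' s13 op)
  define t2 where "t2 \<omega> = fst (snd (snd (a \<omega>))) - (t3 \<omega> * x \<omega> + t4 \<omega> * (x
      \<omega>)\<^sup>2 / 2 + s3 \<omega> * y \<omega> + u3 \<omega> * e \<omega>
     + 2 * p \<omega> * (s2 \<omega> + s3 \<omega> * x \<omega> + s5 \<omega> * y \<omega>) + (p \<omega>)\<^sup>2
         * (s4 \<omega> + s5 \<omega> * x \<omega>))" for \<omega>
  have s15: "smooth_on \<Omega> t2" unfolding t2_def by (intro smooth_intros s0 s1 s2 s3' s4' s7 s13 s14 op) auto
  define t1 where "t1 \<omega> = fst (snd (a \<omega>)) - (t2 \<omega> * x \<omega> + t3 \<omega> * (x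
      \<omega>)\<^sup>2 / 2 + t4 \<omega> * (x \<omega>) ^ 3 / 6 + s2 \<omega> * y \<omega>
     + s3 \<omega> * x \<omega> * y \<omega> + s5 \<omega> * (y \<omega>)\<^sup>2 / 2 + u2 \<omega> * e \<omega> +
         u3 \<omega> * x \<omega> * e \<omega> + r1 \<omega> * p \<omega> + p \<omega> * Fy \<omega>)" for \<omega>
  have s16: "smooth_on \<Omega> t1" unfolding t1_def
    by (intro smooth_intros s0 s1 s3' s4' s5' s7 s8 s11 s13 s14 s15 op) auto
  define t0 where "t0 \<omega> = fst (a \<omega>) - (t1 \<omega> * x \<omega> + t2 \<omega> * (x \<omega>)\<^sup>2
      / 2 + t3 \<omega> * (x \<omega>) ^ 3 / 6 + t4 \<omega> * (x \<omega>) ^ 4 / 24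
     + s1 \<omega> * y \<omega> + s2 \<omega> * x \<omega> * y \<omega> + s3 \<omega> * (x \<omega>)\<^sup>2 * y
         \<omega> / 2 + s4 \<omega> * (y \<omega>)\<^sup>2 / 2 + s5 \<omega> * x \<omega> * (y \<omega>)\<^sup>2 / 2
     + u1 \<omega> * e \<omega> + u2 \<omega> * x \<omega> * e \<omega> + u3 \<omega> * (x \<omega>)\<^sup>2 * e
         \<omega> / 2 + (r0 \<omega> + r1 \<omega> * x \<omega>) * p \<omega> + c0 \<omega> * (p
            \<omega>)\<^sup>2)" for \<omega>
  have s17: "smooth_on \<Omega> t0" unfolding t0_def
    by (intro smooth_intros s0 s1 s2 s3' s4' s6 s7 s8 s9 s10 s11 s12 s13 s14 s15 s16 op) auto
  define \<tau> where "\<tau> \<omega> = ((t0 \<omega>, t1 \<omega>, t2 \<omega>, t3 \<omega>), (t4 \<omega>, s1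
      \<omega>, s2 \<omega>, s3 \<omega>), (s4 \<omega>, s5 \<omega>, u1 \<omega>, u2 \<omega>), (u3 \<omega>, r0
          \<omega>, r1 \<omega>, c0 \<omega>))" for \<omega>
  have s\<tau>: "smooth_on \<Omega> \<tau>" unfolding \<tau>_def
    by (intro smooth_on_Pair s1 s2 s3' s4' s6 s7 s8 s9 s10 s11 s12 s13 s14 s15 s16 s17)
  \<comment> \<open>A differentiable image of a fifteen-dimensional set in sixteen dimensions is
    null.\<close>
  have "negligible (\<tau> ` \<Omega>)"
    by (rule negligible_differentiable_image_lowdim[OF _ smooth_on_differentiable_on[OF s\<tau>]]) simp
  moreover have "{t. \<exists>\<omega>\<in>\<Omega>. jet_values (\<lambda>w. F w + F4 (pert t) w) (fst \<omega>) =
      V \<omega>} \<subseteq> \<tau> ` \<Omega>"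
  proof
    fix t assume "t \<in> {t. \<exists>\<omega>\<in>\<Omega>. jet_values (\<lambda>w. F w + F4 (pert t) w) (fst
        \<omega>) = V \<omega>}"
    then obtain \<omega> where \<omega>: "\<omega> \<in> \<Omega>" and eq: "jet_values (\<lambda>w. F w + F4 (pert
        t) w) (fst \<omega>) = V \<omega>" by blast
    have deq: "d \<omega> = jet_values (F4 (pert t)) (fst \<omega>)"
      unfolding d_def eq[symmetric] jet_values_plus[OF F smooth_on_F4[OF smooth_on_pert]] by simp
    obtain t0' t1' t2' t3' t4' s1' s2' s3' s4' s5' u1' u2' u3' r0' r1' c' where
      t: "t = ((t0', t1', t2', t3'), (t4', s1', s2', s3'), (s4', s5', u1', u2'), (u3', r0', r1', c'))"
      by (rule par_cases)
    \<comment> \<open>The iterated derivatives are evaluated from the longest to the shortest, so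
      that no inner part of an expression is replaced before the whole.\<close>
    note dq = deq[unfolded t jet_values_def, unfolded pert_jet(5), unfolded pert_jet(4), unfolded pert_jet(8),
        unfolded pert_jet(13), unfolded pert_jet(3), unfolded pert_jet(10), unfolded pert_jet(7), unfolded
            pert_jet(12), unfolded pert_jet(15), unfolded pert_jet(2), unfolded pert_jet(9), unfolded pert_jet(17),
            unfolded pert_jet(6), unfolded pert_jet(11), unfolded pert_jet(14), unfolded pert_jet(1)]
    have ab: "x \<omega> = fst (fst (fst (fst \<omega>)))" "y \<omega> = snd (fst (fst (fst \<omega>)))" "e
        \<omega> = snd (fst (fst \<omega>))" "p \<omega> = snd (fst \<omega>)"
      by (simp_all add: x_def y_def e_def p_def)
    have comp: "a \<omega> = fst (d \<omega>)" "b \<omega> = fst (snd (d \<omega>))" "c \<omega> = fst (snd (snd (d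
        \<omega>)))" "g \<omega> = snd (snd (snd (d \<omega>)))"
      by (simp_all add: a_def b_def c_def g_def)
    note dq' = comp[unfolded dq, folded ab, unfolded fst_conv snd_conv]
    have 1: "s5 \<omega> = s5'" by (simp add: s5_def dq')
    have 2: "s4 \<omega> = s4'" by (simp add: s4_def dq' 1)
    have 3: "s3 \<omega> = s3'" by (simp add: s3_def dq' 1)
    have 4: "s2 \<omega> = s2'" by (simp add: s2_def dq' 1 2 3 algebra_simps)
    have 5: "s1 \<omega> = s1'" by (simp add: s1_def Fy_def dq' 1 2 3 4)
    have 6: "u3 \<omega> = u3'" "u2 \<omega> = u2'" by (simp_all add: u2_def u3_def dq')
    have 7: "u1 \<omega> = u1'" by (simp add: u1_def dq' 6)
    have 8: "c0 \<omega> = c'" "r1 \<omega> = r1'" by (simp_all add: c0_def r1_def Fy_def dq')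
    have 9: "r0 \<omega> = r0'" by (simp add: r0_def dq' 8)
    have 10: "t4 \<omega> = t4'" by (simp add: t4_def dq')
    have 11: "t3 \<omega> = t3'" by (simp add: t3_def dq' 1 3 10)
    have 12: "t2 \<omega> = t2'" by (simp add: t2_def dq' 1 2 3 4 6 10 11)
    have 13: "t1 \<omega> = t1'" by (simp add: t1_def Fy_def dq' 1 3 4 6 8 10 11 12)
    have 14: "t0 \<omega> = t0'" by (simp add: t0_def dq' 1 2 3 4 5 6 7 8 9 10 11 12 13)
    have "t = \<tau> \<omega>" unfolding t \<tau>_def 1 2 3 4 5 6 7 8 9 10 11 12 13 14 ..
    then show "t \<in> \<tau> ` \<Omega>" using \<omega> by blast
  qed
  ultimately show ?thesis by (rule negligible_subset)
qed

text \<open>In \<open>pert\<close> the coefficient of p depends on x alone and that of p^2 is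
  constant. Hence the jets outside \<open>jet_values\<close> are either not moved at all or move
  together with F_yy or I_y, where I is \<open>xi F\<close>.\<close>

lemma pert_relations:
  assumes F: "smooth_on UNIV F"
  defines "H \<equiv> \<lambda>t w. F w + F4 (pert t) w"
  shows "dd dY (dd dP (H t)) w = dd dY (dd dP F) w"
    and "dd dP (dd dY (H t)) w = dd dP (dd dY F) w"
    and "dd dP (dd dP (xi (H t))) w = dd dP (dd dP (xi F)) w"
    and "dd dP (dd dP (dd dP (xi (H t)))) w = dd dP (dd dP (dd dP (xi F))) w"
    and "dd dY (dd dP (xi (H t))) w = dd dY (dd dP (xi F)) w + (dd dY (dd dY (H t)) w - dd dY (dd dY F) w)"
    and "dd dP (dd dY (xi (H t))) w = dd dP (dd dY (xi F)) w + (dd dY (dd dY (H t)) w - dd dY (dd dY F) w)"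
    and "dd dP (xi (xi (H t))) w = dd dP (xi (xi F)) w + 2 * (dd dY (xi (H t)) w - dd dY (xi F) w)"
proof -
  have Q: "smooth_on UNIV (F4 (pert t))" by (rule smooth_on_F4[OF smooth_on_pert])
  note s = smooth_on_xi smooth_on_dd F Q
  obtain t0 t1 t2 t3 t4 s1 s2 s3 s4 s5 u1 u2 u3 r0 r1 c where
    t: "t = ((t0, t1, t2, t3), (t4, s1, s2, s3), (s4, s5, u1, u2), (u3, r0, r1, c))"
    by (rule par_cases)
  note j = pert_jet[of t0 t1 t2 t3 t4 s1 s2 s3 s4 s5 u1 u2 u3 r0 r1 c, folded t]
  show "dd dY (dd dP (H t)) w = dd dY (dd dP F) w"
    and "dd dP (dd dY (H t)) w = dd dP (dd dY F) w"
    and "dd dP (dd dP (xi (H t))) w = dd dP (dd dP (xi F)) w"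
    and "dd dP (dd dP (dd dP (xi (H t)))) w = dd dP (dd dP (dd dP (xi F))) w"
    unfolding H_def by (simp_all only: xi_plus dd_plus s j(18,19,21,22) add_0_right)
  show "dd dY (dd dP (xi (H t))) w = dd dY (dd dP (xi F)) w + (dd dY (dd dY (H t)) w - dd dY (dd dY F) w)"
    and "dd dP (dd dY (xi (H t))) w = dd dP (dd dY (xi F)) w + (dd dY (dd dY (H t)) w - dd dY (dd dY F) w)"
    unfolding H_def by (simp_all only: xi_plus dd_plus s j(9,20,23) add_diff_cancel_left')
  show "dd dP (xi (xi (H t))) w = dd dP (xi (xi F)) w + 2 * (dd dY (xi (H t)) w - dd dY (xi F) w)"
    unfolding H_def by (simp only: xi_plus dd_plus s j(7,16) add_diff_cancel_left') (simp only: distrib_left mult.assoc)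
qed

lemma dd_jdet:
  assumes H: "smooth_on UNIV H"
  shows "dd v (jdet H) w = dd v (dd dY (xi H)) w * dd dP H w + dd dY (xi H) w * dd v (dd dP H) w
    - (dd v (dd dP (xi H)) w * dd dY H w + dd dP (xi H) w * dd v (dd dY H) w)"
proof -
  have s: "dd u H differentiable (at w)" "dd u (xi H) differentiable (at w)" for u
    by (intro smooth_on_differentiable[OF smooth_on_dd[OF H]]
      smooth_on_differentiable[OF smooth_on_dd[OF smooth_on_xi[OF H]]] UNIV_I)+
  show ?thesis unfolding jdet_def[abs_def]
    by (subst dd_diff) (auto intro!: differentiable_mult s simp: dd_mult s algebra_simps)
qed

lemma Basis_Pair_iff: "(a, b) \<in> Basis \<longleftrightarrow> a \<in> Basis \<and> b = 0 \<or> a = 0 \<and> b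
    \<in> Basis"
  unfolding Basis_prod_def by auto

text \<open>Three of the sixteen jet coordinates vanish and two are functions of the other ones, so the
  parameters in question form the image of a subset of \<open>\<real>\<^sup>4 \<times> \<real>\<^sup>1\<^sup>1\<close> under a smooth map to
  \<open>\<real>\<^sup>1\<^sup>6\<close>.\<close>

lemma negligible_codim5:
  fixes h1 h2 n :: "jet_family \<times> par \<Rightarrow> real" and b1 b2 :: par
  assumes F: "smooth_on UNIV F" and b: "b1 \<in> Basis" "b2 \<in> Basis" "b1 \<noteq> b2"
    and b0: "{b1, b2} \<inter> {((1, 0, 0, 0), 0), ((0, 1, 0, 0), 0), ((0, 0, 1, 0), 0)} = {}"
    and n: "smooth_on UNIV n"
    and h: "\<And>\<Omega>. open \<Omega> \<Longrightarrow> (\<And>\<omega>. \<omega> \<in> \<Omega>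
        \<Longrightarrow> n \<omega> \<noteq> 0) \<Longrightarrow> smooth_on \<Omega> h1 \<and> smooth_on \<Omega> h2"
    and indep: "\<And>w s r. n (w, s + r *\<^sub>R b1) = n (w, s) \<and> n (w, s + r *\<^sub>R b2) = n (w, s) \<and>
      h1 (w, s + r *\<^sub>R b1) = h1 (w, s) \<and> h1 (w, s + r *\<^sub>R b2) = h1 (w, s) \<and> h2 (w, s + r
          *\<^sub>R b2) = h2 (w, s)"
  defines "H \<equiv> \<lambda>t w. F w + F4 (pert t) w"
  shows "negligible {t. \<exists>w. H t w = 0 \<and> xi (H t) w = 0 \<and> xi (xi (H t)) w = 0 \<and> n (w,
      jet_values (H t) w) \<noteq> 0 \<and>
    jet_values (H t) w \<bullet> b1 = h1 (w, jet_values (H t) w) \<and> jet_values (H t) w \<bullet> b2 = h2 (w,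
        jet_values (H t) w)}"
proof -
  let ?C = "{b1, b2, ((1, 0, 0, 0), 0), ((0, 1, 0, 0), 0), ((0, 0, 1, 0), 0)}"
  \<comment> \<open>The jets whose five distinguished coordinates are zero: an eleven-dimensional
    space, parametrised linearly by \<open>f\<close>.\<close>
  define D where "D = {s :: par. \<forall>i\<in>Basis. i \<notin> Basis - ?C \<longrightarrow> s \<bullet> i = 0}"
  have C: "?C \<subseteq> Basis" using b(1,2) by (simp add: Basis_Pair_iff zero_prod_def)
  have "b1 \<notin> {((1, 0, 0, 0), 0), ((0, 1, 0, 0), 0), ((0, 0, 1, 0), 0)}" "b2 \<notin> {((1, 0, 0, 0), 0),
      ((0, 1, 0, 0), 0), ((0, 0, 1, 0), 0)}"
    using b0 by blast+
  then have "card ?C = 5" using b(3) by (simp add: card_insert_if)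
  then have c11: "card (Basis - ?C) = 11" using C by (simp add: card_Diff_subset)
  have sD: "subspace D" unfolding D_def by (rule subspace_substandard)
  have "dim (UNIV :: free set) = dim D" unfolding D_def using c11 by (subst dim_substandard) (auto simp: dim_UNIV)
  then obtain f :: "free \<Rightarrow> par" where f: "linear f" "f ` UNIV = D"
    by (rule isometries_subspaces[OF subspace_UNIV sD]) (rule that; assumption)
  define \<Omega> where "\<Omega> = {\<omega> \<in> UNIV. n (fst \<omega>, f (snd \<omega>)) \<in> - {0}}"
  have lf: "bounded_linear f" using f(1) linear_conv_bounded_linear by blast
  have sf: "smooth_on UNIV (\<lambda>\<omega>::jet_family \<times> free. (fst \<omega>, f (snd \<omega>)))"
    by (intro smooth_on_Pair smooth_on_bounded_linear_comp[OF lf] smooth_intros open_UNIV)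
  have "open {\<omega> \<in> UNIV. n \<omega> \<in> - {0}}" by (rule open_smooth_vimage[OF n]) auto
  then have h': "smooth_on {\<omega> \<in> UNIV. n \<omega> \<in> - {0}} h1" "smooth_on {\<omega> \<in> UNIV. n
      \<omega> \<in> - {0}} h2"
    using h by auto
  have op: "open \<Omega>" unfolding \<Omega>_def by (rule open_smooth_vimage[OF smooth_on_compose[OF n sf]]) auto
  have s\<Omega>: "smooth_on \<Omega> (\<lambda>\<omega>. (fst \<omega>, f (snd \<omega>)))" by (rule
      smooth_on_subset[OF sf op]) simp
  \<comment> \<open>The missing coordinates are filled in one after the other: first
    \<open>b1\<close> by \<open>h1\<close>, then \<open>b2\<close> by \<open>h2\<close>, which may
    depend on the coordinate just inserted.\<close>
  define v where "v \<omega> = f (snd \<omega>) + h1 (fst \<omega>, f (snd \<omega>)) *\<^sub>R b1" for \<omega> ::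
      "jet_family \<times> free"
  define V where "V \<omega> = v \<omega> + h2 (fst \<omega>, v \<omega>) *\<^sub>R b2" for \<omega>
  have "smooth_on \<Omega> (\<lambda>\<omega>. h1 (fst \<omega>, f (snd \<omega>)))"
    by (rule smooth_on_compose[OF h'(1) s\<Omega>]) (auto simp: \<Omega>_def)
  moreover have "smooth_on \<Omega> (\<lambda>\<omega>. f (snd \<omega>))" using smooth_on_snd[OF s\<Omega>] by simp
  ultimately have sv: "smooth_on \<Omega> v" unfolding v_def by (intro smooth_on_add smooth_on_scaleR
      smooth_on_const op)
  have "smooth_on \<Omega> (\<lambda>\<omega>. (fst \<omega>, v \<omega>))" using smooth_on_Pair[OF
      smooth_on_fst[OF s\<Omega>] sv] by simp
  then have "smooth_on \<Omega> (\<lambda>\<omega>. h2 (fst \<omega>, v \<omega>))"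
    by (rule smooth_on_compose[OF h'(2)]) (auto simp: \<Omega>_def v_def indep)
  then have sV: "smooth_on \<Omega> V" unfolding V_def by (intro smooth_on_add smooth_on_scaleR sv smooth_on_const op)
  show ?thesis
  proof (rule negligible_subset[OF negligible_parametrised[OF F sV]], rule subsetI, rule CollectI, elim CollectE exE)
    fix t w
    define s where "s = jet_values (H t) w"
    assume *: "H t w = 0 \<and> xi (H t) w = 0 \<and> xi (xi (H t)) w = 0 \<and> n (w, jet_values (H t) w) \<noteq>
        0 \<and>
      jet_values (H t) w \<bullet> b1 = h1 (w, jet_values (H t) w) \<and> jet_values (H t) w \<bullet> b2 = h2 (w,
          jet_values (H t) w)"
    \<comment> \<open>The actual jet with its two solvable coordinates erased; by
      \<open>indep\<close> the erasure does not change the formulas that restore them.\<close>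
    define u where "u = s + (- (s \<bullet> b1)) *\<^sub>R b1 + (- (s \<bullet> b2)) *\<^sub>R b2"
    have bb: "b1 \<bullet> b1 = 1" "b2 \<bullet> b2 = 1" "b1 \<bullet> b2 = 0" "b2 \<bullet> b1 = 0"
      using b by (auto simp: inner_Basis)
    have "u \<in> D" unfolding D_def
    proof (intro CollectI ballI impI)
      fix i :: par assume i: "i \<in> Basis" "i \<notin> Basis - ?C"
      have ui: "u \<bullet> i = s \<bullet> i - (s \<bullet> b1) * (b1 \<bullet> i) - (s \<bullet> b2) * (b2
          \<bullet> i)"
        by (simp add: u_def inner_add_left inner_diff_left)
      consider "i = b1" | "i = b2" | "i \<noteq> b1" "i \<noteq> b2" "i \<in> {((1, 0, 0, 0), 0), ((0, 1, 0, 0),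
          0), ((0, 0, 1, 0), 0)}"
        using i by blast
      then show "u \<bullet> i = 0"
      proof cases
        case 3
        have "s \<bullet> ((1, 0, 0, 0), 0) = 0" "s \<bullet> ((0, 1, 0, 0), 0) = 0" "s \<bullet> ((0, 0, 1, 0), 0) = 0"
          using * by (simp_all add: s_def jet_values_def)
        then have "s \<bullet> i = 0" using 3(3) by (elim insertE emptyE) simp_all
        then show ?thesis using 3(1,2) i(1) b by (simp add: ui inner_Basis)
      qed (use ui bb in simp_all)
    qed
    then obtain a where a: "u = f a" using f(2) by blast
    have i: "n (w, u) = n (w, s)" "h1 (w, u) = h1 (w, s)" "h2 (w, u + (s \<bullet> b1) *\<^sub>R b1) = h2 (w, s)"
      using indep[of w "s + (- (s \<bullet> b1)) *\<^sub>R b1" "- (s \<bullet> b2)"] indep[of w s "- (s \<bullet>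
          b1)"] indep[of w s "- (s \<bullet> b2)"]
      by (simp_all add: u_def algebra_simps)
    have v: "v (w, a) = u + (s \<bullet> b1) *\<^sub>R b1" using * by (simp add: v_def a[symmetric] i s_def)
    show "\<exists>\<omega>\<in>\<Omega>. jet_values (\<lambda>w. F w + F4 (pert t) w) (fst \<omega>) = V \<omega>"
    proof (rule bexI[of _ "(w, a)"])
      show "(w, a) \<in> \<Omega>" unfolding \<Omega>_def using * by (simp add: a[symmetric] i s_def)
      have "s = u + (s \<bullet> b1) *\<^sub>R b1 + (s \<bullet> b2) *\<^sub>R b2" by (simp add: u_def)
      also have "\<dots> = V (w, a)" unfolding V_def v fst_conv i(3) using * by (simp add: s_def)
      finally show "jet_values (\<lambda>w. F w + F4 (pert t) w) (fst (w, a)) = V (w, a)" by (simp add: s_def H_def)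
    qed
  qed
qed

text \<open>Each degeneracy that is not itself a jet coordinate is affine in some free coordinate,
  with a coefficient that the side conditions keep away from zero: here the coefficient of I_p is
  F_pp^2, below that of I_yy is K F_p^2 and that of J_e is jdet F_p.\<close>

lemma solve_other:
  fixes ip fp fpp g h :: real
  assumes "ip * fpp\<^sup>2 - g * fp * fpp + 2 / 3 * h * fp\<^sup>2 = 0" "fpp \<noteq> 0"
  shows "ip = (g * fp * fpp - 2 / 3 * h * fp\<^sup>2) / fpp\<^sup>2"
  using assms by (simp add: field_simps)

lemma solve_hessian:
  fixes k fp fy D E T iyy r :: real
  assumes "k * ((iyy * fp + r) * fp - D * fy) - T\<^sup>2 = 0" "k \<noteq> 0" "fp \<noteq> 0"
  shows "iyy = ((T\<^sup>2 / k + D * fy) / fp - r) / fp"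
  using assms by (simp add: field_simps)

lemma solve_versality:
  fixes D je fp jp fe N T :: real
  assumes "D * (je * fp - jp * fe) - N * T = 0" "D \<noteq> 0" "fp \<noteq> 0"
  shows "je = (N * T / D + jp * fe) / fp"
  using assms by (simp add: field_simps)

text \<open>Case by case the two extra equations are solved for two jet coordinates, so that
  \<open>negligible_codim5\<close> applies. In each case the first formula involves neither
  coordinate and the second may involve the first.\<close>

lemma negligible_degenerate:
  assumes F: "smooth_on UNIV F" and bad: "(E1, E2, B1, B2) \<in> degeneracies"
  defines "H \<equiv> \<lambda>t w. F w + F4 (pert t) w"
  shows "negligible {t. \<exists>w. H t w = 0 \<and> xi (H t) w = 0 \<and> xi (xi (H t)) w = 0 \<and>
    E1 (H t) w = 0 \<and> E2 (H t) w = 0 \<and> B1 (H t) w \<noteq> 0 \<and> B2 (H t) w \<noteq> 0}"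
proof -
  define Z where "Z t w \<longleftrightarrow> H t w = 0 \<and> xi (H t) w = 0 \<and> xi (xi (H t)) w = 0" for t w
  define q where "q b \<omega> = snd \<omega> \<bullet> b" for b and \<omega> :: "jet_family \<times> par"
  have sq: "smooth_on \<Omega> (q b)" if "open \<Omega>" for \<Omega> b
    unfolding q_def by (intro smooth_intros that)
  \<comment> \<open>Unit vectors picking out the jet coordinates. Letters f, i, j stand for F and
    its first two fibre derivatives, followed by the variables of differentiation; \<open>k\<close>
    and \<open>l\<close> are the third and fourth fibre derivative.\<close>
  define k :: par where "k = ((0, 0, 0, 1), (0, 0, 0, 0), (0, 0, 0, 0), (0, 0, 0, 0))"
  define l :: par where "l = ((0, 0, 0, 0), (1, 0, 0, 0), (0, 0, 0, 0), (0, 0, 0, 0))"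
  define fy :: par where "fy = ((0, 0, 0, 0), (0, 1, 0, 0), (0, 0, 0, 0), (0, 0, 0, 0))"
  define iy :: par where "iy = ((0, 0, 0, 0), (0, 0, 1, 0), (0, 0, 0, 0), (0, 0, 0, 0))"
  define jy :: par where "jy = ((0, 0, 0, 0), (0, 0, 0, 1), (0, 0, 0, 0), (0, 0, 0, 0))"
  define fyy :: par where "fyy = ((0, 0, 0, 0), (0, 0, 0, 0), (1, 0, 0, 0), (0, 0, 0, 0))"
  define iyy :: par where "iyy = ((0, 0, 0, 0), (0, 0, 0, 0), (0, 1, 0, 0), (0, 0, 0, 0))"
  define fe :: par where "fe = ((0, 0, 0, 0), (0, 0, 0, 0), (0, 0, 1, 0), (0, 0, 0, 0))"
  define ie :: par where "ie = ((0, 0, 0, 0), (0, 0, 0, 0), (0, 0, 0, 1), (0, 0, 0, 0))"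
  define je :: par where "je = ((0, 0, 0, 0), (0, 0, 0, 0), (0, 0, 0, 0), (1, 0, 0, 0))"
  define fp :: par where "fp = ((0, 0, 0, 0), (0, 0, 0, 0), (0, 0, 0, 0), (0, 1, 0, 0))"
  define ip :: par where "ip = ((0, 0, 0, 0), (0, 0, 0, 0), (0, 0, 0, 0), (0, 0, 1, 0))"
  define fpp :: par where "fpp = ((0, 0, 0, 0), (0, 0, 0, 0), (0, 0, 0, 0), (0, 0, 0, 1))"
  note slots = k_def l_def fy_def iy_def jy_def fyy_def iyy_def fe_def ie_def je_def fp_def ip_def fpp_def
  \<comment> \<open>Data of the unperturbed \<open>F\<close> alone. Jets outside
    \<open>jet_values\<close> are sums of these and of free coordinates; for example J_p is
    \<open>z0\<close> plus twice I_y.\<close>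
  define g0 where "g0 \<omega> = dd dP (dd dP (xi F)) (fst \<omega>)" for \<omega> :: "jet_family \<times> par"
  define h0 where "h0 \<omega> = dd dP (dd dP (dd dP (xi F))) (fst \<omega>)" for \<omega> :: "jet_family \<times> par"
  define a0 where "a0 \<omega> = dd dY (dd dP F) (fst \<omega>)" for \<omega> :: "jet_family \<times> par"
  define b0 where "b0 \<omega> = dd dP (dd dY F) (fst \<omega>)" for \<omega> :: "jet_family \<times> par"
  define c0 where "c0 \<omega> = dd dY (dd dP (xi F)) (fst \<omega>) - dd dY (dd dY F) (fst \<omega>)" for \<omega>
      :: "jet_family \<times> par"
  define d0 where "d0 \<omega> = dd dP (dd dY (xi F)) (fst \<omega>) - dd dY (dd dY F) (fst \<omega>)" for \<omega>
      :: "jet_family \<times> par"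
  define z0 where "z0 \<omega> = dd dP (xi (xi F)) (fst \<omega>) - 2 * dd dY (xi F) (fst \<omega>)" for \<omega>
      :: "jet_family \<times> par"
  note olds = g0_def h0_def a0_def b0_def c0_def d0_def z0_def
  have sf: "smooth_on \<Omega> (\<lambda>\<omega>::jet_family \<times> par. g (fst \<omega>))" if "open \<Omega>"
      "smooth_on UNIV g" for \<Omega> and g :: "jet_family \<Rightarrow> real"
    by (rule smooth_on_compose[OF that(2)]) (auto intro!: smooth_intros that(1))
  have so: "open \<Omega> \<Longrightarrow> smooth_on \<Omega> g0" "open \<Omega> \<Longrightarrow> smooth_on
      \<Omega> h0" "open \<Omega> \<Longrightarrow> smooth_on \<Omega> a0" "open \<Omega> \<Longrightarrow>
          smooth_on \<Omega> b0" "open \<Omega> \<Longrightarrow> smooth_on \<Omega> c0" "open \<Omega>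
            \<Longrightarrow> smooth_on \<Omega> d0" "open \<Omega> \<Longrightarrow> smooth_on \<Omega> z0" for
            \<Omega>
    unfolding olds by (intro smooth_intros sf smooth_on_dd smooth_on_xi F; assumption)+
  have jv: "jet_values (H t) w \<bullet> k = xi (xi (xi (H t))) w" "jet_values (H t) w \<bullet> l = xi (xi (xi (xi
      (H t)))) w" "jet_values (H t) w \<bullet> fy = dd dY (H t) w" "jet_values (H t) w \<bullet> iy = dd dY (xi (H
          t)) w" "jet_values (H t) w \<bullet> jy = dd dY (xi (xi (H t))) w" "jet_values (H t) w \<bullet> fyy = dd
            dY (dd dY (H t)) w" "jet_values (H t) w \<bullet> iyy = dd dY (dd dY (xi (H t))) w" "jet_values (H t) w
            \<bullet> fe = dd dE (H t) w" "jet_values (H t) w \<bullet> ie = dd dE (xi (H t)) w" "jet_values (H t)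
            w \<bullet> je = dd dE (xi (xi (H t))) w" "jet_values (H t) w \<bullet> fp = dd dP (H t) w" "jet_values
            (H t) w \<bullet> ip = dd dP (xi (H t)) w" "jet_values (H t) w \<bullet> fpp = dd dP (dd dP (H t)) w"
            for t w
    by (simp_all add: slots jet_values_def)
  have "(\<lambda>w. F w + F4 (pert t) w) = H t" for t by (simp add: H_def)
  note rel = pert_relations[OF F, unfolded this]
  have sH: "smooth_on UNIV (H t)" for t unfolding H_def by (intro smooth_on_add F smooth_on_F4 smooth_on_pert)
  have solved: "negligible {t. \<exists>w. Z t w \<and> P t w}"
    if P: "\<And>t w. P t w \<Longrightarrow> n (w, jet_values (H t) w) \<noteq> 0 \<and> jet_values (H t) w
        \<bullet> b1 = h1 (w, jet_values (H t) w) \<and>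
      jet_values (H t) w \<bullet> b2 = h2 (w, jet_values (H t) w)"
      and b: "b1 \<in> Basis" "b2 \<in> Basis" "b1 \<noteq> b2"
        "{b1, b2} \<inter> {((1, 0, 0, 0), 0), ((0, 1, 0, 0), 0), ((0, 0, 1, 0), 0)} = {}"
      and n: "smooth_on UNIV n"
      and h: "\<And>\<Omega>. open \<Omega> \<Longrightarrow> (\<And>\<omega>. \<omega> \<in> \<Omega>
          \<Longrightarrow> n \<omega> \<noteq> 0) \<Longrightarrow> smooth_on \<Omega> h1 \<and> smooth_on \<Omega> h2"
      and i: "\<And>w s r. n (w, s + r *\<^sub>R b1) = n (w, s) \<and> n (w, s + r *\<^sub>R b2) = n (w, s) \<and>
        h1 (w, s + r *\<^sub>R b1) = h1 (w, s) \<and> h1 (w, s + r *\<^sub>R b2) = h1 (w, s) \<and> h2 (w, s + r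
            *\<^sub>R b2) = h2 (w, s)"
    for b1 b2 and n h1 h2 :: "jet_family \<times> par \<Rightarrow> real" and P
    by (rule negligible_subset, rule negligible_codim5[OF F b n, of h1 h2], rule h, assumption, blast, rule i)
      (use P in \<open>unfold Z_def H_def, blast\<close>)
  have C1: "negligible {t. \<exists>w. Z t w \<and> dd dP (H t) w = 0 \<and> dd dY (H t) w = 0}"
  proof (rule solved[of _ "\<lambda>\<omega>. 1"
      fp "\<lambda>\<omega>. 0"
      fy "\<lambda>\<omega>. 0"])
    fix t w assume c: "dd dP (H t) w = 0 \<and> dd dY (H t) w = 0"
    show "(1::real) \<noteq> 0 \<and>
      jet_values (H t) w \<bullet> fp = 0 \<and>
      jet_values (H t) w \<bullet> fy = 0"
      using c by (simp add: jv)
  qed ((simp add: slots Basis_Pair_iff zero_prod_def; fail) | (simp add: q_def slots olds inner_add_left; fail) |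
      (intro conjI smooth_intros sq so open_UNIV; (assumption | force)))+
  have C2: "negligible {t. \<exists>w. Z t w \<and> dd dP (H t) w = 0 \<and> dd dP (xi (H t)) w = 0}"
  proof (rule solved[of _ "\<lambda>\<omega>. 1"
      fp "\<lambda>\<omega>. 0"
      ip "\<lambda>\<omega>. 0"])
    fix t w assume c: "dd dP (H t) w = 0 \<and> dd dP (xi (H t)) w = 0"
    show "(1::real) \<noteq> 0 \<and>
      jet_values (H t) w \<bullet> fp = 0 \<and>
      jet_values (H t) w \<bullet> ip = 0"
      using c by (simp add: jv)
  qed ((simp add: slots Basis_Pair_iff zero_prod_def; fail) | (simp add: q_def slots olds inner_add_left; fail) |
      (intro conjI smooth_intros sq so open_UNIV; (assumption | force)))+
  have C3: "negligible {t. \<exists>w. Z t w \<and> dd dP (H t) w = 0 \<and> xi (xi (xi (H t))) w = 0}"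
  proof (rule solved[of _ "\<lambda>\<omega>. 1"
      fp "\<lambda>\<omega>. 0"
      k "\<lambda>\<omega>. 0"])
    fix t w assume c: "dd dP (H t) w = 0 \<and> xi (xi (xi (H t))) w = 0"
    show "(1::real) \<noteq> 0 \<and>
      jet_values (H t) w \<bullet> fp = 0 \<and>
      jet_values (H t) w \<bullet> k = 0"
      using c by (simp add: jv)
  qed ((simp add: slots Basis_Pair_iff zero_prod_def; fail) | (simp add: q_def slots olds inner_add_left; fail) |
      (intro conjI smooth_intros sq so open_UNIV; (assumption | force)))+
  have C4: "negligible {t. \<exists>w. Z t w \<and> xi (xi (xi (H t))) w = 0 \<and> xi (xi (xi (xi (H t)))) w = 0}"
  proof (rule solved[of _ "\<lambda>\<omega>. 1"
      k "\<lambda>\<omega>. 0"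
      l "\<lambda>\<omega>. 0"])
    fix t w assume c: "xi (xi (xi (H t))) w = 0 \<and> xi (xi (xi (xi (H t)))) w = 0"
    show "(1::real) \<noteq> 0 \<and>
      jet_values (H t) w \<bullet> k = 0 \<and>
      jet_values (H t) w \<bullet> l = 0"
      using c by (simp add: jv)
  qed ((simp add: slots Basis_Pair_iff zero_prod_def; fail) | (simp add: q_def slots olds inner_add_left; fail) |
      (intro conjI smooth_intros sq so open_UNIV; (assumption | force)))+
  have C5: "negligible {t. \<exists>w. Z t w \<and> xi (xi (xi (H t))) w = 0 \<and> dd dP (dd dP (H t)) w = 0}"
  proof (rule solved[of _ "\<lambda>\<omega>. 1"
      k "\<lambda>\<omega>. 0"
      fpp "\<lambda>\<omega>. 0"])
    fix t w assume c: "xi (xi (xi (H t))) w = 0 \<and> dd dP (dd dP (H t)) w = 0"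
    show "(1::real) \<noteq> 0 \<and>
      jet_values (H t) w \<bullet> k = 0 \<and>
      jet_values (H t) w \<bullet> fpp = 0"
      using c by (simp add: jv)
  qed ((simp add: slots Basis_Pair_iff zero_prod_def; fail) | (simp add: q_def slots olds inner_add_left; fail) |
      (intro conjI smooth_intros sq so open_UNIV; (assumption | force)))+
  have C6: "negligible {t. \<exists>w. Z t w \<and> jdet (H t) w = 0 \<and> xi (xi (xi (H t))) w = 0 \<and> dd dP
      (H t) w \<noteq> 0}"
  proof (rule solved[of _ "\<lambda>\<omega>. q fp \<omega>"
      iy "\<lambda>\<omega>. q ip \<omega> * q fy \<omega> / q fp \<omega>"
      k "\<lambda>\<omega>. 0"])
    fix t w assume c: "jdet (H t) w = 0 \<and> xi (xi (xi (H t))) w = 0 \<and> dd dP (H t) w \<noteq> 0"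
    show "q fp (w, jet_values (H t) w) \<noteq> 0 \<and>
      jet_values (H t) w \<bullet> iy = q ip (w, jet_values (H t) w) * q fy (w, jet_values (H t) w) / q fp (w,
          jet_values (H t) w) \<and>
      jet_values (H t) w \<bullet> k = 0"
      using c by (simp add: jv q_def jdet_def field_simps)
  qed ((simp add: slots Basis_Pair_iff zero_prod_def; fail) | (simp add: q_def slots olds inner_add_left; fail) |
      (intro conjI smooth_intros sq so open_UNIV; (assumption | force)))+
  \<comment> \<open>The Hessian condition is solved for I_yy, which enters only through the
    y-derivative of \<open>jdet\<close>; all other mixed jets are rewritten by
    \<open>pert_relations\<close>.\<close>
  have C7: "negligible {t. \<exists>w. Z t w \<and> jdet (H t) w = 0 \<and> hessian_det (H t) w = 0 \<and>
    dd dP (H t) w \<noteq> 0 \<and> xi (xi (xi (H t))) w \<noteq> 0}"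
  proof (rule solved[of _ "\<lambda>\<omega>. q k \<omega> * q fp \<omega>"
      iy "\<lambda>\<omega>. q ip \<omega> * q fy \<omega> / q fp \<omega>"
      iyy "\<lambda>\<omega>. (((q jy \<omega> * q fp \<omega> - (z0 \<omega> + 2 * q iy \<omega>) * q fy
          \<omega>)\<^sup>2 / q k \<omega> + ((q fyy \<omega> + d0 \<omega>) * q fp \<omega> + q iy \<omega> * q
            fpp \<omega> - (g0 \<omega> * q fy \<omega> + q ip \<omega> * b0 \<omega>)) * q fy \<omega>) / q fp
            \<omega> - (q iy \<omega> * a0 \<omega> - ((q fyy \<omega> + c0 \<omega>) * q fy \<omega> + q ip
            \<omega> * q fyy \<omega>))) / q fp \<omega>"])
    fix t w assume c: "jdet (H t) w = 0 \<and> hessian_det (H t) w = 0 \<and>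
    dd dP (H t) w \<noteq> 0 \<and> xi (xi (xi (H t))) w \<noteq> 0"
    show "q k (w, jet_values (H t) w) * q fp (w, jet_values (H t) w) \<noteq> 0 \<and>
      jet_values (H t) w \<bullet> iy = q ip (w, jet_values (H t) w) * q fy (w, jet_values (H t) w) / q fp (w,
          jet_values (H t) w) \<and>
      jet_values (H t) w \<bullet> iyy = (((q jy (w, jet_values (H t) w) * q fp (w, jet_values (H t) w) - (z0 (w,
          jet_values (H t) w) + 2 * q iy (w, jet_values (H t) w)) * q fy (w, jet_values (H t) w))\<^sup>2 / q k (w,
            jet_values (H t) w) + ((q fyy (w, jet_values (H t) w) + d0 (w, jet_values (H t) w)) * q fp (w,
            jet_values (H t) w) + q iy (w, jet_values (H t) w) * q fpp (w, jet_values (H t) w) - (g0 (w, jet_values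
            (H t) w) * q fy (w, jet_values (H t) w) + q ip (w, jet_values (H t) w) * b0 (w, jet_values (H t) w))) *
            q fy (w, jet_values (H t) w)) / q fp (w, jet_values (H t) w) - (q iy (w, jet_values (H t) w) * a0 (w,
            jet_values (H t) w) - ((q fyy (w, jet_values (H t) w) + c0 (w, jet_values (H t) w)) * q fy (w,
            jet_values (H t) w) + q ip (w, jet_values (H t) w) * q fyy (w, jet_values (H t) w)))) / q fp (w,
            jet_values (H t) w)"
      using c by (intro conjI; unfold jv q_def snd_conv; (rule solve_hessian)?)
        (simp_all add: olds rel jdet_def hessian_det_def tangential_det_def dd_jdet[OF sH] field_simps)
  qed ((simp add: slots Basis_Pair_iff zero_prod_def; fail) | (simp add: q_def slots olds inner_add_left; fail) |
      (intro conjI smooth_intros sq so open_UNIV; (assumption | force)))+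
  have C8: "negligible {t. \<exists>w. Z t w \<and> jdet (H t) w = 0 \<and> parameter_det xi (H t) w = 0 \<and> dd
      dP (H t) w \<noteq> 0}"
  proof (rule solved[of _ "\<lambda>\<omega>. q fp \<omega>"
      iy "\<lambda>\<omega>. q ip \<omega> * q fy \<omega> / q fp \<omega>"
      ie "\<lambda>\<omega>. q ip \<omega> * q fe \<omega> / q fp \<omega>"])
    fix t w assume c: "jdet (H t) w = 0 \<and> parameter_det xi (H t) w = 0 \<and> dd dP (H t) w \<noteq> 0"
    show "q fp (w, jet_values (H t) w) \<noteq> 0 \<and>
      jet_values (H t) w \<bullet> iy = q ip (w, jet_values (H t) w) * q fy (w, jet_values (H t) w) / q fp (w,
          jet_values (H t) w) \<and>
      jet_values (H t) w \<bullet> ie = q ip (w, jet_values (H t) w) * q fe (w, jet_values (H t) w) / q fp (w,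
          jet_values (H t) w)"
      using c by (simp add: jv q_def jdet_def parameter_det_def field_simps)
  qed ((simp add: slots Basis_Pair_iff zero_prod_def; fail) | (simp add: q_def slots olds inner_add_left; fail) |
      (intro conjI smooth_intros sq so open_UNIV; (assumption | force)))+
  have C9: "negligible {t. \<exists>w. Z t w \<and> jdet (H t) w = 0 \<and> dd dP (dd dP (H t)) w = 0 \<and> dd dP
      (H t) w \<noteq> 0}"
  proof (rule solved[of _ "\<lambda>\<omega>. q fp \<omega>"
      iy "\<lambda>\<omega>. q ip \<omega> * q fy \<omega> / q fp \<omega>"
      fpp "\<lambda>\<omega>. 0"])
    fix t w assume c: "jdet (H t) w = 0 \<and> dd dP (dd dP (H t)) w = 0 \<and> dd dP (H t) w \<noteq> 0"
    show "q fp (w, jet_values (H t) w) \<noteq> 0 \<and>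
      jet_values (H t) w \<bullet> iy = q ip (w, jet_values (H t) w) * q fy (w, jet_values (H t) w) / q fp (w,
          jet_values (H t) w) \<and>
      jet_values (H t) w \<bullet> fpp = 0"
      using c by (simp add: jv q_def jdet_def field_simps)
  qed ((simp add: slots Basis_Pair_iff zero_prod_def; fail) | (simp add: q_def slots olds inner_add_left; fail) |
      (intro conjI smooth_intros sq so open_UNIV; (assumption | force)))+
  have C10: "negligible {t. \<exists>w. Z t w \<and> jdet (H t) w = 0 \<and> other_root_inflection (H t) w = 0 \<and>
    dd dP (H t) w \<noteq> 0 \<and> dd dP (dd dP (H t)) w \<noteq> 0}"
  \<comment> \<open>I_p is determined first from the condition at the second root; the formula for
    I_y that solves \<open>jdet\<close> = 0 contains I_p.\<close>
  proof (rule solved[of _ "\<lambda>\<omega>. q fp \<omega> * q fpp \<omega>"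
      ip "\<lambda>\<omega>. (g0 \<omega> * q fp \<omega> * q fpp \<omega> - 2 / 3 * h0 \<omega> * (q fp
          \<omega>)\<^sup>2) / (q fpp \<omega>)\<^sup>2"
      iy "\<lambda>\<omega>. q ip \<omega> * q fy \<omega> / q fp \<omega>"])
    fix t w assume c: "jdet (H t) w = 0 \<and> other_root_inflection (H t) w = 0 \<and>
    dd dP (H t) w \<noteq> 0 \<and> dd dP (dd dP (H t)) w \<noteq> 0"
    show "q fp (w, jet_values (H t) w) * q fpp (w, jet_values (H t) w) \<noteq> 0 \<and>
      jet_values (H t) w \<bullet> ip = (g0 (w, jet_values (H t) w) * q fp (w, jet_values (H t) w) * q fpp (w,
          jet_values (H t) w) - 2 / 3 * h0 (w, jet_values (H t) w) * (q fp (w, jet_values (H t) w))\<^sup>2) / (q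
            fpp (w, jet_values (H t) w))\<^sup>2 \<and>
      jet_values (H t) w \<bullet> iy = q ip (w, jet_values (H t) w) * q fy (w, jet_values (H t) w) / q fp (w,
          jet_values (H t) w)"
      using c by (intro conjI; unfold jv q_def snd_conv; (rule solve_other)?)
        (simp_all add: olds rel jdet_def other_root_inflection_def field_simps)
  qed ((simp add: slots Basis_Pair_iff zero_prod_def; fail) | (simp add: q_def slots olds inner_add_left; fail) |
      (intro conjI smooth_intros sq so open_UNIV; (assumption | force)))+
  have C11: "negligible {t. \<exists>w. Z t w \<and> xi (xi (xi (H t))) w = 0 \<and> versality_det (H t) w = 0 \<and>
    dd dP (H t) w \<noteq> 0 \<and> jdet (H t) w \<noteq> 0}"
  \<comment> \<open>The nonvanishing function includes the expression for \<open>jdet\<close>, by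
    which the formula for J_e divides.\<close>
  proof (rule solved[of _ "\<lambda>\<omega>. q fp \<omega> * (q iy \<omega> * q fp \<omega> - q ip \<omega> * q fy
      \<omega>)"
      k "\<lambda>\<omega>. 0"
      je "\<lambda>\<omega>. ((q ie \<omega> * q fp \<omega> - q ip \<omega> * q fe \<omega>) * (q jy \<omega> * q
          fp \<omega> - (z0 \<omega> + 2 * q iy \<omega>) * q fy \<omega>) / (q iy \<omega> * q fp \<omega> - q ip
            \<omega> * q fy \<omega>) + (z0 \<omega> + 2 * q iy \<omega>) * q fe \<omega>) / q fp \<omega>"])
    fix t w assume c: "xi (xi (xi (H t))) w = 0 \<and> versality_det (H t) w = 0 \<and>
    dd dP (H t) w \<noteq> 0 \<and> jdet (H t) w \<noteq> 0"
    show "q fp (w, jet_values (H t) w) * (q iy (w, jet_values (H t) w) * q fp (w, jet_values (H t) w) - q ip (w,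
        jet_values (H t) w) * q fy (w, jet_values (H t) w)) \<noteq> 0 \<and>
      jet_values (H t) w \<bullet> k = 0 \<and>
      jet_values (H t) w \<bullet> je = ((q ie (w, jet_values (H t) w) * q fp (w, jet_values (H t) w) - q ip (w,
          jet_values (H t) w) * q fe (w, jet_values (H t) w)) * (q jy (w, jet_values (H t) w) * q fp (w, jet_values
            (H t) w) - (z0 (w, jet_values (H t) w) + 2 * q iy (w, jet_values (H t) w)) * q fy (w, jet_values (H t)
            w)) / (q iy (w, jet_values (H t) w) * q fp (w, jet_values (H t) w) - q ip (w, jet_values (H t) w) * q
            fy (w, jet_values (H t) w)) + (z0 (w, jet_values (H t) w) + 2 * q iy (w, jet_values (H t) w)) * q fe
            (w, jet_values (H t) w)) / q fp (w, jet_values (H t) w)"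
      using c by (intro conjI; unfold jv q_def snd_conv; (rule solve_versality)?)
        (simp_all add: olds rel jdet_def versality_det_def tangential_det_def parameter_det_def field_simps)
  qed ((simp add: slots Basis_Pair_iff zero_prod_def; fail) | (simp add: q_def slots olds inner_add_left; fail) |
      (intro conjI smooth_intros sq so open_UNIV; (assumption | force)))+
  have C12: "negligible {t. \<exists>w. Z t w \<and> xi (xi (xi (H t))) w = 0 \<and> other_root_inflection (H t) w
      = 0 \<and>
    dd dP (H t) w \<noteq> 0 \<and> dd dP (dd dP (H t)) w \<noteq> 0}"
  proof (rule solved[of _ "\<lambda>\<omega>. q fp \<omega> * q fpp \<omega>"
      k "\<lambda>\<omega>. 0"
      ip "\<lambda>\<omega>. (g0 \<omega> * q fp \<omega> * q fpp \<omega> - 2 / 3 * h0 \<omega> * (q fp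
          \<omega>)\<^sup>2) / (q fpp \<omega>)\<^sup>2"])
    fix t w assume c: "xi (xi (xi (H t))) w = 0 \<and> other_root_inflection (H t) w = 0 \<and>
    dd dP (H t) w \<noteq> 0 \<and> dd dP (dd dP (H t)) w \<noteq> 0"
    show "q fp (w, jet_values (H t) w) * q fpp (w, jet_values (H t) w) \<noteq> 0 \<and>
      jet_values (H t) w \<bullet> k = 0 \<and>
      jet_values (H t) w \<bullet> ip = (g0 (w, jet_values (H t) w) * q fp (w, jet_values (H t) w) * q fpp (w,
          jet_values (H t) w) - 2 / 3 * h0 (w, jet_values (H t) w) * (q fp (w, jet_values (H t) w))\<^sup>2) / (q
            fpp (w, jet_values (H t) w))\<^sup>2"
      using c by (intro conjI; unfold jv q_def snd_conv; (rule solve_other)?)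
        (simp_all add: olds rel other_root_inflection_def field_simps)
  qed ((simp add: slots Basis_Pair_iff zero_prod_def; fail) | (simp add: q_def slots olds inner_add_left; fail) |
      (intro conjI smooth_intros sq so open_UNIV; (assumption | force)))+
  show ?thesis using bad unfolding degeneracies_def Let_def
    by (elim insertE emptyE) (use C1 C2 C3 C4 C5 C6 C7 C8 C9 C10 C11 C12 in \<open>simp_all add: Z_def
        conj_assoc\<close>)
qed

section \<open>Density\<close>

text \<open>The ball bounds the points and the threshold 1/(n+1) replaces B \<noteq> 0 by a closed
  condition; together they make the forbidden configurations compact, hence the set open.\<close>

definition avoids :: "jet_operator \<times> jet_operator \<times> jet_operator \<times> jet_operator \<Rightarrow>
    nat \<Rightarrow> bde_family set" where
  "avoids = (\<lambda>(E1, E2, B1, B2) n. {A. smooth_on UNIV A \<and>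
     (\<forall>w\<in>cball 0 (real n). \<not> ((\<forall>E\<in>{F4, \<lambda>A. xi (F4 A), \<lambda>A. xi (xi (F4
         A)), \<lambda>A. E1 (F4 A), \<lambda>A. E2 (F4 A)}. E A w = 0) \<and>
       (\<forall>B\<in>{\<lambda>A. B1 (F4 A), \<lambda>A. B2 (F4 A)}. 1 / real (Suc n) \<le> \<bar>B A w\<bar>)))})"

lemma jet_ops_of_degeneracy:
  assumes "(E1, E2, B1, B2) \<in> degeneracies"
  shows "E \<in> {F4, \<lambda>A. xi (F4 A), \<lambda>A. xi (xi (F4 A)), \<lambda>A. E1 (F4 A), \<lambda>A. E2 (F4
      A)} \<Longrightarrow> jet_op E"
    and "B \<in> {\<lambda>A. B1 (F4 A), \<lambda>A. B2 (F4 A)} \<Longrightarrow> jet_op B"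
  using jet_op_degeneracies[OF assms jet_op_F4] jet_op_F4 jet_op_xi[OF jet_op_F4] jet_op_xi[OF jet_op_xi[OF
      jet_op_F4]] by blast+

lemma openin_avoids:
  assumes "b \<in> degeneracies" shows "openin whitney_topology (avoids b n)"
proof -
  obtain E1 E2 B1 B2 where b: "b = (E1, E2, B1, B2)" by (rule prod_cases4)
  show ?thesis unfolding b avoids_def prod.case
    by (rule openin_avoid[OF jet_ops_of_degeneracy[OF assms[unfolded b]] compact_cball])
qed

text \<open>Arbitrarily small parameters lie outside the null set of
  \<open>negligible_degenerate\<close>, because a neighbourhood of 0 is not null. The perturbation
  is multiplied by a bump function to stay in the given Whitney-open set; over the ball in question
  the bump is 1 and, by locality, the jets are those of the polynomial perturbation.\<close>

lemma dense_avoids: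
  assumes bad: "b \<in> degeneracies" shows "whitney_topology closure_of avoids b n = topspace whitney_topology"
proof (intro subset_antisym closure_of_subset_topspace subsetI)
  obtain E1 E2 B1 B2 where b: "b = (E1, E2, B1, B2)" by (rule prod_cases4)
  note bad' = bad[unfolded b]
  fix A :: bde_family assume top: "A \<in> topspace whitney_topology"
  then have A: "smooth_on UNIV A" by (simp add: topspace_whitney_topology)
  have "\<exists>A'\<in>avoids b n. A' \<in> W" if W: "openin whitney_topology W" "A \<in> W" for W
  proof -
    have pos: "0 < real n + 1" by simp
    \<comment> \<open>The radius n + 1 makes the bump equal to 1 on an open neighbourhood of all
      base points with norm at most n, as locality requires.\<close>
    obtain \<beta> :: "plane \<times> real \<Rightarrow> real" where \<beta>: "smooth_on UNIV \<beta>" "\<And>z.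
        norm z < real n + 1 \<Longrightarrow> \<beta> z = 1"
      "\<And>z. norm z > real n + 1 + 1 \<Longrightarrow> \<beta> z = 0"
      by (rule bump_function[OF pos]) (rule that; assumption)
    define hb where "hb c z = \<beta> z *\<^sub>R pert c z" for c z
    have hb: "smooth_on UNIV (hb c)" "norm z > real n + 2 \<Longrightarrow> hb c z = 0" for c z
      unfolding hb_def using \<beta>(3)[of z] by (auto intro!: smooth_on_scaleR \<beta>(1) smooth_on_pert)
    have sum: "(\<Sum>c\<in>Basis. (t \<bullet> c) *\<^sub>R hb c z) = \<beta> z *\<^sub>R pert t z" for t z
      unfolding pert_basis[of t] hb_def scaleR_sum_right by (simp add: mult.commute)
    have "\<forall>\<^sub>F t in nhds 0. (\<lambda>z. A z + (\<Sum>c\<in>Basis. (t \<bullet> c) *\<^sub>R hb c z))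
        \<in> W"
      by (rule perturbation_in_open[OF W hb(1)]) (rule hb(2))
    then have "\<forall>\<^sub>F t in nhds 0. (\<lambda>z. A z + \<beta> z *\<^sub>R pert t z) \<in> W" unfolding sum .
    then obtain U where U: "open U" "0 \<in> U" "\<And>t. t \<in> U \<Longrightarrow> (\<lambda>z. A z + \<beta> z
        *\<^sub>R pert t z) \<in> W"
      unfolding eventually_nhds by blast
    let ?H = "\<lambda>t w. F4 A w + F4 (pert t) w"
    let ?N = "{t. \<exists>w. ?H t w = 0 \<and> xi (?H t) w = 0 \<and> xi (xi (?H t)) w = 0 \<and>
      E1 (?H t) w = 0 \<and> E2 (?H t) w = 0 \<and> B1 (?H t) w \<noteq> 0 \<and> B2 (?H t) w \<noteq> 0}"
    have "negligible ?N" by (rule negligible_degenerate[OF smooth_on_F4[OF A] bad'])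
    then have "\<not> U \<subseteq> ?N" using open_not_negligible[OF U(1)] U(2) negligible_subset by blast
    then obtain t where t: "t \<in> U" "t \<notin> ?N" by blast
    define A' where "A' z = A z + \<beta> z *\<^sub>R pert t z" for z
    have "smooth_on UNIV A'"
      unfolding A'_def by (intro smooth_on_add smooth_on_scaleR A \<beta>(1) smooth_on_pert)
    moreover have "\<not> ((\<forall>E\<in>{F4, \<lambda>A. xi (F4 A), \<lambda>A. xi (xi (F4 A)), \<lambda>A. E1
        (F4 A), \<lambda>A. E2 (F4 A)}. E A' w = 0) \<and>
       (\<forall>B\<in>{\<lambda>A. B1 (F4 A), \<lambda>A. B2 (F4 A)}. 1 / real (Suc n) \<le> \<bar>B A' w\<bar>))"
           if w: "w \<in> cball 0 (real n)" for w
    proof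
      assume *: "(\<forall>E\<in>{F4, \<lambda>A. xi (F4 A), \<lambda>A. xi (xi (F4 A)), \<lambda>A. E1 (F4 A),
          \<lambda>A. E2 (F4 A)}. E A' w = 0) \<and>
       (\<forall>B\<in>{\<lambda>A. B1 (F4 A), \<lambda>A. B2 (F4 A)}. 1 / real (Suc n) \<le> \<bar>B A' w\<bar>)"
      have "norm (fst w) < real n + 1" using w norm_fst_le[of "fst w" "snd w"] by simp
      then have loc: "T A' w = T (\<lambda>z. A z + pert t z) w" if "jet_op T" for T
        by (intro jet_op_local[OF that, of "ball 0 (real n + 1)"]) (auto simp: A'_def \<beta>(2))
      have pos: "0 < 1 / real (Suc n)" by simp
      note l = loc[OF jet_ops_of_degeneracy(1)[OF bad']] loc[OF jet_ops_of_degeneracy(2)[OF bad']]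
      have eq: "F4 (\<lambda>z. A z + pert t z) = ?H t" by (rule F4_plus)
      have Es: "E (\<lambda>z. A z + pert t z) w = 0"
        if "E \<in> {F4, \<lambda>A. xi (F4 A), \<lambda>A. xi (xi (F4 A)), \<lambda>A. E1 (F4 A), \<lambda>A. E2
            (F4 A)}" for E
        using *[THEN conjunct1, rule_format, OF that] l(1)[OF that] by simp
      have Bs: "B (\<lambda>z. A z + pert t z) w \<noteq> 0" if "B \<in> {\<lambda>A. B1 (F4 A), \<lambda>A. B2 (F4
          A)}" for B
        using *[THEN conjunct2, rule_format, OF that] l(2)[OF that] pos by auto
      have "?H t w = 0" "xi (?H t) w = 0" "xi (xi (?H t)) w = 0" "E1 (?H t) w = 0" "E2 (?H t) w = 0"
        "B1 (?H t) w \<noteq> 0" "B2 (?H t) w \<noteq> 0"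
        using Es[of F4] Es[of "\<lambda>A. xi (F4 A)"] Es[of "\<lambda>A. xi (xi (F4 A))"] Es[of "\<lambda>A. E1
            (F4 A)"]
          Es[of "\<lambda>A. E2 (F4 A)"] Bs[of "\<lambda>A. B1 (F4 A)"] Bs[of "\<lambda>A. B2 (F4 A)"]
        unfolding eq by simp_all
      then have "t \<in> ?N" by blast
      then show False using t(2) by blast
    qed
    ultimately have "A' \<in> avoids b n" unfolding b avoids_def prod.case by blast
    then show ?thesis using U(3)[OF t(1)] unfolding A'_def[abs_def] by blast
  qed
  then show "A \<in> whitney_topology closure_of avoids b n" unfolding in_closure_of using top by blast
qed

lemma generic_family_if_avoids:
  assumes "\<And>b n. b \<in> degeneracies \<Longrightarrow> A \<in> avoids b n" shows "generic_family (F4 A)"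
  unfolding generic_family_def
proof (clarify)
  fix E1 E2 B1 B2 w
  assume bad: "(E1, E2, B1, B2) \<in> degeneracies" and *: "F4 A w = 0" "xi (F4 A) w = 0" "xi (xi (F4 A)) w = 0"
    "E1 (F4 A) w = 0" "E2 (F4 A) w = 0" "B1 (F4 A) w \<noteq> 0" "B2 (F4 A) w \<noteq> 0"
  \<comment> \<open>A violation at w is detected by every n with n \<ge> norm w and 1/(n+1) \<le>
    m.\<close>
  define m where "m = min \<bar>B1 (F4 A) w\<bar> \<bar>B2 (F4 A) w\<bar>"
  have "m > 0" using * by (simp add: m_def)
  obtain n where n: "max (norm w) (1 / m) \<le> real n" using real_arch_simple by blast
  then have "1 / m \<le> real (Suc n)" by simp
  then have "1 / real (Suc n) \<le> m" using \<open>m > 0\<close> by (simp add: field_simps)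
  moreover have "w \<in> cball 0 (real n)" using n by simp
  ultimately show False using assms[OF bad, of n] * unfolding avoids_def prod.case m_def by auto
qed

theorem theorem1p3:
  shows "generic_property (\<lambda>A :: bde_family. \<forall>\<epsilon>\<^sub>0 m.
    (type3 (bde A \<epsilon>\<^sub>0) m \<longrightarrow> lips_transition A (base_proj m) \<epsilon>\<^sub>0) \<and>
    (type4 (bde A \<epsilon>\<^sub>0) m \<longrightarrow> bec_a_bec_transition A (base_proj m) \<epsilon>\<^sub>0)
        \<and>
    (type5 (bde A \<epsilon>\<^sub>0) m \<longrightarrow> swallowtail_transition A (base_proj m) \<epsilon>\<^sub>0))"
proof -
  have "finite degeneracies" "degeneracies \<noteq> {}"
    unfolding degeneracies_def Let_def by (intro finite.insertI finite.emptyI insert_not_empty)+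
  then have c: "countable (degeneracies \<times> (UNIV :: nat set))" and ne: "degeneracies \<times> (UNIV :: nat
      set) \<noteq> {}"
    by (simp_all add: countable_finite)
  \<comment> \<open>The pairs of a degeneracy and an index n are countable; they are enumerated to
    give the sequence of open dense sets in \<open>generic_property\<close>.\<close>
  define U where "U k = (\<lambda>(b, n). avoids b n) (from_nat_into (degeneracies \<times> UNIV) k)" for k :: nat
  have "openin whitney_topology (U k) \<and> whitney_topology closure_of U k = topspace whitney_topology" for k
  proof -
    obtain b and n :: nat where bn: "from_nat_into (degeneracies \<times> UNIV) k = (b, n)" by fastforce
    then have "b \<in> degeneracies" using from_nat_into[OF ne, of k] by simp
    then show ?thesis using openin_avoids dense_avoids by (simp add: U_def bn)
  qed
  moreover have "generic_family (F4 A)" if "\<And>k. A \<in> U k" for A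
  proof (rule generic_family_if_avoids)
    fix b and n :: nat assume "b \<in> degeneracies"
    then have "(b, n) \<in> degeneracies \<times> UNIV" by simp
    then obtain k where "from_nat_into (degeneracies \<times> UNIV) k = (b, n)" using from_nat_into_surj[OF c] by blast
    then show "A \<in> avoids b n" using that[of k] by (simp add: U_def)
  qed
  ultimately show ?thesis
    unfolding generic_property_def
    by (intro exI[of _ U] conjI allI impI) (auto intro: transitions_of_generic_family)
qed

end
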